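(* Let $k$ be a field, $H$ a Hopf algebra over $k$, and $A$ a right $H$-comodule algebra such that $A$ is a simple object of the category ${}_A\mathcal{M}^H$. Suppose that (1) $A$ has a von Neumann regular two-sided classical quotient ring $Q(A)$, (2) $A$ is right coherent, (3) the projective dimension of $V$ over $A$ is finite for each finitely presented right $A$-module $V$. Then all objects of the category $\mathcal{M}_A^H$ are flat right $A$-modules. If, moreover, there exists a ring homomorphism $A\to R$ for some nonzero right Artinian ring $R$, then all objects of $\mathcal{M}_A^H$ are projective as right $A$-modules.
   Context: Tensor products are over $k$; antipodes are not assumed bijective. A right $H$-comodule algebra is an algebra $A$ with a right $H$-comodule structure $\rho_A:A\to A\otimes H$, $a\mapsto\sum a_{(0)}\otimes a_{(1)}$, that is an algebra homomorphism. Objects of $\mathcal{M}_A^H$ (Hopf modules) are right $A$-modules $M$ with a right $H$-comodule structure $\rho_M$ such that $\rho_M(ma)=\sum m_{(0)}a_{(0)}\otimes m_{(1)}a_{(1)}$; objects of ${}_A\mathcal{M}^H$ are left $A$-modules $M$ with a right $H$-comodule structure such that $\rho_M(am)=\sum a_{(0)}m_{(0)}\otimes a_{(1)}m_{(1)}$. Subobjects are submodules that are also subcomodules. $A$ itself is an object of both categories; it is a simple object of ${}_A\mathcal{M}^H$ if $A\ne0$ and $A$ has no nonzero proper left ideals $I$ with $\rho_A(I)\subset I\otimes H$. A two-sided classical quotient ring of $A$ is a ring $Q(A)$ containing $A$ as a subring such that all nonzerodivisors of $A$ are invertible in $Q(A)$ and for each $x\in Q(A)$ there exist nonzerodivisors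 $s,t\in A$ with $sx\in A$ and $xt\in A$. A ring is right coherent if each of its finitely generated right ideals is finitely presented as a right module. *)

theory Defs
  imports "HOL-Algebra.Free_Abelian_Groups" "HOL-Algebra.QuotRing" "HOL-Algebra.Module"
begin

section \<open>One-sided modules over noncommutative rings\<close>

text \<open>The library locale \<open>module\<close> requires a commutative base ring.  We reuse its record for
  one-sided modules over arbitrary rings; for a right module, \<open>smult M a x\<close> is the product
  \<open>x a\<close>.\<close>

locale left_module = R?: ring A + M?: abelian_group M for A (structure) and M (structure) +
  assumes smult_closed: "\<lbrakk>a \<in> carrier A; x \<in> carrier M\<rbrakk> \<Longrightarrow> a \<odot>\<^bsub>M\<^esub> x \<in> carrier M"
    and smult_l_distr: "\<lbrakk>a \<in> carrier A; b \<in> carrier A; x \<in> carrier M\<rbrakk>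
      \<Longrightarrow> (a \<oplus> b) \<odot>\<^bsub>M\<^esub> x = a \<odot>\<^bsub>M\<^esub> x \<oplus>\<^bsub>M\<^esub> b \<odot>\<^bsub>M\<^esub> x"
    and smult_r_distr: "\<lbrakk>a \<in> carrier A; x \<in> carrier M; y \<in> carrier M\<rbrakk>
      \<Longrightarrow> a \<odot>\<^bsub>M\<^esub> (x \<oplus>\<^bsub>M\<^esub> y) = a \<odot>\<^bsub>M\<^esub> x \<oplus>\<^bsub>M\<^esub> a \<odot>\<^bsub>M\<^esub> y"
    and smult_assoc: "\<lbrakk>a \<in> carrier A; b \<in> carrier A; x \<in> carrier M\<rbrakk>
      \<Longrightarrow> (a \<otimes> b) \<odot>\<^bsub>M\<^esub> x = a \<odot>\<^bsub>M\<^esub> (b \<odot>\<^bsub>M\<^esub> x)"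
    and smult_one: "x \<in> carrier M \<Longrightarrow> \<one> \<odot>\<^bsub>M\<^esub> x = x"

locale right_module = R?: ring A + M?: abelian_group M for A (structure) and M (structure) +
  assumes smult_closed: "\<lbrakk>a \<in> carrier A; x \<in> carrier M\<rbrakk> \<Longrightarrow> a \<odot>\<^bsub>M\<^esub> x \<in> carrier M"
    and smult_l_distr: "\<lbrakk>a \<in> carrier A; b \<in> carrier A; x \<in> carrier M\<rbrakk>
      \<Longrightarrow> (a \<oplus> b) \<odot>\<^bsub>M\<^esub> x = a \<odot>\<^bsub>M\<^esub> x \<oplus>\<^bsub>M\<^esub> b \<odot>\<^bsub>M\<^esub> x"
    and smult_r_distr: "\<lbrakk>a \<in> carrier A; x \<in> carrier M; y \<in> carrier M\<rbrakk>
      \<Longrightarrow> a \<odot>\<^bsub>M\<^esub> (x \<oplus>\<^bsub>M\<^esub> y) = a \<odot>\<^bsub>M\<^esub> x \<oplus>\<^bsub>M\<^esub> a \<odot>\<^bsub>M\<^esub> y"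
    and smult_assoc: "\<lbrakk>a \<in> carrier A; b \<in> carrier A; x \<in> carrier M\<rbrakk>
      \<Longrightarrow> (a \<otimes> b) \<odot>\<^bsub>M\<^esub> x = b \<odot>\<^bsub>M\<^esub> (a \<odot>\<^bsub>M\<^esub> x)"
    and smult_one: "x \<in> carrier M \<Longrightarrow> \<one> \<odot>\<^bsub>M\<^esub> x = x"

definition left_regular :: "('a, 'c) ring_scheme \<Rightarrow> ('a, 'a) module" where
  "left_regular A = \<lparr>carrier = carrier A, mult = mult A, one = one A, zero = zero A, add = add A,
     smult = (\<lambda>a x. a \<otimes>\<^bsub>A\<^esub> x)\<rparr>"

definition right_regular :: "('a, 'c) ring_scheme \<Rightarrow> ('a, 'a) module" where
  "right_regular A = \<lparr>carrier = carrier A, mult = mult A, one = one A, zero = zero A, add = add A,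
     smult = (\<lambda>a x. x \<otimes>\<^bsub>A\<^esub> a)\<rparr>"

text \<open>The library predicate \<open>submodule\<close> does not depend on the side or on commutativity.\<close>

abbreviation left_ideal :: "'a set \<Rightarrow> ('a, 'c) ring_scheme \<Rightarrow> bool" where
  "left_ideal I A \<equiv> submodule I A (left_regular A)"

abbreviation right_ideal :: "'a set \<Rightarrow> ('a, 'c) ring_scheme \<Rightarrow> bool" where
  "right_ideal I A \<equiv> submodule I A (right_regular A)"

text \<open>Homomorphisms of modules over \<open>A\<close>, for modules on either side.\<close>

definition mod_hom ::
  "('a, 'c) ring_scheme \<Rightarrow> ('a, 'm, 'd) module_scheme \<Rightarrow> ('a, 'n, 'e) module_scheme \<Rightarrow> ('m \<Rightarrow> 'n) set"
  where "mod_hom A M N = {f \<in> carrier M \<rightarrow> carrier N.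
    (\<forall>x\<in>carrier M. \<forall>y\<in>carrier M. f (x \<oplus>\<^bsub>M\<^esub> y) = f x \<oplus>\<^bsub>N\<^esub> f y) \<and>
    (\<forall>a\<in>carrier A. \<forall>x\<in>carrier M. f (a \<odot>\<^bsub>M\<^esub> x) = a \<odot>\<^bsub>N\<^esub> f x)}"

definition finitely_generated :: "('a, 'c) ring_scheme \<Rightarrow> ('a, 'm, 'd) module_scheme \<Rightarrow> bool" where
  "finitely_generated A M \<longleftrightarrow> (\<exists>S. finite S \<and> S \<subseteq> carrier M \<and>
     (\<forall>N. submodule N A M \<and> S \<subseteq> N \<longrightarrow> carrier M \<subseteq> N))"

text \<open>The free right module on \<open>X\<close>: finitely supported functions from \<open>X\<close> to \<open>A\<close>.\<close>

definition free_right_module :: "('a, 'c) ring_scheme \<Rightarrow> 'x set \<Rightarrow> ('a, 'x \<Rightarrow> 'a) module" where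
  "free_right_module A X =
    \<lparr>carrier = {c \<in> X \<rightarrow>\<^sub>E carrier A. finite {x \<in> X. c x \<noteq> \<zero>\<^bsub>A\<^esub>}},
     mult = undefined, one = undefined,
     zero = (\<lambda>x\<in>X. \<zero>\<^bsub>A\<^esub>),
     add = (\<lambda>c d. \<lambda>x\<in>X. c x \<oplus>\<^bsub>A\<^esub> d x),
     smult = (\<lambda>a c. \<lambda>x\<in>X. c x \<otimes>\<^bsub>A\<^esub> a)\<rparr>"

definition finitely_presented :: "('a, 'c) ring_scheme \<Rightarrow> ('a, 'm, 'd) module_scheme \<Rightarrow> bool" where
  "finitely_presented A M \<longleftrightarrow> (\<exists>(n::nat) f.
     f \<in> mod_hom A (free_right_module A {..<n}) M \<and>
     f ` carrier (free_right_module A {..<n}) = carrier M \<and>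
     finitely_generated A
       (free_right_module A {..<n}\<lparr>carrier := a_kernel (free_right_module A {..<n}) M f\<rparr>))"

definition right_coherent :: "('a, 'c) ring_scheme \<Rightarrow> bool" where
  "right_coherent A \<longleftrightarrow> (\<forall>I. right_ideal I A \<and>
     finitely_generated A (right_regular A\<lparr>carrier := I\<rparr>) \<longrightarrow>
     finitely_presented A (right_regular A\<lparr>carrier := I\<rparr>))"

text \<open>A right module is projective if it is a direct summand of a free module, with inclusion \<open>i\<close>
  and projection \<open>p\<close>.  Bases inside the type of \<open>M\<close> suffice, since \<open>M\<close> is a quotient of the
  free module on \<open>carrier M\<close>.\<close>

definition projective :: "('a, 'c) ring_scheme \<Rightarrow> ('a, 'm, 'd) module_scheme \<Rightarrow> bool" where
  "projective A M \<longleftrightarrow> right_module A M \<and> (\<exists>(X::'m set) i p.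
     i \<in> mod_hom A M (free_right_module A X) \<and>
     p \<in> mod_hom A (free_right_module A X) M \<and>
     (\<forall>x\<in>carrier M. p (i x) = x))"

text \<open>A projective resolution \<open>\<dots> \<rightarrow> P 1 \<rightarrow> P 0 \<rightarrow> V \<rightarrow> 0\<close>, with \<open>e : P 0 \<rightarrow> V\<close> and
  \<open>d i : P (i + 1) \<rightarrow> P i\<close>.\<close>

definition projective_resolution ::
  "('a, 'c) ring_scheme \<Rightarrow> ('a, 'm, 'd) module_scheme \<Rightarrow> (nat \<Rightarrow> ('a, 'p) module) \<Rightarrow>
   (nat \<Rightarrow> 'p \<Rightarrow> 'p) \<Rightarrow> ('p \<Rightarrow> 'm) \<Rightarrow> bool" where
  "projective_resolution A V P d e \<longleftrightarrow>
     (\<forall>i. projective A (P i)) \<and>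
     e \<in> mod_hom A (P 0) V \<and> (\<forall>i. d i \<in> mod_hom A (P (Suc i)) (P i)) \<and>
     e ` carrier (P 0) = carrier V \<and>
     d 0 ` carrier (P 1) = a_kernel (P 0) V e \<and>
     (\<forall>i. d (Suc i) ` carrier (P (Suc (Suc i))) = a_kernel (P (Suc i)) (P i) (d i))"

text \<open>The terms of the resolution have to live in a type determined by those of \<open>A\<close> and \<open>V\<close>.
  Every set of cardinality at most \<open>max(|A|, |V|, \<aleph>\<^sub>0)\<close> embeds in \<open>('a + 'm) list\<close>, and
  this bounds the free module on \<open>V\<close>, the kernel of its projection onto \<open>V\<close>, and so on.  Hence \<open>V\<close>
  and all its syzygies have free covers in this type, and if \<open>V\<close> has a projective resolution of
  length \<open>n\<close> in some type, it has one here.\<close>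

definition proj_dim_le :: "('a, 'c) ring_scheme \<Rightarrow> ('a, 'm, 'd) module_scheme \<Rightarrow> nat \<Rightarrow> bool" where
  "proj_dim_le A V n \<longleftrightarrow> (\<exists>(P :: nat \<Rightarrow> ('a, ('a + 'm) list) module) d e.
     projective_resolution A V P d e \<and> (\<forall>i>n. carrier (P i) = {\<zero>\<^bsub>P i\<^esub>}))"

text \<open>Up to isomorphism every finitely presented right module is a quotient of
  some \<open>A\<^sup>n\<close>, whose elements are cosets in \<open>nat \<Rightarrow> 'a\<close>, so \<open>V\<close> ranges over all of them.\<close>

definition finite_proj_dim_of_finitely_presented :: "('a, 'c) ring_scheme \<Rightarrow> bool" where
  "finite_proj_dim_of_finitely_presented A \<longleftrightarrow>
     (\<forall>V :: ('a, (nat \<Rightarrow> 'a) set) module.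
        right_module A V \<and> finitely_presented A V \<longrightarrow> (\<exists>n. proj_dim_le A V n))"

definition right_artinian :: "('a, 'c) ring_scheme \<Rightarrow> bool" where
  "right_artinian R \<longleftrightarrow> ring R \<and>
     (\<forall>I :: nat \<Rightarrow> 'a set. (\<forall>i. right_ideal (I i) R \<and> I (Suc i) \<subseteq> I i) \<longrightarrow>
       (\<exists>n. \<forall>m\<ge>n. I m = I n))"

definition von_neumann_regular :: "('a, 'c) ring_scheme \<Rightarrow> bool" where
  "von_neumann_regular Q \<longleftrightarrow>
     ring Q \<and> (\<forall>x\<in>carrier Q. \<exists>y\<in>carrier Q. x \<otimes>\<^bsub>Q\<^esub> y \<otimes>\<^bsub>Q\<^esub> x = x)"

definition nonzerodivisors :: "('a, 'c) ring_scheme \<Rightarrow> 'a set" where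
  "nonzerodivisors A = {s \<in> carrier A. \<forall>x\<in>carrier A.
     (s \<otimes>\<^bsub>A\<^esub> x = \<zero>\<^bsub>A\<^esub> \<longrightarrow> x = \<zero>\<^bsub>A\<^esub>) \<and> (x \<otimes>\<^bsub>A\<^esub> s = \<zero>\<^bsub>A\<^esub> \<longrightarrow> x = \<zero>\<^bsub>A\<^esub>)}"

text \<open>The inclusion of \<open>A\<close> into its quotient ring \<open>Q\<close> is an embedding \<open>\<iota>\<close>.\<close>

definition classical_quotient_ring ::
  "('a, 'c) ring_scheme \<Rightarrow> ('q, 'd) ring_scheme \<Rightarrow> ('a \<Rightarrow> 'q) \<Rightarrow> bool" where
  "classical_quotient_ring A Q \<iota> \<longleftrightarrow>
     ring A \<and> ring Q \<and> \<iota> \<in> ring_hom A Q \<and> inj_on \<iota> (carrier A) \<and>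
     \<iota> ` nonzerodivisors A \<subseteq> Units Q \<and>
     (\<forall>x\<in>carrier Q. \<exists>s\<in>nonzerodivisors A. \<exists>t\<in>nonzerodivisors A.
        \<iota> s \<otimes>\<^bsub>Q\<^esub> x \<in> \<iota> ` carrier A \<and> x \<otimes>\<^bsub>Q\<^esub> \<iota> t \<in> \<iota> ` carrier A)"


section \<open>Tensor products\<close>

text \<open>The tensor product of a right module \<open>M\<close> and a left module \<open>N\<close> over \<open>R\<close> is the free abelian
  group on pairs modulo the subgroup generated by the biadditivity and balancing relations.\<close>

type_synonym ('m, 'n) tensor = "(('m \<times> 'n) \<Rightarrow>\<^sub>0 int) set"

definition tensor_relations ::
  "('r, 'c) ring_scheme \<Rightarrow> ('r, 'm, 'd) module_scheme \<Rightarrow> ('r, 'n, 'e) module_scheme \<Rightarrow>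
   (('m \<times> 'n) \<Rightarrow>\<^sub>0 int) set" where
  "tensor_relations R M N = generate (free_Abelian_group (carrier M \<times> carrier N))
    ({frag_of (x \<oplus>\<^bsub>M\<^esub> x', y) - frag_of (x, y) - frag_of (x', y) | x x' y.
        x \<in> carrier M \<and> x' \<in> carrier M \<and> y \<in> carrier N} \<union>
     {frag_of (x, y \<oplus>\<^bsub>N\<^esub> y') - frag_of (x, y) - frag_of (x, y') | x y y'.
        x \<in> carrier M \<and> y \<in> carrier N \<and> y' \<in> carrier N} \<union>
     {frag_of (r \<odot>\<^bsub>M\<^esub> x, y) - frag_of (x, r \<odot>\<^bsub>N\<^esub> y) | r x y.
        r \<in> carrier R \<and> x \<in> carrier M \<and> y \<in> carrier N})"

text \<open>The multiplicative fields of the \<open>ring\<close> record play no role here.\<close>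

definition tensor_group ::
  "('r, 'c) ring_scheme \<Rightarrow> ('r, 'm, 'd) module_scheme \<Rightarrow> ('r, 'n, 'e) module_scheme \<Rightarrow>
   ('m, 'n) tensor ring" where
  "tensor_group R M N =
    (let T = free_Abelian_group (carrier M \<times> carrier N) Mod tensor_relations R M N
     in \<lparr>carrier = carrier T, mult = undefined, one = undefined,
         zero = one T, add = mult T\<rparr>)"

definition pure_tensor ::
  "('r, 'c) ring_scheme \<Rightarrow> ('r, 'm, 'd) module_scheme \<Rightarrow> ('r, 'n, 'e) module_scheme \<Rightarrow>
   'm \<Rightarrow> 'n \<Rightarrow> ('m, 'n) tensor" where
  "pure_tensor R M N x y =
     tensor_relations R M N #>\<^bsub>free_Abelian_group (carrier M \<times> carrier N)\<^esub> frag_of (x, y)"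

text \<open>The additive map to \<open>G\<close> that sends \<open>x \<otimes> y\<close> to \<open>\<beta> x y\<close>.  For a balanced biadditive
  \<open>\<beta>\<close> the result does not depend on the representative \<open>u\<close> of the coset \<open>t\<close>.\<close>

definition tensor_lift :: "('g, 'c) ring_scheme \<Rightarrow> ('m \<Rightarrow> 'n \<Rightarrow> 'g) \<Rightarrow> ('m, 'n) tensor \<Rightarrow> 'g" where
  "tensor_lift G \<beta> t = (let u = (SOME u. u \<in> t) in
     (\<Oplus>\<^bsub>G\<^esub>p\<in>Poly_Mapping.keys u. [Poly_Mapping.lookup u p] \<cdot>\<^bsub>G\<^esub> \<beta> (fst p) (snd p)))"

text \<open>The map \<open>f \<otimes> g : _ \<rightarrow> M \<otimes> N\<close>.\<close>

definition tensor_map ::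
  "('r, 'c) ring_scheme \<Rightarrow> ('r, 'm, 'd) module_scheme \<Rightarrow> ('r, 'n, 'e) module_scheme \<Rightarrow>
   ('x \<Rightarrow> 'm) \<Rightarrow> ('y \<Rightarrow> 'n) \<Rightarrow> ('x, 'y) tensor \<Rightarrow> ('m, 'n) tensor" where
  "tensor_map R M N f g =
     tensor_lift (tensor_group R M N) (\<lambda>x y. pure_tensor R M N (f x) (g y))"

text \<open>Flatness: tensoring with the right module \<open>M\<close> preserves injectivity of homomorphisms
  \<open>L \<rightarrow> N\<close> of left modules.  The types of the test modules are parameters.\<close>

definition flat ::
  "'l itself \<Rightarrow> 'n itself \<Rightarrow> ('a, 'c) ring_scheme \<Rightarrow> ('a, 'm, 'd) module_scheme \<Rightarrow> bool" where
  "flat TL TN A M \<longleftrightarrow> right_module A M \<and>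
     (\<forall>(L :: ('a, 'l) module) (N :: ('a, 'n) module) f.
        left_module A L \<and> left_module A N \<and> f \<in> mod_hom A L N \<and> inj_on f (carrier L) \<longrightarrow>
        inj_on (tensor_map A M N id f) (carrier (tensor_group A M L)))"

text \<open>Over a field (or commutative ring) \<open>K\<close>, the tensor product is again a \<open>K\<close>-module, and
  for \<open>K\<close>-algebras it is a ring.\<close>

definition tensor ::
  "('k, 'c) ring_scheme \<Rightarrow> ('k, 'm, 'd) module_scheme \<Rightarrow> ('k, 'n, 'e) module_scheme \<Rightarrow>
   ('k, ('m, 'n) tensor) module" where
  "tensor K M N = ring.extend (tensor_group K M N)
     (module.fields (\<lambda>c. tensor_map K M N (\<lambda>x. c \<odot>\<^bsub>M\<^esub> x) id))"

definition tensor_algebra ::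
  "('k, 'c) ring_scheme \<Rightarrow> ('k, 'a, 'd) module_scheme \<Rightarrow> ('k, 'b, 'e) module_scheme \<Rightarrow>
   ('k, ('a, 'b) tensor) module" where
  "tensor_algebra K A B = (tensor K A B)
    \<lparr>mult := (\<lambda>s t. tensor_lift (tensor_group K A B) (\<lambda>a b.
               tensor_lift (tensor_group K A B) (\<lambda>a' b'.
                 pure_tensor K A B (a \<otimes>\<^bsub>A\<^esub> a') (b \<otimes>\<^bsub>B\<^esub> b')) t) s),
     one := pure_tensor K A B \<one>\<^bsub>A\<^esub> \<one>\<^bsub>B\<^esub>\<rparr>"

text \<open>The canonical isomorphism \<open>(L \<otimes> M) \<otimes> N \<rightarrow> L \<otimes> (M \<otimes> N)\<close>.\<close>

definition tensor_assoc ::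
  "('k, 'c) ring_scheme \<Rightarrow> ('k, 'l, 'd) module_scheme \<Rightarrow> ('k, 'm, 'e) module_scheme \<Rightarrow>
   ('k, 'n, 'f) module_scheme \<Rightarrow> (('l, 'm) tensor, 'n) tensor \<Rightarrow> ('l, ('m, 'n) tensor) tensor" where
  "tensor_assoc K L M N =
    tensor_lift (tensor_group K L (tensor K M N)) (\<lambda>t z.
      tensor_lift (tensor_group K L (tensor K M N)) (\<lambda>x y.
        pure_tensor K L (tensor K M N) x (pure_tensor K M N y z)) t)"


section \<open>Hopf algebras and Hopf modules\<close>

text \<open>Vector spaces over the field \<open>K\<close> are modules in the sense of the library.  The library locale
  \<open>algebra\<close> requires commutative algebras.\<close>

locale unital_algebra = K?: field K + A?: ring A + module K A
  for K (structure) and A (structure) +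
  assumes smult_mult_left: "\<lbrakk>c \<in> carrier K; x \<in> carrier A; y \<in> carrier A\<rbrakk>
      \<Longrightarrow> (c \<odot>\<^bsub>A\<^esub> x) \<otimes>\<^bsub>A\<^esub> y = c \<odot>\<^bsub>A\<^esub> (x \<otimes>\<^bsub>A\<^esub> y)"
    and smult_mult_right: "\<lbrakk>c \<in> carrier K; x \<in> carrier A; y \<in> carrier A\<rbrakk>
      \<Longrightarrow> x \<otimes>\<^bsub>A\<^esub> (c \<odot>\<^bsub>A\<^esub> y) = c \<odot>\<^bsub>A\<^esub> (x \<otimes>\<^bsub>A\<^esub> y)"

locale right_comodule = K?: field K + H?: module K H + M?: module K M
  for K (structure) and H (structure) and \<Delta> \<epsilon> and M (structure) and \<rho> +
  assumes coaction_linear: "\<rho> \<in> mod_hom K M (tensor K M H)"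
    and coaction_coassoc: "m \<in> carrier M \<Longrightarrow>
      tensor_assoc K M H H (tensor_map K (tensor K M H) H \<rho> id (\<rho> m)) =
      tensor_map K M (tensor K H H) id \<Delta> (\<rho> m)"
    and coaction_counit: "m \<in> carrier M \<Longrightarrow> tensor_lift M (\<lambda>x h. \<epsilon> h \<odot>\<^bsub>M\<^esub> x) (\<rho> m) = m"

text \<open>Coassociativity and the right counit law say that \<open>\<Delta>\<close> is a right coaction on \<open>H\<close>.\<close>

locale coalgebra = right_comodule K H \<Delta> \<epsilon> H \<Delta>
  for K (structure) and H (structure) and \<Delta> \<epsilon> +
  assumes counit_linear: "\<epsilon> \<in> mod_hom K H (left_regular K)"
    and left_counit: "h \<in> carrier H \<Longrightarrow> tensor_lift H (\<lambda>x y. \<epsilon> x \<odot>\<^bsub>H\<^esub> y) (\<Delta> h) = h"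

locale hopf_algebra = unital_algebra K H + coalgebra K H \<Delta> \<epsilon>
  for K (structure) and H (structure) and \<Delta> \<epsilon> and S +
  assumes comult_ring_hom: "\<Delta> \<in> ring_hom H (tensor_algebra K H H)"
    and counit_ring_hom: "\<epsilon> \<in> ring_hom H K"
    and antipode_linear: "S \<in> mod_hom K H H"
    and left_antipode: "h \<in> carrier H \<Longrightarrow>
      tensor_lift H (\<lambda>x y. S x \<otimes>\<^bsub>H\<^esub> y) (\<Delta> h) = \<epsilon> h \<odot>\<^bsub>H\<^esub> \<one>\<^bsub>H\<^esub>"
    and right_antipode: "h \<in> carrier H \<Longrightarrow>
      tensor_lift H (\<lambda>x y. x \<otimes>\<^bsub>H\<^esub> S y) (\<Delta> h) = \<epsilon> h \<odot>\<^bsub>H\<^esub> \<one>\<^bsub>H\<^esub>"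

locale comodule_algebra = unital_algebra K A + right_comodule K H \<Delta> \<epsilon> A \<rho>
  for K (structure) and H (structure) and \<Delta> \<epsilon> and A (structure) and \<rho> +
  assumes coaction_ring_hom: "\<rho> \<in> ring_hom A (tensor_algebra K A H)"

text \<open>\<open>A\<close> is simple in the category of left \<open>A\<close>-modules with compatible right \<open>H\<close>-coaction.
  Over a field, \<open>I \<otimes> H\<close> is the subgroup of \<open>A \<otimes> H\<close> generated by the \<open>x \<otimes> h\<close> with
  \<open>x \<in> I\<close>.\<close>

definition simple_comodule_algebra ::
  "('k, 'c) ring_scheme \<Rightarrow> ('k, 'h, 'd) module_scheme \<Rightarrow> ('k, 'a, 'e) module_scheme \<Rightarrow>
   ('a \<Rightarrow> ('a, 'h) tensor) \<Rightarrow> bool" where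
  "simple_comodule_algebra K H A \<rho> \<longleftrightarrow> carrier A \<noteq> {\<zero>\<^bsub>A\<^esub>} \<and>
     (\<forall>I. left_ideal I A \<and>
        \<rho> ` I \<subseteq> generate (add_monoid (tensor_group K A H))
          {pure_tensor K A H x h | x h. x \<in> I \<and> h \<in> carrier H} \<longrightarrow>
        I = {\<zero>\<^bsub>A\<^esub>} \<or> I = carrier A)"

text \<open>The \<open>K\<close>-vector space underlying a module over a \<open>K\<close>-algebra \<open>A\<close>.  A Hopf module
  carries this structure as a comodule; applying the counit to the compatibility axiom with
  \<open>a = c 1\<close> shows that no other one is possible.\<close>

definition underlying_space ::
  "('k, 'a, 'c) module_scheme \<Rightarrow> ('a, 'm, 'd) module_scheme \<Rightarrow> ('k, 'm) module" where
  "underlying_space A M =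
    \<lparr>carrier = carrier M, mult = mult M, one = one M, zero = zero M, add = add M,
     smult = (\<lambda>c x. (c \<odot>\<^bsub>A\<^esub> \<one>\<^bsub>A\<^esub>) \<odot>\<^bsub>M\<^esub> x)\<rparr>"

text \<open>The last axiom reads \<open>\<rho>\<^sub>M (m a) = \<Sum> m\<^sub>(\<^sub>0\<^sub>) a\<^sub>(\<^sub>0\<^sub>) \<otimes> m\<^sub>(\<^sub>1\<^sub>) a\<^sub>(\<^sub>1\<^sub>)\<close>.\<close>

locale hopf_module = right_module A M + right_comodule K H \<Delta> \<epsilon> "underlying_space A M" \<rho>M
  for K (structure) and H (structure) and \<Delta> \<epsilon> and A (structure) and \<rho>A and M (structure) and \<rho>M +
  assumes coaction_smult: "\<lbrakk>m \<in> carrier M; a \<in> carrier A\<rbrakk> \<Longrightarrow>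
    \<rho>M (a \<odot>\<^bsub>M\<^esub> m) =
      tensor_lift (tensor_group K (underlying_space A M) H) (\<lambda>x h.
        tensor_lift (tensor_group K (underlying_space A M) H) (\<lambda>b g.
          pure_tensor K (underlying_space A M) H (b \<odot>\<^bsub>M\<^esub> x) (h \<otimes>\<^bsub>H\<^esub> g)) (\<rho>A a)) (\<rho>M m)"

end

theory Submission
  imports Defs
begin

text \<open>Finitely generated Hopf submodules \<open>L\<close> of \<open>A\<^sup>n\<close>, with coactions twisted by coefficient matrices, control
  everything, because Hopf modules are locally quotients of such \<open>A\<^sup>n\<close>.  Since \<open>Q(A)\<close> is regular, a
  functional on \<open>L\<close> extends to \<open>A\<^sup>n\<close> after multiplication by a nonzerodivisor; the elements with this
  property for all coacted functionals form a stable left ideal, so simplicity of \<open>A\<close> makes every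
  functional on \<open>L\<close> extend.  Therefore \<open>L\<close> is a direct summand of \<open>A\<^sup>n\<close> as soon as it is projective, and
  dimension shifting along a finite projective resolution of \<open>A\<^sup>n/L\<close>, possible by coherence, shows that it
  always is.  Finitely many relations in a Hopf module thus come from a direct summand, which gives
  flatness.  Given \<open>A \<rightarrow> R\<close>, the descending chain condition over \<open>R\<close> makes all Hopf submodules of \<open>A\<^sup>n\<close>
  finitely generated, and Zorn's lemma then produces a section of a free cover.\<close>

text \<open>The sides shape the argument. Left multiplication keeps a functional on a right module
  linear, so the multipliers that make it extendable form a left ideal, and simplicity of
  \<open>A\<close> concerns left ideals. The obstacle is stability of that ideal, which forces the
  coaction to pass to the dual of \<open>L\<close>. With \<rho>(m) = m_0 \<otimes> m_1 it sends
  \<open>f\<close> to f(m_0)_0 \<otimes> f(m_0)_1 S(m_1); this uses \<open>S\<close> and never an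
  inverse of it. Writing the result as f_0 \<otimes> f_1, the identity (a f_0)_0 \<otimes> (a f_0)_1
  S(f_1) = a_0 f \<otimes> a_1 shows that one denominator for the finitely many f_0 is enough.
  Coactions are handled through the operators (id \<otimes> psi) \<rho> for functionals psi on
  \<open>H\<close>: iterated tensor products disappear, and coassociativity says that composition of
  operators is convolution of functionals. Sweedler sums become sums over matrices with
  \<Delta>(c_ik) = \<Sum> c_ij \<otimes> c_jk, whose inverse is the matrix of the S(c_ij).\<close>

text \<open>The infix operations carry the structure as an index after the dot: \<open>x *.R y\<close> is the product in \<open>R\<close>.\<close>

abbreviation (input) mult_in :: "'a => ('a, 'b) monoid_scheme => 'a => 'a" ("_ *._ _" [70, 1000, 71] 70)
  where "x *.R y \<equiv> x \<otimes>\<^bsub>R\<^esub> y"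
abbreviation (input) add_in :: "'a => ('a, 'b) ring_scheme => 'a => 'a" ("_ +._ _" [65, 1000, 66] 65)
  where "x +.R y \<equiv> x \<oplus>\<^bsub>R\<^esub> y"
abbreviation (input) diff_in :: "'a => ('a, 'b) ring_scheme => 'a => 'a" ("_ -._ _" [65, 1000, 66] 65)
  where "x -.R y \<equiv> x \<ominus>\<^bsub>R\<^esub> y"
abbreviation (input) neg_in :: "('a, 'b) ring_scheme => 'a => 'a" ("-._ _" [1000, 81] 80)
  where "-.R x \<equiv> \<ominus>\<^bsub>R\<^esub> x"
abbreviation (input) smult_in :: "'a => ('a, 'm, 'b) module_scheme => 'm => 'm" ("_ **._ _" [70, 1000, 71] 70)
  where "a **.M x \<equiv> a \<odot>\<^bsub>M\<^esub> x"
abbreviation (input) zero_in :: "('a, 'b) ring_scheme => 'a" ("\<zero>._" [1000] 1000)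
  where "\<zero>.R \<equiv> \<zero>\<^bsub>R\<^esub>"
abbreviation (input) one_in :: "('a, 'b) monoid_scheme => 'a" ("\<one>._" [1000] 1000)
  where "\<one>.R \<equiv> \<one>\<^bsub>R\<^esub>"
abbreviation (input) in_carrier :: "'a => ('a, 'b) partial_object_scheme => bool" (infix "<:" 50)
  where "x <: M \<equiv> x \<in> carrier M"

syntax
  "_sum_in" :: "logic => idt => logic => logic => logic" ("(3\<Sum>._ _:_./ _)" [1000, 0, 51, 10] 10)
translations
  "\<Sum>.G i:I. t" \<rightharpoonup> "CONST finsum G (\<lambda>i. t) I"

section \<open>Finite sums and one-sided modules\<close>

lemma (in comm_monoid) finprod_swap:
 assumes "finite I" "finite J" "!!i j. i : I ==> j : J ==> f i j <: G"
 shows "(\<Otimes>i\<in>I. \<Otimes>j\<in>J. f i j) = (\<Otimes>j\<in>J. \<Otimes>i\<in>I. f i j)"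
 using assms(1,3)
proof (induction I)
 case empty
 then show ?case by simp
next
 case (insert i I)
 have 1: "f i : J \<rightarrow> carrier G" "(%j. \<Otimes>i\<in>I. f i j) : J \<rightarrow> carrier G"
  using insert.prems by (auto intro!: finprod_closed)
 have "(\<Otimes>j\<in>J. \<Otimes>i\<in>insert i I. f i j) = (\<Otimes>j\<in>J. f i j \<otimes> (\<Otimes>i\<in>I. f i j))"
  using insert by (intro finprod_cong') (auto intro!: finprod_insert finprod_closed)
 also have "... = (\<Otimes>j\<in>J. f i j) \<otimes> (\<Otimes>j\<in>J. \<Otimes>i\<in>I. f i j)"
  using 1 by (rule finprod_multf)
 also have "... = (\<Otimes>i\<in>insert i I. \<Otimes>j\<in>J. f i j)"
 proof -
  have "(\<Otimes>i\<in>I. \<Otimes>j\<in>J. f i j) = (\<Otimes>j\<in>J. \<Otimes>i\<in>I. f i j)"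
   using insert by auto
  moreover have "(\<Otimes>i\<in>insert i I. \<Otimes>j\<in>J. f i j) = (\<Otimes>j\<in>J. f i j) \<otimes> (\<Otimes>i\<in>I. \<Otimes>j\<in>J. f i j)"
   using insert by (intro finprod_insert) (auto intro!: finprod_closed)
  ultimately show ?thesis by simp
 qed
 finally show ?case by simp
qed

lemmas (in abelian_monoid) finsum_swap = add.finprod_swap

lemma (in comm_monoid) finprod_Times:
 assumes "finite I" "finite J" "!!i j. i : I ==> j : J ==> f i j <: G"
 shows "(\<Otimes>p\<in>I \<times> J. f (fst p) (snd p)) = (\<Otimes>i\<in>I. \<Otimes>j\<in>J. f i j)"
 using assms(1,3)
proof (induction I)
 case empty
 then show ?case by simp
next
 case (insert i I)
 have "(\<Otimes>p\<in>insert i I \<times> J. f (fst p) (snd p)) = (\<Otimes>p\<in>Pair i ` J \<union> I \<times> J. f (fst p) (snd p))"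
  by (rule arg_cong[where f="finprod G _"]) auto
 also have "... = (\<Otimes>p\<in>Pair i ` J. f (fst p) (snd p)) \<otimes> (\<Otimes>p\<in>I \<times> J. f (fst p) (snd p))"
  using insert assms(2) by (intro finprod_Un_disjoint) auto
 also have "(\<Otimes>p\<in>Pair i ` J. f (fst p) (snd p)) = (\<Otimes>j\<in>J. f i j)"
  using insert.prems by (subst finprod_reindex) (auto simp: inj_on_def)
 also have "(\<Otimes>p\<in>I \<times> J. f (fst p) (snd p)) = (\<Otimes>i\<in>I. \<Otimes>j\<in>J. f i j)"
  using insert by auto
 also have "(\<Otimes>j\<in>J. f i j) \<otimes> (\<Otimes>i\<in>I. \<Otimes>j\<in>J. f i j) = (\<Otimes>i\<in>insert i I. \<Otimes>j\<in>J. f i j)"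
  using insert by (intro finprod_insert[symmetric]) (auto intro!: finprod_closed)
 finally show ?case .
qed

lemmas (in abelian_monoid) finsum_Times = add.finprod_Times

lemma (in abelian_monoid) finsum_eqI:
 "[|!!i. i : I ==> f i = g i; !!i. i : I ==> g i <: G|] ==> finsum G f I = finsum G g I"
 by (rule finsum_cong') auto

lemma (in abelian_monoid) finsum_zero':
 "(!!i. i : I ==> f i = \<zero>) ==> finsum G f I = \<zero>"
 by (rule add.finprod_one_eqI)

lemma (in abelian_monoid) finsum_in:
 "(!!i. i : I ==> f i <: G) ==> finsum G f I <: G"
 by (rule finsum_closed) auto

lemma (in abelian_monoid) finsum_add:
 "[|!!i. i : I ==> f i <: G; !!i. i : I ==> g i <: G|] ==>
  (\<Oplus>i\<in>I. f i \<oplus> g i) = finsum G f I \<oplus> finsum G g I"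
 by (rule finsum_addf) auto

lemma (in abelian_monoid) finsum_superset:
 assumes "finite J" "I \<subseteq> J" "!!i. i : J - I ==> f i = \<zero>" "!!i. i : I ==> f i <: G"
 shows "finsum G f I = finsum G f J"
proof (rule add.finprod_mono_neutral_cong_left)
 show "f : J \<rightarrow> carrier G"
  using assms(3,4) by (metis DiffI Pi_I zero_closed)
qed (use assms in auto)

lemma (in abelian_monoid) finsum_delta:
 assumes "finite I" "k : I" "f k <: G"
 shows "(\<Oplus>i\<in>I. if i = k then f i else \<zero>) = f k"
proof -
 have "(\<Oplus>i\<in>I. if i = k then f i else \<zero>) = (\<Oplus>i\<in>{k}. if i = k then f i else \<zero>)"
  using assms by (intro finsum_superset[symmetric]) auto
 also have "... = f k"
  using assms by (simp add: finsum_insert)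
 finally show ?thesis .
qed

text \<open>Cancellation in the group \<open>G'\<close> gives \<open>f\<close> of zero, which also
  settles infinite \<open>I\<close>, where both sums are zero by convention.\<close>

lemma finsum_additive:
 assumes "abelian_monoid G" "abelian_group G'"
  and "!!x. x <: G ==> f x <: G'"
  and add: "!!x y. [|x <: G; y <: G|] ==> f (x +.G y) = f x +.G' f y"
  and g: "!!i. i : I ==> g i <: G"
 shows "f (finsum G g I) = (\<Sum>.G' i:I. f (g i))"
proof -
 interpret G: abelian_monoid G by fact
 interpret G': abelian_group G' by fact
 have z: "f \<zero>.G = \<zero>.G'"
  using add[of "\<zero>.G" "\<zero>.G"] assms(3)[of "\<zero>.G"] by simp
 show ?thesis
 proof (cases "finite I")
  case True
  then show ?thesis
   using g
  proof (induction I)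
   case empty
   then show ?case using z by simp
  next
   case (insert i I)
   have "finsum G g (insert i I) = g i +.G finsum G g I"
    using insert by (intro G.finsum_insert) auto
   moreover have "(\<Sum>.G' i:insert i I. f (g i)) = f (g i) +.G' (\<Sum>.G' i:I. f (g i))"
    using insert assms(3) by (intro G'.finsum_insert) auto
   ultimately show ?case
    using insert by (simp add: add G.finsum_in)
  qed
 qed (use z in simp)
qed

lemma (in ring) finsum_mult_left:
 assumes "a <: R" "!!i. i : I ==> f i <: R"
 shows "a \<otimes> finsum R f I = (\<Oplus>i\<in>I. a \<otimes> f i)"
 using assms by (intro finsum_additive) (auto simp: r_distr intro: is_abelian_group abelian_monoid_axioms)

lemma (in ring) finsum_mult_right:
 assumes "a <: R" "!!i. i : I ==> f i <: R"
 shows "finsum R f I \<otimes> a = (\<Oplus>i\<in>I. f i \<otimes> a)"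
 using assms by (intro finsum_additive[where f="%x. x \<otimes> a"])
  (auto simp: l_distr intro: is_abelian_group abelian_monoid_axioms)

context right_module
begin

lemma abelian_group_M: "abelian_group M" ..

lemma ring_A: "ring A" ..

lemma smult_finsum:
 assumes "a <: A" "!!i. i : I ==> f i <: M"
 shows "a **.M finsum M f I = (\<Sum>.M i:I. a **.M f i)"
 using assms by (intro finsum_additive)
  (auto simp: smult_r_distr smult_closed intro: abelian_group_M M.abelian_monoid_axioms)

lemma finsum_smult:
 assumes "x <: M" "!!i. i : I ==> f i <: A"
 shows "finsum A f I **.M x = (\<Sum>.M i:I. f i **.M x)"
 using assms by (intro finsum_additive[where f="%a. a **.M x"])
  (auto simp: smult_l_distr smult_closed intro: abelian_group_M R.abelian_monoid_axioms)

lemma smult_zero: "a <: A ==> a **.M \<zero>.M = \<zero>.M"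
 using smult_finsum[of a "{}" "%_. \<zero>.M"] by simp

lemma zero_smult: "x <: M ==> \<zero> **.M x = \<zero>.M"
 using finsum_smult[of x "{}" "%_. \<zero>"] by simp

lemma minus_one_smult: "x <: M ==> (\<ominus> \<one>) **.M x = -.M x"
proof -
 assume x: "x <: M"
 have "(\<ominus> \<one>) **.M x +.M x = (\<ominus> \<one> \<oplus> \<one>) **.M x"
  using x by (simp add: smult_l_distr smult_one)
 also have "... = \<zero>.M" using x by (simp add: R.l_neg zero_smult)
 finally show ?thesis
  using x by (metis M.minus_equality R.one_closed R.a_inv_closed smult_closed)
qed

lemma submoduleI':
 assumes "P \<subseteq> carrier M" "\<zero>.M : P" "!!x y. [|x : P; y : P|] ==> x +.M y : P"
  "!!a x. [|a <: A; x : P|] ==> a **.M x : P"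
 shows "submodule P A M"
proof (unfold_locales)
 fix x assume "x : P"
 then show "inv\<^bsub>add_monoid M\<^esub> x : P"
  using assms(4)[of "\<ominus> \<one>" x] assms(1) minus_one_smult[of x] by (auto simp: a_inv_def[of M])
qed (use assms in auto)

lemma submoduleD:
 assumes "submodule P A M"
 shows "P \<subseteq> carrier M" "x : P ==> x <: M" "\<zero>.M : P"
  "[|x : P; y : P|] ==> x +.M y : P"
  "[|a <: A; x : P|] ==> a **.M x : P"
  "x : P ==> -.M x : P"
  "[|x : P; y : P|] ==> x -.M y : P"
proof -
 interpret P: submodule P A M by fact
 show sub: "P \<subseteq> carrier M" using P.subset by simp
 show "x : P ==> x <: M" using sub by auto
 show "\<zero>.M : P" using P.one_closed by simp
 show add: "[|x : P; y : P|] ==> x +.M y : P" for x y using P.m_closed by simp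
 show "[|a <: A; x : P|] ==> a **.M x : P" using P.smult_closed by simp
 show inv: "x : P ==> -.M x : P" for x using P.m_inv_closed by (simp add: a_inv_def)
 show "[|x : P; y : P|] ==> x -.M y : P" by (simp add: a_minus_def add inv)
qed

lemma submodule_finsum:
 assumes "submodule P A M" "!!i. i : I ==> f i : P"
 shows "finsum M f I : P"
proof (cases "finite I")
 case True
 then show ?thesis
  using assms(2)
 proof (induction I)
  case (insert i I)
  have "finsum M f (insert i I) = f i +.M finsum M f I"
   using insert submoduleD(1)[OF assms(1)] by (intro M.finsum_insert) auto
  then show ?case
   using insert submoduleD(4)[OF assms(1)] by simp
 qed (use submoduleD(3)[OF assms(1)] in simp)
qed (use submoduleD(3)[OF assms(1)] in simp)

lemma submodule_carrier: "submodule (carrier M) A M"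
 by (rule submoduleI') (auto simp: smult_closed)

lemma right_module_submodule:
 assumes "submodule P A M"
 shows "right_module A (M(|carrier := P|))"
proof -
 note P = submoduleD[OF assms]
 have "abelian_group (M(|carrier := P|))"
 proof (rule abelian_groupI)
  fix x assume "x <: (M(|carrier := P|))"
  then show "EX y:carrier (M(|carrier := P|)). y +.(M(|carrier := P|)) x = \<zero>.(M(|carrier := P|))"
   using P(2,6) by (intro bexI[of _ "-.M x"]) (auto simp: M.l_neg)
 qed (auto simp: P M.a_ac)
 moreover have "right_module_axioms A (M(|carrier := P|))"
  by (rule right_module_axioms.intro)
   (auto simp: P smult_closed smult_l_distr smult_r_distr smult_assoc smult_one)
 ultimately show ?thesis
  by (intro right_module.intro ring_A)
qed

lemma finsum_submodule:
 assumes "submodule P A M" "!!i. i : I ==> f i : P"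
 shows "finsum (M(|carrier := P|)) f I = finsum M f I"
proof -
 interpret P: right_module A "M(|carrier := P|)" by (rule right_module_submodule[OF assms(1)])
 show ?thesis
  using finsum_additive[of "M(|carrier := P|)" M "%x. x" I f] submoduleD[OF assms(1)] assms(2)
   P.M.abelian_monoid_axioms abelian_group_M by simp
qed

end

lemma mod_hom_mem: "f : mod_hom A M N \<longleftrightarrow> (ALL x:carrier M. f x <: N) &
  (ALL x:carrier M. ALL y:carrier M. f (x +.M y) = f x +.N f y) &
  (ALL a:carrier A. ALL x:carrier M. f (a **.M x) = a **.N f x)"
 by (auto simp: mod_hom_def)

lemma mod_homI:
 assumes "!!x. x <: M ==> f x <: N"
  "!!x y. [|x <: M; y <: M|] ==> f (x +.M y) = f x +.N f y"
  "!!a x. [|a <: A; x <: M|] ==> f (a **.M x) = a **.N f x"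
 shows "f : mod_hom A M N"
 using assms by (auto simp: mod_hom_mem)

lemma mod_hom_closed: "[|f : mod_hom A M N; x <: M|] ==> f x <: N"
 and mod_hom_add: "[|f : mod_hom A M N; x <: M; y <: M|] ==> f (x +.M y) = f x +.N f y"
 and mod_hom_smult: "[|f : mod_hom A M N; a <: A; x <: M|] ==> f (a **.M x) = a **.N f x"
 by (auto simp: mod_hom_mem)

lemma mod_hom_compose: "[|f : mod_hom A M N; g : mod_hom A L M|] ==> (%x. f (g x)) : mod_hom A L N"
 by (auto simp: mod_hom_mem)

lemma mod_hom_finsum:
 assumes "f : mod_hom A M N" "right_module A M" "right_module A N" "!!i. i : I ==> g i <: M"
 shows "f (finsum M g I) = (\<Sum>.N i:I. f (g i))"
 using assms
 by (intro finsum_additive) (auto simp: mod_hom_add mod_hom_closed right_module_def abelian_group_def)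

lemma mod_hom_zero:
 assumes "f : mod_hom A M N" "right_module A M" "right_module A N"
 shows "f \<zero>.M = \<zero>.N"
proof -
 interpret M: right_module A M by fact
 interpret N: right_module A N by fact
 show ?thesis using mod_hom_finsum[OF assms, of "{}" "%_. \<zero>.M"] by simp
qed

lemma mod_hom_neg:
 assumes "f : mod_hom A M N" "right_module A M" "right_module A N" "x <: M"
 shows "f (-.M x) = -.N f x"
proof -
 interpret M: right_module A M by fact
 interpret N: right_module A N by fact
 show ?thesis
  using assms by (metis M.R.one_closed M.R.a_inv_closed M.minus_one_smult N.minus_one_smult
    mod_hom_closed mod_hom_smult)
qed

lemma mod_hom_minus:
 assumes "f : mod_hom A M N" "right_module A M" "right_module A N" "x <: M" "y <: M"
 shows "f (x -.M y) = f x -.N f y"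
proof -
 interpret M: right_module A M by fact
 interpret N: right_module A N by fact
 show ?thesis
  using assms by (simp add: a_minus_def mod_hom_add mod_hom_neg)
qed

lemma mod_hom_sum:
 assumes "right_module A M" "right_module A N" "f : mod_hom A M N" "g : mod_hom A M N"
 shows "(%x. f x +.N g x) : mod_hom A M N"
proof -
 interpret M: right_module A M by fact
 interpret N: right_module A N by fact
 show ?thesis
  using assms(3,4) by (intro mod_homI) (auto simp: mod_hom_mem N.smult_r_distr N.a_ac)
qed

lemma mod_hom_diff:
 assumes "right_module A M" "right_module A N" "f : mod_hom A M N" "g : mod_hom A M N"
 shows "(%x. f x -.N g x) : mod_hom A M N"
proof -
 interpret M: right_module A M by fact
 interpret N: right_module A N by fact
 have neg: "-.N (a **.N x) = a **.N (-.N x)" if "a <: A" "x <: N" for a x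
  using that by (metis N.M.a_inv_closed N.M.minus_equality N.M.l_neg N.smult_closed
    N.smult_r_distr N.smult_zero)
 show ?thesis
  using assms(3,4)
  by (intro mod_homI) (auto simp: mod_hom_mem N.smult_r_distr N.M.minus_add a_minus_def N.a_ac neg N.smult_closed)
qed

lemma mod_hom_finsum_fun:
 assumes "right_module A M" "right_module A N" "!!i. i : I ==> f i : mod_hom A M N"
 shows "(%x. \<Sum>.N i:I. f i x) : mod_hom A M N"
proof -
 interpret M: right_module A M by fact
 interpret N: right_module A N by fact
 have f: "f i x <: N" if "i : I" "x <: M" for i x
  using assms(3) that mod_hom_closed by metis
 show ?thesis
 proof (rule mod_homI)
  fix x y assume xy: "x <: M" "y <: M"
  have "(\<Sum>.N i:I. f i (x +.M y)) = (\<Sum>.N i:I. f i x +.N f i y)"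
   using xy f by (intro N.M.finsum_eqI) (auto simp: mod_hom_add[OF assms(3)])
  then show "(\<Sum>.N i:I. f i (x +.M y)) = (\<Sum>.N i:I. f i x) +.N (\<Sum>.N i:I. f i y)"
   using xy f by (simp add: N.M.finsum_add)
 next
  fix a x assume ax: "a <: A" "x <: M"
  have "(\<Sum>.N i:I. f i (a **.M x)) = (\<Sum>.N i:I. a **.N f i x)"
   using ax f N.smult_closed by (intro N.M.finsum_eqI) (auto simp: mod_hom_smult[OF assms(3)])
  then show "(\<Sum>.N i:I. f i (a **.M x)) = a **.N (\<Sum>.N i:I. f i x)"
   using ax f by (simp add: N.smult_finsum)
 qed (use f in \<open>auto intro: N.M.finsum_in\<close>)
qed

lemma mod_hom_ident: "(%x. x) : mod_hom A M M"
 by (rule mod_homI) auto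

lemma mod_hom_subdomain:
 "[|f : mod_hom A M N; P \<subseteq> carrier M|] ==> f : mod_hom A (M(|carrier := P|)) N"
 by (auto simp: mod_hom_mem subset_iff)

lemma submodule_kernel:
 assumes "right_module A M" "right_module A N" "f : mod_hom A M N"
 shows "submodule {x : carrier M. f x = \<zero>.N} A M"
proof -
 interpret M: right_module A M by fact
 interpret N: right_module A N by fact
 show ?thesis
  using assms(3) by (intro M.submoduleI')
   (auto simp: mod_hom_add mod_hom_smult mod_hom_zero[OF assms(3,1,2)] N.smult_zero M.smult_closed)
qed

lemma submodule_image:
 assumes "right_module A M" "right_module A N" "f : mod_hom A M N" "submodule P A M"
 shows "submodule (f ` P) A N"
proof -
 interpret M: right_module A M by fact
 interpret N: right_module A N by fact
 note P = M.submoduleD[OF assms(4)]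
 show ?thesis
 proof (rule N.submoduleI')
  show "f ` P \<subseteq> carrier N" using P(1) assms(3) by (auto simp: mod_hom_closed)
  show "\<zero>.N : f ` P" using P(3) mod_hom_zero[OF assms(3,1,2)] by force
  show "x +.N y : f ` P" if "x : f ` P" "y : f ` P" for x y
   using that P assms(3) by (auto simp flip: mod_hom_add)
  show "a **.N x : f ` P" if "a <: A" "x : f ` P" for a x
   using that P assms(3) by (auto simp flip: mod_hom_smult)
 qed
qed

lemma right_regular_simps [simp]:
 "carrier (right_regular A) = carrier A" "add (right_regular A) = add A"
 "zero (right_regular A) = zero A" "smult (right_regular A) = (%a x. x *.A a)"
 by (auto simp: right_regular_def)

lemma finsum_right_regular [simp]: "finsum (right_regular A) = finsum A"
proof -
 have "finprod (add_monoid (right_regular A)) f I = finprod (add_monoid A) f I" for f I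
  by (simp add: finprod_def)
 then show ?thesis by (intro ext) (simp add: finsum_def)
qed

lemma (in ring) right_module_right_regular: "right_module R (right_regular R)"
proof (intro right_module.intro right_module_axioms.intro)
 show "abelian_group (right_regular R)"
  by (rule abelian_groupI) (auto simp: a_ac intro: l_neg)
qed (auto simp: l_distr r_distr m_assoc ring_axioms)

lemma left_regular_simps [simp]:
 "carrier (left_regular A) = carrier A" "add (left_regular A) = add A"
 "zero (left_regular A) = zero A" "smult (left_regular A) = (%a x. a *.A x)"
 by (auto simp: left_regular_def)

definition span :: "('a, 'c) ring_scheme => ('a, 'm, 'd) module_scheme => 'i set => ('i => 'm) => 'm set" where
 "span A M I x = {\<Sum>.M i:I. c i **.M x i | c. c : I \<rightarrow> carrier A}"

context right_module
begin

lemma submodule_span: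
 assumes "finite I" "!!i. i : I ==> x i <: M"
 shows "submodule (span A M I x) A M"
proof (rule submoduleI')
 show "span A M I x \<subseteq> carrier M"
  using assms by (auto simp: span_def Pi_def intro!: M.finsum_in smult_closed)
 show "\<zero>.M : span A M I x"
  unfolding span_def using assms
  by (auto intro!: exI[of _ "%_. \<zero>"] M.finsum_zero'[symmetric] simp: zero_smult)
 fix u v assume "u : span A M I x" "v : span A M I x"
 then obtain c d where cd: "c : I \<rightarrow> carrier A" "d : I \<rightarrow> carrier A"
  "u = (\<Sum>.M i:I. c i **.M x i)" "v = (\<Sum>.M i:I. d i **.M x i)"
  by (auto simp: span_def)
 then have "u +.M v = (\<Sum>.M i:I. c i **.M x i +.M d i **.M x i)"
  using assms by (subst M.finsum_add) (auto simp: Pi_def smult_closed)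
 also have "... = (\<Sum>.M i:I. (c i \<oplus> d i) **.M x i)"
  using assms cd by (intro M.finsum_eqI) (auto simp: Pi_def smult_l_distr smult_closed)
 finally show "u +.M v : span A M I x"
  unfolding span_def using cd by (auto intro!: exI[of _ "%i. c i \<oplus> d i"])
next
 fix a u assume a: "a <: A" and "u : span A M I x"
 then obtain c where c: "c : I \<rightarrow> carrier A" "u = (\<Sum>.M i:I. c i **.M x i)"
  by (auto simp: span_def)
 have "a **.M u = (\<Sum>.M i:I. (c i \<otimes> a) **.M x i)"
  using assms a c by (auto simp: smult_finsum smult_assoc Pi_def smult_closed intro!: M.finsum_eqI)
 then show "a **.M u : span A M I x"
  unfolding span_def using a c by (auto intro!: exI[of _ "%i. c i \<otimes> a"])
qed

lemma span_subset:
 assumes "submodule P A M" "!!i. i : I ==> x i : P"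
 shows "span A M I x \<subseteq> P"
 using assms submoduleD(5)[OF assms(1)]
 by (auto simp: span_def Pi_def intro!: submodule_finsum)

lemma mod_hom_eq_on_span:
 assumes "right_module A N" "submodule P A M" "f : mod_hom A (M(|carrier := P|)) N" "g : mod_hom A (M(|carrier := P|)) N"
  and "!!i. i : I ==> x i : P" "!!i. i : I ==> f (x i) = g (x i)" "u : span A M I x"
 shows "f u = g u"
proof -
 interpret N: right_module A N by fact
 note P = submoduleD[OF assms(2)]
 obtain c where c: "c : I \<rightarrow> carrier A" "u = (\<Sum>.M i:I. c i **.M x i)"
  using assms(7) by (auto simp: span_def)
 have u: "u = (\<Sum>.(M(|carrier := P|)) i:I. c i **.M x i)"
  unfolding c(2) using c(1) assms(5) P(5) by (intro finsum_submodule[OF assms(2), symmetric]) auto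
 have "h u = (\<Sum>.N i:I. c i **.N h (x i))" if "h : mod_hom A (M(|carrier := P|)) N" for h
  unfolding u using c(1) assms(5) P(5) mod_hom_smult[OF that] mod_hom_closed[OF that]
  by (subst mod_hom_finsum[OF that right_module_submodule[OF assms(2)] assms(1)])
   (auto simp: Pi_def intro!: N.M.finsum_eqI N.smult_closed)
 from this[OF assms(3)] this[OF assms(4)] show ?thesis
  using assms(4-6) c(1) mod_hom_closed[OF assms(4)]
  by (auto simp: Pi_def intro!: N.M.finsum_eqI N.smult_closed)
qed

end

section \<open>Free and projective modules\<close>

lemma free_right_module_simps:
 "carrier (free_right_module A X) = {c : X \<rightarrow>\<^sub>E carrier A. finite {x : X. c x ~= \<zero>.A}}"
 "zero (free_right_module A X) = (\<lambda>x\<in>X. \<zero>.A)"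
 "add (free_right_module A X) = (%c d. \<lambda>x\<in>X. c x +.A d x)"
 "smult (free_right_module A X) = (%a c. \<lambda>x\<in>X. c x *.A a)"
 by (auto simp: free_right_module_def)

lemma free_at:
 "c <: (free_right_module A X) ==> x : X ==> c x <: A"
 by (auto simp: free_right_module_simps)

lemma free_ext:
 "[|c <: (free_right_module A X); d <: (free_right_module A X); !!x. x : X ==> c x = d x|] ==> c = d"
 by (auto simp: free_right_module_simps intro: PiE_ext)

lemma free_at_simps:
 assumes "x : X"
 shows "(\<zero>.(free_right_module A X)) x = \<zero>.A"
  "(c +.(free_right_module A X) d) x = c x +.A d x"
  "(a **.(free_right_module A X) c) x = c x *.A a"
 using assms by (auto simp: free_right_module_simps)

definition fbasis :: "('a, 'c) ring_scheme => 'x set => 'x => 'x => 'a" where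
 "fbasis A X x = (\<lambda>y\<in>X. if y = x then \<one>.A else \<zero>.A)"

text \<open>Summing over the support keeps the index set finite for elements of the free module even
  when \<open>X\<close> is infinite, as for the free cover on \<open>carrier M\<close>.\<close>

definition free_lift ::
 "('a, 'c) ring_scheme => ('a, 'm, 'd) module_scheme => 'x set => ('x => 'm) => ('x => 'a) => 'm" where
 "free_lift A M X u c = (\<Sum>.M x:{x : X. c x ~= \<zero>.A}. c x **.M u x)"

context ring
begin

lemma right_module_free: "right_module R (free_right_module R X)"
proof (intro right_module.intro right_module_axioms.intro)
 let ?F = "free_right_module R X"
 have fin2: "finite {x : X. c x \<oplus> d x ~= \<zero>}"
  if "finite {x : X. c x ~= \<zero>}" "finite {x : X. d x ~= \<zero>}" for c d
  by (rule finite_subset[OF _ finite_UnI[OF that]]) auto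
 have fin1: "finite {x : X. f (c x) ~= \<zero>}" if "finite {x : X. c x ~= \<zero>}" "f \<zero> = \<zero>" for c f
  by (rule finite_subset[OF _ that(1)]) (use that(2) in auto)
 have closed: "a **.?F c <: ?F" if "a <: R" "c <: ?F" for a c
  using that fin1[of c "%x. x \<otimes> a"] by (auto simp: free_right_module_simps cong: conj_cong)
 have add: "c +.?F d <: ?F" if "c <: ?F" "d <: ?F" for c d
  using that fin2[of c d] by (auto simp: free_right_module_simps cong: conj_cong)
 have zero: "\<zero>.?F <: ?F"
  by (auto simp: free_right_module_simps)
 note at = free_at free_at_simps
 show "ring R" by (rule ring_axioms)
 show "abelian_group ?F"
 proof (rule abelian_groupI)
  fix c assume c: "c <: ?F"
  have "(\<ominus> \<one>) **.?F c +.?F c = \<zero>.?F"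
   using c closed add zero by (intro free_ext[where A = R]) (auto simp: at r_minus l_neg)
  then show "EX d:carrier ?F. d +.?F c = \<zero>.?F"
   using closed[of "\<ominus> \<one>" c] c by blast
 next
  fix c d e assume "c <: ?F" "d <: ?F" "e <: ?F"
  then show "c +.?F d +.?F e = c +.?F (d +.?F e)"
   using add by (intro free_ext[where A = R]) (auto simp: at a_ac)
 next
  fix c d assume "c <: ?F" "d <: ?F"
  then show "c +.?F d = d +.?F c"
   using add by (intro free_ext[where A = R]) (auto simp: at a_ac)
 next
  fix c assume "c <: ?F"
  then show "\<zero>.?F +.?F c = c"
   using add zero by (intro free_ext[where A = R]) (auto simp: at)
 qed (use zero add in auto)
 show "\<one> **.?F c = c" if "c <: ?F" for c
  using that closed by (intro free_ext[where A = R]) (auto simp: at)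
 fix a b c d assume ab: "a <: R" "c <: ?F"
 show "a **.?F c <: ?F" using closed ab by simp
 {
  assume b: "b <: R"
  show "(a \<oplus> b) **.?F c = a **.?F c +.?F b **.?F c"
   using ab b closed add by (intro free_ext[where A = R]) (auto simp: at r_distr)
  show "(a \<otimes> b) **.?F c = b **.?F (a **.?F c)"
   using ab b closed add by (intro free_ext[where A = R]) (auto simp: at m_assoc)
 next
  assume d: "d <: ?F"
  show "a **.?F (c +.?F d) = a **.?F c +.?F a **.?F d"
   using ab d closed add by (intro free_ext[where A = R]) (auto simp: at l_distr)
 }
qed

lemma fbasis_closed: "fbasis R X x <: (free_right_module R X)"
 unfolding fbasis_def free_right_module_simps
 by (auto intro: finite_subset[of _ "{x}"])

lemma free_finsum_at:
 assumes "x : X" "!!i. i : I ==> f i <: (free_right_module R X)"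
 shows "finsum (free_right_module R X) f I x = (\<Oplus>i\<in>I. f i x)"
proof -
 interpret F: right_module R "free_right_module R X" by (rule right_module_free)
 show ?thesis
  using assms by (intro finsum_additive[where f = "%c. c x"])
   (auto simp: free_at free_at_simps intro: is_abelian_group F.M.abelian_monoid_axioms)
qed

lemma free_minus_at:
 assumes "x : X" "c <: (free_right_module R X)" "d <: (free_right_module R X)"
 shows "(c -.(free_right_module R X) d) x = c x \<ominus> d x"
proof -
 interpret F: right_module R "free_right_module R X" by (rule right_module_free)
 have "(-.(free_right_module R X) d) x = \<ominus> d x"
  using assms by (simp add: free_at free_at_simps F.minus_one_smult[symmetric] r_minus)
 then show ?thesis
  using assms by (simp add: a_minus_def free_at_simps)
qed

end

context right_module
begin

lemma free_lift_superset:
 assumes "!!x. x : X ==> u x <: M" "c <: (free_right_module A X)"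
  and "finite Y" "{x : X. c x ~= \<zero>} \<subseteq> Y" "Y \<subseteq> X"
 shows "free_lift A M X u c = (\<Sum>.M x:Y. c x **.M u x)"
 unfolding free_lift_def
proof (rule M.finsum_superset)
 fix i assume "i : Y - {x : X. c x ~= \<zero>}"
 then show "c i **.M u i = \<zero>.M" using assms by (auto simp: zero_smult)
qed (use assms free_at[OF assms(2)] in \<open>auto intro!: smult_closed\<close>)

lemma free_lift_hom:
 assumes u: "!!x. x : X ==> u x <: M"
 shows "free_lift A M X u : mod_hom A (free_right_module A X) M"
proof (rule mod_homI)
 let ?F = "free_right_module A X"
 interpret F: right_module A ?F by (rule R.right_module_free)
 have at: "c x **.M u x <: M" if "c <: ?F" "x : X" for c x
  using that u by (auto intro: smult_closed free_at)
 fix c assume c: "c <: ?F"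
 then have fc: "finite {x : X. c x ~= \<zero>}" by (simp add: free_right_module_simps)
 show "free_lift A M X u c <: M"
  unfolding free_lift_def using at c by (auto intro: M.finsum_in)
 {
  fix d assume d: "d <: ?F"
  then have fd: "finite {x : X. d x ~= \<zero>}" by (simp add: free_right_module_simps)
  let ?Y = "{x : X. c x ~= \<zero>} \<union> {x : X. d x ~= \<zero>}"
  have "free_lift A M X u (c +.?F d) = (\<Sum>.M x:?Y. (c +.?F d) x **.M u x)"
   using fc fd c d by (intro free_lift_superset u) (auto simp: free_at_simps)
  also have "... = (\<Sum>.M x:?Y. c x **.M u x +.M d x **.M u x)"
   using c d at u by (intro M.finsum_eqI) (auto simp: free_at_simps smult_l_distr free_at)
  also have "... = (\<Sum>.M x:?Y. c x **.M u x) +.M (\<Sum>.M x:?Y. d x **.M u x)"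
   using c d at by (intro M.finsum_add) auto
  also have "(\<Sum>.M x:?Y. c x **.M u x) = free_lift A M X u c"
   using fc fd c u by (intro free_lift_superset[symmetric]) auto
  also have "(\<Sum>.M x:?Y. d x **.M u x) = free_lift A M X u d"
   using fc fd d u by (intro free_lift_superset[symmetric]) auto
  finally show "free_lift A M X u (c +.?F d) = free_lift A M X u c +.M free_lift A M X u d" .
 next
  fix a assume a: "a <: A"
  let ?Y = "{x : X. c x ~= \<zero>}"
  have "free_lift A M X u (a **.?F c) = (\<Sum>.M x:?Y. (a **.?F c) x **.M u x)"
   using fc c a by (intro free_lift_superset u) (auto simp: free_at_simps F.smult_closed)
  also have "... = (\<Sum>.M x:?Y. a **.M (c x **.M u x))"
   using c a u at by (intro M.finsum_eqI) (auto simp: free_at_simps smult_assoc free_at intro: smult_closed)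
  also have "... = a **.M free_lift A M X u c"
   unfolding free_lift_def using a c at by (intro smult_finsum[symmetric]) auto
  finally show "free_lift A M X u (a **.?F c) = a **.M free_lift A M X u c" .
 }
qed

lemma free_lift_fbasis:
 assumes "!!x. x : X ==> u x <: M" "x : X"
 shows "free_lift A M X u (fbasis A X x) = u x"
proof -
 have "free_lift A M X u (fbasis A X x) = (\<Sum>.M y:{x}. fbasis A X x y **.M u y)"
  using assms by (intro free_lift_superset R.fbasis_closed) (auto simp: fbasis_def)
 also have "... = u x"
  using assms by (simp add: M.finsum_insert fbasis_def smult_one)
 finally show ?thesis .
qed

lemma free_hom_expand:
 assumes "g : mod_hom A (free_right_module A X) M" "c <: (free_right_module A X)"
 shows "g c = free_lift A M X (%x. g (fbasis A X x)) c"
proof -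
 let ?F = "free_right_module A X"
 interpret F: right_module A ?F by (rule R.right_module_free)
 let ?Y = "{x : X. c x ~= \<zero>}"
 have fin: "finite ?Y" using assms(2) by (simp add: free_right_module_simps)
 have "c = (\<Sum>.?F x:?Y. c x **.?F fbasis A X x)"
 proof (rule free_ext[where A = A])
  show "(\<Sum>.?F x:?Y. c x **.?F fbasis A X x) <: ?F"
   using assms(2) by (auto intro!: F.M.finsum_in F.smult_closed R.fbasis_closed intro: free_at)
  fix y assume y: "y : X"
  have "(\<Sum>.?F x:?Y. c x **.?F fbasis A X x) y = (\<Oplus>x\<in>?Y. (c x **.?F fbasis A X x) y)"
   using assms(2) y by (intro R.free_finsum_at)
    (auto intro!: F.M.finsum_in F.smult_closed R.fbasis_closed intro: free_at)
  also have "... = (\<Oplus>x\<in>?Y. if x = y then c x else \<zero>)"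
   using assms(2) y by (intro R.finsum_eqI) (auto simp: free_at_simps fbasis_def free_at)
  also have "... = c y"
  proof (cases "c y = \<zero>")
   case True
   then show ?thesis by (auto intro!: R.finsum_zero')
  next
   case False
   then show ?thesis using fin y assms(2) by (intro R.finsum_delta) (auto simp: free_at)
  qed
  finally show "c y = (\<Sum>.?F x:?Y. c x **.?F fbasis A X x) y" ..
 qed (use assms in simp)
 then have "g c = g (\<Sum>.?F x:?Y. c x **.?F fbasis A X x)" by simp
 also have "... = (\<Sum>.M x:?Y. g (c x **.?F fbasis A X x))"
  using assms(2)
  by (intro mod_hom_finsum[OF assms(1) F.right_module_axioms right_module_axioms])
   (auto intro!: F.smult_closed R.fbasis_closed intro: free_at)
 also have "... = free_lift A M X (%x. g (fbasis A X x)) c"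
  unfolding free_lift_def using assms
  by (intro M.finsum_eqI)
   (auto simp: mod_hom_smult[OF assms(1)] free_at R.fbasis_closed
    intro!: smult_closed mod_hom_closed[OF assms(1)])
 finally show ?thesis .
qed

lemma free_hom_eqI:
 assumes "g : mod_hom A (free_right_module A X) M" "h : mod_hom A (free_right_module A X) M"
  and "!!x. x : X ==> g (fbasis A X x) = h (fbasis A X x)" "c <: (free_right_module A X)"
 shows "g c = h c"
 unfolding free_hom_expand[OF assms(1,4)] free_hom_expand[OF assms(2,4)] free_lift_def
 using assms by (intro M.finsum_eqI)
  (auto intro!: smult_closed mod_hom_closed[OF assms(2)] R.fbasis_closed intro: free_at)

lemma free_lift_lessThan:
 assumes "!!i. i < n ==> u i <: M" "c <: (free_right_module A {..<n::nat})"
 shows "free_lift A M {..<n} u c = (\<Sum>.M i:{..<n}. c i **.M u i)"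
 using assms by (intro free_lift_superset) auto

end

text \<open>Zorn's lemma is applied to the partial sections of the free cover of \<open>M\<close> on \<open>carrier M\<close>
 whose domain belongs to \<open>\<N>\<close>, represented by their graphs.\<close>

lemma projective_by_extension:
 fixes A :: "('a, 'c) ring_scheme" and M :: "('a, 'm, 'd) module_scheme"
 assumes rm: "right_module A M"
  and zero: "{\<zero>.M} : \<N>"
  and sub: "!!N. N : \<N> ==> submodule N A M"
  and chain: "!!C. [|C ~= {}; C \<subseteq> \<N>; !!N N'. [|N : C; N' : C|] ==> N \<subseteq> N' \<or> N' \<subseteq> N|] ==> \<Union>C : \<N>"
  and ext: "!!N. [|N : \<N>; N ~= carrier M|] ==> EX (n::nat) p q.
   p : mod_hom A (free_right_module A {..<n}) M &
   q : mod_hom A (free_right_module A {..<n}) (free_right_module A {..<n}) &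
   (ALL x:carrier (free_right_module A {..<n}). p x -.M p (q x) : N) &
   (ALL x:carrier (free_right_module A {..<n}). p (q x) : N --> q x = \<zero>.(free_right_module A {..<n})) &
   {y +.M p x | y x. y : N & x <: (free_right_module A {..<n})} : \<N> &
   \<not> p ` carrier (free_right_module A {..<n}) \<subseteq> N"
 shows "projective A M"
proof -
 interpret M: right_module A M by fact
 let ?X = "carrier M"
 let ?F = "free_right_module A ?X"
 let ?\<pi> = "free_lift A M ?X (%x. x)"
 interpret F: right_module A ?F by (rule M.R.right_module_free)
 have \<pi>: "?\<pi> : mod_hom A ?F M" by (rule M.free_lift_hom)
 note \<pi>0 = mod_hom_zero[OF \<pi> F.right_module_axioms rm]
 \<comment> \<open>Closure under the operations together with a trivial fibre over zero makes
   \<open>G\<close> the graph of a linear map on \<open>Domain G\<close>; the clause with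
   \<open>free_lift\<close> says that this map is a section of the cover.\<close>
 define Gr where "Gr = {G. G \<subseteq> carrier M \<times> carrier ?F & (\<zero>.M, \<zero>.?F) : G &
  (ALL x c y d. (x, c) : G & (y, d) : G --> (x +.M y, c +.?F d) : G) &
  (ALL a x c. a <: A & (x, c) : G --> (a **.M x, a **.?F c) : G) &
  (ALL x c. (x, c) : G --> ?\<pi> c = x) & (ALL c. (\<zero>.M, c) : G --> c = \<zero>.?F) & Domain G : \<N>}"
 have "EX G:Gr. ALL G':Gr. G \<subseteq> G' --> G' = G"
 proof (rule subset_Zorn_nonempty)
  have "{(\<zero>.M, \<zero>.?F)} : Gr"
   using zero \<pi>0 by (auto simp: Gr_def M.smult_zero F.smult_zero Domain_insert)
  then show "Gr ~= {}" by blast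
  fix C assume C: "C ~= {}" "subset.chain Gr C"
  then have CG: "C \<subseteq> Gr" and Ch: "!!G G'. [|G : C; G' : C|] ==> G \<subseteq> G' \<or> G' \<subseteq> G"
   by (simp_all only: subset_chain_def)
  have GC: "G : C ==> G \<subseteq> carrier M \<times> carrier ?F" "G : C ==> (\<zero>.M, \<zero>.?F) : G"
   "[|G : C; (x, c) : G; (y, d) : G|] ==> (x +.M y, c +.?F d) : G"
   "[|G : C; a <: A; (x, c) : G|] ==> (a **.M x, a **.?F c) : G"
   "[|G : C; (x, c) : G|] ==> ?\<pi> c = x" "[|G : C; (\<zero>.M, c) : G|] ==> c = \<zero>.?F"
   "G : C ==> Domain G : \<N>" for G a x c y d
   using subsetD[OF CG, of G] by (simp_all add: Gr_def)
  show "\<Union>C : Gr"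
   unfolding Gr_def mem_Collect_eq
  proof (intro conjI allI impI)
   show "\<Union>C \<subseteq> carrier M \<times> carrier ?F" "(\<zero>.M, \<zero>.?F) : \<Union>C"
    using C(1) GC(1,2) by blast+
  next
   fix x c y d assume "(x, c) : \<Union>C & (y, d) : \<Union>C"
   then obtain G G' where G: "G : C" "G' : C" "(x, c) : G" "(y, d) : G'" by auto
   then obtain G'' where "G'' : C" "(x, c) : G''" "(y, d) : G''" using Ch[of G G'] by blast
   then show "(x +.M y, c +.?F d) : \<Union>C" using GC(3) by blast
  next
   fix a x c assume "a <: A & (x, c) : \<Union>C"
   then show "(a **.M x, a **.?F c) : \<Union>C" using GC(4) by blast
  next
   fix x c assume "(x, c) : \<Union>C"
   then show "?\<pi> c = x" using GC(5) by blast
  next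
   fix c assume "(\<zero>.M, c) : \<Union>C"
   then show "c = \<zero>.?F" using GC(6) by blast
  next
   have "Domain (\<Union>C) = \<Union>(Domain ` C)" by auto
   moreover have "\<Union>(Domain ` C) : \<N>"
   proof (rule chain)
    show "Domain ` C ~= {}" using C by auto
    show "Domain ` C \<subseteq> \<N>" using GC(7) by blast
    show "N \<subseteq> N' \<or> N' \<subseteq> N" if "N : Domain ` C" "N' : Domain ` C" for N N'
    proof -
     from that obtain G G' where "G : C" "G' : C" "N = Domain G" "N' = Domain G'" by blast
     then show ?thesis using Ch[of G G'] Domain_mono[of G G'] Domain_mono[of G' G] by blast
    qed
   qed
   ultimately show "Domain (\<Union>C) : \<N>" by simp
  qed
 qed
 then obtain G where G: "G : Gr" and max: "!!G'. [|G' : Gr; G \<subseteq> G'|] ==> G' = G" by blast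
 have G1: "(x, c) : G ==> x <: M" "(x, c) : G ==> c <: ?F" "(\<zero>.M, \<zero>.?F) : G"
  and Gadd: "[|(x, c) : G; (y, d) : G|] ==> (x +.M y, c +.?F d) : G"
  and Gsmult: "[|a <: A; (x, c) : G|] ==> (a **.M x, a **.?F c) : G"
  and G\<pi>: "(x, c) : G ==> ?\<pi> c = x" and G0: "(\<zero>.M, c) : G ==> c = \<zero>.?F"
  and GN: "Domain G : \<N>" for x c y d a
  using G unfolding Gr_def by (simp_all add: subset_iff)
 have dom: "Domain G = carrier M"
 proof (rule ccontr)
  assume ne: "Domain G ~= carrier M"
  obtain n p q where p: "p : mod_hom A (free_right_module A {..<n::nat}) M"
   and q: "q : mod_hom A (free_right_module A {..<n}) (free_right_module A {..<n})"
   and pq: "!!x. x <: (free_right_module A {..<n}) ==> p x -.M p (q x) : Domain G"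
   and pq0: "!!x. [|x <: (free_right_module A {..<n}); p (q x) : Domain G|] ==> q x = \<zero>.(free_right_module A {..<n})"
   and N': "{y +.M p x | y x. y : Domain G & x <: (free_right_module A {..<n})} : \<N>"
   and np: "\<not> p ` carrier (free_right_module A {..<n}) \<subseteq> Domain G"
   using ext[OF GN ne] by blast
  let ?E = "free_right_module A {..<n}"
  interpret E: right_module A ?E by (rule M.R.right_module_free)
  note DG = M.submoduleD[OF sub[OF GN]]
  have pc: "x <: ?E ==> p x <: M" and qc: "x <: ?E ==> q x <: ?E" for x
   using p q mod_hom_closed by metis+
  define s where "s = free_lift A ?F {..<n} (%j. fbasis A ?X (p (fbasis A {..<n} j)))"
  have s: "s : mod_hom A ?E ?F"
   unfolding s_def by (intro F.free_lift_hom M.R.fbasis_closed)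
  have sc: "x <: ?E ==> s x <: ?F" for x using s mod_hom_closed by metis
  have \<pi>s: "?\<pi> (s x) = p x" if "x <: ?E" for x
  proof (rule M.free_hom_eqI[OF mod_hom_compose[OF \<pi> s] p _ that])
   fix j assume j: "j : {..<n}"
   have "s (fbasis A {..<n} j) = fbasis A ?X (p (fbasis A {..<n} j))"
    unfolding s_def using j by (intro F.free_lift_fbasis M.R.fbasis_closed)
   then show "?\<pi> (s (fbasis A {..<n} j)) = p (fbasis A {..<n} j)"
    using M.free_lift_fbasis[of ?X "%x. x"] pc M.R.fbasis_closed[of "{..<n}" j] by simp
  qed
  \<comment> \<open>The section is prolonged along \<open>p o q\<close> only. Since
    \<open>p (q x)\<close> lies in \<open>Domain G\<close> only for \<open>q x\<close> zero, the new
    values cannot conflict with the old section; since \<open>p x\<close> and \<open>p (q x)\<close>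
    differ by an element of \<open>Domain G\<close>, the enlarged domain still contains the image of
    \<open>p\<close>.\<close>
  define pp where "pp = (%x. p (q x))"
  define ss where "ss = (%x. s (q x))"
  have pp: "pp : mod_hom A ?E M" and ss: "ss : mod_hom A ?E ?F"
   unfolding pp_def ss_def using p q s mod_hom_compose by blast+
  note ppc = mod_hom_closed[OF pp] and ssc = mod_hom_closed[OF ss]
  define G' where "G' = {(y +.M pp x, c +.?F ss x) | y c x. (y, c) : G & x <: ?E}"
  have DG': "Domain G' = {y +.M p x | y x. y : Domain G & x <: ?E}" (is "_ = ?N'")
  proof (intro equalityI subsetI)
   fix z assume "z : Domain G'"
   then obtain y c x where "z = y +.M pp x" "(y, c) : G" "x <: ?E"
    unfolding G'_def by auto
   then show "z : ?N'" using qc unfolding pp_def by blast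
  next
   fix z assume "z : ?N'"
   then obtain y x where z: "z = y +.M p x" "y : Domain G" "x <: ?E" by blast
   have y': "y +.M (p x -.M pp x) : Domain G"
    using z pq DG(4) unfolding pp_def by blast
   have "(y +.M (p x -.M pp x)) +.M pp x = y +.M p x"
    using z DG(2) pc ppc by (simp add: a_minus_def M.a_assoc M.M.l_neg)
   then have "z = (y +.M (p x -.M pp x)) +.M pp x" using z by simp
   then show "z : Domain G'" using y' z(3) unfolding G'_def by blast
  qed
  have "G' : Gr"
   unfolding Gr_def mem_Collect_eq
  proof (intro conjI allI impI)
   show "G' \<subseteq> carrier M \<times> carrier ?F"
    unfolding G'_def using G1 ppc ssc by auto
   have "(\<zero>.M +.M pp \<zero>.?E, \<zero>.?F +.?F ss \<zero>.?E) : G'"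
    unfolding G'_def using G1(3) E.M.zero_closed by blast
   then show "(\<zero>.M, \<zero>.?F) : G'"
    using mod_hom_zero[OF pp E.right_module_axioms rm] mod_hom_zero[OF ss E.right_module_axioms F.right_module_axioms]
    by simp
   show "Domain G' : \<N>" unfolding DG' by (rule N')
  next
   fix z c w d assume "(z, c) : G' & (w, d) : G'"
   then obtain y e x y' e' x' where *: "z = y +.M pp x" "c = e +.?F ss x" "(y, e) : G" "x <: ?E"
    "w = y' +.M pp x'" "d = e' +.?F ss x'" "(y', e') : G" "x' <: ?E"
    unfolding G'_def by blast
   have "z +.M w = (y +.M y') +.M pp (x +.?E x')"
    using * G1(1) ppc by (simp add: mod_hom_add[OF pp] M.a_ac)
   moreover have "c +.?F d = (e +.?F e') +.?F ss (x +.?E x')"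
    using * G1(2) ssc by (simp add: mod_hom_add[OF ss] F.M.a_ac)
   ultimately show "(z +.M w, c +.?F d) : G'"
    unfolding G'_def using Gadd[OF *(3,7)] E.M.a_closed[OF *(4,8)] by blast
  next
   fix a z c assume "a <: A & (z, c) : G'"
   then obtain y e x where *: "z = y +.M pp x" "c = e +.?F ss x" "(y, e) : G" "x <: ?E" "a <: A"
    unfolding G'_def by blast
   have "a **.M z = (a **.M y) +.M pp (a **.?E x)"
    using * G1(1) ppc by (simp add: mod_hom_smult[OF pp] M.smult_r_distr)
   moreover have "a **.?F c = (a **.?F e) +.?F ss (a **.?E x)"
    using * G1(2) ssc by (simp add: mod_hom_smult[OF ss] F.smult_r_distr)
   ultimately show "(a **.M z, a **.?F c) : G'"
    unfolding G'_def using Gsmult[OF *(5,3)] E.smult_closed[OF *(5,4)] by blast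
  next
   fix z c assume "(z, c) : G'"
   then obtain y e x where *: "z = y +.M pp x" "c = e +.?F ss x" "(y, e) : G" "x <: ?E"
    unfolding G'_def by blast
   then show "?\<pi> c = z"
    using G1 ssc G\<pi> \<pi>s qc by (simp add: mod_hom_add[OF \<pi>] pp_def ss_def)
  next
   fix c assume "(\<zero>.M, c) : G'"
   then obtain y e x where *: "\<zero>.M = y +.M pp x" "c = e +.?F ss x" "(y, e) : G" "x <: ?E"
    unfolding G'_def by blast
   have "pp x = -.M y"
    using * G1(1) ppc by (metis M.a_comm M.M.minus_equality)
   then have "p (q x) : Domain G" using *(3) DG(6) unfolding pp_def by auto
   then have q0: "q x = \<zero>.?E" using pq0 *(4) by blast
   then have "pp x = \<zero>.M" "ss x = \<zero>.?F"
    unfolding pp_def ss_def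
    using mod_hom_zero[OF p E.right_module_axioms rm] mod_hom_zero[OF s E.right_module_axioms F.right_module_axioms]
    by simp_all
   with *(1) G1(1)[OF *(3)] have "y = \<zero>.M" by simp
   with *(3) G0 have "e = \<zero>.?F" by blast
   then show "c = \<zero>.?F" using *(2) \<open>ss x = \<zero>.?F\<close> by simp
  qed
  moreover have "G \<subseteq> G'"
  proof safe
   fix y c assume yc: "(y, c) : G"
   have "(y +.M pp \<zero>.?E, c +.?F ss \<zero>.?E) : G'"
    unfolding G'_def using yc E.M.zero_closed by blast
   then show "(y, c) : G'"
    using mod_hom_zero[OF pp E.right_module_axioms rm] G1(1)[OF yc] G1(2)[OF yc]
     mod_hom_zero[OF ss E.right_module_axioms F.right_module_axioms] by simp
  qed
  ultimately have "G' = G" by (rule max)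
  moreover obtain x where x: "x <: ?E" "p x \<notin> Domain G" using np by blast
  moreover have "p x <: M" using x(1) by (rule pc)
  moreover have "p x = \<zero>.M +.M p x" using pc[OF x(1)] by simp
  moreover have "\<zero>.M +.M p x : Domain G'" unfolding DG' using G1(3) x(1) by blast
  ultimately show False by simp
 qed
 have ex: "EX c. (x, c) : G" if "x <: M" for x using dom that by auto
 define i where "i x = (SOME c. (x, c) : G)" for x
 have i: "(x, i x) : G" if "x <: M" for x
  unfolding i_def using ex[OF that] by (rule someI_ex)
 have uniq: "c = d" if "(x, c) : G" "(x, d) : G" for x c d
 proof -
  have "(x +.M (-.A \<one>.A) **.M x, c +.?F (-.A \<one>.A) **.?F d) : G"
   using that by (intro Gadd Gsmult) auto
  then have "(\<zero>.M, c +.?F (-.?F d)) : G"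
   using G1(1)[OF that(1)] G1(2)[OF that(1)] G1(2)[OF that(2)] by (simp add: M.minus_one_smult F.minus_one_smult M.M.r_neg)
  then have "c +.?F (-.?F d) = \<zero>.?F" by (rule G0)
  then show ?thesis using G1(2)[OF that(1)] G1(2)[OF that(2)]
   by (metis F.M.a_inv_closed F.M.minus_equality F.M.minus_minus)
 qed
 have "i : mod_hom A M ?F"
 proof (rule mod_homI)
  show "i x <: ?F" if "x <: M" for x using G1(2)[OF i[OF that]] .
  show "i (x +.M y) = i x +.?F i y" if "x <: M" "y <: M" for x y
   by (rule uniq[OF i Gadd[OF i[OF that(1)] i[OF that(2)]]]) (use that in simp)
  show "i (a **.M x) = a **.?F i x" if "a <: A" "x <: M" for a x
   by (rule uniq[OF i Gsmult[OF that(1) i[OF that(2)]]]) (use that M.smult_closed in simp)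
 qed
 moreover have "ALL x:carrier M. ?\<pi> (i x) = x" using i G\<pi> by blast
 ultimately show ?thesis
  unfolding projective_def using rm \<pi> by blast
qed

section \<open>Tensor products\<close>

text \<open>This is what \<open>tensor_lift\<close> computes from its chosen representative, made
  available for every formal sum so that independence of the representative can be stated and
  proved.\<close>

definition frag_eval :: "('g, 'c) ring_scheme => ('m => 'n => 'g) => ('m \<times> 'n \<Rightarrow>\<^sub>0 int) => 'g" where
 "frag_eval G \<beta> u =
   (\<Sum>.G p:Poly_Mapping.keys u. [Poly_Mapping.lookup u p] \<cdot>\<^bsub>G\<^esub> \<beta> (fst p) (snd p))"

definition balanced ::
 "('r, 'c) ring_scheme => ('r, 'm, 'd) module_scheme => ('r, 'n, 'e) module_scheme =>
  ('g, 'f) ring_scheme => ('m => 'n => 'g) => bool" where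
 "balanced R M N G \<beta> \<longleftrightarrow> (ALL x:carrier M. ALL y:carrier N. \<beta> x y <: G) &
   (ALL x:carrier M. ALL x':carrier M. ALL y:carrier N. \<beta> (x +.M x') y = \<beta> x y +.G \<beta> x' y) &
   (ALL x:carrier M. ALL y:carrier N. ALL y':carrier N. \<beta> x (y +.N y') = \<beta> x y +.G \<beta> x y') &
   (ALL r:carrier R. ALL x:carrier M. ALL y:carrier N. \<beta> (r **.M x) y = \<beta> x (r **.N y))"

text \<open>The part of balancedness used by finitely many relations: those between elements of the
 set \<open>X\<close> with scalars from \<open>B\<close>.\<close>

definition balanced_on ::
 "'m set => 'r set => ('r, 'm, 'd) module_scheme => ('r, 'n, 'e) module_scheme =>
  ('g, 'f) ring_scheme => ('m => 'n => 'g) => bool" where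
 "balanced_on X B M N G \<beta> \<longleftrightarrow> (ALL x:carrier M. ALL y:carrier N. \<beta> x y <: G) &
   (ALL x:X. ALL x':X. ALL y:carrier N. x +.M x' : X --> \<beta> (x +.M x') y = \<beta> x y +.G \<beta> x' y) &
   (ALL x:X. ALL y:carrier N. ALL y':carrier N. \<beta> x (y +.N y') = \<beta> x y +.G \<beta> x y') &
   (ALL r:B. ALL x:X. ALL y:carrier N. r **.M x : X --> \<beta> (r **.M x) y = \<beta> x (r **.N y))"

section \<open>Evaluation of formal sums of pairs\<close>

context abelian_group
begin

lemma frag_eval_superset:
 assumes "ALL x y. (x, y) : S --> \<beta> x y <: G" "finite Y" "Poly_Mapping.keys u \<subseteq> Y" "Y \<subseteq> S"
 shows "frag_eval G \<beta> u = (\<Oplus>p\<in>Y. [Poly_Mapping.lookup u p] \<cdot> \<beta> (fst p) (snd p))"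
 unfolding frag_eval_def
proof (rule finsum_superset)
 fix p assume "p : Y - Poly_Mapping.keys u"
 then have "Poly_Mapping.lookup u p = 0" by (simp add: in_keys_iff)
 then show "[Poly_Mapping.lookup u p] \<cdot> \<beta> (fst p) (snd p) = \<zero>"
  by (simp add: add_pow_def)
qed (use assms in auto)

lemma frag_eval_closed:
 assumes "ALL x y. (x, y) : S --> \<beta> x y <: G" "Poly_Mapping.keys u \<subseteq> S"
 shows "frag_eval G \<beta> u <: G"
 unfolding frag_eval_def using assms by (auto intro!: finsum_in)

lemma frag_eval_add:
 assumes \<beta>: "ALL x y. (x, y) : S --> \<beta> x y <: G"
  and uv: "Poly_Mapping.keys u \<subseteq> S" "Poly_Mapping.keys v \<subseteq> S"
 shows "frag_eval G \<beta> (u + v) = frag_eval G \<beta> u \<oplus> frag_eval G \<beta> v"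
proof -
 let ?Y = "Poly_Mapping.keys u \<union> Poly_Mapping.keys v"
 have c: "\<beta> (fst p) (snd p) <: G" if "p : ?Y" for p
  using that uv \<beta>[rule_format, of "fst p" "snd p"] by auto
 have "frag_eval G \<beta> (u + v) = (\<Oplus>p\<in>?Y. [Poly_Mapping.lookup (u + v) p] \<cdot> \<beta> (fst p) (snd p))"
  using uv keys_add[of u v] by (intro frag_eval_superset[OF \<beta>]) auto
 also have "... = (\<Oplus>p\<in>?Y. [Poly_Mapping.lookup u p] \<cdot> \<beta> (fst p) (snd p) \<oplus> [Poly_Mapping.lookup v p] \<cdot> \<beta> (fst p) (snd p))"
  using c by (intro finsum_eqI) (auto simp: Poly_Mapping.lookup_add add.int_pow_mult)
 also have "... = (\<Oplus>p\<in>?Y. [Poly_Mapping.lookup u p] \<cdot> \<beta> (fst p) (snd p)) \<oplus> (\<Oplus>p\<in>?Y. [Poly_Mapping.lookup v p] \<cdot> \<beta> (fst p) (snd p))"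
  using c by (intro finsum_add) auto
 also have "(\<Oplus>p\<in>?Y. [Poly_Mapping.lookup u p] \<cdot> \<beta> (fst p) (snd p)) = frag_eval G \<beta> u"
  using uv by (intro frag_eval_superset[OF \<beta>, symmetric]) auto
 also have "(\<Oplus>p\<in>?Y. [Poly_Mapping.lookup v p] \<cdot> \<beta> (fst p) (snd p)) = frag_eval G \<beta> v"
  using uv by (intro frag_eval_superset[OF \<beta>, symmetric]) auto
 finally show ?thesis .
qed

lemma frag_eval_of: "\<beta> x y <: G ==> frag_eval G \<beta> (frag_of (x, y)) = \<beta> x y"
 using add.int_pow_1[of "\<beta> x y"] by (simp add: frag_eval_def finsum_insert)

lemma frag_eval_diff:
 assumes \<beta>: "ALL x y. (x, y) : S --> \<beta> x y <: G"
  and uv: "Poly_Mapping.keys u \<subseteq> S" "Poly_Mapping.keys v \<subseteq> S"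
 shows "frag_eval G \<beta> (u - v) = frag_eval G \<beta> u \<ominus> frag_eval G \<beta> v"
proof -
 have k: "Poly_Mapping.keys (u - v) \<subseteq> S" using uv keys_diff[of u v] by auto
 have "frag_eval G \<beta> u = frag_eval G \<beta> (u - v) \<oplus> frag_eval G \<beta> v"
  using frag_eval_add[OF \<beta> k uv(2)] by simp
 then show ?thesis
  using frag_eval_closed[OF \<beta> k] frag_eval_closed[OF \<beta> uv(2)]
  by (simp add: a_minus_def a_assoc r_neg)
qed

end

text \<open>Closure under both scalar actions is the common ground of the two uses: a right and a
  left module over \<open>A\<close> in the proof of flatness, and two vector spaces over
  \<open>K\<close> for coactions.\<close>

locale tensor_pair = M: abelian_group M + N: abelian_group N
 for R :: "('r, 'c) ring_scheme" and M :: "('r, 'm, 'd) module_scheme" and N :: "('r, 'n, 'e) module_scheme" +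
 assumes smult_M: "[|r <: R; x <: M|] ==> r **.M x <: M"
  and smult_N: "[|r <: R; y <: N|] ==> r **.N y <: N"
begin

abbreviation "Fr \<equiv> free_Abelian_group (carrier M \<times> carrier N)"
abbreviation "Rel \<equiv> tensor_relations R M N"
abbreviation "T \<equiv> tensor_group R M N"
abbreviation "cls u \<equiv> Rel #>\<^bsub>Fr\<^esub> u"
abbreviation "pt \<equiv> pure_tensor R M N"

lemma keys_diff3: "Poly_Mapping.keys (frag_of a - frag_of b - frag_of c) \<subseteq> {a, b, c}"
 "Poly_Mapping.keys (frag_of a - frag_of b) \<subseteq> {a, b}"
 using keys_diff[of "frag_of a - frag_of b" "frag_of c"] keys_diff[of "frag_of a" "frag_of b"] by auto

lemma subgroup_Rel: "subgroup Rel Fr"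
 unfolding tensor_relations_def
proof (rule group.generate_is_subgroup[OF group_free_Abelian_group], intro subsetI)
 fix u assume "u : {frag_of (x +.M x', y) - frag_of (x, y) - frag_of (x', y) | x x' y.
    x <: M & x' <: M & y <: N} \<union>
   {frag_of (x, y +.N y') - frag_of (x, y) - frag_of (x, y') | x y y'.
    x <: M & y <: N & y' <: N} \<union>
   {frag_of (r **.M x, y) - frag_of (x, r **.N y) | r x y.
    r <: R & x <: M & y <: N}"
 then consider x x' y where "u = frag_of (x +.M x', y) - frag_of (x, y) - frag_of (x', y)"
   "x <: M" "x' <: M" "y <: N"
  | x y y' where "u = frag_of (x, y +.N y') - frag_of (x, y) - frag_of (x, y')"
   "x <: M" "y <: N" "y' <: N"
  | r x y where "u = frag_of (r **.M x, y) - frag_of (x, r **.N y)"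
   "r <: R" "x <: M" "y <: N"
  by blast
 then show "u <: Fr"
  by cases (use keys_diff3 smult_M smult_N in \<open>fastforce simp del: keys_single\<close>)+
qed

lemma Rel_keys: "u : Rel ==> Poly_Mapping.keys u \<subseteq> carrier M \<times> carrier N"
 using subsetD[OF subgroup.subset[OF subgroup_Rel], of u] by (simp only: carrier_free_Abelian_group_iff)

lemma rel_add_left: "[|x <: M; x' <: M; y <: N|] ==>
  frag_of (x +.M x', y) - frag_of (x, y) - frag_of (x', y) : Rel"
 and rel_add_right: "[|x <: M; y <: N; y' <: N|] ==>
  frag_of (x, y +.N y') - frag_of (x, y) - frag_of (x, y') : Rel"
 and rel_smult: "[|r <: R; x <: M; y <: N|] ==>
  frag_of (r **.M x, y) - frag_of (x, r **.N y) : Rel"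
 unfolding tensor_relations_def by (rule generate.incl, blast)+

lemma normal_Rel: "Rel \<lhd> Fr"
 by (rule comm_group.subgroup_imp_normal[OF abelian_free_Abelian_group subgroup_Rel])

lemma T_simps:
 "carrier T = {cls u | u. Poly_Mapping.keys u \<subseteq> carrier M \<times> carrier N}" "\<zero>.T = Rel"
 "add T = (<#>\<^bsub>Fr\<^esub>)"
 by (auto simp: tensor_group_def Let_def FactGroup_def RCOSETS_def)

lemma cls_closed: "Poly_Mapping.keys u \<subseteq> carrier M \<times> carrier N ==> cls u <: T"
 by (auto simp: T_simps(1))

lemma cls_add:
 assumes "Poly_Mapping.keys u \<subseteq> carrier M \<times> carrier N" "Poly_Mapping.keys v \<subseteq> carrier M \<times> carrier N"
 shows "cls u +.T cls v = cls (u + v)"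
 using normal.rcos_sum[OF normal_Rel, of u v] assms by (simp add: T_simps)

lemma cls_zero_iff: "Poly_Mapping.keys u \<subseteq> carrier M \<times> carrier N ==> cls u = \<zero>.T \<longleftrightarrow> u : Rel"
 using group.coset_join1[OF group_free_Abelian_group _ _ subgroup_Rel]
  group.coset_join2[OF group_free_Abelian_group _ subgroup_Rel]
 by (auto simp: T_simps)

lemma abelian_group_T: "abelian_group T"
proof (rule abelian_groupI)
 show "\<zero>.T <: T"
  using cls_zero_iff[of 0] cls_closed[of 0] subgroup.one_closed[OF subgroup_Rel] by simp
 have z: "\<zero>.T = cls 0"
  using cls_zero_iff[of 0] subgroup.one_closed[OF subgroup_Rel] by simp
 fix s assume s: "s <: T"
 then obtain u where u: "s = cls u" "Poly_Mapping.keys u \<subseteq> carrier M \<times> carrier N"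
  by (auto simp: T_simps)
 show "\<zero>.T +.T s = s" unfolding z u using u cls_add[of 0 u] by simp
 have "cls (- u) +.T s = \<zero>.T" unfolding z u using u cls_add[of "- u" u] by simp
 then show "EX t:carrier T. t +.T s = \<zero>.T"
  using u cls_closed[of "- u"] by auto
 fix t assume "t <: T"
 then obtain v where v: "t = cls v" "Poly_Mapping.keys v \<subseteq> carrier M \<times> carrier N"
  by (auto simp: T_simps)
 have uv: "Poly_Mapping.keys (u + v) \<subseteq> carrier M \<times> carrier N"
  using u v keys_add[of u v] by auto
 then show "s +.T t <: T" using u v cls_add[of u v] cls_closed by simp
 show "s +.T t = t +.T s" using u v by (simp add: cls_add add.commute)
 fix r assume "r <: T"
 then obtain w where w: "r = cls w" "Poly_Mapping.keys w \<subseteq> carrier M \<times> carrier N"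
  by (auto simp: T_simps)
 have "Poly_Mapping.keys (v + w) \<subseteq> carrier M \<times> carrier N"
  using w v keys_add[of v w] by auto
 then show "s +.T t +.T r = s +.T (t +.T r)"
  using u v w uv by (simp add: cls_add add.assoc)
qed

sublocale T: abelian_group T by (rule abelian_group_T)

lemma pt_cls: "pt x y = cls (frag_of (x, y))"
 by (simp add: pure_tensor_def)

lemma pt_closed: "[|x <: M; y <: N|] ==> pt x y <: T"
 unfolding pt_cls T_simps by (auto simp: keys_frag_of intro!: exI[of _ "frag_of (x, y)"])

lemma cls_eqI:
 assumes "u - v : Rel" "Poly_Mapping.keys u \<subseteq> carrier M \<times> carrier N" "Poly_Mapping.keys v \<subseteq> carrier M \<times> carrier N"
 shows "cls u = cls v"
proof -
 have k: "Poly_Mapping.keys (u - v) \<subseteq> carrier M \<times> carrier N" using assms keys_diff[of u v] by auto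
 have v: "cls v <: T" using assms(3) by (auto simp: T_simps(1))
 have "cls u = cls (u - v) +.T cls v" using cls_add[OF k assms(3)] by simp
 also have "cls (u - v) = \<zero>.T" using cls_zero_iff[OF k] assms(1) by simp
 finally show ?thesis using v by simp
qed

lemma balanced_pt: "balanced R M N T pt"
 unfolding balanced_def
proof (intro conjI ballI)
 fix x x' y assume *: "x <: M" "x' <: M" "y <: N"
 have "pt x y +.T pt x' y = cls (frag_of (x, y) + frag_of (x', y))"
  unfolding pt_cls using * by (intro cls_add) auto
 also have "... = pt (x +.M x') y"
  unfolding pt_cls using * rel_add_left[OF *] keys_add[of "frag_of (x, y)" "frag_of (x', y)"]
  by (intro cls_eqI[symmetric]) (auto simp: algebra_simps)
 finally show "pt (x +.M x') y = pt x y +.T pt x' y" ..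
next
 fix x y y' assume *: "x <: M" "y <: N" "y' <: N"
 have "pt x y +.T pt x y' = cls (frag_of (x, y) + frag_of (x, y'))"
  unfolding pt_cls using * by (intro cls_add) auto
 also have "... = pt x (y +.N y')"
  unfolding pt_cls using * rel_add_right[OF *] keys_add[of "frag_of (x, y)" "frag_of (x, y')"]
  by (intro cls_eqI[symmetric]) (auto simp: algebra_simps)
 finally show "pt x (y +.N y') = pt x y +.T pt x y'" ..
next
 fix r x y assume *: "r <: R" "x <: M" "y <: N"
 show "pt (r **.M x) y = pt x (r **.N y)"
  unfolding pt_cls using * rel_smult[OF *] smult_M smult_N by (intro cls_eqI) auto
qed (use pt_closed in auto)

text \<open>Integer coefficients disappear because sums can be concatenated and a minus sign is
  absorbed by the first factor.\<close>

lemma pt_repr: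
 assumes "t <: T"
 obtains n :: nat and x y where "!!i. i < n ==> x i <: M" "!!i. i < n ==> y i <: N"
  "t = (\<Sum>.T i:{..<n}. pt (x i) (y i))"
proof -
 define P where "P t \<longleftrightarrow> (EX (n::nat) x y. (ALL i<n. x i <: M & y i <: N) &
  t = (\<Sum>.T i:{..<n}. pt (x i) (y i)))" for t
 note bal = balanced_pt[unfolded balanced_def]
 have Padd: "P (s +.T t)" if "P s" "P t" for s t
 proof -
  from that obtain n x y m x' y' where
   1: "ALL i<n. x i <: M & y i <: N" "s = (\<Sum>.T i:{..<n::nat}. pt (x i) (y i))" and
   2: "ALL i<m. x' i <: M & y' i <: N" "t = (\<Sum>.T i:{..<m::nat}. pt (x' i) (y' i))"
   unfolding P_def by blast
  define x'' y'' where "x'' i = (if i < n then x i else x' (i - n))"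
   and "y'' i = (if i < n then y i else y' (i - n))" for i
  have mem: "ALL i<n+m. x'' i <: M & y'' i <: N"
   using 1 2 by (auto simp: x''_def y''_def)
  have "{..<n+m} = {..<n} \<union> (%i. i + n) ` {..<m}"
  proof -
   have "k : (%i. i + n) ` {..<m}" if "k < n + m" "\<not> k < n" for k
    using that by (intro image_eqI[of _ _ "k - n"]) auto
   then show ?thesis by auto
  qed
  then have "(\<Sum>.T i:{..<n+m}. pt (x'' i) (y'' i)) =
   (\<Sum>.T i:{..<n}. pt (x'' i) (y'' i)) +.T (\<Sum>.T i:(%i. i + n) ` {..<m}. pt (x'' i) (y'' i))"
   using mem pt_closed by (simp only:) (intro T.finsum_Un_disjoint, auto)
  also have "(\<Sum>.T i:{..<n}. pt (x'' i) (y'' i)) = s"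
   unfolding 1(2) using 1(1) pt_closed by (intro T.finsum_eqI) (auto simp: x''_def y''_def)
  also have "(\<Sum>.T i:(%i. i + n) ` {..<m}. pt (x'' i) (y'' i)) = (\<Sum>.T i:{..<m}. pt (x'' (i + n)) (y'' (i + n)))"
   using mem pt_closed by (intro T.finsum_reindex) (auto simp: inj_on_def)
  also have "... = t"
   unfolding 2(2) using 2(1) pt_closed by (intro T.finsum_eqI) (auto simp: x''_def y''_def)
  finally show ?thesis unfolding P_def using mem by (intro exI[of _ "n + m"] exI[of _ x''] exI[of _ y'']) simp
 qed
 have P0: "P \<zero>.T" unfolding P_def by (intro exI[of _ 0]) auto
 have P1: "P (pt x y)" if "x <: M" "y <: N" for x y
  unfolding P_def using that pt_closed[of x y]
  by (intro exI[of _ 1] exI[of _ "%_. x"] exI[of _ "%_. y"]) (auto simp: lessThan_Suc T.finsum_insert)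
 have neg_pt: "-.T pt x y = pt (-.M x) y" if xy: "x <: M" "y <: N" for x y
 proof -
  have a: "pt (a +.M b) y = pt a y +.T pt b y" if "a <: M" "b <: M" for a b
   using bal that xy by blast
  have "pt \<zero>.M y +.T pt \<zero>.M y = pt \<zero>.M y" using a[of "\<zero>.M" "\<zero>.M"] by simp
  then have z: "pt \<zero>.M y = \<zero>.T" using pt_closed[of "\<zero>.M" y] xy by (simp add: T.add.l_cancel_one)
  have "pt (-.M x) y +.T pt x y = \<zero>.T"
   using a[of "-.M x" x] z xy by (simp add: M.l_neg)
  then show ?thesis using xy pt_closed by (intro T.minus_equality) auto
 qed
 have Pneg: "P (-.T t)" if t: "P t" for t
 proof -
  obtain n x y where 1: "ALL i<n. x i <: M & y i <: N" "t = (\<Sum>.T i:{..<n::nat}. pt (x i) (y i))"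
   using t unfolding P_def by blast
  have "-.T t = (\<Sum>.T i:{..<n}. -.T pt (x i) (y i))"
   unfolding 1(2) using 1(1) pt_closed T.abelian_monoid_axioms abelian_group_T
   by (intro finsum_additive[where f = "%t. -.T t"]) (auto simp: T.minus_add)
  also have "... = (\<Sum>.T i:{..<n}. pt (-.M x i) (y i))"
   using 1(1) pt_closed neg_pt by (intro T.finsum_eqI) auto
  finally show ?thesis
   unfolding P_def using 1(1) by (intro exI[of _ n] exI[of _ "%i. -.M x i"] exI[of _ y]) auto
 qed
 obtain u where u: "t = cls u" "Poly_Mapping.keys u \<subseteq> carrier M \<times> carrier N"
  using assms by (auto simp: T_simps)
 have "P (cls u)"
 proof (rule free_Abelian_group_induct[where P = "%u. P (cls u)", OF u(2)])
  show "P (cls 0)" using P0 cls_zero_iff[of 0] subgroup.one_closed[OF subgroup_Rel] by simp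
 next
  fix x y assume 2: "Poly_Mapping.keys x \<subseteq> carrier M \<times> carrier N"
   "Poly_Mapping.keys y \<subseteq> carrier M \<times> carrier N" "P (cls x)" "P (cls y)"
  have c: "cls x <: T" "cls y <: T" using 2 cls_closed by auto
  have "cls (x - y) +.T cls y = cls x"
   using 2 keys_diff[of x y] by (subst cls_add) auto
  moreover have "cls (x - y) <: T" using 2 keys_diff[of x y] by (intro cls_closed) auto
  ultimately have "cls (x - y) = cls x +.T -.T cls y"
   using c by (metis T.add.inv_solve_right)
  then show "P (cls (x - y))" using Padd Pneg 2 by simp
 next
  fix a assume "a : carrier M \<times> carrier N"
  then show "P (cls (frag_of a))" using P1[of "fst a" "snd a"] by (auto simp: pt_cls)
 qed
 then show ?thesis using that u(1) unfolding P_def by blast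
qed

text \<open>A relation is a finite combination of generators, each of which mentions at most three
  elements of \<open>M\<close> and one scalar. Balancedness on these finitely many data already
  forces its value to vanish. This locality later turns a vanishing tensor into finitely many
  relations in \<open>M\<close>.\<close>

lemma rel_eval:
 assumes "abelian_group G" "u : Rel"
 shows "EX X B. finite X & X \<subseteq> carrier M & finite B & B \<subseteq> carrier R &
  (ALL \<beta>. balanced_on X B M N G \<beta> --> frag_eval G \<beta> u = \<zero>.G)"
proof -
 interpret G: abelian_group G by fact
 have key: "P" if "EX X B. finite X & X \<subseteq> carrier M & finite B & B \<subseteq> carrier R & Q X B"
  "!!X B. [|finite X; X \<subseteq> carrier M; finite B; B \<subseteq> carrier R; Q X B|] ==> P" for P Q
  using that by blast
 have bc: "ALL x y. (x, y) : carrier M \<times> carrier N --> \<beta> x y <: G" if "balanced_on X B M N G \<beta>" for X B \<beta>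
  using that by (auto simp: balanced_on_def)
 have mono: "balanced_on X B M N G \<beta>" if "balanced_on X' B' M N G \<beta>" "X \<subseteq> X'" "B \<subseteq> B'" for X B X' B' \<beta>
  using that unfolding balanced_on_def subset_iff by simp
 have gen: "EX X B. finite X & X \<subseteq> carrier M & finite B & B \<subseteq> carrier R &
  (ALL \<beta>. balanced_on X B M N G \<beta> --> frag_eval G \<beta> h = \<zero>.G)"
  if "h : {frag_of (x +.M x', y) - frag_of (x, y) - frag_of (x', y) | x x' y.
    x <: M & x' <: M & y <: N} \<union>
   {frag_of (x, y +.N y') - frag_of (x, y) - frag_of (x, y') | x y y'.
    x <: M & y <: N & y' <: N} \<union>
   {frag_of (r **.M x, y) - frag_of (x, r **.N y) | r x y.
    r <: R & x <: M & y <: N}" for h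
 proof -
  have d3: "frag_eval G \<beta> (frag_of (x, y) - frag_of (x', y') - frag_of (x'', y'')) = \<zero>.G"
   if "balanced_on X B M N G \<beta>" "x <: M" "x' <: M" "x'' <: M"
    "y <: N" "y' <: N" "y'' <: N" "\<beta> x y = \<beta> x' y' +.G \<beta> x'' y''"
   for X B \<beta> x x' x'' y y' y''
  proof -
   note c = bc[OF that(1)]
   have k: "Poly_Mapping.keys (frag_of (x, y) - frag_of (x', y')) \<subseteq> carrier M \<times> carrier N"
    using keys_diff3(2)[of "(x, y)" "(x', y')"] that by auto
   have "frag_eval G \<beta> (frag_of (x, y) - frag_of (x', y') - frag_of (x'', y'')) =
    \<beta> x y -.G \<beta> x' y' -.G \<beta> x'' y''"
    using that c G.frag_eval_diff[OF c k, where v = "frag_of (x'', y'')"]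
     G.frag_eval_diff[OF c, where u = "frag_of (x, y)" and v = "frag_of (x', y')"] by (simp add: G.frag_eval_of)
   also have "... = \<zero>.G"
    using that c by (simp add: a_minus_def G.a_ac G.r_neg G.r_neg1)
   finally show ?thesis .
  qed
  from that consider x x' y where "h = frag_of (x +.M x', y) - frag_of (x, y) - frag_of (x', y)"
    "x <: M" "x' <: M" "y <: N"
   | x y y' where "h = frag_of (x, y +.N y') - frag_of (x, y) - frag_of (x, y')"
    "x <: M" "y <: N" "y' <: N"
   | r x y where "h = frag_of (r **.M x, y) - frag_of (x, r **.N y)"
    "r <: R" "x <: M" "y <: N"
   by blast
  then show ?thesis
  proof cases
   case 1
   have "frag_eval G \<beta> h = \<zero>.G" if b: "balanced_on {x, x', x +.M x'} {} M N G \<beta>" for \<beta>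
    unfolding 1(1) using 1 b by (intro d3[OF b]) (auto simp: balanced_on_def)
   then show ?thesis using 1 by (intro exI[of _ "{x, x', x +.M x'}"] exI[of _ "{}"]) auto
  next
   case 2
   have "frag_eval G \<beta> h = \<zero>.G" if b: "balanced_on {x} {} M N G \<beta>" for \<beta>
    unfolding 2(1) using 2 b by (intro d3[OF b]) (auto simp: balanced_on_def)
   then show ?thesis using 2 by (intro exI[of _ "{x}"] exI[of _ "{}"]) auto
  next
   case 3
   have "frag_eval G \<beta> h = \<zero>.G" if b: "balanced_on {x, r **.M x} {r} M N G \<beta>" for \<beta>
   proof -
    have "frag_eval G \<beta> h = \<beta> (r **.M x) y -.G \<beta> x (r **.N y)"
     unfolding 3(1) using 3 bc[OF b] smult_M smult_N
      G.frag_eval_diff[OF bc[OF b], where u = "frag_of (r **.M x, y)" and v = "frag_of (x, r **.N y)"]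
     by (simp add: G.frag_eval_of)
    also have "\<beta> (r **.M x) y = \<beta> x (r **.N y)"
     using b 3 by (auto simp: balanced_on_def)
    finally show ?thesis using bc[OF b] 3 smult_N by (simp add: a_minus_def G.r_neg)
   qed
   then show ?thesis using 3 smult_M by (intro exI[of _ "{x, r **.M x}"] exI[of _ "{r}"]) auto
  qed
 qed
 show ?thesis
  using assms(2) unfolding tensor_relations_def
 proof (induction rule: generate.induct)
  case one
  show ?case by (intro exI[of _ "{}"]) (auto simp: frag_eval_def)
 next
  case (incl h)
  show ?case using gen[OF incl(1)] .
 next
  case (inv h)
  have "h : Rel" unfolding tensor_relations_def using inv(1) by (rule generate.incl)
  then have k: "Poly_Mapping.keys h \<subseteq> carrier M \<times> carrier N"
   by (auto dest: Rel_keys)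
  show ?case
  proof (rule key[OF gen[OF inv(1)]], intro exI conjI allI impI)
   fix X B \<beta> assume b: "balanced_on X B M N G \<beta>"
    and z: "ALL \<beta>. balanced_on X B M N G \<beta> --> frag_eval G \<beta> h = \<zero>.G"
   have "inv\<^bsub>Fr\<^esub> h = 0 - h" using k by simp
   also have "frag_eval G \<beta> (0 - h) = frag_eval G \<beta> 0 -.G frag_eval G \<beta> h"
    using k by (intro G.frag_eval_diff[OF bc[OF b]]) auto
   also have "... = \<zero>.G" using z b by (simp add: frag_eval_def a_minus_def)
   finally show "frag_eval G \<beta> (inv\<^bsub>Fr\<^esub> h) = \<zero>.G" .
  qed
 next
  case (eng h1 h2)
  have "h1 : Rel" "h2 : Rel" unfolding tensor_relations_def using eng(1,2) .
  then have k: "Poly_Mapping.keys h1 \<subseteq> carrier M \<times> carrier N" "Poly_Mapping.keys h2 \<subseteq> carrier M \<times> carrier N"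
   by (auto dest: Rel_keys)
  obtain X1 B1 where 1: "finite X1" "X1 \<subseteq> carrier M" "finite B1" "B1 \<subseteq> carrier R"
   "ALL \<beta>. balanced_on X1 B1 M N G \<beta> --> frag_eval G \<beta> h1 = \<zero>.G" using eng.IH(1) by blast
  obtain X2 B2 where 2: "finite X2" "X2 \<subseteq> carrier M" "finite B2" "B2 \<subseteq> carrier R"
   "ALL \<beta>. balanced_on X2 B2 M N G \<beta> --> frag_eval G \<beta> h2 = \<zero>.G" using eng.IH(2) by blast
  have "frag_eval G \<beta> (h1 *.Fr h2) = \<zero>.G" if b: "balanced_on (X1 \<union> X2) (B1 \<union> B2) M N G \<beta>" for \<beta>
  proof -
   have "balanced_on X1 B1 M N G \<beta>" "balanced_on X2 B2 M N G \<beta>"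
    by (rule mono[OF b]; blast)+
   then have "frag_eval G \<beta> h1 = \<zero>.G" "frag_eval G \<beta> h2 = \<zero>.G" using 1 2 by blast+
   then show ?thesis using G.frag_eval_add[OF bc[OF b] k] by simp
  qed
  then show ?case using 1 2 by (intro exI[of _ "X1 \<union> X2"] exI[of _ "B1 \<union> B2"]) auto
 qed
qed

lemma balanced_imp_balanced_on: "balanced R M N G \<beta> ==> X \<subseteq> carrier M ==> B \<subseteq> carrier R ==> balanced_on X B M N G \<beta>"
 unfolding balanced_def balanced_on_def subset_iff by simp

context
 fixes G :: "('g, 'f) ring_scheme" and \<beta>
 assumes G: "abelian_group G" and \<beta>: "balanced R M N G \<beta>"
begin

interpretation G: abelian_group G by (rule G)

lemma balanced_closed: "ALL x y. (x, y) : carrier M \<times> carrier N --> \<beta> x y <: G"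
 using \<beta> by (auto simp: balanced_def)

text \<open>The representative picked by \<open>SOME\<close> has the form \<open>r + u\<close> with
  \<open>r\<close> in \<open>Rel\<close>, and \<open>r\<close> evaluates to zero.\<close>

lemma tensor_lift_cls:
 assumes "Poly_Mapping.keys u \<subseteq> carrier M \<times> carrier N"
 shows "tensor_lift G \<beta> (cls u) = frag_eval G \<beta> u"
proof -
 have "u : cls u" using assms subgroup_Rel by (intro group.rcos_self) auto
 then have "(SOME v. v : cls u) : cls u" by (rule someI)
 then obtain r where r: "r : Rel" "(SOME v. v : cls u) = r + u"
  by (auto simp: r_coset_def)
 have k: "Poly_Mapping.keys r \<subseteq> carrier M \<times> carrier N"
  using Rel_keys[OF r(1)] .
 have "frag_eval G \<beta> r = \<zero>.G"
  using rel_eval[OF G r(1)] balanced_imp_balanced_on[OF \<beta>] by blast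
 then have "frag_eval G \<beta> (r + u) = frag_eval G \<beta> u"
  using G.frag_eval_add[OF balanced_closed k assms] G.frag_eval_closed[OF balanced_closed assms] by simp
 then show ?thesis
  unfolding tensor_lift_def Let_def r(2) frag_eval_def .
qed

lemma tensor_lift_pt: "[|x <: M; y <: N|] ==> tensor_lift G \<beta> (pt x y) = \<beta> x y"
 unfolding pt_cls by (subst tensor_lift_cls) (auto simp: G.frag_eval_of balanced_closed)

lemma tensor_lift_closed: "t <: T ==> tensor_lift G \<beta> t <: G"
 by (auto simp: T_simps tensor_lift_cls intro: G.frag_eval_closed[OF balanced_closed])

lemma tensor_lift_add:
 assumes "s <: T" "t <: T"
 shows "tensor_lift G \<beta> (s +.T t) = tensor_lift G \<beta> s +.G tensor_lift G \<beta> t"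
proof -
 obtain u v where u: "s = cls u" "Poly_Mapping.keys u \<subseteq> carrier M \<times> carrier N"
  and v: "t = cls v" "Poly_Mapping.keys v \<subseteq> carrier M \<times> carrier N"
  using assms by (auto simp: T_simps)
 have "Poly_Mapping.keys (u + v) \<subseteq> carrier M \<times> carrier N" using u v keys_add[of u v] by auto
 then show ?thesis using u v by (simp add: cls_add tensor_lift_cls G.frag_eval_add[OF balanced_closed])
qed

lemma tensor_lift_finsum:
 "(!!i. i : I ==> t i <: T) ==> tensor_lift G \<beta> (finsum T t I) = (\<Sum>.G i:I. tensor_lift G \<beta> (t i))"
 by (rule finsum_additive) (auto simp: tensor_lift_closed tensor_lift_add G T.abelian_monoid_axioms)

lemma tensor_lift_sum_pt:
 assumes "!!i. i : I ==> x i <: M" "!!i. i : I ==> y i <: N"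
 shows "tensor_lift G \<beta> (\<Sum>.T i:I. pt (x i) (y i)) = (\<Sum>.G i:I. \<beta> (x i) (y i))"
 using assms by (subst tensor_lift_finsum)
  (auto simp: pt_closed tensor_lift_pt balanced_closed intro!: G.finsum_eqI)

end

text \<open>The order of the quantifiers matters: \<open>X\<close> and \<open>B\<close> are fixed
  before \<beta>, so the test maps \<beta> may be built from coordinates that exist only on a finite
  part of \<open>M\<close>.\<close>

lemma sum_pt_zeroD:
 assumes G: "abelian_group G" and fin: "finite I"
  and xy: "!!i. i : I ==> x i <: M" "!!i. i : I ==> y i <: N"
  and zero: "(\<Sum>.T i:I. pt (x i) (y i)) = \<zero>.T"
 shows "EX X B. finite X & X \<subseteq> carrier M & finite B & B \<subseteq> carrier R &
  (ALL \<beta>. balanced_on X B M N G \<beta> --> (\<Sum>.G i:I. \<beta> (x i) (y i)) = \<zero>.G)"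
proof -
 interpret G: abelian_group G by fact
 define u where "u = (\<Sum>i\<in>I. frag_of (x i, y i))"
 have k: "Poly_Mapping.keys (\<Sum>i\<in>J. frag_of (x i, y i)) \<subseteq> carrier M \<times> carrier N" if "J \<subseteq> I" for J
  using that xy by (intro order_trans[OF keys_sum]) auto
 have cls: "cls (\<Sum>i\<in>J. frag_of (x i, y i)) = (\<Sum>.T i:J. pt (x i) (y i))" if "J \<subseteq> I" for J
  using finite_subset[OF that fin] that
 proof (induction J)
  case empty
  then show ?case using cls_zero_iff[of 0] subgroup.one_closed[OF subgroup_Rel] by simp
 next
  case (insert j J)
  have "(\<Sum>.T i:insert j J. pt (x i) (y i)) = pt (x j) (y j) +.T (\<Sum>.T i:J. pt (x i) (y i))"
   using insert by (intro T.finsum_insert) (auto intro!: pt_closed xy)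
  also have "... = cls (frag_of (x j, y j)) +.T cls (\<Sum>i\<in>J. frag_of (x i, y i))"
   using insert by (simp add: pt_cls)
  also have "... = cls (frag_of (x j, y j) + (\<Sum>i\<in>J. frag_of (x i, y i)))"
   using insert xy[of j] k[of J] by (intro cls_add) auto
  finally show ?case using insert by simp
 qed
 have uR: "u : Rel" using cls[of I] zero cls_zero_iff[OF k[of I]] unfolding u_def by simp
 obtain X B where XB: "finite X" "X \<subseteq> carrier M" "finite B" "B \<subseteq> carrier R"
  and z: "!!\<beta>. balanced_on X B M N G \<beta> ==> frag_eval G \<beta> u = \<zero>.G"
  using rel_eval[OF G uR] by (elim exE conjE) (rule that, auto)
 have "(\<Sum>.G i:I. \<beta> (x i) (y i)) = \<zero>.G" if b: "balanced_on X B M N G \<beta>" for \<beta>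
 proof -
  have bc: "ALL x y. (x, y) : carrier M \<times> carrier N --> \<beta> x y <: G"
   using b by (auto simp: balanced_on_def)
  have "frag_eval G \<beta> (\<Sum>i\<in>J. frag_of (x i, y i)) = (\<Sum>.G i:J. \<beta> (x i) (y i))" if "J \<subseteq> I" for J
   using finite_subset[OF that fin] that
  proof (induction J)
   case empty
   then show ?case by (simp add: frag_eval_def)
  next
   case (insert j J)
   have "frag_eval G \<beta> (\<Sum>i\<in>insert j J. frag_of (x i, y i)) = frag_eval G \<beta> (frag_of (x j, y j)) +.G frag_eval G \<beta> (\<Sum>i\<in>J. frag_of (x i, y i))"
    using insert xy[of j] k[of J] by (subst G.frag_eval_add[OF bc, symmetric]) auto
   also have "... = \<beta> (x j) (y j) +.G (\<Sum>.G i:J. \<beta> (x i) (y i))"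
    using insert xy[of j] bc by (simp add: G.frag_eval_of)
   also have "... = (\<Sum>.G i:insert j J. \<beta> (x i) (y i))"
    using insert bc xy by (intro G.finsum_insert[symmetric]) (auto simp: subset_iff)
   finally show ?case .
  qed
  from this[of I] show ?thesis using z[OF b] unfolding u_def by simp
 qed
 then show ?thesis using XB by blast
qed

end

section \<open>Functionals on a Hopf algebra\<close>

text \<open>Existence of a basis as an instance of the Zorn argument: one vector \<open>u\<close>
  outside \<open>N\<close> is adjoined at a time, with \<open>q\<close> the identity, because a
  nonzero scalar is invertible and so the line through \<open>u\<close> meets \<open>N\<close> only
  in zero.\<close>

lemma projective_over_field:
 assumes K: "field K" and rm: "right_module K V"
 shows "projective K V"
proof -
 interpret K: field K by fact
 interpret V: right_module K V by fact
 show ?thesis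
 proof (rule projective_by_extension[OF rm, where \<N> = "{N. submodule N K V}"])
  show "{\<zero>.V} : {N. submodule N K V}"
   by (auto intro!: V.submoduleI' simp: V.smult_zero)
 next
  fix C assume C: "C ~= {}" "C \<subseteq> {N. submodule N K V}"
   and ch: "!!N N'. [|N : C; N' : C|] ==> N \<subseteq> N' \<or> N' \<subseteq> N"
  have s: "submodule N K V" if "N : C" for N using that C by auto
  have "submodule (\<Union>C) K V"
  proof (rule V.submoduleI')
   show "\<Union>C \<subseteq> carrier V" using V.submoduleD(1)[OF s] by auto
   show "\<zero>.V : \<Union>C" using V.submoduleD(3)[OF s] C(1) by auto
   show "a **.V x : \<Union>C" if "a <: K" "x : \<Union>C" for a x
    using V.submoduleD(5)[OF s] that by auto
   fix x y assume "x : \<Union>C" "y : \<Union>C"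
   then obtain N N' where N: "N : C" "N' : C" "x : N" "y : N'" by auto
   with ch[OF N(1,2)] obtain N'' where "N'' : C" "x : N''" "y : N''" by blast
   then show "x +.V y : \<Union>C" using V.submoduleD(4)[OF s] by auto
  qed
  then show "\<Union>C : {N. submodule N K V}" by simp
 next
  fix N assume "N : {N. submodule N K V}" and ne: "N ~= carrier V"
  then have N: "submodule N K V" by simp
  note ND = V.submoduleD[OF N]
  obtain u where u: "u <: V" "u \<notin> N" using ND(1) ne by auto
  let ?F = "free_right_module K {..<1::nat}"
  let ?p = "free_lift K V {..<1::nat} (%_. u)"
  interpret F: right_module K ?F by (rule K.right_module_free)
  have p: "?p : mod_hom K ?F V" by (rule V.free_lift_hom) (rule u)
  have p_eq: "?p x = x 0 **.V u" if x: "x <: ?F" for x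
  proof -
   have "?p x = (\<Sum>.V i:{..<1}. x i **.V u)"
    using x u by (intro V.free_lift_lessThan) auto
   also have "... = x 0 **.V u"
    using x u free_at[OF x, of 0] by (simp add: V.M.finsum_insert V.smult_closed lessThan_Suc)
   finally show ?thesis .
  qed
  have inj: "x = \<zero>.?F" if x: "x <: ?F" "?p x : N" for x
  proof (rule free_ext[OF x(1) F.M.zero_closed])
   fix i assume "i : {..<1::nat}"
   then have i: "i = 0" by simp
   have x0: "x 0 <: K" using free_at[OF x(1), of 0] by simp
   have "x 0 = \<zero>.K"
   proof (rule ccontr)
    assume "x 0 ~= \<zero>.K"
    then have U: "x 0 : Units K" using x0 by (simp add: K.field_Units)
    then have "u = inv\<^bsub>K\<^esub> (x 0) **.V (x 0 **.V u)"
     using u x0 by (simp add: V.smult_assoc[symmetric] V.smult_one)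
    also have "... : N" using ND(5) U x(2) p_eq[OF x(1)] by simp
    finally show False using u by simp
   qed
   then show "x i = \<zero>.?F i" using i by (simp add: free_at_simps)
  qed
  have sub: "submodule {y +.V ?p x | y x. y : N & x <: ?F} K V" (is "submodule ?N' K V")
  proof (rule V.submoduleI')
   show "?N' \<subseteq> carrier V" using ND(2) mod_hom_closed[OF p] by auto
   have "\<zero>.V +.V ?p \<zero>.?F : ?N'" using ND(3) F.M.zero_closed by blast
   then show "\<zero>.V : ?N'" using mod_hom_zero[OF p F.right_module_axioms rm] by simp
  next
   fix z w assume "z : ?N'" "w : ?N'"
   then obtain y x y' x' where *: "z = y +.V ?p x" "y : N" "x <: ?F"
    "w = y' +.V ?p x'" "y' : N" "x' <: ?F" by blast
   have "z +.V w = (y +.V y') +.V ?p (x +.?F x')"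
    using * ND(2) mod_hom_closed[OF p] mod_hom_add[OF p *(3,6)] by (simp add: V.M.a_ac)
   then show "z +.V w : ?N'" using ND(4)[OF *(2,5)] F.M.a_closed[OF *(3,6)] by blast
  next
   fix a z assume a: "a <: K" and "z : ?N'"
   then obtain y x where *: "z = y +.V ?p x" "y : N" "x <: ?F" by blast
   have "a **.V z = (a **.V y) +.V ?p (a **.?F x)"
    using * a ND(2) mod_hom_closed[OF p] mod_hom_smult[OF p a *(3)] by (simp add: V.smult_r_distr)
   then show "a **.V z : ?N'" using ND(5)[OF a *(2)] F.smult_closed[OF a *(3)] by blast
  qed
  have nsub: "\<not> ?p ` carrier ?F \<subseteq> N"
  proof
   assume s: "?p ` carrier ?F \<subseteq> N"
   have "?p (fbasis K {..<1} 0) = u" by (rule V.free_lift_fbasis) (use u in auto)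
   then show False using u subsetD[OF s imageI[OF K.fbasis_closed[of "{..<1}" 0]]] by simp
  qed
  show "EX (n::nat) p q. p : mod_hom K (free_right_module K {..<n}) V &
   q : mod_hom K (free_right_module K {..<n}) (free_right_module K {..<n}) &
   (ALL x:carrier (free_right_module K {..<n}). p x -.V p (q x) : N) &
   (ALL x:carrier (free_right_module K {..<n}). p (q x) : N --> q x = \<zero>.(free_right_module K {..<n})) &
   {y +.V p x | y x. y : N & x <: (free_right_module K {..<n})} : {N. submodule N K V} &
   \<not> p ` carrier (free_right_module K {..<n}) \<subseteq> N"
  proof (rule exI[of _ 1], rule exI[of _ ?p], rule exI[of _ "%x. x"], intro conjI ballI impI)
   show "?p : mod_hom K ?F V" by (rule p)
   show "(%x. x) : mod_hom K ?F ?F" by (rule mod_hom_ident)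
   show "?p x -.V ?p x : N" if "x <: ?F" for x
    using ND(3) mod_hom_closed[OF p that] by (simp add: a_minus_def V.M.r_neg)
   show "x = \<zero>.?F" if "x <: ?F" "?p x : N" for x by (rule inj[OF that])
   show "{y +.V ?p x |y x. y : N & x <: ?F} : {N. submodule N K V}" using sub by simp
   show "\<not> ?p ` carrier ?F \<subseteq> N" by (rule nsub)
  qed
 qed simp
qed

text \<open>The dual basis of a split free cover: \<open>cf b\<close> is a coordinate of the section
  \<open>i\<close>, and \<open>v b\<close> is the image under \<open>p\<close> of a standard basis
  vector. Expanding \<open>p (i h) = h\<close> gives the formula. Commutativity of \<open>K\<close>
  makes the coordinates linear in the sense of \<open>left_regular\<close>.\<close>

lemma dual_basis:
 fixes V :: "('k, 'v, 'd) module_scheme"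
 assumes K: "field K" and rm: "right_module K V"
 obtains B :: "'v set" and cf v where
  "!!b. b : B ==> cf b : mod_hom K V (left_regular K)" "!!b. b : B ==> v b <: V"
  "!!h. h <: V ==> finite {b : B. cf b h ~= \<zero>.K}"
  "!!h. h <: V ==> h = (\<Sum>.V b:{b : B. cf b h ~= \<zero>.K}. cf b h **.V v b)"
proof -
 interpret K: field K by fact
 interpret V: right_module K V by fact
 obtain X :: "'v set" and i p where i: "i : mod_hom K V (free_right_module K X)"
  and p: "p : mod_hom K (free_right_module K X) V" and pi: "!!x. x <: V ==> p (i x) = x"
  using projective_over_field[OF assms] unfolding projective_def by blast
 let ?F = "free_right_module K X"
 have ic: "h <: V ==> i h <: ?F" for h using mod_hom_closed[OF i] .
 show ?thesis
 proof (rule that[of X "%b h. i h b" "%b. p (fbasis K X b)"])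
  show "(%h. i h b) : mod_hom K V (left_regular K)" if b: "b : X" for b
  proof (rule mod_homI)
   show "i h b <: (left_regular K)" if "h <: V" for h
    using free_at[OF ic[OF that] b] by simp
   show "i (h +.V h') b = i h b +.(left_regular K) i h' b" if "h <: V" "h' <: V" for h h'
    using b that by (simp add: mod_hom_add[OF i] free_at_simps)
   show "i (a **.V h) b = a **.(left_regular K) i h b" if "a <: K" "h <: V" for a h
    using b that free_at[OF ic[OF that(2)] b] by (simp add: mod_hom_smult[OF i] free_at_simps K.m_comm)
  qed
  show "p (fbasis K X b) <: V" for b using mod_hom_closed[OF p K.fbasis_closed] .
  show "finite {b : X. i h b ~= \<zero>.K}" if "h <: V" for h
   using ic[OF that] by (simp add: free_right_module_simps)
  show "h = (\<Sum>.V b:{b : X. i h b ~= \<zero>.K}. i h b **.V p (fbasis K X b))" if "h <: V" for h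
   using V.free_hom_expand[OF p ic[OF that]] pi[OF that] by (simp add: free_lift_def)
 qed
qed

text \<open>A Hopf algebra seen through its dual: \<open>conv\<close> is the convolution product of functionals, and
 \<open>h = \<Sum> cf b h v\<^sub>b\<close> expresses \<open>h\<close> in coordinates.\<close>

locale hopf_dual =
 fixes K :: "'k ring" and H :: "('k, 'h) module"
  and conv :: "('h => 'k) => ('h => 'k) => 'h => 'k" and eps :: "'h => 'k" and S :: "'h => 'h"
  and B :: "'h set" and cf :: "'h => 'h => 'k" and v :: "'h => 'h"
 assumes field_K: "field K" and mod_H: "right_module K H" and ring_H: "ring H"
  and mult_left: "[|c <: K; x <: H; y <: H|] ==> (c **.H x) *.H y = c **.H (x *.H y)"
  and mult_right: "[|c <: K; x <: H; y <: H|] ==> x *.H (c **.H y) = c **.H (x *.H y)"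
  and cf: "b : B ==> cf b : mod_hom K H (left_regular K)" and v: "b : B ==> v b <: H"
  and cf_finite: "h <: H ==> finite {b : B. cf b h ~= \<zero>.K}"
  and basis: "h <: H ==> h = (\<Sum>.H b:{b : B. cf b h ~= \<zero>.K}. cf b h **.H v b)"
  and eps: "eps : mod_hom K H (left_regular K)"
  and eps_mult: "[|x <: H; y <: H|] ==> eps (x *.H y) = eps x *.K eps y"
  and S: "S : mod_hom K H H"
  and conv: "[|phi : mod_hom K H (left_regular K); psi : mod_hom K H (left_regular K)|] ==>
   conv phi psi : mod_hom K H (left_regular K)"
  and conv_assoc: "[|phi : mod_hom K H (left_regular K); psi : mod_hom K H (left_regular K);
   \<theta> : mod_hom K H (left_regular K); h <: H|] ==> conv (conv phi psi) \<theta> h = conv phi (conv psi \<theta>) h"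
  and conv_eps_left: "[|psi : mod_hom K H (left_regular K); h <: H|] ==> conv eps psi h = psi h"
  and conv_eps_right: "[|psi : mod_hom K H (left_regular K); h <: H|] ==> conv psi eps h = psi h"
  and antipode_ex: "h <: H ==> EX (n::nat) x y. (ALL i<n. x i <: H & y i <: H) &
   (ALL phi:mod_hom K H (left_regular K). ALL psi:mod_hom K H (left_regular K).
    conv phi psi h = (\<Sum>.K i:{..<n}. phi (x i) *.K psi (y i))) &
   (\<Sum>.H i:{..<n}. S (x i) *.H y i) = eps h **.H \<one>.H &
   (\<Sum>.H i:{..<n}. x i *.H S (y i)) = eps h **.H \<one>.H"
  and conv_mult_ex: "[|g <: H; h <: H|] ==> EX (n::nat) x y (m::nat) x' y'.
   (ALL i<n. x i <: H & y i <: H) & (ALL i<m. x' i <: H & y' i <: H) &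
   (ALL phi:mod_hom K H (left_regular K). ALL psi:mod_hom K H (left_regular K).
    conv phi psi g = (\<Sum>.K i:{..<n}. phi (x i) *.K psi (y i)) &
    conv phi psi h = (\<Sum>.K i:{..<m}. phi (x' i) *.K psi (y' i)) &
    conv phi psi (g *.H h) = (\<Sum>.K i:{..<n}. \<Sum>.K j:{..<m}.
     phi (x i *.H x' j) *.K psi (y i *.H y' j)))"
begin

sublocale K: field K by (rule field_K)
sublocale H: ring H by (rule ring_H)
sublocale HM: right_module K H by (rule mod_H)

abbreviation "D \<equiv> mod_hom K H (left_regular K)"

lemma dual_closed [intro, simp]: "[|psi : D; h <: H|] ==> psi h <: K"
 using mod_hom_closed[of psi K H "left_regular K"] by simp

lemma dual_add: "[|psi : D; h <: H; g <: H|] ==> psi (h +.H g) = psi h +.K psi g"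
 using mod_hom_add[of psi K H "left_regular K"] by simp

lemma dual_smult: "[|psi : D; c <: K; h <: H|] ==> psi (c **.H h) = c *.K psi h"
 using mod_hom_smult[of psi K H "left_regular K"] by simp

lemma dualI:
 assumes "!!h. h <: H ==> psi h <: K"
  "!!h g. [|h <: H; g <: H|] ==> psi (h +.H g) = psi h +.K psi g"
  "!!c h. [|c <: K; h <: H|] ==> psi (c **.H h) = c *.K psi h"
 shows "psi : D"
 by (rule mod_homI) (use assms in auto)

lemma dual_finsum:
 "[|psi : D; !!i. i : I ==> f i <: H|] ==> psi (finsum H f I) = (\<Sum>.K i:I. psi (f i))"
 by (rule finsum_additive)
  (auto simp: dual_add intro: H.abelian_monoid_axioms K.is_abelian_group)

lemma S_closed [intro, simp]: "h <: H ==> S h <: H"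
 using mod_hom_closed[OF S] .

lemma dual_left: "[|psi : D; g <: H|] ==> (%h. psi (g *.H h)) : D"
 by (rule dualI) (auto simp: H.r_distr dual_add mult_right dual_smult)

lemma dual_right: "[|psi : D; g <: H|] ==> (%h. psi (h *.H g)) : D"
 by (rule dualI) (auto simp: H.l_distr dual_add mult_left dual_smult)

lemma dual_lincomb:
 assumes "!!i. i : I ==> c i <: K" "!!i. i : I ==> psi i : D"
 shows "(%h. \<Sum>.K i:I. c i *.K psi i h) : D"
proof (rule dualI)
 fix h assume h: "h <: H"
 show "(\<Sum>.K i:I. c i *.K psi i h) <: K" using assms h by (auto intro!: K.finsum_in)
 {
  fix g assume g: "g <: H"
  have "(\<Sum>.K i:I. c i *.K psi i (h +.H g)) = (\<Sum>.K i:I. c i *.K psi i h +.K c i *.K psi i g)"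
   using assms g h by (intro K.finsum_eqI) (auto simp: dual_add K.r_distr dual_closed)
  also have "... = (\<Sum>.K i:I. c i *.K psi i h) +.K (\<Sum>.K i:I. c i *.K psi i g)"
   using assms g h by (intro K.finsum_add) auto
  finally show "(\<Sum>.K i:I. c i *.K psi i (h +.H g)) = (\<Sum>.K i:I. c i *.K psi i h) +.K (\<Sum>.K i:I. c i *.K psi i g)" .
 next
  fix k assume k: "k <: K"
  have "(\<Sum>.K i:I. c i *.K psi i (k **.H h)) = (\<Sum>.K i:I. k *.K (c i *.K psi i h))"
   using assms k h by (intro K.finsum_eqI) (auto simp: dual_smult K.m_lcomm dual_closed)
  also have "... = k *.K (\<Sum>.K i:I. c i *.K psi i h)"
   using assms k h by (intro K.finsum_mult_left[symmetric]) auto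
  finally show "(\<Sum>.K i:I. c i *.K psi i (k **.H h)) = k *.K (\<Sum>.K i:I. c i *.K psi i h)" .
 }
qed

lemma basis_superset:
 assumes "h <: H" "finite B0" "B0 \<subseteq> B" "{b : B. cf b h ~= \<zero>.K} \<subseteq> B0"
 shows "h = (\<Sum>.H b:B0. cf b h **.H v b)"
proof -
 have "(\<Sum>.H b:{b : B. cf b h ~= \<zero>.K}. cf b h **.H v b) = (\<Sum>.H b:B0. cf b h **.H v b)"
 proof (rule H.finsum_superset)
  fix b assume "b : B0 - {b : B. cf b h ~= \<zero>.K}"
  then show "cf b h **.H v b = \<zero>.H" using assms v by (auto simp: HM.zero_smult)
 qed (use assms v cf in \<open>auto intro!: HM.smult_closed\<close>)
 then show ?thesis using basis[OF assms(1)] by simp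
qed

lemma dual_basis_superset:
 assumes "psi : D" "h <: H" "finite B0" "B0 \<subseteq> B" "{b : B. cf b h ~= \<zero>.K} \<subseteq> B0"
 shows "psi h = (\<Sum>.K b:B0. cf b h *.K psi (v b))"
proof -
 have c: "b : B0 ==> cf b h <: K" "b : B0 ==> v b <: H" for b
  using assms(2,4) cf v by auto
 have "psi h = psi (\<Sum>.H b:B0. cf b h **.H v b)"
  using basis_superset[OF assms(2-5)] by simp
 also have "... = (\<Sum>.K b:B0. psi (cf b h **.H v b))"
  using c assms(1) by (intro dual_finsum) (auto intro: HM.smult_closed)
 also have "... = (\<Sum>.K b:B0. cf b h *.K psi (v b))"
  using c assms(1) by (intro K.finsum_eqI) (auto simp: dual_smult)
 finally show ?thesis .
qed

lemma dual_separates: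
 assumes "g <: H" "h <: H" "!!psi. psi : D ==> psi g = psi h"
 shows "g = h"
proof -
 have e': "cf b g = cf b h" if "b : B" for b using assms(3)[OF cf[OF that]] .
 then have e: "{b : B. cf b g ~= \<zero>.K} = {b : B. cf b h ~= \<zero>.K}" by auto
 have "g = (\<Sum>.H b:{b : B. cf b h ~= \<zero>.K}. cf b g **.H v b)"
  using basis[OF assms(1)] unfolding e .
 also have "... = (\<Sum>.H b:{b : B. cf b h ~= \<zero>.K}. cf b h **.H v b)"
  using assms(2) v cf e' by (intro H.finsum_eqI) (auto intro!: HM.smult_closed)
 also have "... = h" using basis[OF assms(2)] by simp
 finally show ?thesis .
qed

end

text \<open>The scalars of \<open>K\<close> act on \<open>Z\<close>-modules through the central
  homomorphism \<open>ks\<close>, so that no separate vector space structure has to be carried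
  along. The instances are the comodule algebra \<open>A\<close> with \<open>ks c = c 1\<close>, and
  \<open>K\<close> itself with the identity.\<close>

locale hopf_dual_coeff = hopf_dual +
 fixes Z :: "('z, 'zc) ring_scheme" and ks :: "'a => 'z"
 assumes ring_Z: "ring Z" and ks: "ks : ring_hom K Z"
  and ks_central: "[|c <: K; z <: Z|] ==> ks c *.Z z = z *.Z ks c"
begin

sublocale Z: ring Z by (rule ring_Z)

lemma ks_closed [intro, simp]: "c <: K ==> ks c <: Z"
 and ks_add: "[|c <: K; d <: K|] ==> ks (c +.K d) = ks c +.Z ks d"
 and ks_mult: "[|c <: K; d <: K|] ==> ks (c *.K d) = ks c *.Z ks d"
 and ks_one [simp]: "ks \<one>.K = \<one>.Z"
 using ks by (auto simp: ring_hom_def)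

lemma ks_zero [simp]: "ks \<zero>.K = \<zero>.Z"
 using ring_hom_zero[OF ks K.ring_axioms ring_Z] .

lemma ks_finsum: "(!!i. i : I ==> f i <: K) ==> ks (finsum K f I) = (\<Sum>.Z i:I. ks (f i))"
 by (rule finsum_additive)
  (auto simp: ks_add intro: K.abelian_monoid_axioms Z.is_abelian_group)

definition lc :: "('z, 'm, 'mc) module_scheme => 'i set => ('i => 'a) => ('i => 'm) => 'm" where
 "lc M I k x = (\<Sum>.M i:I. ks (k i) **.M x i)"

lemma lc_closed:
 assumes "right_module Z M" "!!i. i : I ==> k i <: K" "!!i. i : I ==> x i <: M"
 shows "lc M I k x <: M"
proof -
 interpret M: right_module Z M by fact
 show ?thesis unfolding lc_def using assms by (auto intro!: M.M.finsum_in M.smult_closed)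
qed

lemma lc_cong:
 assumes "right_module Z M" "!!i. i : I ==> k i = k' i" "!!i. i : I ==> x i = x' i"
  "!!i. i : I ==> k' i <: K" "!!i. i : I ==> x' i <: M"
 shows "lc M I k x = lc M I k' x'"
proof -
 interpret M: right_module Z M by fact
 show ?thesis unfolding lc_def using assms by (auto intro!: M.M.finsum_eqI M.smult_closed)
qed

lemma lc_delta:
 assumes "right_module Z M" "finite I" "j : I" "!!i. i : I ==> x i <: M"
 shows "lc M I (%i. if i = j then \<one>.K else \<zero>.K) x = x j"
proof -
 interpret M: right_module Z M by fact
 have "lc M I (%i. if i = j then \<one>.K else \<zero>.K) x = (\<Sum>.M i:I. if i = j then x i else \<zero>.M)"
  unfolding lc_def using assms by (intro M.M.finsum_eqI) (auto simp: M.smult_one M.zero_smult)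
 then show ?thesis using assms by (simp add: M.M.finsum_delta)
qed

lemma ks_lc:
 assumes "right_module Z M" "c <: K" "!!i. i : I ==> k i <: K" "!!i. i : I ==> x i <: M"
 shows "ks c **.M lc M I k x = lc M I (%i. c *.K k i) x"
proof -
 interpret M: right_module Z M by fact
 have "ks c **.M lc M I k x = (\<Sum>.M i:I. ks c **.M (ks (k i) **.M x i))"
  unfolding lc_def using assms by (intro M.smult_finsum) (auto intro: M.smult_closed)
 also have "... = lc M I (%i. c *.K k i) x"
  unfolding lc_def using assms
  by (intro M.M.finsum_eqI) (auto simp: ks_mult ks_central[of c] M.smult_assoc intro!: M.smult_closed)
 finally show ?thesis .
qed

lemma lc_add:
 assumes "right_module Z M" "!!i. i : I ==> k i <: K" "!!i. i : I ==> l i <: K"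
  "!!i. i : I ==> x i <: M"
 shows "lc M I (%i. k i +.K l i) x = lc M I k x +.M lc M I l x"
proof -
 interpret M: right_module Z M by fact
 have "lc M I (%i. k i +.K l i) x = (\<Sum>.M i:I. ks (k i) **.M x i +.M ks (l i) **.M x i)"
  unfolding lc_def using assms
  by (intro M.M.finsum_eqI) (auto simp: ks_add M.smult_l_distr intro!: M.smult_closed)
 also have "... = lc M I k x +.M lc M I l x"
  unfolding lc_def using assms by (intro M.M.finsum_add) (auto intro: M.smult_closed)
 finally show ?thesis .
qed

lemma lc_lc:
 assumes "right_module Z M" "finite I" "finite J" "!!i. i : I ==> k i <: K"
  "!!i j. [|i : I; j : J|] ==> l i j <: K" "!!j. j : J ==> x j <: M"
 shows "lc M I k (%i. lc M J (l i) x) = lc M J (%j. \<Sum>.K i:I. k i *.K l i j) x"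
proof -
 interpret M: right_module Z M by fact
 have c: "ks (k i *.K l i j) **.M x j <: M" if "i : I" "j : J" for i j
  using assms that by (auto intro!: M.smult_closed)
 have "lc M I k (%i. lc M J (l i) x) = (\<Sum>.M i:I. \<Sum>.M j:J. ks (k i *.K l i j) **.M x j)"
 proof -
  have "ks (k i) **.M lc M J (l i) x = (\<Sum>.M j:J. ks (k i *.K l i j) **.M x j)" if "i : I" for i
   using ks_lc[OF assms(1), of "k i" J "l i" x] that assms(4-6) by (simp add: lc_def)
  then show ?thesis
   unfolding lc_def[of M I] using c by (intro M.M.finsum_eqI) (auto intro!: M.M.finsum_in)
 qed
 also have "... = (\<Sum>.M j:J. \<Sum>.M i:I. ks (k i *.K l i j) **.M x j)"
  using assms c by (intro M.M.finsum_swap) auto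
 also have "... = lc M J (%j. \<Sum>.K i:I. k i *.K l i j) x"
  unfolding lc_def
 proof (rule M.M.finsum_eqI)
  fix j assume j: "j : J"
  have s: "ks (\<Sum>.K i:I. k i *.K l i j) = (\<Sum>.Z i:I. ks (k i *.K l i j))"
   using assms j by (intro ks_finsum) auto
  show "(\<Sum>.M i:I. ks (k i *.K l i j) **.M x j) = ks (\<Sum>.K i:I. k i *.K l i j) **.M x j"
   unfolding s using assms j by (intro M.finsum_smult[symmetric]) auto
  show "ks (\<Sum>.K i:I. k i *.K l i j) **.M x j <: M"
   using assms j by (intro M.smult_closed ks_closed K.finsum_in) auto
 qed
 finally show ?thesis .
qed

lemma lc_additive:
 assumes "right_module Z M" "right_module Z N" "!!x. x <: M ==> f x <: N"
  and "!!x y. [|x <: M; y <: M|] ==> f (x +.M y) = f x +.N f y"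
  and "!!c x. [|c <: K; x <: M|] ==> f (ks c **.M x) = ks c **.N f x"
  and "!!i. i : I ==> k i <: K" "!!i. i : I ==> x i <: M"
 shows "f (lc M I k x) = lc N I k (%i. f (x i))"
proof -
 interpret M: right_module Z M by fact
 interpret N: right_module Z N by fact
 have "f (lc M I k x) = (\<Sum>.N i:I. f (ks (k i) **.M x i))"
  unfolding lc_def using assms
  by (intro finsum_additive) (auto intro: M.M.abelian_monoid_axioms N.abelian_group_M M.smult_closed)
 also have "... = lc N I k (%i. f (x i))"
  unfolding lc_def using assms by (intro N.M.finsum_eqI) (auto intro: N.smult_closed)
 finally show ?thesis .
qed

text \<open>These are the maps that factor through the tensor product of \<open>M\<close> and
  \<open>H\<close> over \<open>K\<close>, the scalars acting on \<open>M\<close> by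
  \<open>ks\<close>.\<close>

definition kbal :: "('z, 'm, 'mc) module_scheme => ('g, 'gc) ring_scheme => ('m => 'b => 'g) => bool" where
 "kbal M G \<beta> \<longleftrightarrow> (ALL x:carrier M. ALL h:carrier H. \<beta> x h <: G) &
   (ALL x:carrier M. ALL x':carrier M. ALL h:carrier H. \<beta> (x +.M x') h = \<beta> x h +.G \<beta> x' h) &
   (ALL x:carrier M. ALL h:carrier H. ALL h':carrier H. \<beta> x (h +.H h') = \<beta> x h +.G \<beta> x h') &
   (ALL c:carrier K. ALL x:carrier M. ALL h:carrier H. \<beta> (ks c **.M x) h = \<beta> x (c **.H h))"

text \<open>Each \<open>h i\<close> is expanded in the dual basis and its coordinates are moved to
  the first factor. Afterwards the \<open>h i\<close> enter only through values of the functionals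
  \<open>cf b\<close>, which is the reason that functionals suffice to compare two tensors.\<close>

lemma kbal_sum_expand:
 assumes M: "right_module Z M" and G: "abelian_group G" and \<beta>: "kbal M G \<beta>"
  and I: "finite I" "!!i. i : I ==> x i <: M" "!!i. i : I ==> h i <: H"
  and B0: "finite B0" "B0 \<subseteq> B" "!!i. i : I ==> {b : B. cf b (h i) ~= \<zero>.K} \<subseteq> B0"
 shows "(\<Sum>.G i:I. \<beta> (x i) (h i)) = (\<Sum>.G b:B0. \<beta> (lc M I (%i. cf b (h i)) x) (v b))"
proof -
 interpret M: right_module Z M by fact
 interpret G: abelian_group G by fact
 have \<beta>c: "\<beta> x h <: G" if "x <: M" "h <: H" for x h
  using \<beta> that by (auto simp: kbal_def)
 have \<beta>l: "\<beta> (finsum M f J) h = (\<Sum>.G j:J. \<beta> (f j) h)" if "h <: H" "!!j. j : J ==> f j <: M" for f J h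
  using \<beta> that by (intro finsum_additive[where f = "%x. \<beta> x h"])
   (auto simp: kbal_def intro: M.M.abelian_monoid_axioms G)
 have \<beta>r: "\<beta> x (finsum H f J) = (\<Sum>.G j:J. \<beta> x (f j))" if "x <: M" "!!j. j : J ==> f j <: H" for f J x
  using \<beta> that by (intro finsum_additive)
   (auto simp: kbal_def intro: H.abelian_monoid_axioms G)
 have cfv: "[|b : B0; g <: H|] ==> cf b g <: K" "b : B0 ==> v b <: H" for b g
  using cf v B0(2) by auto
 have kx: "ks (cf b (h i)) **.M x i <: M" if "b : B0" "i : I" for b i
  using cfv that I by (auto intro!: M.smult_closed)
 have "(\<Sum>.G i:I. \<beta> (x i) (h i)) = (\<Sum>.G i:I. \<Sum>.G b:B0. \<beta> (ks (cf b (h i)) **.M x i) (v b))"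
 proof (rule G.finsum_eqI)
  fix i assume i: "i : I"
  have "\<beta> (x i) (h i) = \<beta> (x i) (\<Sum>.H b:B0. cf b (h i) **.H v b)"
   using basis_superset[OF I(3)[OF i] B0(1,2) B0(3)[OF i]] by simp
  also have "... = (\<Sum>.G b:B0. \<beta> (x i) (cf b (h i) **.H v b))"
   using i I cfv by (intro \<beta>r) (auto intro!: HM.smult_closed)
  also have "... = (\<Sum>.G b:B0. \<beta> (ks (cf b (h i)) **.M x i) (v b))"
   using i I cfv kx \<beta> by (intro G.finsum_eqI \<beta>c) (auto simp: kbal_def)
  finally show "\<beta> (x i) (h i) = (\<Sum>.G b:B0. \<beta> (ks (cf b (h i)) **.M x i) (v b))" .
  show "(\<Sum>.G b:B0. \<beta> (ks (cf b (h i)) **.M x i) (v b)) <: G"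
   using i I kx cfv by (intro G.finsum_in \<beta>c) auto
 qed
 also have "... = (\<Sum>.G b:B0. \<Sum>.G i:I. \<beta> (ks (cf b (h i)) **.M x i) (v b))"
  using I kx cfv B0(1) by (intro G.finsum_swap \<beta>c) auto
 also have "... = (\<Sum>.G b:B0. \<beta> (lc M I (%i. cf b (h i)) x) (v b))"
  unfolding lc_def using I kx v B0(2)
  by (intro G.finsum_eqI) (auto simp: \<beta>l subset_iff intro!: \<beta>c M.M.finsum_in G.finsum_in)
 finally show ?thesis .
qed

text \<open>Functionals on \<open>H\<close> separate the elements of \<open>M \<otimes> H\<close>: this replaces the tensor product.\<close>

lemma functionals_determine:
 assumes M: "right_module Z M" and G: "abelian_group G" and \<beta>: "kbal M G \<beta>"
  and I: "finite I" "!!i. i : I ==> x i <: M" "!!i. i : I ==> h i <: H"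
  and J: "finite J" "!!j. j : J ==> x' j <: M" "!!j. j : J ==> h' j <: H"
  and eq: "!!psi. psi : D ==> lc M I (%i. psi (h i)) x = lc M J (%j. psi (h' j)) x'"
 shows "(\<Sum>.G i:I. \<beta> (x i) (h i)) = (\<Sum>.G j:J. \<beta> (x' j) (h' j))"
proof -
 interpret M: right_module Z M by fact
 interpret G: abelian_group G by fact
 let ?B = "(\<Union>i\<in>I. {b : B. cf b (h i) ~= \<zero>.K}) \<union> (\<Union>j\<in>J. {b : B. cf b (h' j) ~= \<zero>.K})"
 have fin: "finite ?B" using I J cf_finite by auto
 have c: "lc M J (%i. cf b (h' i)) x' <: M" if "b : B" for b
  using J cf that by (intro lc_closed M) auto
 have "(\<Sum>.G i:I. \<beta> (x i) (h i)) = (\<Sum>.G b:?B. \<beta> (lc M I (%i. cf b (h i)) x) (v b))"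
  using I by (intro kbal_sum_expand[OF M G \<beta> _ _ _ fin]) auto
 also have "... = (\<Sum>.G b:?B. \<beta> (lc M J (%i. cf b (h' i)) x') (v b))"
  using eq cf c v \<beta> by (intro G.finsum_eqI) (auto simp: kbal_def)
 also have "... = (\<Sum>.G j:J. \<beta> (x' j) (h' j))"
  using J by (intro kbal_sum_expand[OF M G \<beta> _ _ _ fin, symmetric]) auto
 finally show ?thesis .
qed

end

section \<open>Comodules and coefficient matrices\<close>

text \<open>L = L (X Y) = (L X) Y = Y. This form is needed for the antipode of a product: one
  candidate is known to invert a matrix from the left, the other from the right.\<close>

lemma (in ring) matrix_left_right_inverse:
 assumes fin: "finite I"
  and L: "!!i j. [|i : I; j : I|] ==> L i j <: R" and X: "!!i j. [|i : I; j : I|] ==> X i j <: R"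
  and Y: "!!i j. [|i : I; j : I|] ==> Y i j <: R"
  and LX: "!!i k. [|i : I; k : I|] ==> (\<Oplus>j\<in>I. L i j \<otimes> X j k) = (if i = k then \<one> else \<zero>)"
  and XY: "!!i k. [|i : I; k : I|] ==> (\<Oplus>j\<in>I. X i j \<otimes> Y j k) = (if i = k then \<one> else \<zero>)"
  and pq: "p : I" "q : I"
 shows "L p q = Y p q"
proof -
 have "L p q = (\<Oplus>r\<in>I. if r = q then L p r else \<zero>)"
  using pq L fin by (simp add: finsum_delta)
 also have "... = (\<Oplus>r\<in>I. L p r \<otimes> (\<Oplus>s\<in>I. X r s \<otimes> Y s q))"
  using pq L by (intro finsum_eqI) (auto simp: XY)
 also have "... = (\<Oplus>r\<in>I. \<Oplus>s\<in>I. L p r \<otimes> (X r s \<otimes> Y s q))"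
  using pq L X Y by (intro finsum_eqI) (auto simp: finsum_mult_left intro!: finsum_in)
 also have "... = (\<Oplus>s\<in>I. \<Oplus>r\<in>I. L p r \<otimes> (X r s \<otimes> Y s q))"
  using pq L X Y fin by (intro finsum_swap) auto
 also have "... = (\<Oplus>s\<in>I. (\<Oplus>r\<in>I. L p r \<otimes> X r s) \<otimes> Y s q)"
 proof (rule finsum_eqI)
  fix s assume s: "s : I"
  have "(\<Oplus>r\<in>I. L p r \<otimes> X r s) \<otimes> Y s q = (\<Oplus>r\<in>I. (L p r \<otimes> X r s) \<otimes> Y s q)"
   using s pq L X Y by (intro finsum_mult_right) auto
  also have "... = (\<Oplus>r\<in>I. L p r \<otimes> (X r s \<otimes> Y s q))"
   using s pq L X Y by (intro finsum_eqI) (auto simp: m_assoc)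
  finally show "(\<Oplus>r\<in>I. L p r \<otimes> (X r s \<otimes> Y s q)) = (\<Oplus>r\<in>I. L p r \<otimes> X r s) \<otimes> Y s q" ..
  show "(\<Oplus>r\<in>I. L p r \<otimes> X r s) \<otimes> Y s q <: R"
   using s pq L X Y by (auto intro!: finsum_in)
 qed
 also have "... = (\<Oplus>s\<in>I. if s = p then Y s q else \<zero>)"
  using pq Y by (intro finsum_eqI) (auto simp: LX)
 also have "... = Y p q"
  using pq Y fin by (simp add: finsum_delta)
 finally show ?thesis .
qed

context hopf_dual_coeff
begin

lemma lc_superset:
 assumes "right_module Z M" "finite J" "I \<subseteq> J" "!!i. i : J - I ==> k i = \<zero>.K \<or> x i = \<zero>.M"
  "!!i. i : J ==> k i <: K" "!!i. i : J ==> x i <: M"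
 shows "lc M I k x = lc M J k x"
proof -
 interpret M: right_module Z M by fact
 show ?thesis
  unfolding lc_def
 proof (rule M.M.finsum_superset)
  fix i assume i: "i : J - I"
  with assms(4)[OF i] assms(5,6) show "ks (k i) **.M x i = \<zero>.M"
   by (auto simp: M.zero_smult M.smult_zero)
 qed (use assms in \<open>auto intro!: M.smult_closed\<close>)
qed

text \<open>\<open>T psi x\<close> stands for \<open>(id \<otimes> psi) (\<rho> x)\<close> where \<open>\<rho>\<close> is a coaction on \<open>M\<close>.\<close>

definition rep ::
 "('z, 'm, 'mc) module_scheme => (('b => 'a) => 'm => 'm) => 'i set => ('i => 'm) => ('i => 'b) => 'm => bool" where
 "rep M T I y h x \<longleftrightarrow> finite I & (ALL i:I. y i <: M & h i <: H) &
  (ALL psi:D. T psi x = lc M I (%i. psi (h i)) y)"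

text \<open>A comodule seen as a module over the convolution algebra \<open>D\<close>. The clause
  with \<open>rep\<close> is rationality: the action comes from a finite sum in the tensor product
  of \<open>M\<close> and \<open>H\<close>. The last two clauses are coassociativity and the counit
  law.\<close>

definition comod :: "('z, 'm, 'mc) module_scheme => (('b => 'a) => 'm => 'm) => bool" where
 "comod M T \<longleftrightarrow> right_module Z M & (ALL psi:D. ALL x:carrier M. T psi x <: M) &
  (ALL psi:D. ALL x:carrier M. ALL y:carrier M. T psi (x +.M y) = T psi x +.M T psi y) &
  (ALL psi:D. ALL c:carrier K. ALL x:carrier M. T psi (ks c **.M x) = ks c **.M T psi x) &
  (ALL x:carrier M. EX (n::nat) y h. rep M T {..<n} y h x) &
  (ALL phi:D. ALL psi:D. ALL x:carrier M. T phi (T psi x) = T (conv phi psi) x) &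
  (ALL x:carrier M. T eps x = x)"

text \<open>In terms of the coaction: \<rho>(y_j) = \<Sum> y_i \<otimes> c_ij. The span of the
  family is a subcomodule and \<open>c\<close> is its coefficient matrix; linear independence is not
  part of the notion.\<close>

definition fam ::
 "('z, 'm, 'mc) module_scheme => (('b => 'a) => 'm => 'm) => 'i set => ('i => 'i => 'b) => ('i => 'm) => bool" where
 "fam M T I c y \<longleftrightarrow> finite I & (ALL i:I. y i <: M) & (ALL i:I. ALL j:I. c i j <: H) &
  (ALL psi:D. ALL j:I. T psi (y j) = lc M I (%i. psi (c i j)) y)"

lemma comodD:
 assumes "comod M T"
 shows "right_module Z M" "[|psi : D; x <: M|] ==> T psi x <: M"
  "[|psi : D; x <: M; y <: M|] ==> T psi (x +.M y) = T psi x +.M T psi y"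
  "[|psi : D; c <: K; x <: M|] ==> T psi (ks c **.M x) = ks c **.M T psi x"
  "[|phi : D; psi : D; x <: M|] ==> T phi (T psi x) = T (conv phi psi) x"
  "x <: M ==> T eps x = x"
 using assms unfolding comod_def by auto

lemma comod_rep:
 assumes "comod M T" "x <: M"
 obtains n y h where "rep M T {..<n::nat} y h x"
proof -
 have "ALL x:carrier M. EX (n::nat) y h. rep M T {..<n} y h x" using assms(1) unfolding comod_def by blast
 then show ?thesis using assms(2) that by blast
qed

lemma fam_rep: "[|fam M T I c y; j : I|] ==> rep M T I y (%i. c i j) (y j)"
 unfolding fam_def rep_def by auto

lemma T_lincomb:
 assumes "comod M T" "x <: M" "finite I" "!!i. i : I ==> c i <: K" "!!i. i : I ==> psi i : D"
 shows "T (%h. \<Sum>.K i:I. c i *.K psi i h) x = lc M I c (%i. T (psi i) x)"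
proof -
 note rm = comodD(1)[OF assms(1)]
 obtain n y h where r: "rep M T {..<n::nat} y h x" using comod_rep[OF assms(1,2)] .
 have "T (%h. \<Sum>.K i:I. c i *.K psi i h) x = lc M {..<n} (%j. \<Sum>.K i:I. c i *.K psi i (h j)) y"
  using r dual_lincomb[OF assms(4,5), of I] unfolding rep_def by auto
 also have "... = lc M I c (%i. lc M {..<n} (%j. psi i (h j)) y)"
  using r assms by (intro lc_lc[OF rm, symmetric]) (auto simp: rep_def)
 also have "... = lc M I c (%i. T (psi i) x)"
 proof (rule lc_cong[OF rm])
  fix i assume i: "i : I"
  show "lc M {..<n} (%j. psi i (h j)) y = T (psi i) x" using r assms(5)[OF i] by (simp add: rep_def)
  show "T (psi i) x <: M" using comodD(2)[OF assms(1) assms(5)[OF i] assms(2)] .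
 qed (use assms in auto)
 finally show ?thesis .
qed

text \<open>Elements of \<open>D\<close> are total functions, so two of them may differ outside
  \<open>carrier H\<close>; a representation evaluates them only inside.\<close>

lemma T_cong:
 assumes "comod M T" "x <: M" "psi : D" "phi : D" "!!h. h <: H ==> psi h = phi h"
 shows "T psi x = T phi x"
proof -
 obtain n y h where r: "rep M T {..<n::nat} y h x" using comod_rep[OF assms(1,2)] .
 have "lc M {..<n} (%i. psi (h i)) y = lc M {..<n} (%i. phi (h i)) y"
  using r assms(3-) by (intro lc_cong[OF comodD(1)[OF assms(1)]]) (auto simp: rep_def)
 then show ?thesis using r assms(3,4) by (simp add: rep_def)
qed

lemma T_add_functional:
 assumes "comod M T" "x <: M" "psi : D" "phi : D" "\<theta> : D" "!!h. h <: H ==> \<theta> h = psi h +.K phi h"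
 shows "T \<theta> x = T psi x +.M T phi x"
proof -
 note rm = comodD(1)[OF assms(1)]
 obtain n y h where r: "rep M T {..<n::nat} y h x" using comod_rep[OF assms(1,2)] .
 have "T \<theta> x = lc M {..<n} (%i. psi (h i) +.K phi (h i)) y"
  using r assms(3-) lc_cong[OF rm, of "{..<n}" "%i. \<theta> (h i)" "%i. psi (h i) +.K phi (h i)" y y]
  by (auto simp: rep_def)
 also have "... = lc M {..<n} (%i. psi (h i)) y +.M lc M {..<n} (%i. phi (h i)) y"
  using r assms(3-) by (intro lc_add[OF rm]) (auto simp: rep_def)
 finally show ?thesis using r assms(3,4) by (simp add: rep_def)
qed

lemma T_scale_functional:
 assumes "comod M T" "x <: M" "psi : D" "\<theta> : D" "c <: K" "!!h. h <: H ==> \<theta> h = c *.K psi h"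
 shows "T \<theta> x = ks c **.M T psi x"
proof -
 note rm = comodD(1)[OF assms(1)]
 obtain n y h where r: "rep M T {..<n::nat} y h x" using comod_rep[OF assms(1,2)] .
 have "T \<theta> x = lc M {..<n} (%i. c *.K psi (h i)) y"
  using r assms(3-) lc_cong[OF rm, of "{..<n}" "%i. \<theta> (h i)" "%i. c *.K psi (h i)" y y]
  by (auto simp: rep_def)
 also have "... = ks c **.M lc M {..<n} (%i. psi (h i)) y"
  using r assms(3-) by (intro ks_lc[OF rm, symmetric]) (auto simp: rep_def)
 finally show ?thesis using r assms(3) by (simp add: rep_def)
qed

lemma T_lc:
 assumes "comod M T" "psi : D" "!!i. i : I ==> k i <: K" "!!i. i : I ==> x i <: M"
 shows "T psi (lc M I k x) = lc M I k (%i. T psi (x i))"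
 using comodD[OF assms(1)] assms(2-) by (intro lc_additive) auto

lemma T_zero:
 assumes "comod M T" "psi : D"
 shows "T psi \<zero>.M = \<zero>.M"
proof -
 interpret M: right_module Z M by (rule comodD(1)[OF assms(1)])
 show ?thesis using T_lc[OF assms, of "{}" "%_. \<zero>.K" "%_. \<zero>.M"] by (simp add: lc_def)
qed

text \<open>Expanding the \<open>H\<close>-components in the dual basis and regrouping gives
  \<rho>(x) = \<Sum> T (cf b) x \<otimes> v b. The first factors are now images of \<open>x\<close>
  under the operators, hence lie in every stable submodule that contains \<open>x\<close>.\<close>

lemma rep_canonical_aux:
 assumes "comod M T" "x <: M"
 obtains B1 where "finite B1" "B1 \<subseteq> B" "{b : B. T (cf b) x ~= \<zero>.M} \<subseteq> B1"
  "rep M T B1 (%b. T (cf b) x) v x"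
proof -
 note rm = comodD(1)[OF assms(1)]
 interpret M: right_module Z M by (rule rm)
 obtain n y h where r: "rep M T {..<n::nat} y h x" using comod_rep[OF assms] .
 then have y: "!!i. i < n ==> y i <: M" and h: "!!i. i < n ==> h i <: H"
  and T: "!!psi. psi : D ==> T psi x = lc M {..<n} (%i. psi (h i)) y"
  by (auto simp: rep_def)
 define B1 where "B1 = (\<Union>i<n. {b : B. cf b (h i) ~= \<zero>.K})"
 have B1: "finite B1" "B1 \<subseteq> B" using h cf_finite by (auto simp: B1_def)
 have "T (cf b) x = \<zero>.M" if b: "b : B" "b \<notin> B1" for b
 proof -
  have "lc M {..<n} (%i. cf b (h i)) y = lc M {..<n} (%i. \<zero>.K) y"
   using b y by (intro lc_cong[OF rm]) (auto simp: B1_def)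
  also have "... = \<zero>.M" unfolding lc_def using y by (intro M.M.finsum_zero') (auto simp: M.zero_smult)
  finally show ?thesis using T[OF cf[OF b(1)]] by simp
 qed
 then have supp: "{b : B. T (cf b) x ~= \<zero>.M} \<subseteq> B1" by auto
 have vB: "!!b. b : B1 ==> v b <: H" "!!b. b : B1 ==> cf b : D" using v cf B1(2) by auto
 have "T psi x = lc M B1 (%b. psi (v b)) (%b. T (cf b) x)" if psi: "psi : D" for psi
 proof -
  have "T psi x = lc M {..<n} (%i. \<Sum>.K b:B1. psi (v b) *.K cf b (h i)) y"
   unfolding T[OF psi]
  proof (rule lc_cong[OF rm])
   fix i assume i: "i : {..<n}"
   have "psi (h i) = (\<Sum>.K b:B1. cf b (h i) *.K psi (v b))"
    using i h B1 psi by (intro dual_basis_superset) (auto simp: B1_def)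
   also have "... = (\<Sum>.K b:B1. psi (v b) *.K cf b (h i))"
    using i h psi vB by (intro K.finsum_eqI K.m_comm K.m_closed) auto
   finally show "psi (h i) = (\<Sum>.K b:B1. psi (v b) *.K cf b (h i))" .
   show "(\<Sum>.K b:B1. psi (v b) *.K cf b (h i)) <: K"
    using i h psi vB by (intro K.finsum_in K.m_closed) auto
  qed (use y in auto)
  also have "... = lc M B1 (%b. psi (v b)) (%b. lc M {..<n} (%i. cf b (h i)) y)"
   using y h B1(1) psi vB by (intro lc_lc[OF rm, symmetric]) auto
  also have "... = lc M B1 (%b. psi (v b)) (%b. T (cf b) x)"
   using psi vB T comodD(2)[OF assms(1) vB(2) assms(2)] by (intro lc_cong[OF rm]) auto
  finally show ?thesis .
 qed
 then have "rep M T B1 (%b. T (cf b) x) v x"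
  using B1 cf v comodD(2)[OF assms(1) _ assms(2)] by (auto simp: rep_def)
 then show ?thesis using B1 supp that by blast
qed

lemma supp_finite:
 assumes "comod M T" "x <: M"
 shows "finite {b : B. T (cf b) x ~= \<zero>.M}"
 using rep_canonical_aux[OF assms] finite_subset by metis

lemma rep_canonical:
 assumes "comod M T" "x <: M" "finite B0" "B0 \<subseteq> B" "{b : B. T (cf b) x ~= \<zero>.M} \<subseteq> B0"
 shows "rep M T B0 (%b. T (cf b) x) v x"
proof -
 note rm = comodD(1)[OF assms(1)]
 have c: "T (cf b) x <: M" "v b <: H" if "b : B" for b
  using that cf v comodD(2)[OF assms(1) _ assms(2)] by auto
 obtain B1 where B1: "finite B1" "B1 \<subseteq> B" "{b : B. T (cf b) x ~= \<zero>.M} \<subseteq> B1"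
  "rep M T B1 (%b. T (cf b) x) v x"
  using rep_canonical_aux[OF assms(1,2)] .
 have "lc M B1 (%b. psi (v b)) (%b. T (cf b) x) = lc M B0 (%b. psi (v b)) (%b. T (cf b) x)" if psi: "psi : D" for psi
 proof -
  have "lc M {b : B. T (cf b) x ~= \<zero>.M} (%b. psi (v b)) (%b. T (cf b) x) =
   lc M B' (%b. psi (v b)) (%b. T (cf b) x)"
   if "finite B'" "B' \<subseteq> B" "{b : B. T (cf b) x ~= \<zero>.M} \<subseteq> B'" for B'
   using that c psi by (intro lc_superset[OF rm]) (auto simp: subset_iff)
  from this[OF B1(1-3)] this[OF assms(3-5)] show ?thesis by simp
 qed
 then show ?thesis using B1(4) c assms(3,4) unfolding rep_def by auto
qed

lemma rep_eval:
 assumes "abelian_group G" "comod M T" "kbal M G \<beta>" "rep M T I y h x" "rep M T J y' h' x"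
 shows "(\<Sum>.G i:I. \<beta> (y i) (h i)) = (\<Sum>.G j:J. \<beta> (y' j) (h' j))"
 using assms(4,5) by (intro functionals_determine[OF comodD(1)[OF assms(2)] assms(1,3)])
  (auto simp: rep_def)

end

section \<open>Multiplicative matrices and the antipode\<close>

context hopf_dual
begin

text \<open>A multiplicative matrix, that is \<Delta>(c_ik) = \<Sum> c_ij \<otimes> c_jk together
  with the counit law, where the tensor identity is tested on pairs of functionals.\<close>

definition comat :: "'i set => ('i => 'i => 'h) => bool" where
 "comat I c \<longleftrightarrow> finite I & (ALL i:I. ALL j:I. c i j <: H) &
  (ALL phi:D. ALL psi:D. ALL i:I. ALL k:I. conv phi psi (c i k) = (\<Sum>.K j:I. phi (c i j) *.K psi (c j k))) &
  (ALL i:I. ALL k:I. eps (c i k) = (if i = k then \<one>.K else \<zero>.K))"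

text \<open>The element is (id \<otimes> \<theta>)(\<Delta> h), formed from one representation of
  \<Delta> h.\<close>

lemma conv_slice:
 assumes "\<theta> : D" "h <: H"
 shows "EX g:carrier H. ALL psi:D. psi g = conv psi \<theta> h"
proof -
 obtain n x y where xy: "ALL i<n::nat. x i <: H & y i <: H"
  and c: "ALL phi:D. ALL psi:D. conv phi psi h = (\<Sum>.K i:{..<n}. phi (x i) *.K psi (y i))"
  using antipode_ex[OF assms(2)] by blast
 let ?g = "\<Sum>.H i:{..<n}. \<theta> (y i) **.H x i"
 have "psi ?g = conv psi \<theta> h" if psi: "psi : D" for psi
 proof -
  have "psi ?g = (\<Sum>.K i:{..<n}. psi (\<theta> (y i) **.H x i))"
   using xy assms psi by (intro dual_finsum) (auto intro!: HM.smult_closed)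
  also have "... = (\<Sum>.K i:{..<n}. psi (x i) *.K \<theta> (y i))"
   using xy assms psi by (intro K.finsum_eqI) (auto simp: dual_smult K.m_comm dual_closed)
  finally show ?thesis using c assms psi by simp
 qed
 moreover have "?g <: H" using xy assms by (auto intro!: H.finsum_in HM.smult_closed)
 ultimately show ?thesis by blast
qed

lemma coeff_K: "hopf_dual_coeff K H conv eps S B cf v K (%c. c)"
 by unfold_locales (auto simp: ring_hom_def K.m_comm)

text \<open>With \<open>Z = K\<close> and \<open>M = H\<close>, \<open>functionals_determine\<close>
  asks for an equality in \<open>H\<close> for each psi; applying a second functional phi and
  \<open>dual_separates\<close> reduces it to the hypothesis \<open>eq\<close>.\<close>

lemma dual_pairs_determine:
 assumes G: "abelian_group G"
  and \<beta>: "!!x y. [|x <: H; y <: H|] ==> \<beta> x y <: G"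
   "!!x x' y. [|x <: H; x' <: H; y <: H|] ==> \<beta> (x +.H x') y = \<beta> x y +.G \<beta> x' y"
   "!!x y y'. [|x <: H; y <: H; y' <: H|] ==> \<beta> x (y +.H y') = \<beta> x y +.G \<beta> x y'"
   "!!c x y. [|c <: K; x <: H; y <: H|] ==> \<beta> (c **.H x) y = \<beta> x (c **.H y)"
  and I: "finite I" "!!i. i : I ==> x i <: H" "!!i. i : I ==> y i <: H"
  and J: "finite J" "!!j. j : J ==> x' j <: H" "!!j. j : J ==> y' j <: H"
  and eq: "!!phi psi. [|phi : D; psi : D|] ==>
   (\<Sum>.K i:I. phi (x i) *.K psi (y i)) = (\<Sum>.K j:J. phi (x' j) *.K psi (y' j))"
 shows "(\<Sum>.G i:I. \<beta> (x i) (y i)) = (\<Sum>.G j:J. \<beta> (x' j) (y' j))"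
proof -
 interpret KK: hopf_dual_coeff K H conv eps S B cf v K "%c. c" by (rule coeff_K)
 have *: "phi (KK.lc H I (%i. psi (y i)) x) = (\<Sum>.K i:I. phi (x i) *.K psi (y i))"
  if "phi : D" "psi : D" "!!i. i : I ==> x i <: H" "!!i. i : I ==> y i <: H"
  for phi psi and I :: "'i set" and x y
 proof -
  have "phi (KK.lc H I (%i. psi (y i)) x) = (\<Sum>.K i:I. phi (psi (y i) **.H x i))"
   unfolding KK.lc_def using that by (intro dual_finsum) (auto intro!: HM.smult_closed)
  also have "... = (\<Sum>.K i:I. phi (x i) *.K psi (y i))"
   using that by (intro K.finsum_eqI) (auto simp: dual_smult K.m_comm dual_closed)
  finally show ?thesis .
 qed
 have **: "phi (KK.lc H J (%i. psi (y' i)) x') = (\<Sum>.K i:J. phi (x' i) *.K psi (y' i))"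
  if "phi : D" "psi : D" for phi psi
 proof -
  have "phi (KK.lc H J (%i. psi (y' i)) x') = (\<Sum>.K i:J. phi (psi (y' i) **.H x' i))"
   unfolding KK.lc_def using that J by (intro dual_finsum) (auto intro!: HM.smult_closed)
  also have "... = (\<Sum>.K i:J. phi (x' i) *.K psi (y' i))"
   using that J by (intro K.finsum_eqI) (auto simp: dual_smult K.m_comm dual_closed)
  finally show ?thesis .
 qed
 show ?thesis
 proof (rule KK.functionals_determine[OF mod_H G _ I J])
  show "KK.kbal H G \<beta>" unfolding KK.kbal_def using \<beta> by auto
  fix psi assume psi: "psi : D"
  show "KK.lc H I (%i. psi (y i)) x = KK.lc H J (%j. psi (y' j)) x'"
   using I J psi eq by (intro dual_separates KK.lc_closed mod_H) (auto simp: * **)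
 qed
qed

text \<open>The antipode axioms are known for one representation of \<Delta>(c_ik), and
  multiplicativity of \<open>c\<close> supplies another. Pairs of functionals do not distinguish
  them, so the axioms carry over and say that the matrix of the S(c_ij) is a two-sided inverse of
  \<open>c\<close>.\<close>

lemma comat_antipode:
 assumes c: "comat I c" and ik: "i : I" "k : I"
 shows "(\<Sum>.H j:I. S (c i j) *.H c j k) = (if i = k then \<one>.H else \<zero>.H)"
  and "(\<Sum>.H j:I. c i j *.H S (c j k)) = (if i = k then \<one>.H else \<zero>.H)"
proof -
 have cc: "!!i j. [|i : I; j : I|] ==> c i j <: H" and fin: "finite I" using c by (auto simp: comat_def)
 obtain n x y where xy: "ALL i<n::nat. x i <: H & y i <: H"
  and cv: "ALL phi:D. ALL psi:D. conv phi psi (c i k) = (\<Sum>.K i:{..<n}. phi (x i) *.K psi (y i))"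
  and 1: "(\<Sum>.H i:{..<n}. S (x i) *.H y i) = eps (c i k) **.H \<one>.H"
  and 2: "(\<Sum>.H i:{..<n}. x i *.H S (y i)) = eps (c i k) **.H \<one>.H"
  using antipode_ex[OF cc[OF ik]] by blast
 have e: "eps (c i k) **.H \<one>.H = (if i = k then \<one>.H else \<zero>.H)"
  using c ik by (auto simp: comat_def HM.smult_one HM.zero_smult)
 have eq: "(\<Sum>.K j:I. phi (c i j) *.K psi (c j k)) = (\<Sum>.K i:{..<n}. phi (x i) *.K psi (y i))"
  if "phi : D" "psi : D" for phi psi
  using c cv ik that by (auto simp: comat_def)
 note S1 = mod_hom_add[OF S] mod_hom_smult[OF S]
 show "(\<Sum>.H j:I. S (c i j) *.H c j k) = (if i = k then \<one>.H else \<zero>.H)"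
  unfolding e[symmetric] 1[symmetric]
  by (rule dual_pairs_determine[where \<beta> = "%x y. S x *.H y", OF H.is_abelian_group])
   (use eq xy cc ik fin in \<open>auto simp: H.l_distr H.r_distr mult_left mult_right S1\<close>)
 show "(\<Sum>.H j:I. c i j *.H S (c j k)) = (if i = k then \<one>.H else \<zero>.H)"
  unfolding e[symmetric] 2[symmetric]
  by (rule dual_pairs_determine[where \<beta> = "%x y. x *.H S y", OF H.is_abelian_group])
   (use eq xy cc ik fin in \<open>auto simp: H.l_distr H.r_distr mult_left mult_right S1\<close>)
qed

end

lemma (in abelian_group) minus_eq_zero_iff:
 assumes "x <: G" "y <: G"
 shows "x \<ominus> y = \<zero> \<longleftrightarrow> x = y"
 using assms by (metis a_inv_closed a_minus_def minus_equality minus_minus r_neg)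

context hopf_dual
begin

text \<open>The choice permitted by \<open>conv_slice\<close>; \<open>dual_separates\<close> makes
  the element unique. These operators turn \<open>H\<close> into a comodule over itself.\<close>

definition slice :: "('h => 'k) => 'h => 'h" where
 "slice \<theta> h = (SOME g. g <: H & (ALL psi:D. psi g = conv psi \<theta> h))"

lemma
 assumes "\<theta> : D" "h <: H"
 shows slice_closed: "slice \<theta> h <: H" and slice_eval: "psi : D ==> psi (slice \<theta> h) = conv psi \<theta> h"
proof -
 have "EX g. g <: H & (ALL psi:D. psi g = conv psi \<theta> h)" using conv_slice[OF assms] by auto
 then have *: "slice \<theta> h <: H & (ALL psi:D. psi (slice \<theta> h) = conv psi \<theta> h)"
  unfolding slice_def by (rule someI_ex)
 show "slice \<theta> h <: H" "psi : D ==> psi (slice \<theta> h) = conv psi \<theta> h"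
  using * by blast+
qed

end

context hopf_dual_coeff
begin

lemma lc_reindex:
 assumes "right_module Z M" "bij_betw g J I" "!!i. i : I ==> k i <: K" "!!i. i : I ==> x i <: M"
 shows "lc M I k x = lc M J (%j. k (g j)) (%j. x (g j))"
proof -
 interpret M: right_module Z M by fact
 have g: "inj_on g J" "I = g ` J" using assms(2) by (auto simp: bij_betw_def)
 show ?thesis
  unfolding lc_def g(2) using assms g by (intro M.M.finsum_reindex) (auto intro!: M.smult_closed)
qed

lemma fam_reindex:
 assumes "comod M T" "fam M T I c y" "bij_betw g J I" "finite J"
 shows "fam M T J (%i j. c (g i) (g j)) (%j. y (g j))"
proof -
 note rm = comodD(1)[OF assms(1)]
 have g: "g j : I" if "j : J" for j using assms(3) that by (auto simp: bij_betw_def)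
 have "T psi (y (g j)) = lc M J (%i. psi (c (g i) (g j))) (%j. y (g j))" if "psi : D" "j : J" for psi j
 proof -
  have "T psi (y (g j)) = lc M I (%i. psi (c i (g j))) y"
   using assms(2) that g unfolding fam_def by blast
  also have "... = lc M J (%i. psi (c (g i) (g j))) (%j. y (g j))"
   using assms(2) that g by (intro lc_reindex[OF rm assms(3)]) (auto simp: fam_def)
  finally show ?thesis .
 qed
 then show ?thesis using assms(2,4) g unfolding fam_def by auto
qed

text \<open>In a family that is minimal among those whose span contains \<open>X\<close> the vectors are linearly
 independent, so coassociativity and the counit law pass to the coefficient matrix.\<close>

lemma comatrix_family:
 assumes M: "comod M T" and P: "submodule P Z M"
  and stable: "!!psi x. [|psi : D; x : P|] ==> T psi x : P"
  and X: "finite X" "X \<subseteq> P"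
 obtains n :: nat and c y where "comat {..<n} c" "fam M T {..<n} c y" "!!i. i < n ==> y i : P"
  "!!x. x : X ==> EX k. (ALL i<n. k i <: K) & x = lc M {..<n} k y"
proof -
 note rm = comodD(1)[OF M]
 interpret M: right_module Z M by (rule rm)
 note PM = M.submoduleD[OF P]
 define B0 where "B0 = (\<Union>x\<in>X. {b : B. T (cf b) x ~= \<zero>.M})"
 have B0: "finite B0" "B0 \<subseteq> B"
  unfolding B0_def using X PM(1) supp_finite[OF M] by auto
 have vB: "v b <: H" "cf b : D" if "b : B0" for b using that B0 v cf by auto
 have rc: "rep M T B0 (%b. T (cf b) x) v x" if "x : X" for x
  using X PM(1) B0 that by (intro rep_canonical[OF M]) (auto simp: B0_def)
 \<comment> \<open>These vectors span a subcomodule containing \<open>X\<close>: the counit writes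
   \<open>x\<close> as the combination of the \<open>T (cf b) x\<close> with coefficients
   \<open>eps (v b)\<close>, and \<open>T psi (T (cf b) x)\<close> equals
   \<open>T (conv psi (cf b)) x\<close>, which is again such a combination.\<close>
 define y0 where "y0 = (%p. T (cf (snd p)) (fst p))"
 have y0P: "y0 p : P" if "p : X \<times> B0" for p
  using that X stable vB by (auto simp: y0_def)
 have y0M: "y0 p <: M" if "p : X \<times> B0" for p using y0P[OF that] PM(1) by auto
 have lift: "lc M (X \<times> B0) (%p. if fst p = x then k (snd p) else \<zero>.K) y0 = lc M B0 k (%b. T (cf b) x)"
  if x: "x : X" and k: "!!b. b : B0 ==> k b <: K" for x k
 proof -
  let ?k = "%p. if fst p = x then k (snd p) else \<zero>.K"
  have "lc M (Pair x ` B0) ?k y0 = lc M (X \<times> B0) ?k y0"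
   using x k y0M X B0 by (intro lc_superset[OF rm]) auto
  moreover have "lc M (Pair x ` B0) ?k y0 = lc M B0 (%b. ?k (x, b)) (%b. y0 (x, b))"
   using x k y0M by (intro lc_reindex[OF rm]) (auto simp: bij_betw_def inj_on_def)
  ultimately show ?thesis by (simp add: y0_def)
 qed
 define g where "g b' b = slice (cf b) (v b')" for b' b
 have g: "!!b b'. [|b : B0; b' : B0|] ==> g b' b <: H"
  "!!b b' psi. [|b : B0; b' : B0; psi : D|] ==> psi (g b' b) = conv psi (cf b) (v b')"
  unfolding g_def by (rule slice_closed[OF vB(2) vB(1)], assumption+) (rule slice_eval[OF vB(2) vB(1)])
 have Q0: "(EX c. fam M T (X \<times> B0) c y0) & (ALL x:X. EX k. (ALL i:X \<times> B0. k i <: K) & x = lc M (X \<times> B0) k y0)"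
 proof (intro conjI ballI)
  \<comment> \<open>The coefficient matrix is block diagonal: vectors that belong to different
    elements of \<open>X\<close> do not mix, and each block is the same matrix
    \<open>g\<close>.\<close>
  define c where "c = (\<lambda>p q :: 'c \<times> 'b. if fst p = fst q then g (snd p) (snd q) else \<zero>.H)"
  have "T psi (y0 q) = lc M (X \<times> B0) (%p. psi (c p q)) y0" if psi: "psi : D" and q: "q : X \<times> B0" for psi q
  proof -
   obtain x b where [simp]: "q = (x, b)" and xb: "x : X" "b : B0" using q by auto
   have xM: "x <: M" using xb X PM(1) by auto
   have "T psi (y0 q) = T (conv psi (cf b)) x"
    using comodD(5)[OF M psi _ xM] vB xb by (simp add: y0_def)
   also have "... = lc M B0 (%b'. conv psi (cf b) (v b')) (%b. T (cf b) x)"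
    using rc[OF xb(1)] conv[OF psi vB(2)[OF xb(2)]] by (simp add: rep_def)
   also have "... = lc M (X \<times> B0) (%p. if fst p = x then conv psi (cf b) (v (snd p)) else \<zero>.K) y0"
    using vB xb psi conv by (intro lift[symmetric]) auto
   also have "... = lc M (X \<times> B0) (%p. psi (c p q)) y0"
   proof (rule lc_cong[OF rm])
    fix p assume p: "p : X \<times> B0"
    have "psi \<zero>.H = \<zero>.K" using dual_finsum[OF psi, of "{}"] by simp
    then show "(if fst p = x then conv psi (cf b) (v (snd p)) else \<zero>.K) = psi (c p q)"
     using g(2)[OF xb(2) _ psi, of "snd p"] p by (auto simp: c_def)
    show "psi (c p q) <: K" using g(1) p xb psi by (auto simp: c_def)
   qed (use y0M in auto)
   finally show ?thesis .
  qed
  then show "EX c. fam M T (X \<times> B0) c y0"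
   using X B0 y0M g(1) by (intro exI[of _ c]) (auto simp: fam_def c_def)
  fix x assume x: "x : X"
  have "x = T eps x" using comodD(6)[OF M] x X PM(1) by auto
  also have "... = lc M (X \<times> B0) (%p. if fst p = x then eps (v (snd p)) else \<zero>.K) y0"
   using rc[OF x] eps vB x by (subst lift) (auto simp: rep_def)
  finally have "x = lc M (X \<times> B0) (%p. if fst p = x then eps (v (snd p)) else \<zero>.K) y0" .
  then show "EX k. (ALL i:X \<times> B0. k i <: K) & x = lc M (X \<times> B0) k y0"
   using eps vB by (intro exI[of _ "%p. if fst p = x then eps (v (snd p)) else \<zero>.K"]) auto
 qed
 obtain c0 where c0: "fam M T (X \<times> B0) c0 y0" using Q0 by blast
 obtain e0 where "bij_betw e0 {0..<card (X \<times> B0)} (X \<times> B0)"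
  using ex_bij_betw_nat_finite[of "X \<times> B0"] X B0 by auto
 then have e0: "bij_betw e0 {..<card (X \<times> B0)} (X \<times> B0)" by (simp add: atLeast0LessThan)
 define J0 where "J0 = {..<card (X \<times> B0)}"
 note e0 = e0[folded J0_def]
 have e0J: "e0 i : X \<times> B0" if "i : J0" for i using e0 that by (auto simp: bij_betw_def)
 define y where "y i = y0 (e0 i)" for i
 have yP: "y i : P" if "i : J0" for i using y0P[OF e0J[OF that]] by (simp add: y_def)
 have yM: "y i <: M" if "i : J0" for i using y0M[OF e0J[OF that]] by (simp add: y_def)
 \<comment> \<open>Minimality is taken over index subsets of one fixed finite family, so that a
   least cardinality exists and no basis has to be chosen.\<close>
 define Q where "Q I \<longleftrightarrow> I \<subseteq> J0 & (EX c. fam M T I c y) &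
  (ALL x:X. EX k. (ALL i:I. k i <: K) & x = lc M I k y)" for I
 have Q0: "Q J0"
  unfolding Q_def
 proof (intro conjI ballI)
  show "EX c. fam M T J0 c y"
   unfolding y_def using fam_reindex[OF M c0 e0] by (auto simp: J0_def)
  fix x assume "x : X"
  then obtain k where k: "ALL i:X \<times> B0. k i <: K" "x = lc M (X \<times> B0) k y0" using Q0 by blast
  have xe: "x = lc M J0 (%i. k (e0 i)) y"
   unfolding k(2) y_def using k(1) y0M by (intro lc_reindex[OF rm e0]) blast+
  show "EX k. (ALL i:J0. k i <: K) & x = lc M J0 k y"
   by (intro exI[of _ "%i. k (e0 i)"] conjI ballI bspec[OF k(1)] e0J xe)
 qed simp
 obtain I where QI: "Q I" and min: "!!J. Q J ==> card I \<le> card J"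
  using ex_has_least_nat[of Q _ card, OF Q0] by blast
 have I: "I \<subseteq> J0" using QI by (simp add: Q_def)
 have fin: "finite I" using I finite_subset by (auto simp: J0_def)
 obtain c where c: "fam M T I c y" using QI by (auto simp: Q_def)
 have cH: "!!i j. [|i : I; j : I|] ==> c i j <: H" using c by (auto simp: fam_def)
 have Tc: "!!psi j. [|psi : D; j : I|] ==> T psi (y j) = lc M I (%i. psi (c i j)) y" using c by (auto simp: fam_def)
 have yI: "!!i. i : I ==> y i <: M" using I yM by auto
 \<comment> \<open>A relation with a nonzero coefficient at \<open>l\<close> expresses
   \<open>y l\<close> through the other vectors; eliminating it everywhere leaves a smaller family
   with the same properties, against minimality.\<close>
 have indep: "ALL i:I. k i = \<zero>.K" if k: "!!i. i : I ==> k i <: K" and z: "lc M I k y = \<zero>.M" for k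
 proof (rule ccontr)
  assume "\<not> ?thesis"
  then obtain l where l: "l : I" "k l ~= \<zero>.K" by auto
  then have U: "k l : Units K" using k by (simp add: K.field_Units)
  let ?u = "inv\<^bsub>K\<^esub> (k l)"
  have u: "?u <: K" "?u *.K k l = \<one>.K" using U by auto
  let ?I = "I - {l}"
  define m where "m i = -.K (?u *.K k i)" for i
  have m: "m i <: K" if "i : I" for i using that k u by (auto simp: m_def)
  have split: "lc M I r x = ks (r l) **.M x l +.M lc M ?I r x"
   if "!!i. i : I ==> r i <: K" "!!i. i : I ==> x i <: M" for r x
  proof -
   have "lc M (insert l ?I) r x = ks (r l) **.M x l +.M lc M ?I r x"
    unfolding lc_def using that l fin by (intro M.M.finsum_insert) (auto intro!: M.smult_closed)
   then show ?thesis using l by (simp add: insert_absorb)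
  qed
  have yl: "y l = lc M ?I m y"
  proof -
   have 1: "lc M I (%i. ?u *.K k i) y = \<zero>.M"
    using ks_lc[OF rm u(1), of I k y] k yI z u by (simp add: M.smult_zero)
   have 2: "y l +.M lc M ?I (%i. ?u *.K k i) y = \<zero>.M"
    using split[of "%i. ?u *.K k i" y] 1 k yI u l by (simp add: M.smult_one)
   have "lc M ?I m y +.M lc M ?I (%i. ?u *.K k i) y = lc M ?I (%i. m i +.K ?u *.K k i) y"
    using m k u yI by (intro lc_add[OF rm, symmetric]) auto
   also have "... = lc M ?I (%i. \<zero>.K) y"
    using m k u yI by (intro lc_cong[OF rm]) (auto simp: m_def K.l_neg)
   also have "... = \<zero>.M" unfolding lc_def using yI by (intro M.M.finsum_zero') (auto simp: M.zero_smult)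
   finally have 3: "lc M ?I m y +.M lc M ?I (%i. ?u *.K k i) y = \<zero>.M" .
   have cl: "lc M ?I m y <: M" "lc M ?I (%i. ?u *.K k i) y <: M"
    using m k u yI by (auto intro!: lc_closed[OF rm])
   from 2 3 cl yI[OF l(1)] show ?thesis by (metis M.M.add.right_cancel)
  qed
  have replace: "lc M I r y = lc M ?I (%i. r i +.K r l *.K m i) y"
   if r: "!!i. i : I ==> r i <: K" for r
  proof -
   have "lc M I r y = ks (r l) **.M lc M ?I m y +.M lc M ?I r y"
    using split[OF r yI] yl by simp
   also have "ks (r l) **.M lc M ?I m y = lc M ?I (%i. r l *.K m i) y"
    using r l m yI by (intro ks_lc[OF rm]) auto
   also have "lc M ?I (%i. r l *.K m i) y +.M lc M ?I r y = lc M ?I r y +.M lc M ?I (%i. r l *.K m i) y"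
    using r l m yI by (intro M.M.a_comm lc_closed[OF rm]) auto
   also have "... = lc M ?I (%i. r i +.K r l *.K m i) y"
    using r l m yI by (intro lc_add[OF rm, symmetric]) auto
   finally show ?thesis .
  qed
  have "Q ?I"
   unfolding Q_def
  proof (intro conjI ballI)
   show "?I \<subseteq> J0" using I by auto
   \<comment> \<open>Substituting \<open>y l\<close> as the combination of the \<open>y i\<close>
     with coefficients \<open>m i\<close> adds \<open>m i\<close> times row \<open>l\<close> to row
     \<open>i\<close>.\<close>
   define c' where "c' i j = c i j +.H m i **.H c l j" for i j
   have "T psi (y j) = lc M ?I (%i. psi (c' i j)) y" if psi: "psi : D" and j: "j : ?I" for psi j
   proof -
    have "T psi (y j) = lc M ?I (%i. psi (c i j) +.K psi (c l j) *.K m i) y"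
     using Tc[OF psi, of j] replace[of "%i. psi (c i j)"] j cH psi by auto
    also have "... = lc M ?I (%i. psi (c' i j)) y"
     using psi j cH m l yI unfolding c'_def
     by (intro lc_cong[OF rm]) (auto simp: dual_add dual_smult HM.smult_closed K.m_comm)
    finally show ?thesis .
   qed
   then show "EX c. fam M T ?I c y"
    using fin yI cH m l unfolding fam_def
    by (intro exI[of _ c']) (auto simp: c'_def intro!: HM.smult_closed)
   fix x assume "x : X"
   then obtain k' where k': "ALL i:I. k' i <: K" "x = lc M I k' y" using QI by (auto simp: Q_def)
   then have "x = lc M ?I (%i. k' i +.K k' l *.K m i) y" using replace[of k'] by auto
   then show "EX k. (ALL i:?I. k i <: K) & x = lc M ?I k y"
    using k' m l by (intro exI[of _ "%i. k' i +.K k' l *.K m i"]) auto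
  qed
  then have "card I \<le> card ?I" by (rule min)
  moreover have "card ?I < card I" using l fin by (intro psubset_card_mono) auto
  ultimately show False by simp
 qed
 have uniq: "ALL i:I. k i = k' i"
  if k: "!!i. i : I ==> k i <: K" "!!i. i : I ==> k' i <: K" and e: "lc M I k y = lc M I k' y" for k k'
 proof -
  have n: "-.K \<one>.K <: K" by simp
  have "lc M I (%i. k i +.K (-.K \<one>.K) *.K k' i) y = lc M I k y +.M ks (-.K \<one>.K) **.M lc M I k' y"
   using k yI ks_lc[OF rm n, of I k' y] by (subst lc_add[OF rm]) auto
  also have "... = lc M I (%i. k' i +.K (-.K \<one>.K) *.K k' i) y"
   unfolding e using k yI ks_lc[OF rm n, of I k' y] by (subst lc_add[OF rm]) auto
  also have "... = lc M I (%i. \<zero>.K) y"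
   using k yI by (intro lc_cong[OF rm]) (auto simp: K.l_minus K.r_neg)
  also have "... = \<zero>.M" unfolding lc_def using yI by (intro M.M.finsum_zero') (auto simp: M.zero_smult)
  finally have "ALL i:I. k i +.K (-.K \<one>.K) *.K k' i = \<zero>.K" using k by (intro indep) auto
  then show ?thesis using k by (auto simp: K.l_minus K.minus_eq[symmetric] K.minus_eq_zero_iff)
 qed
 have "comat I c"
  unfolding comat_def
 proof (intro conjI ballI fin cH)
  fix phi psi i k assume phi: "phi : D" and psi: "psi : D" and ik: "i : I" "k : I"
  \<comment> \<open>The vector \<open>T phi (T psi (y k))\<close> is computed in two ways, once
    through the convolution and once through two applications of the coefficient matrix;
    independence allows comparison of coefficients.\<close>
  have "lc M I (%i. conv phi psi (c i k)) y = T phi (T psi (y k))"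
   using Tc[OF conv[OF phi psi] ik(2)] comodD(5)[OF M phi psi yI[OF ik(2)]] by simp
  also have "... = lc M I (%j. psi (c j k)) (%j. T phi (y j))"
   unfolding Tc[OF psi ik(2)] using phi psi ik cH yI by (intro T_lc[OF M]) auto
  also have "... = lc M I (%j. psi (c j k)) (%j. lc M I (%i. phi (c i j)) y)"
   using phi psi ik cH yI Tc by (intro lc_cong[OF rm]) (auto intro!: lc_closed[OF rm])
  also have "... = lc M I (%i. \<Sum>.K j:I. psi (c j k) *.K phi (c i j)) y"
   using phi psi ik cH yI fin by (intro lc_lc[OF rm]) auto
  finally have e: "lc M I (%i. conv phi psi (c i k)) y = lc M I (%i. \<Sum>.K j:I. psi (c j k) *.K phi (c i j)) y" .
  have "ALL i:I. conv phi psi (c i k) = (\<Sum>.K j:I. psi (c j k) *.K phi (c i j))"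
  proof (rule uniq[OF _ _ e])
   show "conv phi psi (c i k) <: K" if "i : I" for i using conv[OF phi psi] cH[OF that ik(2)] by auto
   show "(\<Sum>.K j:I. psi (c j k) *.K phi (c i j)) <: K" if "i : I" for i
    using phi psi ik cH that by (intro K.finsum_in) auto
  qed
  then have "conv phi psi (c i k) = (\<Sum>.K j:I. psi (c j k) *.K phi (c i j))" using ik(1) by (rule bspec)
  also have "... = (\<Sum>.K j:I. phi (c i j) *.K psi (c j k))"
   using phi psi ik cH by (intro K.finsum_eqI K.m_comm) auto
  finally show "conv phi psi (c i k) = (\<Sum>.K j:I. phi (c i j) *.K psi (c j k))" .
 next
  fix i k assume ik: "i : I" "k : I"
  have "lc M I (%i. eps (c i k)) y = y k" using Tc[OF eps ik(2)] comodD(6)[OF M yI[OF ik(2)]] by simp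
  also have "... = lc M I (%i. if i = k then \<one>.K else \<zero>.K) y"
   using ik fin yI by (intro lc_delta[OF rm, symmetric]) auto
  finally have e: "lc M I (%i. eps (c i k)) y = lc M I (%i. if i = k then \<one>.K else \<zero>.K) y" .
  have "ALL i:I. eps (c i k) = (if i = k then \<one>.K else \<zero>.K)"
   by (rule uniq[OF _ _ e]) (use cH ik eps in auto)
  then show "eps (c i k) = (if i = k then \<one>.K else \<zero>.K)" using ik(1) by (rule bspec)
 qed
 obtain e where e: "bij_betw e {0..<card I} I" using ex_bij_betw_nat_finite[OF fin] by blast
 then have e: "bij_betw e {..<card I} I" by (simp add: atLeast0LessThan)
 then have eI: "!!i. i < card I ==> e i : I" and inj: "inj_on e {..<card I}" and img: "e ` {..<card I} = I"
  by (auto simp: bij_betw_def)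
 have c1: "comat {..<card I} (%i j. c (e i) (e j))"
  unfolding comat_def
 proof (intro conjI ballI)
  fix phi psi i k assume *: "phi : D" "psi : D" "i : {..<card I}" "k : {..<card I}"
  have "conv phi psi (c (e i) (e k)) = (\<Sum>.K j:e ` {..<card I}. phi (c (e i) j) *.K psi (c j (e k)))"
   using \<open>comat I c\<close> * eI unfolding img comat_def by auto
  also have "... = (\<Sum>.K j:{..<card I}. phi (c (e i) (e j)) *.K psi (c (e j) (e k)))"
   using * eI inj cH by (intro K.finsum_reindex) auto
  finally show "conv phi psi (c (e i) (e k)) = (\<Sum>.K j:{..<card I}. phi (c (e i) (e j)) *.K psi (c (e j) (e k)))" .
 next
  fix i k assume "i : {..<card I}" "k : {..<card I}"
  then show "eps (c (e i) (e k)) = (if i = k then \<one>.K else \<zero>.K)"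
   using \<open>comat I c\<close> eI inj_on_eq_iff[OF inj] unfolding comat_def by simp
 qed (use cH eI in auto)
 show ?thesis
 proof (rule that[OF c1])
  show "fam M T {..<card I} (%i j. c (e i) (e j)) (%i. y (e i))" by (rule fam_reindex[OF M c e]) simp
  show "y (e i) : P" if "i < card I" for i using yP eI[OF that] I by auto
  fix x assume "x : X"
  then obtain k where k: "ALL i:I. k i <: K" "x = lc M I k y" using QI by (auto simp: Q_def)
  have "x = lc M {..<card I} (%i. k (e i)) (%i. y (e i))"
   unfolding k(2) using k yI by (intro lc_reindex[OF rm e]) auto
  then show "EX k. (ALL i<card I. k i <: K) & x = lc M {..<card I} k (%i. y (e i))"
   using k(1) eI by (intro exI[of _ "%i. k (e i)"]) auto
 qed
qed

end

section \<open>The antipode reverses products\<close>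

context hopf_dual
begin

lemma dual_zero: "psi : D ==> psi \<zero>.H = \<zero>.K"
 using dual_finsum[of psi "{}" "%_. \<zero>.H"] by simp

text \<open>\<Delta> is multiplicative, and in the product \<Delta>(c_ik) \<Delta>(h) the first
  factor may be rewritten by multiplicativity of \<open>c\<close>. For this \<Delta>(h) is kept
  fixed inside \<beta>, which is bilinear in the two components of the first factor.\<close>

lemma conv_mult_left:
 assumes c: "comat I c" and ik: "i : I" "k : I" and h: "h <: H" and phi: "phi : D" and psi: "psi : D"
 shows "conv phi psi (c i k *.H h) = (\<Sum>.K j:I. conv (%g. phi (c i j *.H g)) (%g. psi (c j k *.H g)) h)"
proof -
 have cc: "!!i j. [|i : I; j : I|] ==> c i j <: H" and fin: "finite I" using c by (auto simp: comat_def)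
 obtain n x y m x' y' where xy: "ALL i<n::nat. x i <: H & y i <: H" "ALL i<m::nat. x' i <: H & y' i <: H"
  and cv: "ALL phi:D. ALL psi:D. conv phi psi (c i k) = (\<Sum>.K i:{..<n}. phi (x i) *.K psi (y i)) &
    conv phi psi h = (\<Sum>.K i:{..<m}. phi (x' i) *.K psi (y' i)) &
    conv phi psi (c i k *.H h) = (\<Sum>.K i:{..<n}. \<Sum>.K j:{..<m}.
     phi (x i *.H x' j) *.K psi (y i *.H y' j))"
  using conv_mult_ex[OF cc[OF ik] h] by (elim exE conjE) (rule that)
 define \<beta> where "\<beta> a b = (\<Sum>.K j:{..<m}. phi (a *.H x' j) *.K psi (b *.H y' j))" for a b
 have d: "!!a j. [|a <: H; j < m|] ==> phi (a *.H x' j) <: K"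
  "!!a j. [|a <: H; j < m|] ==> psi (a *.H y' j) <: K"
  using xy phi psi by auto
 have "conv phi psi (c i k *.H h) = (\<Sum>.K i:{..<n}. \<beta> (x i) (y i))"
  using cv phi psi by (simp add: \<beta>_def)
 also have "... = (\<Sum>.K j:I. \<beta> (c i j) (c j k))"
 proof (rule dual_pairs_determine[OF K.is_abelian_group])
  fix a a' b assume *: "a <: H" "a' <: H" "b <: H"
  have "\<beta> (a +.H a') b = (\<Sum>.K j:{..<m}. phi (a *.H x' j) *.K psi (b *.H y' j) +.K phi (a' *.H x' j) *.K psi (b *.H y' j))"
   unfolding \<beta>_def using * xy d phi by (intro K.finsum_eqI) (auto simp: H.l_distr dual_add K.l_distr)
  then show "\<beta> (a +.H a') b = \<beta> a b +.K \<beta> a' b"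
   unfolding \<beta>_def using * d by (simp add: K.finsum_add)
 next
  fix a b b' assume *: "a <: H" "b <: H" "b' <: H"
  have "\<beta> a (b +.H b') = (\<Sum>.K j:{..<m}. phi (a *.H x' j) *.K psi (b *.H y' j) +.K phi (a *.H x' j) *.K psi (b' *.H y' j))"
   unfolding \<beta>_def using * xy d psi by (intro K.finsum_eqI) (auto simp: H.l_distr dual_add K.r_distr)
  then show "\<beta> a (b +.H b') = \<beta> a b +.K \<beta> a b'"
   unfolding \<beta>_def using * d by (simp add: K.finsum_add)
 next
  fix t a b assume *: "t <: K" "a <: H" "b <: H"
  show "\<beta> (t **.H a) b = \<beta> a (t **.H b)"
   unfolding \<beta>_def using * xy d phi psi by (intro K.finsum_eqI) (auto simp: mult_left dual_smult K.m_ac)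
 next
  fix phi' psi' assume "phi' : D" "psi' : D"
  then show "(\<Sum>.K i:{..<n}. phi' (x i) *.K psi' (y i)) = (\<Sum>.K j:I. phi' (c i j) *.K psi' (c j k))"
   using cv c ik by (simp add: comat_def)
 qed (use xy cc ik fin d in \<open>auto simp: \<beta>_def intro!: K.finsum_in\<close>)
 also have "... = (\<Sum>.K j:I. conv (%g. phi (c i j *.H g)) (%g. psi (c j k *.H g)) h)"
  using cv dual_left[OF phi] dual_left[OF psi] cc ik d unfolding \<beta>_def
  by (intro K.finsum_eqI) (auto intro!: K.finsum_in)
 finally show ?thesis .
qed

text \<open>The Kronecker product is the coefficient matrix of a tensor product of two comodules;
  \<open>conv_mult_left\<close> for \<open>c\<close> followed by multiplicativity of
  \<open>d\<close> gives the formula.\<close>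

lemma comat_Times:
 assumes c: "comat I c" and d: "comat J d"
 shows "comat (I \<times> J) (%p q. c (fst p) (fst q) *.H d (snd p) (snd q))"
proof -
 have cc: "!!i j. [|i : I; j : I|] ==> c i j <: H" and finI: "finite I" using c by (auto simp: comat_def)
 have dd: "!!i j. [|i : J; j : J|] ==> d i j <: H" and finJ: "finite J" using d by (auto simp: comat_def)
 have main: "conv phi psi (c i k *.H d j l) =
   (\<Sum>.K p:I \<times> J. phi (c i (fst p) *.H d j (snd p)) *.K psi (c (fst p) k *.H d (snd p) l))"
  if *: "phi : D" "psi : D" "i : I" "k : I" "j : J" "l : J" for phi psi i j k l
 proof -
  have "conv phi psi (c i k *.H d j l) = (\<Sum>.K p:I. conv (%g. phi (c i p *.H g)) (%g. psi (c p k *.H g)) (d j l))"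
   using * dd by (intro conv_mult_left[OF c]) auto
  also have "... = (\<Sum>.K p:I. \<Sum>.K q:J. phi (c i p *.H d j q) *.K psi (c p k *.H d q l))"
  proof (rule K.finsum_eqI)
   fix p assume p: "p : I"
   show "conv (%g. phi (c i p *.H g)) (%g. psi (c p k *.H g)) (d j l) = (\<Sum>.K q:J. phi (c i p *.H d j q) *.K psi (c p k *.H d q l))"
    using d * p dual_left[OF *(1) cc[OF *(3) p]] dual_left[OF *(2) cc[OF p *(4)]] unfolding comat_def by blast
   show "(\<Sum>.K q:J. phi (c i p *.H d j q) *.K psi (c p k *.H d q l)) <: K"
    using * p cc dd by (intro K.finsum_in) auto
  qed
  also have "... = (\<Sum>.K p:I \<times> J. phi (c i (fst p) *.H d j (snd p)) *.K psi (c (fst p) k *.H d (snd p) l))"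
   using * cc dd finI finJ
   by (intro K.finsum_Times[where f = "%p q. phi (c i p *.H d j q) *.K psi (c p k *.H d q l)", symmetric]) auto
  finally show ?thesis .
 qed
 have "eps (c i k *.H d j l) = (if (i, j) = (k, l) then \<one>.K else \<zero>.K)"
  if "i : I" "k : I" "j : J" "l : J" for i j k l
  using c d that cc dd by (auto simp: comat_def eps_mult)
 with main show ?thesis
  using cc dd finI finJ unfolding comat_def by auto
qed

text \<open>Both sides are entries of an inverse of the Kronecker product of \<open>c\<close> and
  \<open>d\<close>. The left inverse comes from \<open>comat_antipode\<close> for that product, the
  right inverse from cancelling \<open>d\<close> first and then \<open>c\<close>, which accounts for
  the reversed order.\<close>

lemma S_comat_mult:
 assumes c: "comat I c" and d: "comat J d" and ik: "i : I" "k : I" and jl: "j : J" "l : J"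
 shows "S (c i k *.H d j l) = S (d j l) *.H S (c i k)"
proof -
 have cc: "!!i j. [|i : I; j : I|] ==> c i j <: H" and finI: "finite I" using c by (auto simp: comat_def)
 have dd: "!!i j. [|i : J; j : J|] ==> d i j <: H" and finJ: "finite J" using d by (auto simp: comat_def)
 let ?X = "%p q. c (fst p) (fst q) *.H d (snd p) (snd q)"
 let ?Y = "%p q. S (d (snd p) (snd q)) *.H S (c (fst p) (fst q))"
 have "S (?X (i, j) (k, l)) = ?Y (i, j) (k, l)"
 proof (rule H.matrix_left_right_inverse[where I = "I \<times> J" and L = "%p q. S (?X p q)" and X = ?X and Y = ?Y])
  fix p r assume pr: "p : I \<times> J" "r : I \<times> J"
  show "(\<Sum>.H q:I \<times> J. S (?X p q) *.H ?X q r) = (if p = r then \<one>.H else \<zero>.H)"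
   by (rule comat_antipode(1)[OF comat_Times[OF c d] pr])
  obtain a b a' b' where [simp]: "p = (a, b)" "r = (a', b')" and ab: "a : I" "b : J" "a' : I" "b' : J"
   using pr by auto
  have "(\<Sum>.H q:I \<times> J. ?X p q *.H ?Y q r) =
   (\<Sum>.H q:I. \<Sum>.H s:J. (c a q *.H d b s) *.H (S (d s b') *.H S (c q a')))"
   using ab cc dd finI finJ
   by (simp, intro H.finsum_Times[where f = "%q s. (c a q *.H d b s) *.H (S (d s b') *.H S (c q a'))"]) auto
  also have "... = (\<Sum>.H q:I. if b = b' then c a q *.H S (c q a') else \<zero>.H)"
  proof (rule H.finsum_eqI)
   fix q assume q: "q : I"
   have "(\<Sum>.H s:J. (c a q *.H d b s) *.H (S (d s b') *.H S (c q a'))) =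
    (\<Sum>.H s:J. c a q *.H ((d b s *.H S (d s b')) *.H S (c q a')))"
    using q ab cc dd by (intro H.finsum_eqI) (auto simp: H.m_assoc)
   also have "... = c a q *.H ((\<Sum>.H s:J. d b s *.H S (d s b')) *.H S (c q a'))"
    using q ab cc dd by (subst H.finsum_mult_right) (auto simp: H.finsum_mult_left)
   also have "... = (if b = b' then c a q *.H S (c q a') else \<zero>.H)"
    using q ab cc by (simp add: comat_antipode(2)[OF d])
   finally show "(\<Sum>.H s:J. (c a q *.H d b s) *.H (S (d s b') *.H S (c q a'))) =
    (if b = b' then c a q *.H S (c q a') else \<zero>.H)" .
  qed (use ab cc in auto)
  also have "... = (if p = r then \<one>.H else \<zero>.H)"
   using ab comat_antipode(2)[OF c, of a a'] by (cases "b = b'") (auto intro!: H.finsum_zero')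
  finally show "(\<Sum>.H q:I \<times> J. ?X p q *.H ?Y q r) = (if p = r then \<one>.H else \<zero>.H)" .
 qed (use cc dd finI finJ ik jl in auto)
 then show ?thesis by simp
qed

text \<open>The element lies in the span of a family with \<Delta>(y_j) = \<Sum> y_i \<otimes> c_ij.
  Applying the counit to the first factor gives y_j = \<Sum> eps(y_i) c_ij, so the coefficients
  already span.\<close>

lemma comat_span:
 assumes x: "x <: H"
 obtains n :: nat and c l where "comat {..<n} c" "!!i j. [|i < n; j < n|] ==> l i j <: K"
  "x = (\<Sum>.H j:{..<n}. \<Sum>.H i:{..<n}. l i j **.H c i j)"
proof -
 interpret KK: hopf_dual_coeff K H conv eps S B cf v K "%c. c" by (rule coeff_K)
 let ?T = "%psi h. slice psi h"
 have sep: "g = h" if "g <: H" "h <: H" "!!psi. psi : D ==> psi g = psi h" for g h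
  using dual_separates that .
 have lcH: "phi (KK.lc H I k y) = (\<Sum>.K i:I. k i *.K phi (y i))"
  if "phi : D" "!!i. i : I ==> k i <: K" "!!i. i : I ==> y i <: H" for phi k y and I :: "nat set"
 proof -
  have "phi (KK.lc H I k y) = (\<Sum>.K i:I. phi (k i **.H y i))"
   unfolding KK.lc_def using that by (intro dual_finsum) (auto intro!: HM.smult_closed)
  then show ?thesis using that by (auto simp: dual_smult intro!: K.finsum_eqI)
 qed
 \<comment> \<open>The coaction of \<open>H\<close> on itself is \<Delta>; every clause is an
   equality in \<open>H\<close> and can be tested on functionals.\<close>
 have com: "KK.comod H ?T"
  unfolding KK.comod_def
 proof (intro conjI ballI mod_H slice_closed, assumption+)
  fix psi h g assume *: "psi : D" "h <: H" "g <: H"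
  show "slice psi (h +.H g) = slice psi h +.H slice psi g"
   using * by (intro sep) (auto simp: slice_closed slice_eval dual_add conv)
 next
  fix psi c h assume *: "psi : D" "c <: K" "h <: H"
  show "slice psi (c **.H h) = c **.H slice psi h"
   using * by (intro sep) (auto simp: slice_closed slice_eval dual_smult conv HM.smult_closed)
 next
  fix h assume h: "h <: H"
  obtain n x y where xy: "ALL i<n::nat. x i <: H & y i <: H"
   and c: "ALL phi:D. ALL psi:D. conv phi psi h = (\<Sum>.K i:{..<n}. phi (x i) *.K psi (y i))"
   using antipode_ex[OF h] by (elim exE conjE) (rule that)
  have "slice psi h = KK.lc H {..<n} (%i. psi (y i)) x" if psi: "psi : D" for psi
  proof (rule sep)
   show "slice psi h <: H" using psi h by (rule slice_closed)
   show "KK.lc H {..<n} (%i. psi (y i)) x <: H" using xy psi by (intro KK.lc_closed mod_H) auto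
   fix phi assume phi: "phi : D"
   have "phi (slice psi h) = (\<Sum>.K i:{..<n}. phi (x i) *.K psi (y i))" using c phi psi h by (simp add: slice_eval)
   also have "... = phi (KK.lc H {..<n} (%i. psi (y i)) x)"
   proof -
    have "phi (KK.lc H {..<n} (%i. psi (y i)) x) = (\<Sum>.K i:{..<n}. psi (y i) *.K phi (x i))"
     using phi psi xy by (intro lcH) auto
    also have "... = (\<Sum>.K i:{..<n}. phi (x i) *.K psi (y i))"
     using phi psi xy by (intro K.finsum_eqI K.m_comm) auto
    finally show ?thesis ..
   qed
   finally show "phi (slice psi h) = phi (KK.lc H {..<n} (%i. psi (y i)) x)" .
  qed
  then have "KK.rep H ?T {..<n} x y h" using xy by (auto simp: KK.rep_def)
  then show "EX n x y. KK.rep H ?T {..<n::nat} x y h" by (intro exI)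
 next
  fix phi psi h assume *: "phi : D" "psi : D" "h <: H"
  show "slice phi (slice psi h) = slice (conv phi psi) h"
   using * by (intro sep) (auto simp: slice_closed slice_eval conv conv_assoc)
 next
  fix h assume "h <: H"
  then show "slice eps h = h" by (intro sep) (auto simp: slice_closed slice_eval eps conv_eps_right)
 qed
 obtain n c y where c: "comat {..<n::nat} c" and f: "KK.fam H ?T {..<n} c y" and y: "!!i. i < n ==> y i <: H"
  and sp: "!!z. z : {x} ==> EX k. (ALL i<n. k i <: K) & z = KK.lc H {..<n} k y"
  by (rule KK.comatrix_family[OF com HM.submodule_carrier, of "{x}"]) (use x slice_closed in auto)
 obtain k where k: "ALL i<n. k i <: K" "x = KK.lc H {..<n} k y" using sp[of x] by auto
 have cc: "!!i j. [|i < n; j < n|] ==> c i j <: H" using c by (auto simp: comat_def)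
 let ?x = "\<Sum>.H j:{..<n}. \<Sum>.H i:{..<n}. (k j *.K eps (y i)) **.H c i j"
 have cl: "(k j *.K eps (y i)) **.H c i j <: H" if "i < n" "j < n" for i j
  using that k cc y eps by (intro HM.smult_closed) auto
 have "x = ?x"
 proof (rule sep[OF x])
  show "?x <: H" using cl by (intro H.finsum_in) auto
  fix psi assume psi: "psi : D"
  have "psi x = eps (slice psi x)" using conv_eps_left[OF psi x] slice_eval[OF psi x eps] by simp
  also have "slice psi x = KK.lc H {..<n} k (%j. slice psi (y j))"
   unfolding k(2) using k y by (intro KK.T_lc[OF com psi]) auto
  also have "eps ... = (\<Sum>.K j:{..<n}. k j *.K eps (slice psi (y j)))"
   using k y psi by (intro lcH eps slice_closed) auto
  also have "... = (\<Sum>.K j:{..<n}. \<Sum>.K i:{..<n}. psi ((k j *.K eps (y i)) **.H c i j))"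
  proof (rule K.finsum_eqI)
   fix j assume "j : {..<n}"
   then have j: "j < n" by simp
   have "slice psi (y j) = KK.lc H {..<n} (%i. psi (c i j)) y" using f psi j by (simp add: KK.fam_def)
   then have "eps (slice psi (y j)) = (\<Sum>.K i:{..<n}. psi (c i j) *.K eps (y i))"
    using lcH[OF eps, of "{..<n}" "%i. psi (c i j)" y] cc j psi y by auto
   then have "k j *.K eps (slice psi (y j)) = (\<Sum>.K i:{..<n}. k j *.K (psi (c i j) *.K eps (y i)))"
    using k j cc psi y eps by (simp, intro K.finsum_mult_left) auto
   also have "... = (\<Sum>.K i:{..<n}. psi ((k j *.K eps (y i)) **.H c i j))"
    using k j cc psi y eps by (intro K.finsum_eqI) (auto simp: dual_smult K.m_ac)
   finally show "k j *.K eps (slice psi (y j)) = (\<Sum>.K i:{..<n}. psi ((k j *.K eps (y i)) **.H c i j))" .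
   show "(\<Sum>.K i:{..<n}. psi ((k j *.K eps (y i)) **.H c i j)) <: K"
    using cl j psi by (intro K.finsum_in) auto
  qed
  also have "... = (\<Sum>.K j:{..<n}. psi (\<Sum>.H i:{..<n}. (k j *.K eps (y i)) **.H c i j))"
   using cl psi by (intro K.finsum_eqI dual_finsum[symmetric]) (auto intro!: dual_closed H.finsum_in)
  also have "... = psi ?x"
   using cl psi by (intro dual_finsum[symmetric]) (auto intro!: H.finsum_in)
  finally show "psi x = psi ?x" .
 qed
 then show ?thesis
  using k y eps by (intro that[OF c, of "%i j. k j *.K eps (y i)"]) auto
qed

lemma comat_span_induct:
 assumes "x <: H" and P: "submodule P K H" and "!!n c i j. [|comat {..<n::nat} c; i < n; j < n|] ==> c i j : P"
 shows "x : P"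
proof -
 obtain n c l where c: "comat {..<n::nat} c" "!!i j. [|i < n; j < n|] ==> l i j <: K"
  "x = (\<Sum>.H j:{..<n}. \<Sum>.H i:{..<n}. l i j **.H c i j)"
  by (rule comat_span[OF assms(1)]) (rule that, assumption+)
 show ?thesis
  unfolding c(3) using c(1,2) assms(3) HM.submoduleD(5)[OF P]
  by (intro HM.submodule_finsum[OF P]) auto
qed

text \<open>For fixed \<open>y\<close> the elements \<open>x\<close> satisfying the identity form a
  subspace, and likewise with the roles exchanged; entries of multiplicative matrices span
  \<open>H\<close>, and for them it is \<open>S_comat_mult\<close>.\<close>

lemma S_mult:
 assumes x: "x <: H" and y: "y <: H"
 shows "S (x *.H y) = S y *.H S x"
proof -
 have sub1: "submodule {x : carrier H. S (x *.H y) = S y *.H S x} K H" if y: "y <: H" for y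
  using y by (intro HM.submoduleI')
   (auto simp: H.l_distr H.r_distr mod_hom_add[OF S] mod_hom_smult[OF S] mult_left mult_right HM.smult_closed
    mod_hom_zero[OF S mod_H mod_H])
 have sub2: "submodule {y : carrier H. S (x *.H y) = S y *.H S x} K H" if x: "x <: H" for x
  using x by (intro HM.submoduleI')
   (auto simp: H.l_distr H.r_distr mod_hom_add[OF S] mod_hom_smult[OF S] mult_left mult_right HM.smult_closed
    mod_hom_zero[OF S mod_H mod_H])
 have 1: "S (c i j *.H y) = S y *.H S (c i j)" if "comat {..<n::nat} c" "i < n" "j < n" "y <: H" for n c i j y
 proof -
  have cc: "c i j <: H" using that by (auto simp: comat_def)
  have "y : {y : carrier H. S (c i j *.H y) = S y *.H S (c i j)}"
  proof (rule comat_span_induct[OF that(4) sub2[OF cc]])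
   fix m d k l assume d: "comat {..<m::nat} d" "k < m" "l < m"
   then have "d k l <: H" by (auto simp: comat_def)
   then show "d k l : {y : carrier H. S (c i j *.H y) = S y *.H S (c i j)}"
    using S_comat_mult[OF that(1) d(1)] that d by simp
  qed
  then show ?thesis by simp
 qed
 have "x : {x : carrier H. S (x *.H y) = S y *.H S x}"
  by (rule comat_span_induct[OF x sub1[OF y]]) (use 1 y in \<open>auto simp: comat_def\<close>)
 then show ?thesis by simp
qed

end

section \<open>Hopf modules\<close>

context hopf_dual_coeff
begin

text \<open>The compatibility \<rho>(m a) = \<rho>(m) \<rho>(a) after applying (id \<otimes> psi).
  The operators \<open>TZ\<close> describe the coaction on the algebra; one representation of the
  coacted \<open>a\<close> is enough, because \<open>hm_rep\<close> passes to any other.\<close>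

definition hopfm :: "(('b => 'a) => 'z => 'z) => ('z, 'm, 'mc) module_scheme => (('b => 'a) => 'm => 'm) => bool" where
 "hopfm TZ M T \<longleftrightarrow> comod M T & (ALL psi:D. ALL x:carrier M. ALL a:carrier Z. EX (n::nat) z g.
  rep (right_regular Z) TZ {..<n} z g a &
  T psi (a **.M x) = (\<Sum>.M j:{..<n}. z j **.M T (%h. psi (h *.H g j)) x))"

lemma T_sum_scaled:
 assumes "comod M T" "x <: M" "finite I" "!!i. i : I ==> c i <: K" "!!i. i : I ==> psi i : D" "\<theta> : D"
  "!!h. h <: H ==> \<theta> h = (\<Sum>.K i:I. c i *.K psi i h)"
 shows "T \<theta> x = lc M I c (%i. T (psi i) x)"
proof -
 have "T \<theta> x = T (%h. \<Sum>.K i:I. c i *.K psi i h) x"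
  by (rule T_cong[OF assms(1,2,6) dual_lincomb]) (use assms in auto)
 also have "... = lc M I c (%i. T (psi i) x)"
  using assms by (intro T_lincomb) auto
 finally show ?thesis .
qed

lemma T_sum:
 assumes M: "comod M T" and "x <: M" "finite I" "!!i. i : I ==> psi i : D" "\<theta> : D"
  "!!h. h <: H ==> \<theta> h = (\<Sum>.K i:I. psi i h)"
 shows "T \<theta> x = (\<Sum>.M i:I. T (psi i) x)"
proof -
 interpret M: right_module Z M by (rule comodD(1)[OF M])
 have "T \<theta> x = lc M I (%_. \<one>.K) (%i. T (psi i) x)"
  using assms by (intro T_sum_scaled[OF M]) (auto intro!: K.finsum_eqI)
 also have "... = (\<Sum>.M i:I. T (psi i) x)"
  unfolding lc_def using assms comodD(2)[OF M] by (intro M.M.finsum_eqI) (auto simp: M.smult_one)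
 finally show ?thesis .
qed

lemma T_finsum:
 assumes "comod M T" "psi : D" "!!i. i : I ==> x i <: M"
 shows "T psi (finsum M x I) = (\<Sum>.M i:I. T psi (x i))"
proof -
 interpret M: right_module Z M by (rule comodD(1)[OF assms(1)])
 show ?thesis
  using comodD[OF assms(1)] assms(2,3)
  by (intro finsum_additive) (auto intro: M.M.abelian_monoid_axioms M.abelian_group_M)
qed

lemma rep_to_nat:
 assumes "right_module Z M" "rep M T I y h x"
 shows "EX (n::nat) y h. rep M T {..<n} y h x"
proof -
 obtain e where "bij_betw e {0..<card I} I" using ex_bij_betw_nat_finite[of I] assms(2) by (auto simp: rep_def)
 then have e: "bij_betw e {..<card I} I" by (simp add: atLeast0LessThan)
 then have eI: "e i : I" if "i < card I" for i using that by (auto simp: bij_betw_def)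
 have "rep M T {..<card I} (%i. y (e i)) (%i. h (e i)) x"
  unfolding rep_def
 proof (intro conjI ballI)
  fix psi assume "psi : D"
  then have "T psi x = lc M I (%i. psi (h i)) y" using assms(2) by (simp add: rep_def)
  also have "... = lc M {..<card I} (%i. psi (h (e i))) (%i. y (e i))"
   using assms(2) \<open>psi : D\<close> by (intro lc_reindex[OF assms(1) e]) (auto simp: rep_def)
  finally show "T psi x = lc M {..<card I} (%i. psi (h (e i))) (%i. y (e i))" .
 qed (use assms(2) eI in \<open>auto simp: rep_def\<close>)
 then show ?thesis by (intro exI)
qed

lemma lc_submodule:
 assumes "right_module Z M" "submodule P Z M" "!!i. i : I ==> k i <: K" "!!i. i : I ==> x i : P"
 shows "lc (M(|carrier := P|)) I k x = lc M I k x" "lc M I k x : P"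
proof -
 interpret M: right_module Z M by fact
 show "lc (M(|carrier := P|)) I k x = lc M I k x"
  unfolding lc_def using M.finsum_submodule[OF assms(2), of I "%i. ks (k i) **.M x i"]
   M.submoduleD(5)[OF assms(2)] assms(3,4) by auto
 show "lc M I k x : P"
  unfolding lc_def using M.submoduleD(5)[OF assms(2)] assms(3,4) by (intro M.submodule_finsum[OF assms(2)]) auto
qed

end

text \<open>Multiplicativity of the coaction of \<open>A\<close> is expressed by
  \<open>hopf_A\<close>: \<open>A\<close> is a Hopf module over itself. In \<open>simple_A\<close>
  the subcomodule condition is stability under the operators \<open>TA psi\<close>.\<close>

locale hopf_comod_alg = hopf_dual_coeff K H conv eps S B cf v A ks
 for K :: "'k ring" and H :: "('k, 'h) module" and conv eps S B cf v
  and A :: "('a, 'ac) ring_scheme" and ks :: "'k => 'a" +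
 fixes TA :: "('h => 'k) => 'a => 'a"
 assumes hopf_A: "hopfm TA (right_regular A) TA"
  and simple_A: "[|submodule J A (left_regular A); !!psi a. [|psi : D; a : J|] ==> TA psi a : J; J ~= {\<zero>.A}|] ==> J = carrier A"
  and nontrivial_A: "carrier A ~= {\<zero>.A}"
begin

abbreviation "RR \<equiv> right_regular A"
abbreviation "hm M T \<equiv> hopfm TA M T"

lemma comod_A: "comod RR TA" using hopf_A by (simp add: hopfm_def)

lemma rm_RR: "right_module A RR" by (rule Z.right_module_right_regular)

lemma TA_closed [simp]: "[|psi : D; a <: A|] ==> TA psi a <: A"
 using comodD(2)[OF comod_A] by simp

lemma TA_add: "[|psi : D; a <: A; b <: A|] ==> TA psi (a +.A b) = TA psi a +.A TA psi b"
 using comodD(3)[OF comod_A] by simp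

lemma TA_ks: "[|psi : D; a <: A; c <: K|] ==> TA psi (a *.A ks c) = TA psi a *.A ks c"
 using comodD(4)[OF comod_A] by simp

lemma lc_RR: "lc RR I k z = (\<Sum>.A i:I. z i *.A ks (k i))"
 by (simp add: lc_def)

lemma hm_comod: "hm M T ==> comod M T" by (simp add: hopfm_def)

text \<open>The definition supplies the formula for one representation of \<open>a\<close>. The
  summand is balanced in \<open>z\<close> and \<open>g\<close>, so by \<open>rep_eval\<close> its
  sum is the same for all representations.\<close>

lemma hm_rep:
 assumes M: "hm M T" and psi: "psi : D" and x: "x <: M" and a: "a <: A" and J: "rep RR TA J z g a"
 shows "T psi (a **.M x) = (\<Sum>.M j:J. z j **.M T (%h. psi (h *.H g j)) x)"
proof -
 note com = hm_comod[OF M]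
 interpret M: right_module A M by (rule comodD(1)[OF com])
 obtain n z' g' where r: "rep RR TA {..<n::nat} z' g' a"
  and T: "T psi (a **.M x) = (\<Sum>.M j:{..<n}. z' j **.M T (%h. psi (h *.H g' j)) x)"
  using M psi x a unfolding hopfm_def by blast
 have d: "(%h. psi (h *.H g)) : D" if "g <: H" for g using dual_right[OF psi that] .
 have Tc: "T (%h. psi (h *.H g)) x <: M" if "g <: H" for g
  using comodD(2)[OF com d[OF that] x] .
 have kb: "kbal RR M (%z g. z **.M T (%h. psi (h *.H g)) x)"
  unfolding kbal_def
 proof (intro conjI ballI)
  fix w g assume *: "w <: RR" "g <: H"
  then show "w **.M T (%h. psi (h *.H g)) x <: M" using Tc by (auto intro: M.smult_closed)
  {
   fix w' assume "w' <: RR"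
   then show "(w +.RR w') **.M T (%h. psi (h *.H g)) x = w **.M T (%h. psi (h *.H g)) x +.M w' **.M T (%h. psi (h *.H g)) x"
    using * Tc by (auto simp: M.smult_l_distr)
  next
   fix g' assume g': "g' <: H"
   have "T (%h. psi (h *.H (g +.H g'))) x = T (%h. psi (h *.H g)) x +.M T (%h. psi (h *.H g')) x"
    using * g' psi by (intro T_add_functional[OF com x] d) (auto simp: H.r_distr dual_add)
   then show "w **.M T (%h. psi (h *.H (g +.H g'))) x = w **.M T (%h. psi (h *.H g)) x +.M w **.M T (%h. psi (h *.H g')) x"
    using * g' Tc by (auto simp: M.smult_r_distr)
  }
 next
  fix c w g assume *: "c <: K" "w <: RR" "g <: H"
  have "T (%h. psi (h *.H (c **.H g))) x = ks c **.M T (%h. psi (h *.H g)) x"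
   using * psi by (intro T_scale_functional[OF com x] d HM.smult_closed) (auto simp: mult_right dual_smult)
  then have "w **.M T (%h. psi (h *.H (c **.H g))) x = (ks c *.A w) **.M T (%h. psi (h *.H g)) x"
   using * Tc by (simp add: M.smult_assoc)
  then show "(ks c **.RR w) **.M T (%h. psi (h *.H g)) x = w **.M T (%h. psi (h *.H (c **.H g))) x"
   using * ks_central[of c w] by simp
 qed
 show ?thesis
  unfolding T by (rule rep_eval[OF M.abelian_group_M comod_A kb r J])
qed

lemma T_smult_double:
 assumes M: "hm M T" and psi: "psi : D" and x: "x <: M" and a: "a <: A"
  and J: "rep RR TA J z g a" and I: "rep M T I y h x"
 shows "T psi (a **.M x) = (\<Sum>.M i:I. \<Sum>.M j:J. ks (psi (h i *.H g j)) **.M (z j **.M y i))"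
proof -
 note com = hm_comod[OF M]
 interpret M: right_module A M by (rule comodD(1)[OF com])
 have zg: "!!j. j : J ==> z j <: A" "!!j. j : J ==> g j <: H" "finite J"
  and yh: "!!i. i : I ==> y i <: M" "!!i. i : I ==> h i <: H" "finite I"
  using I J by (auto simp: rep_def)
 have cl: "ks (psi (h i *.H g j)) **.M (z j **.M y i) <: M" if "i : I" "j : J" for i j
  using that zg yh psi by (auto intro!: M.smult_closed)
 have "T psi (a **.M x) = (\<Sum>.M j:J. z j **.M T (%h. psi (h *.H g j)) x)"
  by (rule hm_rep[OF M psi x a J])
 also have "... = (\<Sum>.M j:J. \<Sum>.M i:I. ks (psi (h i *.H g j)) **.M (z j **.M y i))"
 proof (rule M.M.finsum_eqI)
  fix j assume j: "j : J"
  have "T (%h. psi (h *.H g j)) x = lc M I (%i. psi (h i *.H g j)) y"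
   using I dual_right[OF psi zg(2)[OF j]] by (simp add: rep_def)
  then have "z j **.M T (%h. psi (h *.H g j)) x = (\<Sum>.M i:I. z j **.M (ks (psi (h i *.H g j)) **.M y i))"
   unfolding lc_def using j zg yh psi by (simp, intro M.smult_finsum) (auto intro!: M.smult_closed)
  also have "... = (\<Sum>.M i:I. ks (psi (h i *.H g j)) **.M (z j **.M y i))"
   using j zg yh psi cl by (intro M.M.finsum_eqI) (auto simp: M.smult_assoc[symmetric] ks_central)
  finally show "z j **.M T (%h. psi (h *.H g j)) x = (\<Sum>.M i:I. ks (psi (h i *.H g j)) **.M (z j **.M y i))" .
  show "(\<Sum>.M i:I. ks (psi (h i *.H g j)) **.M (z j **.M y i)) <: M"
   using j cl by (intro M.M.finsum_in) auto
 qed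
 also have "... = (\<Sum>.M i:I. \<Sum>.M j:J. ks (psi (h i *.H g j)) **.M (z j **.M y i))"
  using cl zg yh by (intro M.M.finsum_swap) auto
 finally show ?thesis .
qed

text \<open>The counterpart of \<open>hm_rep\<close>: the double sum over both representations is
  collected along that of \<open>x\<close>, so that the operators fall on \<open>a\<close>.\<close>

lemma T_smult_rep:
 assumes M: "hm M T" and psi: "psi : D" and x: "x <: M" and a: "a <: A" and I: "rep M T I y h x"
 shows "T psi (a **.M x) = (\<Sum>.M i:I. TA (%u. psi (h i *.H u)) a **.M y i)"
proof -
 interpret M: right_module A M by (rule comodD(1)[OF hm_comod[OF M]])
 have aR: "a <: RR" using a by simp
 obtain n z g where J: "rep RR TA {..<n::nat} z g a" by (rule comod_rep[OF comod_A aR]) (rule that)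
 have zg: "!!j. j < n ==> z j <: A" "!!j. j < n ==> g j <: H"
  and yh: "!!i. i : I ==> y i <: M" "!!i. i : I ==> h i <: H" "finite I"
  using I J by (auto simp: rep_def)
 show ?thesis
  unfolding T_smult_double[OF M psi x a J I]
 proof (rule M.M.finsum_eqI)
  fix i assume i: "i : I"
  have d: "(%u. psi (h i *.H u)) : D" by (rule dual_left[OF psi yh(2)[OF i]])
  have "TA (%u. psi (h i *.H u)) a = (\<Sum>.A j:{..<n}. z j *.A ks (psi (h i *.H g j)))"
   using J d by (simp add: rep_def lc_RR)
  then have "TA (%u. psi (h i *.H u)) a **.M y i = (\<Sum>.M j:{..<n}. (z j *.A ks (psi (h i *.H g j))) **.M y i)"
   using i zg yh psi by (simp, intro M.finsum_smult) auto
  also have "... = (\<Sum>.M j:{..<n}. ks (psi (h i *.H g j)) **.M (z j **.M y i))"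
   using i zg yh psi by (intro M.M.finsum_eqI) (auto simp: M.smult_assoc intro!: M.smult_closed)
  finally show "(\<Sum>.M j:{..<n}. ks (psi (h i *.H g j)) **.M (z j **.M y i)) = TA (%u. psi (h i *.H u)) a **.M y i" ..
  show "TA (%u. psi (h i *.H u)) a **.M y i <: M"
   using d a yh i by (intro M.smult_closed) auto
 qed
qed

lemma rep_smult:
 assumes M: "hm M T" and x: "x <: M" and a: "a <: A"
  and J: "rep RR TA J z g a" and I: "rep M T I y h x"
 shows "rep M T (I \<times> J) (%p. z (snd p) **.M y (fst p)) (%p. h (fst p) *.H g (snd p)) (a **.M x)"
proof -
 interpret M: right_module A M by (rule comodD(1)[OF hm_comod[OF M]])
 have zg: "!!j. j : J ==> z j <: A" "!!j. j : J ==> g j <: H" "finite J"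
  and yh: "!!i. i : I ==> y i <: M" "!!i. i : I ==> h i <: H" "finite I"
  using I J by (auto simp: rep_def)
 have "T psi (a **.M x) = lc M (I \<times> J) (%p. psi (h (fst p) *.H g (snd p))) (%p. z (snd p) **.M y (fst p))" if psi: "psi : D" for psi
  unfolding T_smult_double[OF M psi x a J I] lc_def using zg yh psi
  by (intro M.M.finsum_Times[where f = "%i j. ks (psi (h i *.H g j)) **.M (z j **.M y i)", symmetric])
   (auto intro!: M.smult_closed)
 then show ?thesis using zg yh unfolding rep_def by (auto intro!: M.smult_closed)
qed

text \<open>The point is a representation with first factors in \<open>P\<close>. The canonical one
  has first factors \<open>T (cf b) x\<close>, and stability places them in
  \<open>P\<close>.\<close>

lemma hm_submodule:
 assumes M: "hm M T" and P: "submodule P A M" and stable: "!!psi x. [|psi : D; x : P|] ==> T psi x : P"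
 shows "hm (M(|carrier := P|)) T"
proof -
 note com = hm_comod[OF M]
 note rm = comodD(1)[OF com]
 interpret M: right_module A M by (rule rm)
 note PD = M.submoduleD[OF P]
 let ?P = "M(|carrier := P|)"
 have rmP: "right_module A ?P" by (rule M.right_module_submodule[OF P])
 have rp: "EX (n::nat) y h. rep ?P T {..<n} y h x" if x: "x : P" for x
 proof -
  have xM: "x <: M" using PD(2)[OF x] .
  let ?B = "{b : B. T (cf b) x ~= \<zero>.M}"
  have r: "rep M T ?B (%b. T (cf b) x) v x"
   by (rule rep_canonical[OF com xM supp_finite[OF com xM]]) auto
  have e: "lc ?P ?B (%b. psi (v b)) (%b. T (cf b) x) = lc M ?B (%b. psi (v b)) (%b. T (cf b) x)" if "psi : D" for psi
   using that stable x cf v by (intro lc_submodule(1)[OF rm P]) auto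
  have "rep ?P T ?B (%b. T (cf b) x) v x"
   unfolding rep_def
  proof (intro conjI ballI)
   show "finite ?B" by (rule supp_finite[OF com xM])
   show "T (cf b) x <: ?P" "v b <: H" if "b : ?B" for b
    using that stable[OF cf x] v by auto
   show "T psi x = lc ?P ?B (%b. psi (v b)) (%b. T (cf b) x)" if "psi : D" for psi
    unfolding e[OF that] using r that unfolding rep_def by blast
  qed
  then show ?thesis by (rule rep_to_nat[OF rmP])
 qed
 have "comod ?P T"
  unfolding comod_def using rmP comodD[OF com] PD stable rp by simp
 moreover have "EX (n::nat) z g. rep RR TA {..<n} z g a &
   T psi (a **.?P x) = (\<Sum>.?P j:{..<n}. z j **.?P T (%h. psi (h *.H g j)) x)"
  if psi: "psi : D" and x: "x : P" and a: "a <: A" for psi x a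
 proof -
  have aR: "a <: RR" using a by simp
  obtain n z g where J: "rep RR TA {..<n::nat} z g a" by (rule comod_rep[OF comod_A aR]) (rule that)
  have "T (%h. psi (h *.H g j)) x : P" if "j < n" for j
   using J that x by (intro stable dual_right[OF psi]) (auto simp: rep_def)
  then have "z j **.M T (%h. psi (h *.H g j)) x : P" if "j < n" for j
   using J that by (intro PD(5)) (auto simp: rep_def)
  then have "(\<Sum>.?P j:{..<n}. z j **.M T (%h. psi (h *.H g j)) x) = T psi (a **.M x)"
   using hm_rep[OF M psi PD(2)[OF x] a J]
    M.finsum_submodule[OF P, of "{..<n}" "%j. z j **.M T (%h. psi (h *.H g j)) x"] by simp
  then show ?thesis using J by (intro exI[of _ n] exI[of _ z] exI[of _ g]) simp
 qed
 ultimately show ?thesis unfolding hopfm_def by simp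
qed

text \<open>The coaction on \<open>A\<^sup>n = k\<^sup>n \<otimes> A\<close>, where \<open>k\<^sup>n\<close> is the comodule with coefficient matrix \<open>c\<close>.\<close>

definition TF :: "(nat => nat => 'h) => nat => ('h => 'k) => (nat => 'a) => (nat => 'a)" where
 "TF c n psi x = (\<lambda>i\<in>{..<n}. \<Sum>.A j:{..<n}. TA (%u. psi (c i j *.H u)) (x j))"

abbreviation "FR n \<equiv> free_right_module A {..<n::nat}"

lemma rm_FR: "right_module A (FR n)" by (rule Z.right_module_free)

lemma FR_carrierI: "(!!i. i < n ==> x i <: A) ==> (\<lambda>i\<in>{..<n}. x i) <: (FR n)"
 by (auto simp: free_right_module_simps)

section \<open>The Hopf modules \<open>A^n\<close> twisted by a multiplicative matrix\<close>

context
 fixes c and n :: nat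
 assumes c: "comat {..<n} c"
begin

lemma comat_closed: "i < n ==> j < n ==> c i j <: H"
 using c by (auto simp: comat_def)

lemma dual_c: "psi : D ==> i < n ==> j < n ==> (%u. psi (c i j *.H u)) : D"
 using comat_closed dual_left by blast

lemma TF_at: "i < n ==> TF c n psi x i = (\<Sum>.A j:{..<n}. TA (%u. psi (c i j *.H u)) (x j))"
 by (simp add: TF_def)

lemma TFt_closed: "[|psi : D; x <: (FR n); i < n; j < n|] ==> TA (%u. psi (c i j *.H u)) (x j) <: A"
 using dual_c free_at[of x A "{..<n}" j] by simp

lemma TF_closed: "[|psi : D; x <: (FR n)|] ==> TF c n psi x <: (FR n)"
 unfolding TF_def using TFt_closed by (intro FR_carrierI Z.finsum_in) auto

lemma TF_add:
 assumes "psi : D" "x <: (FR n)" "y <: (FR n)"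
 shows "TF c n psi (x +.(FR n) y) = TF c n psi x +.(FR n) TF c n psi y"
proof (rule free_ext[where A = A and X = "{..<n}"])
 interpret F: right_module A "FR n" by (rule rm_FR)
 show "TF c n psi (x +.(FR n) y) <: (FR n)" "TF c n psi x +.(FR n) TF c n psi y <: (FR n)"
  using assms TF_closed by simp_all
 fix i assume "i : {..<n}"
 then have i: "i < n" by simp
 have "TF c n psi (x +.(FR n) y) i = (\<Sum>.A j:{..<n}. TA (%u. psi (c i j *.H u)) (x j) +.A TA (%u. psi (c i j *.H u)) (y j))"
  unfolding TF_at[OF i] using assms i TFt_closed dual_c free_at[of _ A "{..<n}"]
  by (intro Z.finsum_eqI) (auto simp: free_at_simps TA_add)
 also have "... = TF c n psi x i +.A TF c n psi y i"
  unfolding TF_at[OF i] using assms i TFt_closed by (intro Z.finsum_add) auto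
 finally show "TF c n psi (x +.(FR n) y) i = (TF c n psi x +.(FR n) TF c n psi y) i"
  using i by (simp add: free_at_simps)
qed

lemma TF_ks:
 assumes "psi : D" "x <: (FR n)" "k <: K"
 shows "TF c n psi (ks k **.(FR n) x) = ks k **.(FR n) TF c n psi x"
proof (rule free_ext[where A = A and X = "{..<n}"])
 interpret F: right_module A "FR n" by (rule rm_FR)
 show "TF c n psi (ks k **.(FR n) x) <: (FR n)" "ks k **.(FR n) TF c n psi x <: (FR n)"
  using assms TF_closed F.smult_closed by simp_all
 fix i assume "i : {..<n}"
 then have i: "i < n" by simp
 have "TF c n psi (ks k **.(FR n) x) i = (\<Sum>.A j:{..<n}. TA (%u. psi (c i j *.H u)) (x j) *.A ks k)"
  unfolding TF_at[OF i] using assms i TFt_closed dual_c free_at[of _ A "{..<n}"]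
  by (intro Z.finsum_eqI) (auto simp: free_at_simps TA_ks)
 also have "... = TF c n psi x i *.A ks k"
  unfolding TF_at[OF i] using assms i TFt_closed by (intro Z.finsum_mult_right[symmetric]) auto
 finally show "TF c n psi (ks k **.(FR n) x) i = (ks k **.(FR n) TF c n psi x) i"
  using i by (simp add: free_at_simps)
qed

text \<open>The representation sought is again the canonical \<Sum> TF (cf b) x \<otimes> v b.
  Component \<open>i\<close> of the coaction has \<open>H\<close>-parts c_ij v_b' with v_b' from the
  coactions of the x_j, so the finite set \<open>B0\<close> collects the coordinates of all these
  products.\<close>

lemma TF_rep:
 assumes x: "x <: (FR n)"
 shows "EX (m::nat) y h. rep (FR n) (TF c n) {..<m} y h x"
proof -
 interpret F: right_module A "FR n" by (rule rm_FR)
 have xj: "x j <: RR" if "j < n" for j using free_at[OF x] that by simp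
 define B1 where "B1 = (\<Union>j<n. {b : B. TA (cf b) (x j) ~= \<zero>.RR})"
 have B1: "finite B1" "B1 \<subseteq> B" unfolding B1_def using supp_finite[OF comod_A xj] by auto
 have r: "rep RR TA B1 (%b. TA (cf b) (x j)) v (x j)" if "j < n" for j
  using that by (intro rep_canonical[OF comod_A xj B1]) (auto simp: B1_def)
 have vH: "v b <: H" if "b : B" for b using v that .
 define B0 where "B0 = (\<Union>i<n. \<Union>j<n. \<Union>b'\<in>B1. {b : B. cf b (c i j *.H v b') ~= \<zero>.K})"
 have B0: "finite B0" "B0 \<subseteq> B"
  unfolding B0_def using B1 cf_finite comat_closed vH by auto
 have cfD: "cf b : D" "v b <: H" if "b : B0" for b using B0 that cf v by auto
 \<comment> \<open>Only on the elements u = v_b' occurring for \<open>x j\<close> is the functional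
   u \<mapsto> psi(c_ij u) known to be the combination ?\<theta> over \<open>B0\<close>; both
   functionals therefore act equally on \<open>x j\<close>.\<close>
 have key: "TA (%u. psi (c i j *.H u)) (x j) = (\<Sum>.A b:B0. TA (%u. cf b (c i j *.H u)) (x j) *.A ks (psi (v b)))"
  if psi: "psi : D" and ij: "i < n" "j < n" for psi i j
 proof -
  let ?\<theta> = "%u. \<Sum>.K b:B0. psi (v b) *.K cf b (c i j *.H u)"
  have d: "(%u. cf b (c i j *.H u)) : D" if "b : B0" for b using dual_c[OF cfD(1)[OF that] ij] .
  have \<theta>: "?\<theta> : D" using d cfD psi by (intro dual_lincomb) auto
  have "TA ?\<theta> (x j) = lc RR B0 (%b. psi (v b)) (%b. TA (%u. cf b (c i j *.H u)) (x j))"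
   using d cfD psi B0 by (intro T_lincomb[OF comod_A xj[OF ij(2)]]) auto
  moreover have "TA ?\<theta> (x j) = TA (%u. psi (c i j *.H u)) (x j)"
  proof -
   have "TA ?\<theta> (x j) = lc RR B1 (%b'. ?\<theta> (v b')) (%b. TA (cf b) (x j))"
    using r[OF ij(2)] \<theta> by (simp add: rep_def)
   also have "... = lc RR B1 (%b'. psi (c i j *.H v b')) (%b. TA (cf b) (x j))"
   proof (rule lc_cong[OF rm_RR])
    fix b' assume b': "b' : B1"
    then have hb: "c i j *.H v b' <: H" using ij comat_closed vH B1 by auto
    have "psi (c i j *.H v b') = (\<Sum>.K b:B0. cf b (c i j *.H v b') *.K psi (v b))"
     using b' ij by (intro dual_basis_superset[OF psi hb B0]) (auto simp: B0_def)
    also have "... = ?\<theta> (v b')"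
     using cfD psi hb by (intro K.finsum_eqI K.m_comm K.m_closed) auto
    finally show "?\<theta> (v b') = psi (c i j *.H v b')" ..
    show "psi (c i j *.H v b') <: K" using hb psi by auto
    show "TA (cf b') (x j) <: RR" using b' B1 cf xj[OF ij(2)] by auto
   qed simp
   also have "... = TA (%u. psi (c i j *.H u)) (x j)"
    using r[OF ij(2)] dual_c[OF psi ij] by (simp add: rep_def)
   finally show ?thesis .
  qed
  ultimately show ?thesis by (simp add: lc_RR)
 qed
 have "rep (FR n) (TF c n) B0 (%b. TF c n (cf b) x) v x"
  unfolding rep_def
 proof (intro conjI ballI B0)
  show "TF c n (cf b) x <: (FR n)" "v b <: H" if "b : B0" for b
   using cfD[OF that] TF_closed[OF _ x] by auto
  fix psi assume psi: "psi : D"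
  have cl: "ks (psi (v b)) **.(FR n) TF c n (cf b) x <: (FR n)" if "b : B0" for b
   using cfD[OF that] psi TF_closed[OF _ x] by (intro F.smult_closed) auto
  show "TF c n psi x = lc (FR n) B0 (%b. psi (v b)) (%b. TF c n (cf b) x)"
  proof (rule free_ext[where A = A and X = "{..<n}"])
   show "TF c n psi x <: (FR n)" by (rule TF_closed[OF psi x])
   show "lc (FR n) B0 (%b. psi (v b)) (%b. TF c n (cf b) x) <: (FR n)"
    unfolding lc_def by (rule F.M.finsum_in) (rule cl)
   fix i assume "i : {..<n}"
   then have i: "i < n" by simp
   have tc: "TA (%u. cf b (c i j *.H u)) (x j) <: A" if "b : B0" "j < n" for b j
    using TFt_closed[OF cfD(1)[OF that(1)] x i that(2)] .
   have "lc (FR n) B0 (%b. psi (v b)) (%b. TF c n (cf b) x) i = (\<Sum>.A b:B0. (ks (psi (v b)) **.(FR n) TF c n (cf b) x) i)"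
    unfolding lc_def using i cl by (intro Z.free_finsum_at) auto
   also have "... = (\<Sum>.A b:B0. \<Sum>.A j:{..<n}. TA (%u. cf b (c i j *.H u)) (x j) *.A ks (psi (v b)))"
   proof (rule Z.finsum_eqI)
    fix b assume b: "b : B0"
    have k: "ks (psi (v b)) <: A" using psi cfD[OF b] by auto
    have "(\<Sum>.A j:{..<n}. TA (%u. cf b (c i j *.H u)) (x j)) *.A ks (psi (v b)) =
     (\<Sum>.A j:{..<n}. TA (%u. cf b (c i j *.H u)) (x j) *.A ks (psi (v b)))"
     using tc[OF b] k by (intro Z.finsum_mult_right) auto
    then show "(ks (psi (v b)) **.(FR n) TF c n (cf b) x) i =
     (\<Sum>.A j:{..<n}. TA (%u. cf b (c i j *.H u)) (x j) *.A ks (psi (v b)))"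
     using i by (simp add: free_at_simps TF_at)
    show "(\<Sum>.A j:{..<n}. TA (%u. cf b (c i j *.H u)) (x j) *.A ks (psi (v b))) <: A"
     using tc[OF b] k by (intro Z.finsum_in) auto
   qed
   also have "... = (\<Sum>.A j:{..<n}. \<Sum>.A b:B0. TA (%u. cf b (c i j *.H u)) (x j) *.A ks (psi (v b)))"
    using B0 tc psi cfD by (intro Z.finsum_swap) auto
   also have "... = TF c n psi x i"
    unfolding TF_at[OF i] using i tc psi cfD
    by (intro Z.finsum_eqI) (auto simp: key[OF psi i] intro!: Z.finsum_in)
   finally show "TF c n psi x i = lc (FR n) B0 (%b. psi (v b)) (%b. TF c n (cf b) x) i" ..
  qed
 qed
 then show ?thesis by (rule rep_to_nat[OF rm_FR])
qed

text \<open>Coassociativity on the twisted module is coassociativity on \<open>A\<close> combined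
  with \<open>conv_mult_left\<close> for the matrix \<open>c\<close>.\<close>

lemma TF_conv:
 assumes phi: "phi : D" and psi: "psi : D" and x: "x <: (FR n)"
 shows "TF c n phi (TF c n psi x) = TF c n (conv phi psi) x"
proof (rule free_ext[where A = A and X = "{..<n}"])
 show "TF c n phi (TF c n psi x) <: (FR n)" "TF c n (conv phi psi) x <: (FR n)"
  using assms conv TF_closed by auto
 fix i assume "i : {..<n}"
 then have i: "i < n" by simp
 have xk: "x k <: RR" if "k < n" for k using free_at[OF x] that by simp
 let ?t = "%j k. TA (%u. phi (c i j *.H u)) (TA (%u. psi (c j k *.H u)) (x k))"
 have t: "?t j k <: A" if "j < n" "k < n" for j k
  using dual_c[OF phi i that(1)] TFt_closed[OF psi x that] by simp
 have "TF c n phi (TF c n psi x) i = (\<Sum>.A j:{..<n}. \<Sum>.A k:{..<n}. ?t j k)"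
  unfolding TF_at[OF i]
 proof (rule Z.finsum_eqI)
  fix j assume "j : {..<n}"
  then have j: "j < n" by simp
  show "TA (%u. phi (c i j *.H u)) (TF c n psi x j) = (\<Sum>.A k:{..<n}. ?t j k)"
   unfolding TF_at[OF j] using T_finsum[OF comod_A dual_c[OF phi i j], of "{..<n}" "%k. TA (%u. psi (c j k *.H u)) (x k)"]
    TFt_closed[OF psi x j] by simp
  show "(\<Sum>.A k:{..<n}. ?t j k) <: A" using t j by (intro Z.finsum_in) auto
 qed
 also have "... = (\<Sum>.A k:{..<n}. \<Sum>.A j:{..<n}. ?t j k)"
  using t by (intro Z.finsum_swap) auto
 also have "... = (\<Sum>.A k:{..<n}. TA (%u. conv phi psi (c i k *.H u)) (x k))"
 proof (rule Z.finsum_eqI)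
  fix k assume "k : {..<n}"
  then have k: "k < n" by simp
  have "TA (%u. conv phi psi (c i k *.H u)) (x k) =
   (\<Sum>.RR j:{..<n}. TA (conv (%u. phi (c i j *.H u)) (%u. psi (c j k *.H u))) (x k))"
  proof (rule T_sum[OF comod_A xk[OF k]])
   show "conv (%u. phi (c i j *.H u)) (%u. psi (c j k *.H u)) : D" if "j : {..<n}" for j
    using that by (intro conv dual_c phi psi i k) auto
   show "(%u. conv phi psi (c i k *.H u)) : D" by (rule dual_c[OF conv[OF phi psi] i k])
   show "conv phi psi (c i k *.H h) = (\<Sum>.K j:{..<n}. conv (%u. phi (c i j *.H u)) (%u. psi (c j k *.H u)) h)"
    if "h <: H" for h using i k that by (intro conv_mult_left[OF c] phi psi) auto
  qed simp
  also have "... = (\<Sum>.A j:{..<n}. ?t j k)"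
   unfolding finsum_right_regular
  proof (rule Z.finsum_eqI)
   fix j assume "j : {..<n}"
   then have j: "j < n" by simp
   show "TA (conv (%u. phi (c i j *.H u)) (%u. psi (c j k *.H u))) (x k) = ?t j k"
    by (rule comodD(5)[OF comod_A dual_c[OF phi i j] dual_c[OF psi j k] xk[OF k], symmetric])
   show "?t j k <: A" by (rule t[OF j k])
  qed
  finally show "(\<Sum>.A j:{..<n}. ?t j k) = TA (%u. conv phi psi (c i k *.H u)) (x k)" ..
  show "TA (%u. conv phi psi (c i k *.H u)) (x k) <: A"
   by (rule TFt_closed[OF conv[OF phi psi] x i k])
 qed
 also have "... = TF c n (conv phi psi) x i" by (rule TF_at[OF i, symmetric])
 finally show "TF c n phi (TF c n psi x) i = TF c n (conv phi psi) x i" .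
qed

lemma TF_eps:
 assumes x: "x <: (FR n)"
 shows "TF c n eps x = x"
proof (rule free_ext[where A = A and X = "{..<n}", OF TF_closed[OF eps x] x])
 fix i assume "i : {..<n}"
 then have i: "i < n" by simp
 have xk: "x k <: RR" if "k < n" for k using free_at[OF x] that by simp
 have "TF c n eps x i = (\<Sum>.A j:{..<n}. if j = i then x j else \<zero>.A)"
  unfolding TF_at[OF i]
 proof (rule Z.finsum_eqI)
  fix j assume "j : {..<n}"
  then have j: "j < n" by simp
  have e: "eps (c i j) = (if i = j then \<one>.K else \<zero>.K)" using c i j by (auto simp: comat_def)
  show "TA (%u. eps (c i j *.H u)) (x j) = (if j = i then x j else \<zero>.A)"
  proof (cases "i = j")
   case True
   have "TA (%u. eps (c i j *.H u)) (x j) = TA eps (x j)"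
    using e True i j comat_closed eps by (intro T_cong[OF comod_A xk[OF j] dual_c[OF eps i j] eps]) (auto simp: eps_mult)
   then show ?thesis using True comodD(6)[OF comod_A xk[OF j]] by simp
  next
   case False
   have "TA (%u. eps (c i j *.H u)) (x j) = ks \<zero>.K **.RR TA eps (x j)"
    using e False i j comat_closed eps
    by (intro T_scale_functional[OF comod_A xk[OF j] eps dual_c[OF eps i j]]) (auto simp: eps_mult)
   then show ?thesis using False xk[OF j] eps by simp
  qed
  show "(if j = i then x j else \<zero>.A) <: A" using xk[OF j] by (cases "j = i") simp_all
 qed
 also have "... = x i" using i xk[OF i] by (intro Z.finsum_delta) auto
 finally show "TF c n eps x i = x i" .
qed

lemma hm_FR: "hm (FR n) (TF c n)"
proof -
 interpret F: right_module A "FR n" by (rule rm_FR)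
 have "comod (FR n) (TF c n)"
  unfolding comod_def using rm_FR TF_closed TF_add TF_ks TF_rep TF_conv TF_eps by simp
 moreover have "EX (m::nat) z g. rep RR TA {..<m} z g a &
   TF c n psi (a **.(FR n) x) = (\<Sum>.(FR n) j:{..<m}. z j **.(FR n) TF c n (%h. psi (h *.H g j)) x)"
  if psi: "psi : D" and x: "x <: (FR n)" and a: "a <: A" for psi x a
 proof -
  have aR: "a <: RR" using a by simp
  obtain m z g where J: "rep RR TA {..<m::nat} z g a" by (rule comod_rep[OF comod_A aR]) (rule that)
  have zg: "!!j. j < m ==> z j <: A" "!!j. j < m ==> g j <: H" using J by (auto simp: rep_def)
  have xk: "x k <: A" if "k < n" for k using free_at[OF x] that by simp
  have d: "(%h. psi (h *.H g k)) : D" if "k < m" for k by (rule dual_right[OF psi zg(2)[OF that]])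
  have cl: "z k **.(FR n) TF c n (%h. psi (h *.H g k)) x <: (FR n)" if "k < m" for k
   using TF_closed[OF d[OF that] x] zg that by (intro F.smult_closed) auto
  have "TF c n psi (a **.(FR n) x) = (\<Sum>.(FR n) k:{..<m}. z k **.(FR n) TF c n (%h. psi (h *.H g k)) x)"
  proof (rule free_ext[where A = A and X = "{..<n}"])
   show "TF c n psi (a **.(FR n) x) <: (FR n)" using TF_closed[OF psi F.smult_closed[OF a x]] .
   show "(\<Sum>.(FR n) k:{..<m}. z k **.(FR n) TF c n (%h. psi (h *.H g k)) x) <: (FR n)"
    using cl by (intro F.M.finsum_in) auto
   fix i assume "i : {..<n}"
   then have i: "i < n" by simp
   let ?t = "%j k. TA (%u. psi ((c i j *.H u) *.H g k)) (x j) *.A z k"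
   have t0: "TA (%u. psi ((c i j *.H u) *.H g k)) (x j) <: A" if "j < n" "k < m" for j k
    using TFt_closed[OF d[OF that(2)] x i that(1)] .
   have t: "?t j k <: A" if "j < n" "k < m" for j k
    using t0[OF that] zg that by simp
   have "TF c n psi (a **.(FR n) x) i = (\<Sum>.A j:{..<n}. \<Sum>.A k:{..<m}. ?t j k)"
    unfolding TF_at[OF i]
   proof (rule Z.finsum_eqI)
    fix j assume "j : {..<n}"
    then have j: "j < n" by simp
    have "TA (%u. psi (c i j *.H u)) ((a **.(FR n) x) j) = TA (%u. psi (c i j *.H u)) (a **.RR x j)"
     using j by (simp add: free_at_simps)
    also have "... = (\<Sum>.RR k:{..<m}. z k **.RR TA (%u. psi (c i j *.H (u *.H g k))) (x j))"
     using xk[OF j] by (intro hm_rep[OF hopf_A dual_c[OF psi i j] _ a J]) auto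
    also have "... = (\<Sum>.A k:{..<m}. ?t j k)"
     unfolding finsum_right_regular
    proof (rule Z.finsum_eqI)
     fix k assume "k : {..<m}"
     then have k: "k < m" by simp
     have "TA (%u. psi (c i j *.H (u *.H g k))) (x j) = TA (%u. psi ((c i j *.H u) *.H g k)) (x j)"
     proof (rule T_cong[OF comod_A])
      show "(%u. psi (c i j *.H (u *.H g k))) : D" by (rule dual_right[OF dual_c[OF psi i j] zg(2)[OF k]])
      show "(%u. psi ((c i j *.H u) *.H g k)) : D" by (rule dual_left[OF d[OF k] comat_closed[OF i j]])
     qed (use xk[OF j] zg k i j comat_closed in \<open>auto simp: H.m_assoc\<close>)
     then show "z k **.RR TA (%u. psi (c i j *.H (u *.H g k))) (x j) = ?t j k" by simp
     show "?t j k <: A" by (rule t[OF j k])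
    qed
    finally show "TA (%u. psi (c i j *.H u)) ((a **.(FR n) x) j) = (\<Sum>.A k:{..<m}. ?t j k)" .
    show "(\<Sum>.A k:{..<m}. ?t j k) <: A" using t j by (intro Z.finsum_in) auto
   qed
   also have "... = (\<Sum>.A k:{..<m}. \<Sum>.A j:{..<n}. ?t j k)" using t by (intro Z.finsum_swap) auto
   also have "... = (\<Sum>.A k:{..<m}. (z k **.(FR n) TF c n (%h. psi (h *.H g k)) x) i)"
   proof (rule Z.finsum_eqI)
    fix k assume "k : {..<m}"
    then have k: "k < m" by simp
    show "(\<Sum>.A j:{..<n}. ?t j k) = (z k **.(FR n) TF c n (%h. psi (h *.H g k)) x) i"
    proof -
     have "(\<Sum>.A j:{..<n}. ?t j k) = (\<Sum>.A j:{..<n}. TA (%u. psi ((c i j *.H u) *.H g k)) (x j)) *.A z k"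
      using t0[OF _ k] zg k by (intro Z.finsum_mult_right[symmetric]) auto
     then show ?thesis using i by (simp add: free_at_simps TF_at)
    qed
    show "(z k **.(FR n) TF c n (%h. psi (h *.H g k)) x) i <: A"
     using free_at[OF cl[OF k]] i by simp
   qed
   also have "... = (\<Sum>.(FR n) k:{..<m}. z k **.(FR n) TF c n (%h. psi (h *.H g k)) x) i"
    using i cl by (intro Z.free_finsum_at[symmetric]) auto
   finally show "TF c n psi (a **.(FR n) x) i = (\<Sum>.(FR n) k:{..<m}. z k **.(FR n) TF c n (%h. psi (h *.H g k)) x) i" .
  qed
  then show ?thesis using J by (intro exI conjI)
 qed
 ultimately show ?thesis unfolding hopfm_def by simp
qed

text \<open>The standard basis of \<open>A^n\<close> and the family \<open>y\<close> transform by
  the same matrix: \<rho>(y_j a) = \<Sum> y_i a_0 \<otimes> c_ij a_1, which is the formula behind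
  \<open>TF\<close>.\<close>

lemma fam_cover_equivariant:
 assumes M: "hm M T" and y: "fam M T {..<n} c y" and psi: "psi : D" and x: "x <: (FR n)"
 shows "free_lift A M {..<n} y (TF c n psi x) = T psi (free_lift A M {..<n} y x)"
proof -
 note com = hm_comod[OF M]
 interpret M: right_module A M by (rule comodD(1)[OF com])
 have yM: "!!i. i < n ==> y i <: M" using y by (auto simp: fam_def)
 have xk: "x k <: A" if "k < n" for k using free_at[OF x] that by simp
 have t: "TA (%u. psi (c i j *.H u)) (x j) <: A" if "i < n" "j < n" for i j
  using TFt_closed[OF psi x that] .
 have ty: "TA (%u. psi (c i j *.H u)) (x j) **.M y i <: M" if "i < n" "j < n" for i j
  using t that yM by (intro M.smult_closed) auto
 have "T psi (free_lift A M {..<n} y x) = T psi (\<Sum>.M j:{..<n}. x j **.M y j)"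
  using yM x by (subst M.free_lift_lessThan) auto
 also have "... = (\<Sum>.M j:{..<n}. T psi (x j **.M y j))"
  using xk yM by (intro T_finsum[OF com psi] M.smult_closed) auto
 also have "... = (\<Sum>.M j:{..<n}. \<Sum>.M i:{..<n}. TA (%u. psi (c i j *.H u)) (x j) **.M y i)"
 proof (rule M.M.finsum_eqI)
  fix j assume j: "j : {..<n}"
  show "T psi (x j **.M y j) = (\<Sum>.M i:{..<n}. TA (%u. psi (c i j *.H u)) (x j) **.M y i)"
   using j xk yM by (intro T_smult_rep[OF M psi _ _ fam_rep[OF y]]) auto
  show "(\<Sum>.M i:{..<n}. TA (%u. psi (c i j *.H u)) (x j) **.M y i) <: M"
   using ty j by (intro M.M.finsum_in) auto
 qed
 also have "... = (\<Sum>.M i:{..<n}. \<Sum>.M j:{..<n}. TA (%u. psi (c i j *.H u)) (x j) **.M y i)"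
  using ty by (intro M.M.finsum_swap) auto
 also have "... = (\<Sum>.M i:{..<n}. TF c n psi x i **.M y i)"
 proof (rule M.M.finsum_eqI)
  fix i assume "i : {..<n}"
  then have i: "i < n" by simp
  have "TF c n psi x i **.M y i = (\<Sum>.M j:{..<n}. TA (%u. psi (c i j *.H u)) (x j) **.M y i)"
   unfolding TF_at[OF i] using t[OF i] yM[OF i] by (intro M.finsum_smult) auto
  then show "(\<Sum>.M j:{..<n}. TA (%u. psi (c i j *.H u)) (x j) **.M y i) = TF c n psi x i **.M y i" ..
  show "TF c n psi x i **.M y i <: M"
   using yM[OF i] free_at[OF TF_closed[OF psi x], of i] i by (intro M.smult_closed) auto
 qed
 also have "... = free_lift A M {..<n} y (TF c n psi x)"
  using yM TF_closed[OF psi x] by (intro M.free_lift_lessThan[symmetric]) auto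
 finally show ?thesis ..
qed

end

end

section \<open>The coaction on the dual module\<close>

context hopf_dual
begin

lemma dual_const_zero: "(%_. \<zero>.K) : D"
 by (rule dualI) auto

lemma S_finsum: "(!!i. i : I ==> x i <: H) ==> S (finsum H x I) = (\<Sum>.H i:I. S (x i))"
 by (rule mod_hom_finsum[OF S mod_H mod_H]) auto

text \<open>The arguments of \<open>S\<close> are the \<open>H\<close>-components of the coaction on
  \<Sum> k_j y_j when \<open>y\<close> has matrix \<open>c\<close>; the right inverse matrix of
  \<open>comat_antipode\<close> reduces the sum to the coefficient \<open>k r\<close>.\<close>

lemma comat_antipode_lc:
 assumes c: "comat I c" and k: "!!j. j : I ==> k j <: K" and r: "r : I"
 shows "(\<Sum>.H i:I. c r i *.H S (\<Sum>.H j:I. k j **.H c i j)) = k r **.H \<one>.H"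
proof -
 have cc: "!!i j. [|i : I; j : I|] ==> c i j <: H" and fin: "finite I" using c by (auto simp: comat_def)
 have t: "k j **.H (c r i *.H S (c i j)) <: H" if "i : I" "j : I" for i j
  using that cc k r by (auto intro!: HM.smult_closed)
 have "(\<Sum>.H i:I. c r i *.H S (\<Sum>.H j:I. k j **.H c i j)) =
  (\<Sum>.H i:I. \<Sum>.H j:I. k j **.H (c r i *.H S (c i j)))"
 proof (rule H.finsum_eqI)
  fix i assume i: "i : I"
  have "S (\<Sum>.H j:I. k j **.H c i j) = (\<Sum>.H j:I. S (k j **.H c i j))"
   using i cc k by (intro S_finsum HM.smult_closed) auto
  also have "... = (\<Sum>.H j:I. k j **.H S (c i j))"
   using i cc k by (intro H.finsum_eqI) (auto simp: mod_hom_smult[OF S] intro!: HM.smult_closed)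
  finally have "c r i *.H S (\<Sum>.H j:I. k j **.H c i j) = (\<Sum>.H j:I. c r i *.H (k j **.H S (c i j)))"
   using i cc k r by (simp, intro H.finsum_mult_left) (auto intro!: HM.smult_closed)
  also have "... = (\<Sum>.H j:I. k j **.H (c r i *.H S (c i j)))"
   using i cc k r t by (intro H.finsum_eqI) (auto simp: mult_right)
  finally show "c r i *.H S (\<Sum>.H j:I. k j **.H c i j) = (\<Sum>.H j:I. k j **.H (c r i *.H S (c i j)))" .
  show "(\<Sum>.H j:I. k j **.H (c r i *.H S (c i j))) <: H" using t i by (intro H.finsum_in) auto
 qed
 also have "... = (\<Sum>.H j:I. \<Sum>.H i:I. k j **.H (c r i *.H S (c i j)))"
  using t fin by (intro H.finsum_swap) auto
 also have "... = (\<Sum>.H j:I. if j = r then k j **.H \<one>.H else \<zero>.H)"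
 proof (rule H.finsum_eqI)
  fix j assume j: "j : I"
  have "(\<Sum>.H i:I. k j **.H (c r i *.H S (c i j))) = k j **.H (\<Sum>.H i:I. c r i *.H S (c i j))"
   using j cc k r by (intro HM.smult_finsum[symmetric]) auto
  also have "... = (if j = r then k j **.H \<one>.H else \<zero>.H)"
   using comat_antipode(2)[OF c r j] k j by (auto simp: HM.smult_zero)
  finally show "(\<Sum>.H i:I. k j **.H (c r i *.H S (c i j))) = (if j = r then k j **.H \<one>.H else \<zero>.H)" .
  show "(if j = r then k j **.H \<one>.H else \<zero>.H) <: H" using k j by (auto intro!: HM.smult_closed)
 qed
 also have "... = k r **.H \<one>.H" using r k fin by (intro H.finsum_delta) (auto intro!: HM.smult_closed)
 finally show ?thesis .
qed

end

context hopf_dual_coeff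
begin

lemma rep_lc:
 assumes M: "comod M T" and f: "fam M T I c y" and k: "!!j. j : I ==> k j <: K"
 shows "rep M T I y (%i. \<Sum>.H j:I. k j **.H c i j) (lc M I k y)"
proof -
 note rm = comodD(1)[OF M]
 have fin: "finite I" and yM: "!!i. i : I ==> y i <: M" and cc: "!!i j. [|i : I; j : I|] ==> c i j <: H"
  and Ty: "!!psi j. [|psi : D; j : I|] ==> T psi (y j) = lc M I (%i. psi (c i j)) y"
  using f by (auto simp: fam_def)
 have "T psi (lc M I k y) = lc M I (%i. psi (\<Sum>.H j:I. k j **.H c i j)) y" if psi: "psi : D" for psi
 proof -
  have "T psi (lc M I k y) = lc M I k (%j. T psi (y j))" using k yM by (intro T_lc[OF M psi]) auto
  also have "... = lc M I k (%j. lc M I (%i. psi (c i j)) y)"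
   using k yM cc psi by (intro lc_cong[OF rm]) (auto simp: Ty intro!: lc_closed[OF rm])
  also have "... = lc M I (%i. \<Sum>.K j:I. k j *.K psi (c i j)) y"
   using k yM cc psi fin by (intro lc_lc[OF rm]) auto
  also have "... = lc M I (%i. psi (\<Sum>.H j:I. k j **.H c i j)) y"
  proof (rule lc_cong[OF rm])
   fix i assume i: "i : I"
   have "psi (\<Sum>.H j:I. k j **.H c i j) = (\<Sum>.K j:I. psi (k j **.H c i j))"
    using i k cc by (intro dual_finsum[OF psi] HM.smult_closed) auto
   also have "... = (\<Sum>.K j:I. k j *.K psi (c i j))"
    using i k cc psi by (intro K.finsum_eqI) (auto simp: dual_smult)
   finally show "(\<Sum>.K j:I. k j *.K psi (c i j)) = psi (\<Sum>.H j:I. k j **.H c i j)" ..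
   show "psi (\<Sum>.H j:I. k j **.H c i j) <: K"
    using i k cc by (intro dual_closed[OF psi] H.finsum_in HM.smult_closed) auto
  qed (use yM in auto)
  finally show ?thesis .
 qed
 then show ?thesis
  using fin yM k cc unfolding rep_def by (auto intro!: H.finsum_in HM.smult_closed)
qed

end

context hopf_comod_alg
begin

lemma dual_S: "[|phi : D; h <: H|] ==> (%u. phi (u *.H S h)) : D"
 by (rule dual_right) auto

lemma hom_closed: "[|f : mod_hom A M RR; x <: M|] ==> f x <: A"
 using mod_hom_closed[of f A M RR] by simp

text \<open>It makes the sum that defines the coaction on the dual independent of the representation
  of the coacted element.\<close>

lemma kbal_coact:
 assumes rm: "right_module A M" and f: "f : mod_hom A M RR" and phi: "phi : D"
 shows "kbal M A (%x h. TA (%u. phi (u *.H S h)) (f x))"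
 unfolding kbal_def
proof (intro conjI ballI)
 interpret M: right_module A M by (rule rm)
 fix x h assume *: "x <: M" "h <: H"
 have fx: "f x <: RR" using hom_closed[OF f *(1)] by simp
 show "TA (%u. phi (u *.H S h)) (f x) <: A" using dual_S[OF phi *(2)] fx by simp
 {
  fix x' assume "x' <: M"
  then show "TA (%u. phi (u *.H S h)) (f (x +.M x')) = TA (%u. phi (u *.H S h)) (f x) +.A TA (%u. phi (u *.H S h)) (f x')"
   using * dual_S[OF phi *(2)] hom_closed[OF f] by (simp add: mod_hom_add[OF f] TA_add)
 next
  fix h' assume h': "h' <: H"
  have "TA (%u. phi (u *.H S (h +.H h'))) (f x) = TA (%u. phi (u *.H S h)) (f x) +.RR TA (%u. phi (u *.H S h')) (f x)"
   using * h' phi by (intro T_add_functional[OF comod_A fx] dual_S) (auto simp: mod_hom_add[OF S] H.r_distr dual_add)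
  then show "TA (%u. phi (u *.H S (h +.H h'))) (f x) = TA (%u. phi (u *.H S h)) (f x) +.A TA (%u. phi (u *.H S h')) (f x)"
   by simp
 }
next
 interpret M: right_module A M by (rule rm)
 fix c x h assume *: "c <: K" "x <: M" "h <: H"
 have fx: "f x <: RR" using hom_closed[OF f *(2)] by simp
 have "TA (%u. phi (u *.H S (c **.H h))) (f x) = ks c **.RR TA (%u. phi (u *.H S h)) (f x)"
  using * phi by (intro T_scale_functional[OF comod_A fx] dual_S HM.smult_closed)
   (auto simp: mod_hom_smult[OF S] mult_right dual_smult)
 then show "TA (%u. phi (u *.H S h)) (f (ks c **.M x)) = TA (%u. phi (u *.H S (c **.H h))) (f x)"
  using * fx dual_S[OF phi *(3)] by (simp add: mod_hom_smult[OF f] TA_ks)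
qed

lemma mult_hom: "a <: A ==> (%z. a *.A z) : mod_hom A RR RR"
 by (rule mod_homI) (auto simp: Z.r_distr Z.m_assoc)

lemma mult_hom_compose: "a <: A ==> f : mod_hom A M RR ==> (%x. a *.A f x) : mod_hom A M RR"
 by (rule mod_hom_compose[OF mult_hom])

text \<open>In Sweedler notation: \<open>a\<^sub>0 x\<^sub>0 \<otimes> a\<^sub>1 x\<^sub>1 S(x\<^sub>2) = a\<^sub>0 x \<otimes> a\<^sub>1\<close>.\<close>

lemma antipode_cancel:
 assumes a: "a <: A" and x: "x <: A" and \<theta>: "\<theta> : D" and J: "rep RR TA J z g x"
 shows "(\<Sum>.A j:J. TA (%h. \<theta> (h *.H S (g j))) (a *.A z j)) = TA \<theta> a *.A x"
proof -
 have aR: "a <: RR" and xR: "x <: RR" using a x by auto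
 interpret R: right_module A RR by (rule rm_RR)
 \<comment> \<open>The element \<open>x\<close> is placed in the span of a family with
   multiplicative matrix \<open>d\<close>; the double coproduct in the identity then becomes a
   double sum over matrix indices.\<close>
 obtain n d e where d: "comat {..<n::nat} d" and f: "fam RR TA {..<n} d e"
  and sp: "!!z. z : {x} ==> EX k. (ALL i<n. k i <: K) & z = lc RR {..<n} k e"
  by (rule comatrix_family[OF comod_A R.submodule_carrier, of "{x}"]) (use x in auto)
 obtain k where k: "ALL i<n. k i <: K" "x = lc RR {..<n} k e" using sp[of x] by auto
 have dd: "!!i j. [|i < n; j < n|] ==> d i j <: H" and eA: "!!i. i < n ==> e i <: A"
  using f by (auto simp: fam_def)
 define g' where "g' i = (\<Sum>.H j:{..<n}. k j **.H d i j)" for i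
 have g': "g' i <: H" if "i < n" for i
  unfolding g'_def using that dd k by (intro H.finsum_in HM.smult_closed) auto
 have r: "rep RR TA {..<n} e g' x"
  unfolding k(2) g'_def using k(1) by (intro rep_lc[OF comod_A f]) auto
 have \<theta>S: "(%h. \<theta> (h *.H S (g' i))) : D" if "i < n" for i by (rule dual_S[OF \<theta> g'[OF that]])
 have \<theta>dS: "(%h. \<theta> ((h *.H d r i) *.H S (g' i))) : D" if "r < n" "i < n" for r i
  using dual_right[OF \<theta>S[OF that(2)] dd[OF that]] .
 let ?t = "%i r. TA (%h. \<theta> ((h *.H d r i) *.H S (g' i))) a *.A e r"
 have t0: "TA (%h. \<theta> ((h *.H d r i) *.H S (g' i))) a <: A" if "r < n" "i < n" for r i
  using \<theta>dS[OF that] a by simp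
 have t: "?t i r <: A" if "i < n" "r < n" for i r
  using t0[OF that(2,1)] eA[OF that(2)] by simp
 have "(\<Sum>.A j:J. TA (%h. \<theta> (h *.H S (g j))) (a *.A z j)) = (\<Sum>.A i:{..<n}. TA (%h. \<theta> (h *.H S (g' i))) (a *.A e i))"
  by (rule rep_eval[OF Z.is_abelian_group comod_A kbal_coact[OF rm_RR mult_hom[OF a] \<theta>] J r])
 also have "... = (\<Sum>.A i:{..<n}. \<Sum>.A r:{..<n}. ?t i r)"
 proof (rule Z.finsum_eqI)
  fix i assume "i : {..<n}"
  then have i: "i < n" by simp
  have "TA (%h. \<theta> (h *.H S (g' i))) (e i **.RR a) = (\<Sum>.RR r:{..<n}. e r **.RR TA (%h. \<theta> ((h *.H d r i) *.H S (g' i))) a)"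
   using i eA by (intro hm_rep[OF hopf_A \<theta>S[OF i] aR _ fam_rep[OF f]]) auto
  then show "TA (%h. \<theta> (h *.H S (g' i))) (a *.A e i) = (\<Sum>.A r:{..<n}. ?t i r)" by simp
  show "(\<Sum>.A r:{..<n}. ?t i r) <: A" using t i by (intro Z.finsum_in) auto
 qed
 also have "... = (\<Sum>.A r:{..<n}. \<Sum>.A i:{..<n}. ?t i r)" using t by (intro Z.finsum_swap) auto
 also have "... = (\<Sum>.A r:{..<n}. TA \<theta> a *.A (e r *.A ks (k r)))"
 proof (rule Z.finsum_eqI)
  fix r assume "r : {..<n}"
  then have r: "r < n" by simp
  have kr: "k r <: K" using k r by simp
  have \<theta>k: "(%h. k r *.K \<theta> h) : D"
   using kr \<theta> by (intro dualI) (auto simp: dual_add dual_smult K.r_distr K.m_lcomm)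
  \<comment> \<open>For fixed \<open>r\<close> the sum of d_ri S(g'_i) is \<open>k r\<close> times
    the unit, so the functionals add up to a multiple of \<theta>.\<close>
  have "TA (%h. k r *.K \<theta> h) a = (\<Sum>.RR i:{..<n}. TA (%h. \<theta> ((h *.H d r i) *.H S (g' i))) a)"
  proof (rule T_sum[OF comod_A aR])
   fix h assume h: "h <: H"
   have "(\<Sum>.K i:{..<n}. \<theta> ((h *.H d r i) *.H S (g' i))) = (\<Sum>.K i:{..<n}. \<theta> (h *.H (d r i *.H S (g' i))))"
    using h r dd g' \<theta> by (intro K.finsum_eqI) (auto simp: H.m_assoc)
   also have "... = \<theta> (\<Sum>.H i:{..<n}. h *.H (d r i *.H S (g' i)))"
    using h r dd g' by (intro dual_finsum[OF \<theta>, symmetric]) auto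
   also have "(\<Sum>.H i:{..<n}. h *.H (d r i *.H S (g' i))) = h *.H (\<Sum>.H i:{..<n}. d r i *.H S (g' i))"
    using h r dd g' by (intro H.finsum_mult_left[symmetric]) auto
   also have "(\<Sum>.H i:{..<n}. d r i *.H S (g' i)) = k r **.H \<one>.H"
    unfolding g'_def using k r by (intro comat_antipode_lc[OF d]) auto
   also have "\<theta> (h *.H (k r **.H \<one>.H)) = k r *.K \<theta> h"
    using h kr \<theta> by (simp add: mult_right dual_smult)
   finally show "k r *.K \<theta> h = (\<Sum>.K i:{..<n}. \<theta> ((h *.H d r i) *.H S (g' i)))" ..
  qed (use \<theta>dS r \<theta>k in auto)
  then have s: "(\<Sum>.A i:{..<n}. TA (%h. \<theta> ((h *.H d r i) *.H S (g' i))) a) = TA \<theta> a *.A ks (k r)"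
   using T_scale_functional[OF comod_A aR \<theta> \<theta>k kr] by simp
  have "(\<Sum>.A i:{..<n}. ?t i r) = (\<Sum>.A i:{..<n}. TA (%h. \<theta> ((h *.H d r i) *.H S (g' i))) a) *.A e r"
   using t0[OF r] eA[OF r] by (intro Z.finsum_mult_right[symmetric]) auto
  also have "... = TA \<theta> a *.A (e r *.A ks (k r))"
   unfolding s using eA[OF r] kr \<theta> a ks_central[OF kr eA[OF r]] by (simp add: Z.m_assoc)
  finally show "(\<Sum>.A i:{..<n}. ?t i r) = TA \<theta> a *.A (e r *.A ks (k r))" .
  show "TA \<theta> a *.A (e r *.A ks (k r)) <: A" using eA[OF r] kr \<theta> a by simp
 qed
 also have "... = TA \<theta> a *.A (\<Sum>.A r:{..<n}. e r *.A ks (k r))"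
  using eA k(1) \<theta> a by (intro Z.finsum_mult_left[symmetric]) auto
 also have "(\<Sum>.A r:{..<n}. e r *.A ks (k r)) = x" by (simp add: k(2) lc_RR)
 finally show ?thesis .
qed

text \<open>If \<open>\<rho> p = \<Sum> x\<^sub>i \<otimes> h\<^sub>i\<close>, then \<open>coact M T f phi p\<close> is
 \<open>\<Sum> (id \<otimes> phi) (\<rho> (f x\<^sub>i) (1 \<otimes> S h\<^sub>i))\<close>: the coaction on the dual \<open>Hom\<^sub>A(M, A)\<close>.\<close>

definition coact ::
 "('a, 'm, 'mc) module_scheme => (('h => 'k) => 'm => 'm) => ('m => 'a) => ('h => 'k) => 'm => 'a" where
 "coact M T f phi p = (\<Sum>.A b:{b : B. T (cf b) p ~= \<zero>.M}. TA (%u. phi (u *.H S (v b))) (f (T (cf b) p)))"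

context
 fixes M :: "('a, 'm, 'mc) module_scheme" and T f
 assumes M: "hm M T" and f: "f : mod_hom A M RR"
begin

interpretation M: right_module A M by (rule comodD(1)[OF hm_comod[OF M]])

lemma coact_rep:
 assumes phi: "phi : D" and p: "p <: M" and I: "rep M T I y h p"
 shows "coact M T f phi p = (\<Sum>.A i:I. TA (%u. phi (u *.H S (h i))) (f (y i)))"
proof -
 have com: "comod M T" by (rule hm_comod[OF M])
 have r: "rep M T {b : B. T (cf b) p ~= \<zero>.M} (%b. T (cf b) p) v p"
  by (rule rep_canonical[OF com p supp_finite[OF com p]]) auto
 show ?thesis
  unfolding coact_def by (rule rep_eval[OF Z.is_abelian_group com kbal_coact[OF M.right_module_axioms f phi] r I])
qed

lemma coact_closed:
 assumes phi: "phi : D" and p: "p <: M"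
 shows "coact M T f phi p <: A"
proof -
 have "TA (%u. phi (u *.H S (v b))) (f (T (cf b) p)) <: A" if "b : B" for b
  using dual_S[OF phi v[OF that]] hom_closed[OF f comodD(2)[OF hm_comod[OF M] cf[OF that] p]] by simp
 then show ?thesis unfolding coact_def by (intro Z.finsum_in) auto
qed

lemma coact_add:
 assumes phi: "phi : D" and p: "p <: M" and q: "q <: M"
 shows "coact M T f phi (p +.M q) = coact M T f phi p +.A coact M T f phi q"
proof -
 have com: "comod M T" by (rule hm_comod[OF M])
 have pq: "p +.M q <: M" using p q by simp
 define B0 where "B0 = {b : B. T (cf b) p ~= \<zero>.M} \<union> {b : B. T (cf b) q ~= \<zero>.M} \<union> {b : B. T (cf b) (p +.M q) ~= \<zero>.M}"
 have B0: "finite B0" "B0 \<subseteq> B" unfolding B0_def using supp_finite[OF com] p q pq by auto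
 have r: "rep M T B0 (%b. T (cf b) p) v p" "rep M T B0 (%b. T (cf b) q) v q"
   "rep M T B0 (%b. T (cf b) (p +.M q)) v (p +.M q)"
  by (intro rep_canonical[OF com _ B0] p q pq; auto simp: B0_def)+
 have b: "cf b : D" "(%u. phi (u *.H S (v b))) : D" if "b : B0" for b
  using that B0 cf dual_S[OF phi v] by auto
 have c: "TA (%u. phi (u *.H S (v b))) (f (T (cf b) x)) <: A" if "b : B0" "x <: M" for b x
  using b[OF that(1)] hom_closed[OF f comodD(2)[OF com _ that(2)]] by simp
 have "coact M T f phi (p +.M q) = (\<Sum>.A b:B0. TA (%u. phi (u *.H S (v b))) (f (T (cf b) (p +.M q))))"
  by (rule coact_rep[OF phi pq r(3)])
 also have "... = (\<Sum>.A b:B0. TA (%u. phi (u *.H S (v b))) (f (T (cf b) p)) +.A TA (%u. phi (u *.H S (v b))) (f (T (cf b) q)))"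
 proof (rule Z.finsum_eqI)
  fix b' assume b': "b' : B0"
  have "f (T (cf b') (p +.M q)) = f (T (cf b') p) +.A f (T (cf b') q)"
   using comodD(3)[OF com b(1)[OF b'] p q] mod_hom_add[OF f comodD(2)[OF com b(1)[OF b'] p] comodD(2)[OF com b(1)[OF b'] q]] by simp
  then show "TA (%u. phi (u *.H S (v b'))) (f (T (cf b') (p +.M q))) =
   TA (%u. phi (u *.H S (v b'))) (f (T (cf b') p)) +.A TA (%u. phi (u *.H S (v b'))) (f (T (cf b') q))"
   using TA_add[OF b(2)[OF b']] hom_closed[OF f comodD(2)[OF com b(1)[OF b']]] p q by simp
  show "TA (%u. phi (u *.H S (v b'))) (f (T (cf b') p)) +.A TA (%u. phi (u *.H S (v b'))) (f (T (cf b') q)) <: A"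
   using c[OF b' p] c[OF b' q] by simp
 qed
 also have "... = (\<Sum>.A b:B0. TA (%u. phi (u *.H S (v b))) (f (T (cf b) p))) +.A (\<Sum>.A b:B0. TA (%u. phi (u *.H S (v b))) (f (T (cf b) q)))"
  using c p q by (intro Z.finsum_add) auto
 also have "... = coact M T f phi p +.A coact M T f phi q"
  using coact_rep[OF phi p r(1)] coact_rep[OF phi q r(2)] by simp
 finally show ?thesis .
qed

text \<open>The coaction of m a contributes S(m_1 a_1) = S(a_1) S(m_1), and
  \<open>antipode_cancel\<close> then removes the coaction of \<open>a\<close>. Reversal of products
  by \<open>S\<close> is what makes the coacted functional linear over \<open>A\<close>.\<close>

lemma coact_smult:
 assumes phi: "phi : D" and p: "p <: M" and a: "a <: A"
 shows "coact M T f phi (a **.M p) = coact M T f phi p *.A a"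
proof -
 have com: "comod M T" by (rule hm_comod[OF M])
 have aR: "a <: RR" using a by simp
 obtain m z g where J: "rep RR TA {..<m::nat} z g a" by (rule comod_rep[OF comod_A aR]) (rule that)
 obtain n y h where I: "rep M T {..<n::nat} y h p" by (rule comod_rep[OF com p]) (rule that)
 have zg: "!!j. j < m ==> z j <: A" "!!j. j < m ==> g j <: H"
  and yh: "!!i. i < n ==> y i <: M" "!!i. i < n ==> h i <: H"
  using I J by (auto simp: rep_def)
 have fy: "f (y i) <: A" if "i < n" for i using hom_closed[OF f yh(1)[OF that]] .
 have d1: "(%u. phi (u *.H S (h i))) : D" if "i < n" for i by (rule dual_S[OF phi yh(2)[OF that]])
 have d2: "(%u. phi (u *.H S (h i *.H g j))) : D" if "i < n" "j < m" for i j
  using that yh zg by (intro dual_S[OF phi]) auto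
 let ?t = "%i j. TA (%u. phi (u *.H S (h i *.H g j))) (f (z j **.M y i))"
 have t: "?t i j <: A" if "i < n" "j < m" for i j
  using d2[OF that] that yh zg by (intro TA_closed hom_closed[OF f] M.smult_closed) auto
 have "coact M T f phi (a **.M p) = (\<Sum>.A q:{..<n} \<times> {..<m}. ?t (fst q) (snd q))"
  by (rule coact_rep[OF phi M.smult_closed[OF a p] rep_smult[OF M p a J I]])
 also have "... = (\<Sum>.A i:{..<n}. \<Sum>.A j:{..<m}. ?t i j)"
  using t by (intro Z.finsum_Times[where f = ?t]) auto
 also have "... = (\<Sum>.A i:{..<n}. TA (%u. phi (u *.H S (h i))) (f (y i)) *.A a)"
 proof (rule Z.finsum_eqI)
  fix i assume "i : {..<n}"
  then have i: "i < n" by simp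
  have "(\<Sum>.A j:{..<m}. ?t i j) = (\<Sum>.A j:{..<m}. TA (%u. phi ((u *.H S (g j)) *.H S (h i))) (f (y i) *.A z j))"
  proof (rule Z.finsum_eqI)
   fix j assume "j : {..<m}"
   then have j: "j < m" by simp
   have d3: "(%u. phi ((u *.H S (g j)) *.H S (h i))) : D" by (rule dual_S[OF d1[OF i] zg(2)[OF j]])
   have fz: "f (z j **.M y i) = f (y i) *.A z j" using mod_hom_smult[OF f zg(1)[OF j] yh(1)[OF i]] by simp
   show "?t i j = TA (%u. phi ((u *.H S (g j)) *.H S (h i))) (f (y i) *.A z j)"
    unfolding fz using fy[OF i] zg j yh i
    by (intro T_cong[OF comod_A _ d2[OF i j] d3]) (auto simp: S_mult H.m_assoc)
   show "TA (%u. phi ((u *.H S (g j)) *.H S (h i))) (f (y i) *.A z j) <: A"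
    using d3 fy[OF i] zg(1)[OF j] by simp
  qed
  also have "... = TA (%u. phi (u *.H S (h i))) (f (y i)) *.A a"
   by (rule antipode_cancel[OF fy[OF i] a d1[OF i] J])
  finally show "(\<Sum>.A j:{..<m}. ?t i j) = TA (%u. phi (u *.H S (h i))) (f (y i)) *.A a" .
  show "TA (%u. phi (u *.H S (h i))) (f (y i)) *.A a <: A" using d1[OF i] fy[OF i] a by simp
 qed
 also have "... = (\<Sum>.A i:{..<n}. TA (%u. phi (u *.H S (h i))) (f (y i))) *.A a"
  using d1 fy a by (intro Z.finsum_mult_right[symmetric]) auto
 also have "... = coact M T f phi p *.A a" using coact_rep[OF phi p I] by simp
 finally show ?thesis .
qed

lemma coact_hom: "phi : D ==> coact M T f phi : mod_hom A M RR"
 by (rule mod_homI) (auto simp: coact_closed coact_add coact_smult)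

end

section \<open>Recovering an element and a value from the dual coaction\<close>

context
 fixes M :: "('a, 'm, 'mc) module_scheme" and T f c p and n :: nat
 assumes M: "hm M T" and f: "f : mod_hom A M RR" and c: "comat {..<n} c" and p: "fam M T {..<n} c p"
begin

interpretation M: right_module A M by (rule comodD(1)[OF hm_comod[OF M]])

lemma coact_fam:
 assumes "g : mod_hom A M RR" "phi : D" "i < n"
 shows "coact M T g phi (p i) = (\<Sum>.A l:{..<n}. TA (%u. phi (u *.H S (c l i))) (g (p l)))"
 using assms p by (intro coact_rep[OF M] fam_rep) (auto simp: fam_def)

text \<open>If f_0 \<otimes> f_1 is the coaction on \<open>f\<close>, this is (a f_0)_0 \<otimes> (a
  f_0)_1 S(f_1) = a_0 f \<otimes> a_1, evaluated at the family \<open>p\<close>, with f_1 expanded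
  in the dual basis. The set \<open>B0\<close> depends on \<open>f\<close> and \<open>p\<close> but
  not on \<open>a\<close> or psi: the denominator that later plays the role of \<open>a\<close> is
  chosen after it.\<close>

lemma coact_inverse:
 "EX B0. finite B0 & B0 \<subseteq> B & (ALL psi:D. ALL a:carrier A. ALL j<n. TA psi a *.A f (p j) =
  (\<Sum>.A b:B0. coact M T (%x. a *.A coact M T f (cf b) x) (%h. psi (h *.H S (v b))) (p j)))"
proof -
 have pM: "p l <: M" and cc: "c l i <: H" if "l < n" "i < n" for l i
  using p that by (auto simp: fam_def)
 have fp: "f (p l) <: RR" if "l < n" for l using hom_closed[OF f pM[OF that that]] by simp
 define B1 where "B1 = (\<Union>l<n. {b : B. TA (cf b) (f (p l)) ~= \<zero>.RR})"
 have B1: "finite B1" "B1 \<subseteq> B" unfolding B1_def using supp_finite[OF comod_A fp] by auto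
 have rp: "rep RR TA B1 (%u. TA (cf u) (f (p l))) v (f (p l))" if "l < n" for l
  using that by (intro rep_canonical[OF comod_A fp B1]) (auto simp: B1_def)
 \<comment> \<open>An index is a pair of a member \<open>p l\<close> of the family and a coordinate
   \<open>u\<close> of the coaction on \<open>f (p l)\<close>. With \<open>e\<close> for the part in
   \<open>A\<close> and \<open>w\<close> for the part in \<open>H\<close>, the coacted functional
   takes at \<open>p i\<close> the value \<Sum> e_r \<otimes> w_ri.\<close>
 define R where "R = {..<n} \<times> B1"
 have finR: "finite R" using B1 by (simp add: R_def)
 define e where "e r = TA (cf (snd r)) (f (p (fst r)))" for r
 define w where "w r i = v (snd r) *.H S (c (fst r) i)" for r i
 have vR: "v (snd r) <: H" and fR: "fst r < n" if "r : R" for r using that B1 v by (auto simp: R_def)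
 have eA: "e r <: A" if "r : R" for r
  using that B1 cf fp unfolding e_def R_def by (intro TA_closed) auto
 have wH: "w r i <: H" if "r : R" "i < n" for r i
  using vR[OF that(1)] cc[OF fR[OF that(1)] that(2)] by (simp add: w_def)
 \<comment> \<open>All coordinates of the finitely many elements \<open>w r i\<close>, so that the
   sum over \<open>B0\<close> recombines to \<open>w r i\<close> under any functional.\<close>
 define B0 where "B0 = (\<Union>r\<in>R. \<Union>i<n. {b : B. cf b (w r i) ~= \<zero>.K})"
 have B0: "finite B0" "B0 \<subseteq> B" unfolding B0_def using finR cf_finite wH by auto
 have b0: "cf b : D" "v b <: H" if "b : B0" for b using that B0 cf v by auto
 have G: "coact M T f (cf b) (p i) = (\<Sum>.A r:R. e r *.A ks (cf b (w r i)))" if b: "b : B0" and i: "i < n" for b i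
 proof -
  have k: "cf b (w r i) <: K" if "r : R" for r using b0(1)[OF b] wH[OF that i] by auto
  have "coact M T f (cf b) (p i) = (\<Sum>.A l:{..<n}. TA (%u. cf b (u *.H S (c l i))) (f (p l)))"
   by (rule coact_fam[OF f b0(1)[OF b] i])
  also have "... = (\<Sum>.A l:{..<n}. \<Sum>.A u:B1. e (l, u) *.A ks (cf b (w (l, u) i)))"
  proof (rule Z.finsum_eqI)
   fix l assume "l : {..<n}"
   then have l: "l < n" by simp
   show "TA (%u. cf b (u *.H S (c l i))) (f (p l)) = (\<Sum>.A u:B1. e (l, u) *.A ks (cf b (w (l, u) i)))"
    using rp[OF l] dual_S[OF b0(1)[OF b] cc[OF l i]] by (simp add: rep_def lc_RR e_def w_def)
   show "(\<Sum>.A u:B1. e (l, u) *.A ks (cf b (w (l, u) i))) <: A"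
    using eA k l by (intro Z.finsum_in) (auto simp: R_def)
  qed
  also have "... = (\<Sum>.A r:R. e r *.A ks (cf b (w r i)))"
   unfolding R_def using eA k B1
    Z.finsum_Times[where f = "%l u. e (l, u) *.A ks (cf b (w (l, u) i))" and I = "{..<n}" and J = B1]
   by (auto simp: R_def)
  finally show ?thesis .
 qed
 have "TA psi a *.A f (p j) =
  (\<Sum>.A b:B0. coact M T (%x. a *.A coact M T f (cf b) x) (%h. psi (h *.H S (v b))) (p j))"
  if psi: "psi : D" and a: "a <: A" and j: "j < n" for psi a j
 proof -
  have ae: "a *.A e r <: RR" if "r : R" for r using a eA[OF that] by simp
  have d1: "(%h. psi (h *.H S (v b))) : D" if "b : B0" for b using dual_S[OF psi b0(2)[OF that]] .
  have d2: "(%h. psi ((h *.H S (c i j)) *.H S g)) : D" if "i < n" "g <: H" for i g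
   using dual_S[OF dual_S[OF psi that(2)] cc[OF that(1) j]] .
  let ?Y = "%b i r. TA (%h. psi ((h *.H S (c i j)) *.H S (v b))) (a *.A e r) *.A ks (cf b (w r i))"
  have Y: "?Y b i r <: A" if "b : B0" "i < n" "r : R" for b i r
   using d2[OF that(2) b0(2)[OF that(1)]] ae[OF that(3)] b0(1)[OF that(1)] wH[OF that(3,2)]
   by (intro Z.m_closed[OF TA_closed[OF _ ae[OF that(3), simplified]]] ks_closed dual_closed) simp_all
  have outer: "coact M T (%x. a *.A coact M T f (cf b) x) (%h. psi (h *.H S (v b))) (p j) =
   (\<Sum>.A i:{..<n}. \<Sum>.A r:R. ?Y b i r)" if b: "b : B0" for b
  proof -
   have h: "(%x. a *.A coact M T f (cf b) x) : mod_hom A M RR"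
    by (rule mult_hom_compose[OF a coact_hom[OF M f b0(1)[OF b]]])
   have "coact M T (%x. a *.A coact M T f (cf b) x) (%h. psi (h *.H S (v b))) (p j) =
    (\<Sum>.A i:{..<n}. TA (%h. psi ((h *.H S (c i j)) *.H S (v b))) (a *.A coact M T f (cf b) (p i)))"
    by (rule coact_fam[OF h d1[OF b] j])
   also have "... = (\<Sum>.A i:{..<n}. \<Sum>.A r:R. ?Y b i r)"
   proof (rule Z.finsum_eqI)
    fix i assume "i : {..<n}"
    then have i: "i < n" by simp
    have k: "cf b (w r i) <: K" if "r : R" for r using b0(1)[OF b] wH[OF that i] by auto
    have "a *.A coact M T f (cf b) (p i) = (\<Sum>.A r:R. a *.A (e r *.A ks (cf b (w r i))))"
     unfolding G[OF b i] using eA k a by (intro Z.finsum_mult_left) auto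
    also have "... = lc RR R (%r. cf b (w r i)) (%r. a *.A e r)"
     unfolding lc_RR using eA k a by (intro Z.finsum_eqI) (auto simp: Z.m_assoc)
    finally have "TA (%h. psi ((h *.H S (c i j)) *.H S (v b))) (a *.A coact M T f (cf b) (p i)) =
     lc RR R (%r. cf b (w r i)) (%r. TA (%h. psi ((h *.H S (c i j)) *.H S (v b))) (a *.A e r))"
     using T_lc[OF comod_A d2[OF i b0(2)[OF b]], of R "%r. cf b (w r i)" "%r. a *.A e r"] k ae by simp
    then show "TA (%h. psi ((h *.H S (c i j)) *.H S (v b))) (a *.A coact M T f (cf b) (p i)) = (\<Sum>.A r:R. ?Y b i r)"
     by (simp add: lc_RR)
    show "(\<Sum>.A r:R. ?Y b i r) <: A" using Y[OF b i] by (intro Z.finsum_in) auto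
   qed
   finally show ?thesis .
  qed
  have "(\<Sum>.A b:B0. coact M T (%x. a *.A coact M T f (cf b) x) (%h. psi (h *.H S (v b))) (p j)) =
   (\<Sum>.A b:B0. \<Sum>.A i:{..<n}. \<Sum>.A r:R. ?Y b i r)"
   using outer Y by (intro Z.finsum_eqI) (auto intro!: Z.finsum_in simp del: right_regular_simps)
  also have "... = (\<Sum>.A i:{..<n}. \<Sum>.A b:B0. \<Sum>.A r:R. ?Y b i r)"
   using Y B0(1) by (intro Z.finsum_swap Z.finsum_in) auto
  also have "... = (\<Sum>.A i:{..<n}. \<Sum>.A r:R. \<Sum>.A b:B0. ?Y b i r)"
  proof (rule Z.finsum_eqI)
   fix i assume "i : {..<n}"
   then have i: "i < n" by simp
   show "(\<Sum>.A b:B0. \<Sum>.A r:R. ?Y b i r) = (\<Sum>.A r:R. \<Sum>.A b:B0. ?Y b i r)"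
    by (rule Z.finsum_swap[OF B0(1) finR]) (rule Y[OF _ i])
   show "(\<Sum>.A r:R. \<Sum>.A b:B0. ?Y b i r) <: A" by (intro Z.finsum_in Y[OF _ i])
  qed
  also have "... = (\<Sum>.A r:R. \<Sum>.A i:{..<n}. \<Sum>.A b:B0. ?Y b i r)"
   by (rule Z.finsum_swap) (auto intro!: Z.finsum_in Y finR simp del: right_regular_simps)
  also have "... = (\<Sum>.A r:R. if fst r = j then TA (%h. psi (h *.H S (v (snd r)))) (a *.A e r) else \<zero>.A)"
  proof (rule Z.finsum_eqI)
   fix r assume r: "r : R"
   let ?x = "a *.A e r"
   have d3: "(%h. psi ((h *.H S (c i j)) *.H S (w r i))) : D" if "i < n" for i using d2[OF that wH[OF r that]] .
   have d4: "(%h. psi (h *.H S (v (snd r)))) : D" by (rule dual_S[OF psi vR[OF r]])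
   have 1: "(\<Sum>.A b:B0. ?Y b i r) = TA (%h. psi ((h *.H S (c i j)) *.H S (w r i))) ?x" if i: "i < n" for i
   proof -
    have "TA (%h. psi ((h *.H S (c i j)) *.H S (w r i))) ?x =
     lc RR B0 (%b. cf b (w r i)) (%b. TA (%h. psi ((h *.H S (c i j)) *.H S (v b))) ?x)"
    proof (rule T_sum_scaled[OF comod_A ae[OF r] B0(1)])
     show "cf b (w r i) <: K" if "b : B0" for b using b0(1)[OF that] wH[OF r i] by auto
     show "(%h. psi ((h *.H S (c i j)) *.H S (v b))) : D" if "b : B0" for b by (rule d2[OF i b0(2)[OF that]])
     show "(%h. psi ((h *.H S (c i j)) *.H S (w r i))) : D" by (rule d3[OF i])
     fix h assume h: "h <: H"
     have hc: "h *.H S (c i j) <: H" using h cc[OF i j] by simp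
     have "(%g. psi ((h *.H S (c i j)) *.H S g)) : D"
      using psi hc by (intro dualI)
       (auto simp: mod_hom_add[OF S] mod_hom_smult[OF S] H.r_distr mult_right dual_add dual_smult)
     from dual_basis_superset[OF this wH[OF r i] B0]
     show "psi ((h *.H S (c i j)) *.H S (w r i)) = (\<Sum>.K b:B0. cf b (w r i) *.K psi ((h *.H S (c i j)) *.H S (v b)))"
      using r i by (auto simp: B0_def)
    qed
    then show ?thesis by (simp add: lc_RR)
   qed
   have "(\<Sum>.A i:{..<n}. \<Sum>.A b:B0. ?Y b i r) = (\<Sum>.RR i:{..<n}. TA (%h. psi ((h *.H S (c i j)) *.H S (w r i))) ?x)"
    using 1 d3 ae[OF r] by (simp only: finsum_right_regular) (intro Z.finsum_eqI, auto)
   also have "... = TA (%h. if fst r = j then psi (h *.H S (v (snd r))) else \<zero>.K) ?x"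
   proof (rule T_sum[OF comod_A ae[OF r], symmetric])
    show "(%h. psi ((h *.H S (c i j)) *.H S (w r i))) : D" if "i : {..<n}" for i using d3 that by simp
    show "(%h. if fst r = j then psi (h *.H S (v (snd r))) else \<zero>.K) : D"
     using d4 dual_const_zero by (cases "fst r = j") auto
    fix h assume h: "h <: H"
    \<comment> \<open>S(c_ij) S(w_ri) = S(w_ri c_ij), and w_ri c_ij is v_u S(c_li) c_ij with r = (l,
      u). Summing over \<open>i\<close> with the left inverse matrix leaves v_u for l = j and zero
      otherwise.\<close>
    have "(\<Sum>.K i:{..<n}. psi ((h *.H S (c i j)) *.H S (w r i))) = (\<Sum>.K i:{..<n}. psi (h *.H S (v (snd r) *.H (S (c (fst r) i) *.H c i j))))"
    proof (rule K.finsum_eqI)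
     fix i assume "i : {..<n}"
     then have i: "i < n" by simp
     have "S (v (snd r) *.H (S (c (fst r) i) *.H c i j)) = S (w r i *.H c i j)"
      using vR[OF r] cc[OF fR[OF r] i] cc[OF i j] by (simp add: w_def H.m_assoc)
     also have "... = S (c i j) *.H S (w r i)" by (rule S_mult[OF wH[OF r i] cc[OF i j]])
     finally show "psi ((h *.H S (c i j)) *.H S (w r i)) = psi (h *.H S (v (snd r) *.H (S (c (fst r) i) *.H c i j)))"
      using h cc[OF i j] wH[OF r i] by (simp add: H.m_assoc)
     show "psi (h *.H S (v (snd r) *.H (S (c (fst r) i) *.H c i j))) <: K"
      using h psi vR[OF r] cc[OF fR[OF r] i] cc[OF i j] by simp
    qed
    also have "... = psi (h *.H S (v (snd r) *.H (\<Sum>.H i:{..<n}. S (c (fst r) i) *.H c i j)))"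
    proof -
     have hom: "(%g. psi (h *.H S (v (snd r) *.H g))) : D"
      using psi h vR[OF r] by (intro dualI)
       (auto simp: mod_hom_add[OF S] mod_hom_smult[OF S] H.r_distr mult_right dual_add dual_smult)
     show ?thesis
      using cc[OF fR[OF r]] cc[OF _ j] by (intro dual_finsum[OF hom, symmetric]) auto
    qed
    also have "... = (if fst r = j then psi (h *.H S (v (snd r))) else \<zero>.K)"
     using comat_antipode(1)[OF c, of "fst r" j] fR[OF r] j h vR[OF r] mod_hom_zero[OF S mod_H mod_H] dual_zero[OF psi]
     by simp
    finally show "(if fst r = j then psi (h *.H S (v (snd r))) else \<zero>.K) = (\<Sum>.K i:{..<n}. psi ((h *.H S (c i j)) *.H S (w r i)))" ..
   qed simp
   also have "... = (if fst r = j then TA (%h. psi (h *.H S (v (snd r)))) ?x else \<zero>.A)"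
   proof (cases "fst r = j")
    case False
    have "TA (%h. \<zero>.K) ?x = ks \<zero>.K **.RR TA eps ?x"
     using eps by (intro T_scale_functional[OF comod_A ae[OF r] eps dual_const_zero]) auto
    then show ?thesis using False ae[OF r] eps by simp
   qed simp
   finally show "(\<Sum>.A i:{..<n}. \<Sum>.A b:B0. ?Y b i r) = (if fst r = j then TA (%h. psi (h *.H S (v (snd r)))) ?x else \<zero>.A)" .
   show "(if fst r = j then TA (%h. psi (h *.H S (v (snd r)))) ?x else \<zero>.A) <: A"
    using d4 ae[OF r] by simp
  qed
  also have "... = (\<Sum>.A r:Pair j ` B1. if fst r = j then TA (%h. psi (h *.H S (v (snd r)))) (a *.A e r) else \<zero>.A)"
  proof (rule Z.finsum_superset[OF finR, symmetric])
   show "Pair j ` B1 \<subseteq> R" using j by (auto simp: R_def)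
   then show "(if fst r = j then TA (%h. psi (h *.H S (v (snd r)))) (a *.A e r) else \<zero>.A) <: A" if "r : Pair j ` B1" for r
    using that ae[of r] dual_S[OF psi vR[of r]] by auto
  qed (auto simp: R_def)
  also have "... = (\<Sum>.A u:B1. TA (%h. psi (h *.H S (v u))) (a *.A TA (cf u) (f (p j))))"
  proof -
   have cl: "TA (%h. psi (h *.H S (v u))) (a *.A e (j, u)) <: A" if "u : B1" for u
    using that ae[of "(j, u)"] dual_S[OF psi vR[of "(j, u)"]] j by (auto simp: R_def)
   have "(\<Sum>.A r:Pair j ` B1. if fst r = j then TA (%h. psi (h *.H S (v (snd r)))) (a *.A e r) else \<zero>.A) =
    (\<Sum>.A u:B1. TA (%h. psi (h *.H S (v u))) (a *.A e (j, u)))"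
    using cl by (subst Z.finsum_reindex) (auto simp: inj_on_def)
   then show ?thesis by (simp add: e_def)
  qed
  also have "... = TA psi a *.A f (p j)"
   using fp[OF j] by (intro antipode_cancel[OF a _ psi rp[OF j]]) simp
  finally show ?thesis ..
 qed
 then show ?thesis using B0 by blast
qed

text \<open>In Sweedler notation f(m)_0 \<otimes> f(m)_1 = f(m_0)_0 \<otimes> f(m_0)_1 S(m_1) m_2.
  Hence the coaction on a value of \<open>f\<close> is expressed by values of coacted
  functionals.\<close>

lemma coact_trace:
 assumes psi: "psi : D" and j: "j < n"
 shows "TA psi (f (p j)) = (\<Sum>.A i:{..<n}. coact M T f (%h. psi (h *.H c i j)) (p i))"
proof -
 have pM: "p l <: M" and cc: "c l i <: H" if "l < n" "i < n" for l i
  using p that by (auto simp: fam_def)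
 have fp: "f (p l) <: RR" if "l < n" for l using hom_closed[OF f pM[OF that that]] by simp
 have d1: "(%h. psi (h *.H c i j)) : D" if "i < n" for i by (rule dual_right[OF psi cc[OF that j]])
 have d2: "(%u. psi ((u *.H S (c l i)) *.H c i j)) : D" if "l < n" "i < n" for l i
  by (rule dual_S[OF d1[OF that(2)] cc[OF that]])
 let ?t = "%i l. TA (%u. psi ((u *.H S (c l i)) *.H c i j)) (f (p l))"
 have t: "?t i l <: A" if "i < n" "l < n" for i l using d2[OF that(2,1)] fp[OF that(2)] by simp
 have "(\<Sum>.A i:{..<n}. coact M T f (%h. psi (h *.H c i j)) (p i)) = (\<Sum>.A i:{..<n}. \<Sum>.A l:{..<n}. ?t i l)"
  using coact_fam[OF f d1] t by (intro Z.finsum_eqI) (auto intro!: Z.finsum_in)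
 also have "... = (\<Sum>.A l:{..<n}. \<Sum>.A i:{..<n}. ?t i l)" using t by (intro Z.finsum_swap) auto
 also have "... = (\<Sum>.A l:{..<n}. if l = j then TA psi (f (p l)) else \<zero>.A)"
 proof (rule Z.finsum_eqI)
  fix l assume "l : {..<n}"
  then have l: "l < n" by simp
  have "TA (%u. if l = j then psi u else \<zero>.K) (f (p l)) = (\<Sum>.RR i:{..<n}. ?t i l)"
  proof (rule T_sum[OF comod_A fp[OF l]])
   show "(%u. psi ((u *.H S (c l i)) *.H c i j)) : D" if "i : {..<n}" for i using d2[OF l] that by simp
   show "(%u. if l = j then psi u else \<zero>.K) : D" using psi dual_const_zero by (cases "l = j") auto
   fix h assume h: "h <: H"
   have "(\<Sum>.K i:{..<n}. psi ((h *.H S (c l i)) *.H c i j)) = (\<Sum>.K i:{..<n}. psi (h *.H (S (c l i) *.H c i j)))"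
    using h psi cc[OF l] cc[OF _ j] by (intro K.finsum_eqI) (auto simp: H.m_assoc)
   also have "... = psi (h *.H (\<Sum>.H i:{..<n}. S (c l i) *.H c i j))"
    using cc[OF l] cc[OF _ j] by (intro dual_finsum[OF dual_left[OF psi h], symmetric]) auto
   also have "... = (if l = j then psi h else \<zero>.K)"
    using comat_antipode(1)[OF c, of l j] l j h dual_zero[OF psi] by simp
   finally show "(if l = j then psi h else \<zero>.K) = (\<Sum>.K i:{..<n}. psi ((h *.H S (c l i)) *.H c i j))" ..
  qed simp
  moreover have "TA (%u. if l = j then psi u else \<zero>.K) (f (p l)) = (if l = j then TA psi (f (p l)) else \<zero>.A)"
  proof (cases "l = j")
   case False
   have "TA (%h. \<zero>.K) (f (p l)) = ks \<zero>.K **.RR TA eps (f (p l))"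
    using eps by (intro T_scale_functional[OF comod_A fp[OF l] eps dual_const_zero]) auto
   then show ?thesis using False fp[OF l] eps by simp
  qed simp
  ultimately show "(\<Sum>.A i:{..<n}. ?t i l) = (if l = j then TA psi (f (p l)) else \<zero>.A)" by simp
  show "(if l = j then TA psi (f (p l)) else \<zero>.A) <: A" using fp[OF l] psi by (cases "l = j") auto
 qed
 also have "... = TA psi (f (p j))" using j fp[OF j] psi by (intro Z.finsum_delta) auto
 finally show ?thesis ..
qed

end

end

section \<open>Quotient rings and coherence\<close>

abbreviation frn :: "('a, 'c) ring_scheme => nat => ('a, nat => 'a) module" where
 "frn A n \<equiv> free_right_module A {..<n}"

lemma a_inv_right_regular [simp]: "a_inv (right_regular A) = a_inv A"
 by (intro ext) (simp add: a_inv_def m_inv_def)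

lemma a_minus_right_regular [simp]: "a_minus (right_regular A) = a_minus A"
 by (intro ext) (simp add: a_minus_def)

text \<open>Finite generation is expressed inside the ambient module, so that images and preimages
  of submodules can be compared without changing the carrier.\<close>

definition fg :: "('a, 'c) ring_scheme => ('a, 'm, 'd) module_scheme => 'm set => bool" where
 "fg A M P \<longleftrightarrow> submodule P A M &
   (EX X. finite X & X \<subseteq> P & (ALL N. submodule N A M & X \<subseteq> N --> P \<subseteq> N))"

lemma submodule_preimage:
 assumes "right_module A M" "right_module A N" "f : mod_hom A M N" "submodule P A N"
 shows "submodule {x : carrier M. f x : P} A M"
proof -
 interpret M: right_module A M by fact
 interpret N: right_module A N by fact
 note P = N.submoduleD[OF assms(4)]
 show ?thesis
  using assms(3) P by (intro M.submoduleI')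
   (auto simp: mod_hom_add[OF assms(3)] mod_hom_smult[OF assms(3)] mod_hom_zero[OF assms(3,1,2)] M.smult_closed)
qed

lemma (in right_module) submodule_inter:
 "[|submodule N A M; submodule P A M|] ==> submodule (N \<inter> P) A M"
 using submoduleD by (intro submoduleI') auto

lemma (in ring) free_submodule_top:
 assumes "submodule N R (free_right_module R X)" "!!x. x : X ==> fbasis R X x : N"
 shows "carrier (free_right_module R X) \<subseteq> N"
proof
 interpret F: right_module R "free_right_module R X" by (rule right_module_free)
 fix c assume c: "c <: (free_right_module R X)"
 have "c = free_lift R (free_right_module R X) X (%x. fbasis R X x) c"
  using F.free_hom_expand[OF mod_hom_ident c] by simp
 also have "... : N"
  unfolding free_lift_def using c assms
  by (intro F.submodule_finsum[OF assms(1)] F.submoduleD(5)[OF assms(1)]) (auto simp: free_at)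
 finally show "c : N" .
qed

context right_module
begin

lemma submodule_restrict:
 assumes "submodule P A M"
 shows "submodule N A (M(|carrier := P|)) \<longleftrightarrow> submodule N A M & N \<subseteq> P"
proof -
 interpret P: right_module A "M(|carrier := P|)" by (rule right_module_submodule[OF assms])
 note P = submoduleD[OF assms]
 show ?thesis
 proof (intro iffI conjI)
  assume N: "submodule N A (M(|carrier := P|))"
  show "N \<subseteq> P" using P.submoduleD(1)[OF N] by simp
  show "submodule N A M"
   using P.submoduleD[OF N] P(1) by (intro submoduleI') auto
 next
  assume N: "submodule N A M & N \<subseteq> P"
  show "submodule N A (M(|carrier := P|))"
   using N submoduleD[of N] by (intro P.submoduleI') auto
 qed
qed

lemma fg_iff_finitely_generated:
 assumes P: "submodule P A M"
 shows "fg A M P \<longleftrightarrow> finitely_generated A (M(|carrier := P|))"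
proof -
 have "(ALL N. submodule N A M & X \<subseteq> N --> P \<subseteq> N) \<longleftrightarrow>
   (ALL N. (submodule N A M & N \<subseteq> P) & X \<subseteq> N --> P \<subseteq> N)" if "X \<subseteq> P" for X
 proof (intro iffI allI impI)
  fix N assume "ALL N. (submodule N A M & N \<subseteq> P) & X \<subseteq> N --> P \<subseteq> N" "submodule N A M & X \<subseteq> N"
  then have "P \<subseteq> N \<inter> P" using submodule_inter[OF _ P, of N] that by (metis Int_lower2 Int_subset_iff)
  then show "P \<subseteq> N" by auto
 qed auto
 note eq = this
 have carr: "carrier (M(|carrier := P|)) = P" by simp
 show ?thesis
  unfolding fg_def finitely_generated_def submodule_restrict[OF P] carr
  using P by (simp only: simp_thms eq cong: conj_cong)
qed

lemma fg_range:
 assumes "f : mod_hom A (free_right_module A X) M" "finite X"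
 shows "fg A M (f ` carrier (free_right_module A X))"
 unfolding fg_def
proof (intro conjI exI[of _ "(%x. f (fbasis A X x)) ` X"] allI impI)
 let ?F = "free_right_module A X"
 have F: "right_module A ?F" by (rule R.right_module_free)
 show "submodule (f ` carrier ?F) A M"
  by (intro submodule_image[OF F right_module_axioms assms(1)] right_module.submodule_carrier F)
 show "(%x. f (fbasis A X x)) ` X \<subseteq> f ` carrier ?F" by (auto simp: R.fbasis_closed)
 fix N assume N: "submodule N A M & (%x. f (fbasis A X x)) ` X \<subseteq> N"
 have "carrier ?F \<subseteq> {c : carrier ?F. f c : N}"
  using N by (intro R.free_submodule_top submodule_preimage[OF F right_module_axioms assms(1)])
   (auto simp: R.fbasis_closed)
 then show "f ` carrier ?F \<subseteq> N" by auto
qed (use assms in auto)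

lemma fg_cover:
 assumes "fg A M P"
 obtains n :: nat and y where "!!i. i < n ==> y i : P" "free_lift A M {..<n} y : mod_hom A (frn A n) M"
  "free_lift A M {..<n} y ` carrier (frn A n) = P"
proof -
 obtain X where P: "submodule P A M" and X: "finite X" "X \<subseteq> P"
  and top: "!!N. submodule N A M ==> X \<subseteq> N ==> P \<subseteq> N"
  using assms by (auto simp: fg_def)
 obtain n :: nat and y where y: "X = y ` {..<n}"
  using X(1) by (metis finite_imp_nat_seg_image_inj_on lessThan_def)
 have yP: "y i : P" if "i < n" for i using X(2) y that by auto
 have yM: "y i <: M" if "i : {..<n}" for i using yP submoduleD(2)[OF P] that by simp
 have hom: "free_lift A M {..<n} y : mod_hom A (frn A n) M" by (rule free_lift_hom) (rule yM)
 note F = R.right_module_free[of "{..<n}"]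
 have "free_lift A M {..<n} y ` carrier (frn A n) \<subseteq> P"
 proof (rule image_subsetI)
  fix c assume c: "c <: (frn A n)"
  show "free_lift A M {..<n} y c : P"
   unfolding free_lift_def using c yP
   by (intro submodule_finsum[OF P] submoduleD(5)[OF P]) (auto simp: free_at)
 qed
 moreover have "P \<subseteq> free_lift A M {..<n} y ` carrier (frn A n)"
 proof (rule top)
  show "submodule (free_lift A M {..<n} y ` carrier (frn A n)) A M"
   by (intro submodule_image[OF F right_module_axioms hom] right_module.submodule_carrier F)
  have "y i : free_lift A M {..<n} y ` carrier (frn A n)" if "i < n" for i
   using free_lift_fbasis[where X="{..<n}" and u=y and x=i, OF yM] that
    R.fbasis_closed[of "{..<n}" i] by (metis image_eqI lessThan_iff)
  then show "X \<subseteq> free_lift A M {..<n} y ` carrier (frn A n)" using y by auto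
 qed
 ultimately show ?thesis using that[OF yP hom] by blast
qed

end

lemma fg_image:
 assumes "right_module A M" "right_module A N" "f : mod_hom A M N" "fg A M P"
 shows "fg A N (f ` P)"
proof -
 obtain X where P: "submodule P A M" and X: "finite X" "X \<subseteq> P"
  and top: "!!L. submodule L A M ==> X \<subseteq> L ==> P \<subseteq> L"
  using assms(4) by (auto simp: fg_def)
 note PM = right_module.submoduleD(1)[OF assms(1) P]
 have "f ` P \<subseteq> L" if L: "submodule L A N" "f ` X \<subseteq> L" for L
  using top[OF submodule_preimage[OF assms(1-3) L(1)]] L(2) X(2) PM by auto
 then show ?thesis
  unfolding fg_def using X by (intro conjI submodule_image[OF assms(1-3) P] exI[of _ "f ` X"]) auto
qed

text \<open>The image of \<chi> is a finitely generated right ideal, so coherence presents it by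
  some \<open>f\<close> on \<open>A^n\<close> with finitely generated kernel. Lifts \<open>B\<close>
  and \<open>C\<close> between the two covers satisfy f B = \<chi> and \<chi> C = f. Then z = (z - C
  B z) + C (B z), with B z in the kernel of \<open>f\<close> when \<chi> z = 0, so finitely many
  elements generate the kernel of \<chi>.\<close>

lemma fg_kernel_functional:
 assumes A: "ring A" and coh: "right_coherent A" and \<chi>: "\<chi> : mod_hom A (frn A r) (right_regular A)"
 shows "fg A (frn A r) {z : carrier (frn A r). \<chi> z = \<zero>.A}"
proof -
 interpret A: ring A by fact
 let ?RR = "right_regular A" and ?F = "frn A r"
 note RR = A.right_module_right_regular and F = A.right_module_free[of "{..<_::nat}"]
 interpret RR: right_module A ?RR by (rule RR)
 interpret F: right_module A ?F by (rule F)
 define I where "I = \<chi> ` carrier ?F"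
 have fgI: "fg A ?RR I" unfolding I_def by (rule RR.fg_range[OF \<chi>]) simp
 then have I: "right_ideal I A" by (simp add: fg_def)
 note RI = RR.right_module_submodule[OF I]
 have "finitely_presented A (?RR(|carrier := I|))"
  using coh fgI RR.fg_iff_finitely_generated[OF I] I unfolding right_coherent_def by blast
 then obtain n :: nat and f where f: "f : mod_hom A (frn A n) (?RR(|carrier := I|))"
   and fI: "f ` carrier (frn A n) = I"
   and ker: "finitely_generated A (frn A n(|carrier := a_kernel (frn A n) (?RR(|carrier := I|)) f|))"
  unfolding finitely_presented_def by auto
 interpret Fn: right_module A "frn A n" by (rule F)
 have kereq: "a_kernel (frn A n) (?RR(|carrier := I|)) f = {x : carrier (frn A n). f x = \<zero>.A}"
  by (simp add: a_kernel_def')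
 have subker: "submodule {x : carrier (frn A n). f x = \<zero>.A} A (frn A n)"
  using submodule_kernel[OF F RI f] by simp
 have "fg A (frn A n) {x : carrier (frn A n). f x = \<zero>.A}"
  using ker[unfolded kereq] Fn.fg_iff_finitely_generated[OF subker] by simp
 then obtain S where S: "finite S" "S \<subseteq> {x : carrier (frn A n). f x = \<zero>.A}"
  and S': "ALL N. submodule N A (frn A n) & S \<subseteq> N --> {x : carrier (frn A n). f x = \<zero>.A} \<subseteq> N"
  unfolding fg_def by (elim conjE exE) (rule that)
 note Stop = S'[rule_format, OF conjI]
 have f': "f : mod_hom A (frn A n) ?RR"
  using f I RR.submoduleD(1)[OF I] by (auto simp: mod_hom_mem)
 have "ALL i. EX z:carrier ?F. i < n --> \<chi> z = f (fbasis A {..<n} i)"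
  using fI A.fbasis_closed[of "{..<n}"] unfolding I_def by (metis (no_types, lifting) F.M.zero_closed image_iff)
 then obtain cv where cv: "!!i. cv i <: ?F" "!!i. i < n ==> \<chi> (cv i) = f (fbasis A {..<n} i)" by metis
 have "ALL j. EX z:carrier (frn A n). j < r --> f z = \<chi> (fbasis A {..<r} j)"
  using fI A.fbasis_closed[of "{..<r}"] unfolding I_def by (metis (no_types, lifting) Fn.M.zero_closed image_iff)
 then obtain bv where bv: "!!j. bv j <: (frn A n)" "!!j. j < r ==> f (bv j) = \<chi> (fbasis A {..<r} j)" by metis
 define C where "C = free_lift A ?F {..<n} cv"
 define B where "B = free_lift A (frn A n) {..<r} bv"
 have C: "C : mod_hom A (frn A n) ?F" unfolding C_def by (rule F.free_lift_hom) (rule cv)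
 have B: "B : mod_hom A ?F (frn A n)" unfolding B_def by (rule Fn.free_lift_hom) (rule bv)
 have \<chi>C: "\<chi> (C x) = f x" if "x <: (frn A n)" for x
 proof (rule RR.free_hom_eqI[OF mod_hom_compose[OF \<chi> C] f' _ that])
  fix i assume "i : {..<n}"
  then show "\<chi> (C (fbasis A {..<n} i)) = f (fbasis A {..<n} i)"
   unfolding C_def using F.free_lift_fbasis[of "{..<n}" cv i] cv by simp
 qed
 have fB: "f (B x) = \<chi> x" if "x <: ?F" for x
 proof (rule RR.free_hom_eqI[OF mod_hom_compose[OF f' B] \<chi> _ that])
  fix i assume "i : {..<r}"
  then show "f (B (fbasis A {..<r} i)) = \<chi> (fbasis A {..<r} i)"
   unfolding B_def using Fn.free_lift_fbasis[of "{..<r}" bv i] bv by simp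
 qed
 let ?h = "%z. z -.?F C (B z)"
 have h: "?h : mod_hom A ?F ?F" by (intro mod_hom_diff F mod_hom_ident mod_hom_compose[OF C B])
 have Bc: "B z <: (frn A n)" "C (B z) <: ?F" if "z <: ?F" for z
  using mod_hom_closed[OF B that] mod_hom_closed[OF C] by auto
 have hK: "\<chi> (?h z) = \<zero>.A" if "z <: ?F" for z
  using mod_hom_minus[OF \<chi> F RR that Bc(2)[OF that]] \<chi>C[OF Bc(1)[OF that]] fB[OF that]
   mod_hom_closed[OF \<chi> that] by (simp add: a_minus_def A.r_neg)
 let ?X = "(%j. ?h (fbasis A {..<r} j)) ` {..<r} \<union> C ` S"
 have top: "{z : carrier ?F. \<chi> z = \<zero>.A} \<subseteq> N" if N: "submodule N A ?F" "?X \<subseteq> N" for N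
 proof
  fix z assume z: "z : {z : carrier ?F. \<chi> z = \<zero>.A}"
  have "carrier ?F \<subseteq> {z : carrier ?F. ?h z : N}"
   using N(2) by (intro A.free_submodule_top submodule_preimage[OF F F h N(1)]) (auto simp: A.fbasis_closed)
  then have "?h z : N" using z by auto
  moreover have "C (B z) : N"
  proof -
   have "S \<subseteq> {x : carrier (frn A n). C x : N}" using N(2) S(2) by auto
   from Stop[OF submodule_preimage[OF F F C N(1)] this, THEN subsetD, of "B z"]
   show ?thesis using Bc(1)[of z] fB[of z] z by simp
  qed
  ultimately have "?h z +.?F C (B z) : N" by (rule F.submoduleD(4)[OF N(1)])
  moreover have "?h z +.?F C (B z) = z"
   using z Bc(2)[of z] by (simp add: a_minus_def F.M.a_assoc F.M.l_neg)
  ultimately show "z : N" by simp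
 qed
 have "?X \<subseteq> {z : carrier ?F. \<chi> z = \<zero>.A}"
  using S(2) \<chi>C mod_hom_closed[OF C] hK[OF A.fbasis_closed] mod_hom_closed[OF h A.fbasis_closed] by auto
 with top S(1) submodule_kernel[OF F RR \<chi>] show ?thesis
  unfolding fg_def by (intro conjI exI[of _ ?X]) auto
qed

lemma (in ring) free_coord_hom: "x : X ==> (%c. c x) : mod_hom R (free_right_module R X) (right_regular R)"
 by (rule mod_homI) (auto simp: free_at free_at_simps)

text \<open>Coordinates are treated one at a time: the common kernel of the first ones is an image
  of some \<open>A^t\<close>, and the next coordinate is a functional on that
  \<open>A^t\<close>.\<close>

lemma fg_kernel:
 assumes A: "ring A" and coh: "right_coherent A" and phi: "phi : mod_hom A (frn A r) (frn A m)"
 shows "fg A (frn A r) {z : carrier (frn A r). phi z = \<zero>.(frn A m)}"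
proof -
 interpret A: ring A by fact
 let ?RR = "right_regular A" and ?F = "frn A r"
 note RR = A.right_module_right_regular and F = A.right_module_free[of "{..<_::nat}"]
 interpret F: right_module A ?F by (rule F)
 interpret Fm: right_module A "frn A m" by (rule F)
 have key: "fg A ?F {z : carrier ?F. ALL i<m'. phi z i = \<zero>.A}" if "m' \<le> m" for m'
  using that
 proof (induction m')
  case 0
  show ?case using F.fg_range[OF mod_hom_ident] by simp
 next
  case (Suc m')
  then have IH: "fg A ?F {z : carrier ?F. ALL i<m'. phi z i = \<zero>.A}" and m': "m' : {..<m}" by auto
  obtain t :: nat and w where W: "free_lift A ?F {..<t} w : mod_hom A (frn A t) ?F"
   "free_lift A ?F {..<t} w ` carrier (frn A t) = {z : carrier ?F. ALL i<m'. phi z i = \<zero>.A}"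
   by (rule F.fg_cover[OF IH]) (rule that)
  let ?W = "free_lift A ?F {..<t} w"
  have \<chi>: "(%z. phi (?W z) m') : mod_hom A (frn A t) ?RR"
   by (rule mod_hom_compose[OF A.free_coord_hom[OF m'] mod_hom_compose[OF phi W(1)]])
  have "?W ` {z : carrier (frn A t). phi (?W z) m' = \<zero>.A} = {z : ?W ` carrier (frn A t). phi z m' = \<zero>.A}"
   by auto
  also have "... = {z : carrier ?F. ALL i<Suc m'. phi z i = \<zero>.A}"
   unfolding W(2) by (auto simp: less_Suc_eq)
  finally show ?case
   using fg_image[OF F F W(1) fg_kernel_functional[OF A coh \<chi>]] by simp
 qed
 have eq: "{z : carrier ?F. ALL i<m. phi z i = \<zero>.A} = {z : carrier ?F. phi z = \<zero>.(frn A m)}"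
  using mod_hom_closed[OF phi] by (auto intro!: free_ext[where A=A and X="{..<m}"] simp: free_at_simps)
 show ?thesis using key[OF order_refl] unfolding eq .
qed

text \<open>Regularity for a column: v = v (y v) for some functional \<open>y\<close>. It is built
  by induction on the number of coordinates for which the identity already holds.\<close>

lemma von_neumann_column:
 assumes Q: "von_neumann_regular Q" and v: "v <: (frn Q n)"
 shows "EX y:mod_hom Q (frn Q n) (right_regular Q). y v **.(frn Q n) v = v"
proof -
 have ringQ: "ring Q" and reg: "!!x. x <: Q ==> EX y:carrier Q. x *.Q y *.Q x = x"
  using Q by (auto simp: von_neumann_regular_def)
 interpret Q: ring Q by fact
 let ?RR = "right_regular Q" and ?F = "frn Q n"
 note RR = Q.right_module_right_regular and F = Q.right_module_free[of "{..<n}"]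
 interpret F: right_module Q ?F by (rule F)
 have "EX y:mod_hom Q ?F ?RR. ALL i<m. v i *.Q y v = v i" if "m \<le> n" for m
  using that
 proof (induction m)
  case 0
  have "(%_. \<zero>.Q) : mod_hom Q ?F ?RR" by (rule mod_homI) auto
  then show ?case by auto
 next
  case (Suc m)
  obtain y where y: "y : mod_hom Q ?F ?RR" "!!i. i < m ==> v i *.Q y v = v i"
   using Suc by auto
  have m: "m : {..<n}" using Suc by simp
  define g a where "g = y v" and "a = v m"
  have ga: "g <: Q" "a <: Q"
   unfolding g_def a_def using mod_hom_closed[OF y(1) v] free_at[OF v m] by auto
  obtain z where z: "z <: Q" "(a -.Q a *.Q g) *.Q z *.Q (a -.Q a *.Q g) = a -.Q a *.Q g"
   using reg[of "a -.Q a *.Q g"] ga by auto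
  have mult: "(%x. b *.Q f x) : mod_hom Q ?F ?RR" if "b <: Q" "f : mod_hom Q ?F ?RR" for b f
   using that by (auto simp: mod_hom_mem Q.r_distr Q.m_assoc)
  \<comment> \<open>The factor 1 - g preserves the coordinates already treated, because v_i (1 - g)
    = 0 there. In the new coordinate the value becomes a g + (a - a g) z (a - a g), which is
    \<open>a\<close> by the choice of \<open>z\<close>.\<close>
  let ?y = "%w. y w +.Q ((\<one>.Q -.Q g) *.Q z) *.Q (w m -.Q a *.Q y w)"
  have diff: "(%w. w m -.Q a *.Q y w) : mod_hom Q ?F ?RR"
   using mod_hom_diff[OF F RR Q.free_coord_hom[OF m] mult[OF ga(2) y(1)]]
   by simp
  have y1: "?y : mod_hom Q ?F ?RR"
   using mod_hom_sum[OF F RR y(1) mult[OF _ diff]] ga z by simp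
  have y2: "v i *.Q ?y v = v i" if "i < Suc m" for i
  proof (cases "i = m")
   case True
   have "a *.Q ?y v = a *.Q g +.Q (a -.Q a *.Q g) *.Q z *.Q (a -.Q a *.Q g)"
    using ga z(1) unfolding g_def[symmetric] a_def[symmetric] by algebra
   also have "... = a" unfolding z(2) using ga by algebra
   finally show ?thesis using True by (simp add: a_def)
  next
   case False
   have vi: "v i <: Q" "v i *.Q g = v i"
    using free_at[OF v, of i] that Suc.prems y(2)[of i] False by (auto simp: g_def)
   have "v i *.Q ?y v = v i *.Q g +.Q (v i -.Q v i *.Q g) *.Q (z *.Q (a -.Q a *.Q g))"
    using ga z(1) vi(1) unfolding g_def[symmetric] a_def[symmetric] by algebra
   also have "... = v i" unfolding vi(2) using vi(1) ga z(1) by algebra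
   finally show ?thesis .
  qed
  show ?case by (intro bexI[of _ ?y] allI impI y1 y2)
 qed
 from this[OF order_refl] obtain y where y: "y : mod_hom Q ?F ?RR" "ALL i<n. v i *.Q y v = v i" by auto
 have "y v **.?F v = v"
  using y(2) v mod_hom_closed[OF y(1) v] by (intro free_ext[OF F.smult_closed]) (auto simp: free_at_simps)
 with y(1) show ?thesis by blast
qed

text \<open>Finitely generated submodules of \<open>Q^n\<close> are direct summands: the
  endomorphism w \<mapsto> \<Sum> X_j Y_j(w) has image in the span of the columns and fixes each of
  them. A new column is handled as in orthogonalisation, by applying
  \<open>von_neumann_column\<close> to its residue modulo the previous projector.\<close>

lemma von_neumann_projector:
 fixes r :: nat
 assumes Q: "von_neumann_regular Q" and X: "!!j. j < r ==> X j <: (frn Q n)"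
 shows "EX Y. (ALL j<r. Y j : mod_hom Q (frn Q n) (right_regular Q)) &
  (ALL k<r. (\<Sum>.(frn Q n) j:{..<r}. Y j (X k) **.(frn Q n) X j) = X k)"
 using X
proof (induction r rule: nat.induct)
 case (Suc r)
 have ringQ: "ring Q" using Q by (auto simp: von_neumann_regular_def)
 interpret Q: ring Q by fact
 let ?RR = "right_regular Q" and ?F = "frn Q n"
 note RR = Q.right_module_right_regular and F = Q.right_module_free[of "{..<n}"]
 interpret F: right_module Q ?F by (rule F)
 obtain Y where Y: "!!j. j < r ==> Y j : mod_hom Q ?F ?RR"
  and YX: "!!k. k < r ==> (\<Sum>.?F j:{..<r}. Y j (X k) **.?F X j) = X k"
  using Suc.IH[OF Suc.prems] by auto
 define e where "e w = (\<Sum>.?F j:{..<r}. Y j w **.?F X j)" for w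
 have Yc: "Y j w <: Q" if "j < r" "w <: ?F" for j w using mod_hom_closed[OF Y that(2)] that by simp
 have Xc: "X j <: ?F" if "j \<le> r" for j using Suc.prems that by simp
 have e: "e : mod_hom Q ?F ?F"
  unfolding e_def
 proof (intro mod_hom_finsum_fun F)
  fix j assume j: "j : {..<r}"
  have "(%a. a **.?F X j) : mod_hom Q ?RR ?F"
   using Xc[of j] j by (intro mod_homI) (auto simp: F.smult_closed F.smult_l_distr F.smult_assoc)
  from mod_hom_compose[OF this Y] show "(%w. Y j w **.?F X j) : mod_hom Q ?F ?F" using j by simp
 qed
 note ec = mod_hom_closed[OF e]
 let ?v = "X r"
 define v' where "v' = ?v -.?F e ?v"
 have v: "?v <: ?F" using Xc by simp
 have v': "v' <: ?F" unfolding v'_def using v ec by simp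
 obtain y where y: "y : mod_hom Q ?F ?RR" "y v' **.?F v' = v'" using von_neumann_column[OF Q v'] by auto
 define y' where "y' w = y (w -.?F e w)" for w
 have y': "y' : mod_hom Q ?F ?RR"
  unfolding y'_def by (intro mod_hom_compose[OF y(1)] mod_hom_diff F mod_hom_ident e)
 note y'c = mod_hom_closed[OF y', simplified]
 \<comment> \<open>The new projector is e w + v' y'(w) with v' = X_r - \<Sum> X_j Y_j(X_r); these
   are its coefficients at the columns. The functional \<open>y'\<close> is zero on the earlier
   columns, since \<open>e\<close> fixes them.\<close>
 define Y' where "Y' j w = (if j = r then y' w else Y j w -.Q Y j ?v *.Q y' w)" for j w
 have Y': "Y' j : mod_hom Q ?F ?RR" if "j < Suc r" for j
 proof (cases "j = r")
  case True
  then show ?thesis using y' by (simp add: Y'_def[abs_def])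
 next
  case False
  then have j: "j < r" using that by simp
  have "(%w. Y j ?v *.Q y' w) : mod_hom Q ?F ?RR"
   using y' Yc[OF j v] by (auto simp: mod_hom_mem Q.r_distr Q.m_assoc)
  from mod_hom_diff[OF F RR Y[OF j] this] show ?thesis
   using False by (simp add: Y'_def[abs_def])
 qed
 have expand: "(\<Sum>.?F j:{..<Suc r}. Y' j w **.?F X j) = e w +.?F y' w **.?F v'" if w: "w <: ?F" for w
 proof -
  have neg: "(a -.Q b) **.?F x = a **.?F x -.?F b **.?F x" if "a <: Q" "b <: Q" "x <: ?F" for a b x
  proof -
   have h: "(%a. a **.?F x) : mod_hom Q ?RR ?F"
    using that by (intro mod_homI) (auto simp: F.smult_closed F.smult_l_distr F.smult_assoc)
   show ?thesis using mod_hom_minus[OF h RR F, of a b] that by simp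
  qed
  have diff: "(\<Sum>.?F j:{..<r}. f j -.?F g j) = finsum ?F f {..<r} -.?F finsum ?F g {..<r}"
   if "!!j. j < r ==> f j <: ?F" "!!j. j < r ==> g j <: ?F" for f g
  proof -
   have "(\<Sum>.?F j:{..<r}. -.?F g j) = -.?F finsum ?F g {..<r}"
    using that by (intro finsum_additive[where f="%x. -.?F x", symmetric])
     (auto simp: F.M.minus_add intro: F.abelian_group_M F.M.abelian_monoid_axioms)
   then show ?thesis using that by (simp add: a_minus_def F.M.finsum_add)
  qed
  have "(\<Sum>.?F j:{..<Suc r}. Y' j w **.?F X j) = y' w **.?F X r +.?F (\<Sum>.?F j:{..<r}. Y' j w **.?F X j)"
   unfolding lessThan_Suc using Xc Yc[OF _ w] Yc[OF _ v] y'c[OF w]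
   by (subst F.M.finsum_insert) (auto simp: Y'_def intro!: F.smult_closed)
  also have "(\<Sum>.?F j:{..<r}. Y' j w **.?F X j) = (\<Sum>.?F j:{..<r}. Y j w **.?F X j -.?F y' w **.?F (Y j ?v **.?F X j))"
   using Xc Yc[OF _ w] Yc[OF _ v] y'c[OF w]
   by (intro F.M.finsum_eqI) (auto simp: Y'_def neg F.smult_assoc intro!: F.smult_closed F.M.minus_closed)
  also have "... = e w -.?F y' w **.?F e ?v"
   unfolding e_def using Xc Yc[OF _ w] Yc[OF _ v] y'c[OF w]
   by (subst diff) (auto simp: F.smult_closed intro!: arg_cong2[where f="a_minus ?F"] F.smult_finsum[symmetric])
  also have "y' w **.?F X r +.?F (e w -.?F y' w **.?F e ?v) = e w +.?F (y' w **.?F X r -.?F y' w **.?F e ?v)"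
   using ec[OF w] ec[OF v] v y'c[OF w] by (simp add: a_minus_def F.M.a_lcomm F.smult_closed)
  also have "y' w **.?F X r -.?F y' w **.?F e ?v = y' w **.?F v'"
  proof -
   have "y' w **.?F v' +.?F y' w **.?F e ?v = y' w **.?F X r"
    using v v' ec[OF v] y'c[OF w]
    by (simp add: F.smult_r_distr[symmetric]) (simp add: v'_def a_minus_def F.M.a_assoc F.M.l_neg)
   then show ?thesis
    using v v' ec[OF v] y'c[OF w]
    by (metis F.M.add.inv_solve_right' F.smult_closed a_minus_def F.M.minus_eq)
  qed
  finally show ?thesis .
 qed
 have YX': "(\<Sum>.?F j:{..<Suc r}. Y' j (X k) **.?F X j) = X k" if "k < Suc r" for k
 proof (cases "k = r")
  case True
  have "y' ?v **.?F v' = v'" using y(2) by (simp add: y'_def v'_def)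
  then show ?thesis
   using True v ec[OF v] by (simp only: expand[OF v]) (simp add: v'_def a_minus_def F.M.a_ac F.M.r_neg1 F.M.r_neg2 F.M.r_neg)
 next
  case False
  then have k: "k < r" using that by simp
  have "y' (X k) = \<zero>.Q"
   using YX[OF k] Xc[of k] k mod_hom_zero[OF y(1) F RR] by (simp add: y'_def e_def F.M.r_neg a_minus_def)
  then show ?thesis
   using YX[OF k] Xc[of k] k v' expand[of "X k"] by (simp add: e_def F.zero_smult)
 qed
 show ?case by (intro exI[of _ Y'] conjI allI impI Y' YX')
qed simp

lemma nonzerodivisors_mult:
 assumes A: "ring A" and s: "s : nonzerodivisors A" and t: "t : nonzerodivisors A"
 shows "s *.A t : nonzerodivisors A"
proof -
 interpret A: ring A by fact
 have st: "s <: A" "t <: A" using s t unfolding nonzerodivisors_def by blast+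
 have s0: "x = \<zero>.A" if "s *.A x = \<zero>.A \<or> x *.A s = \<zero>.A" "x <: A" for x
  using s that unfolding nonzerodivisors_def by blast
 have t0: "x = \<zero>.A" if "t *.A x = \<zero>.A \<or> x *.A t = \<zero>.A" "x <: A" for x
  using t that unfolding nonzerodivisors_def by blast
 show ?thesis
  unfolding nonzerodivisors_def
 proof (intro CollectI conjI ballI impI)
  fix x assume x: "x <: A"
  show "x = \<zero>.A" if "s *.A t *.A x = \<zero>.A"
   using that s0[of "t *.A x"] t0[of x] st x by (simp add: A.m_assoc)
  show "x = \<zero>.A" if "x *.A (s *.A t) = \<zero>.A"
   using that t0[of "x *.A s"] s0[of x] st x by (simp add: A.m_assoc[symmetric])
 qed (use st in auto)
qed

locale quotient_ring = fixes A :: "('a, 'c) ring_scheme" and Q :: "('q, 'd) ring_scheme" and \<iota>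
 assumes quot: "classical_quotient_ring A Q \<iota>"
begin

sublocale A: ring A using quot by (simp add: classical_quotient_ring_def)
sublocale Q: ring Q using quot by (simp add: classical_quotient_ring_def)

lemma \<iota>: "\<iota> : ring_hom A Q" and inj: "inj_on \<iota> (carrier A)"
 and unit: "s : nonzerodivisors A ==> \<iota> s : Units Q"
 and denom: "x <: Q ==> EX s:nonzerodivisors A. \<iota> s *.Q x : \<iota> ` carrier A"
  "x <: Q ==> EX s:nonzerodivisors A. x *.Q \<iota> s : \<iota> ` carrier A"
 using quot unfolding classical_quotient_ring_def by blast+

lemma nzd_closed: "s : nonzerodivisors A ==> s <: A"
 by (simp add: nonzerodivisors_def)

sublocale \<iota>: ring_hom_ring A Q \<iota> by (rule ring_hom_ringI2) (auto simp: \<iota> A.ring_axioms Q.ring_axioms)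

lemma nzd_one: "\<one>.A : nonzerodivisors A"
 by (auto simp: nonzerodivisors_def)

text \<open>Left denominators suit functionals, which stay linear only under left multiplication;
  the version on the right suits the coefficients of relations in a right module.\<close>

lemma common_denominator_left:
 "[|finite Z; Z \<subseteq> carrier Q|] ==> EX s:nonzerodivisors A. ALL z:Z. \<iota> s *.Q z : \<iota> ` carrier A"
proof (induction Z rule: finite_induct)
 case empty
 show ?case using nzd_one by auto
next
 case (insert x Z)
 then obtain s where s: "s : nonzerodivisors A" "!!z. z : Z ==> \<iota> s *.Q z : \<iota> ` carrier A" by auto
 note sA = nzd_closed[OF s(1)]
 obtain t where t: "t : nonzerodivisors A" "\<iota> t *.Q (\<iota> s *.Q x) : \<iota> ` carrier A"
  using denom(1)[of "\<iota> s *.Q x"] insert.prems sA by auto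
 note tA = nzd_closed[OF t(1)]
 have "\<iota> (t *.A s) *.Q z : \<iota> ` carrier A" if "z : insert x Z" for z
 proof -
  have "\<iota> (t *.A s) *.Q z = \<iota> t *.Q (\<iota> s *.Q z)" using that insert.prems sA tA by (auto simp: Q.m_assoc)
  moreover have mem: "\<iota> t *.Q \<iota> a : \<iota> ` carrier A" if "a <: A" for a
   using that tA by (metis A.m_closed \<iota>.hom_mult image_eqI)
  ultimately show ?thesis using s(2)[of z] t(2) that by (cases "z = x") auto
 qed
 with nonzerodivisors_mult[OF A.ring_axioms t(1) s(1)] show ?case by blast
qed

lemma common_denominator_right:
 "[|finite Z; Z \<subseteq> carrier Q|] ==> EX s:nonzerodivisors A. ALL z:Z. z *.Q \<iota> s : \<iota> ` carrier A"
proof (induction Z rule: finite_induct)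
 case empty
 show ?case using nzd_one by auto
next
 case (insert x Z)
 then obtain s where s: "s : nonzerodivisors A" "!!z. z : Z ==> z *.Q \<iota> s : \<iota> ` carrier A" by auto
 note sA = nzd_closed[OF s(1)]
 obtain t where t: "t : nonzerodivisors A" "x *.Q \<iota> s *.Q \<iota> t : \<iota> ` carrier A"
  using denom(2)[of "x *.Q \<iota> s"] insert.prems sA by auto
 note tA = nzd_closed[OF t(1)]
 have "z *.Q \<iota> (s *.A t) : \<iota> ` carrier A" if "z : insert x Z" for z
 proof -
  have "z *.Q \<iota> (s *.A t) = z *.Q \<iota> s *.Q \<iota> t" using that insert.prems sA tA by (auto simp: Q.m_assoc)
  moreover have mem: "\<iota> a *.Q \<iota> t : \<iota> ` carrier A" if "a <: A" for a
   using that tA by (metis A.m_closed \<iota>.hom_mult image_eqI)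
  ultimately show ?thesis using s(2)[of z] t(2) that by (cases "z = x") auto
 qed
 with nonzerodivisors_mult[OF A.ring_axioms s(1) t(1)] show ?case by blast
qed

lemma \<iota>_finsum: "(!!i. i : I ==> f i <: A) ==> \<iota> (finsum A f I) = (\<Sum>.Q i:I. \<iota> (f i))"
 by (rule finsum_additive[OF A.abelian_monoid_axioms Q.is_abelian_group]) auto

text \<open>Over the regular ring \<open>Q\<close> a functional on a finitely generated submodule extends to the free
 module; clearing denominators brings the extension back to \<open>A\<close>.\<close>

lemma functional_extends_up_to_denominator:
 assumes reg: "von_neumann_regular Q" and P: "submodule P A (frn A n)"
  and p: "!!j. j < r ==> p j : P" and span: "P \<subseteq> span A (frn A n) {..<r::nat} p"
  and B: "finite B" and f: "!!b. b : B ==> f b : mod_hom A (frn A n(|carrier := P|)) (right_regular A)"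
 shows "EX s:nonzerodivisors A. ALL b:B. EX g:mod_hom A (frn A n) (right_regular A). ALL x:P. g x = s *.A f b x"
proof -
 let ?F = "frn A n" and ?FQ = "frn Q n" and ?RA = "right_regular A" and ?RQ = "right_regular Q"
 let ?P = "?F(|carrier := P|)"
 note F = A.right_module_free[of "{..<n}"] and FQ = Q.right_module_free[of "{..<n}"]
 note RA = A.right_module_right_regular and RQ = Q.right_module_right_regular
 interpret F: right_module A ?F by (rule F)
 interpret FQ: right_module Q ?FQ by (rule FQ)
 interpret RA: right_module A ?RA by (rule RA)
 interpret RQ: right_module Q ?RQ by (rule RQ)
 note rmP = F.right_module_submodule[OF P]
 define X where "X j = (\<lambda>i\<in>{..<n}. \<iota> (p j i))" for j
 have pF: "p j <: ?F" if "j < r" for j using F.submoduleD(2)[OF P p[OF that]] .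
 have pA: "p j i <: A" if "j < r" "i < n" for i j using free_at[OF pF] that by simp
 have X: "X j <: ?FQ" if "j < r" for j
  using pA[OF that] by (auto simp: X_def free_right_module_simps)
 obtain Y where Y: "!!j. j < r ==> Y j : mod_hom Q ?FQ ?RQ"
  and YX: "!!k. k < r ==> (\<Sum>.?FQ j:{..<r}. Y j (X k) **.?FQ X j) = X k"
  using von_neumann_projector[where X=X and r=r, OF reg X] by auto
 have Yc: "Y j (X k) <: Q" if "j < r" "k < r" for j k using mod_hom_closed[OF Y X] that by simp
 have fp: "f b (p j) <: A" if "b : B" "j < r" for b j using mod_hom_closed[OF f[OF that(1)]] p[OF that(2)] by simp
 \<comment> \<open>The extension over \<open>Q\<close>: the projector followed by the prescribed
   values on the generators. It remains to see that it takes these values.\<close>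
 define G where "G b w = (\<Sum>.Q j:{..<r}. \<iota> (f b (p j)) *.Q Y j w)" for b w
 have G: "G b : mod_hom Q ?FQ ?RQ" if b: "b : B" for b
 proof -
  have "(%w. \<Sum>.?RQ j:{..<r}. \<iota> (f b (p j)) *.Q Y j w) : mod_hom Q ?FQ ?RQ"
  proof (intro mod_hom_finsum_fun FQ RQ)
   fix j assume "j : {..<r}"
   then show "(%w. \<iota> (f b (p j)) *.Q Y j w) : mod_hom Q ?FQ ?RQ"
    using Y[of j] fp[OF b, of j] by (auto simp: mod_hom_mem Q.r_distr Q.m_assoc)
  qed
  then show ?thesis by (simp add: G_def[abs_def])
 qed
 \<comment> \<open>The identity X_k = \<Sum> X_j Y_j(X_k) becomes, after multiplication by a right
   denominator \<open>t\<close>, a relation p_k t = \<Sum> p_j a_j over \<open>A\<close>, to which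
   \<open>f b\<close> can be applied. As \<open>t\<close> is invertible in \<open>Q\<close>, the
   equality follows there.\<close>
 have GX: "G b (X k) = \<iota> (f b (p k))" if b: "b : B" and k: "k < r" for b k
 proof -
  obtain t where t: "t : nonzerodivisors A" and ta: "!!j. j < r ==> Y j (X k) *.Q \<iota> t : \<iota> ` carrier A"
  proof -
   have "(%j. Y j (X k)) ` {..<r} \<subseteq> carrier Q" using Yc[OF _ k] by auto
   from common_denominator_right[OF _ this] show ?thesis using that by auto
  qed
  note tA = nzd_closed[OF t]
  have "ALL j. EX a. j < r --> a <: A & Y j (X k) *.Q \<iota> t = \<iota> a" using ta by auto
  then obtain a where a: "!!j. j < r ==> a j <: A" "!!j. j < r ==> Y j (X k) *.Q \<iota> t = \<iota> (a j)" by metis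
  have rel: "(\<Sum>.?F j:{..<r}. a j **.?F p j) = t **.?F p k"
  proof (rule free_ext)
   fix i assume i: "i : {..<n}"
   have "X k i = (\<Sum>.Q j:{..<r}. X j i *.Q Y j (X k))"
    using arg_cong[OF YX[OF k], of "%x. x i"] Q.free_finsum_at[OF i, of "{..<r}" "%j. Y j (X k) **.?FQ X j"]
     X Yc[OF _ k] i by (simp add: free_at_simps FQ.smult_closed)
   then have "\<iota> (p k i) *.Q \<iota> t = (\<Sum>.Q j:{..<r}. \<iota> (p j i) *.Q Y j (X k)) *.Q \<iota> t"
    using i by (simp add: X_def)
   also have "... = (\<Sum>.Q j:{..<r}. \<iota> (p j i) *.Q Y j (X k) *.Q \<iota> t)"
    using pA i Yc[OF _ k] tA by (intro Q.finsum_mult_right) auto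
   also have "... = (\<Sum>.Q j:{..<r}. \<iota> (p j i *.A a j))"
    using pA i Yc[OF _ k] tA a by (intro Q.finsum_eqI) (auto simp: Q.m_assoc)
   also have "... = \<iota> (\<Sum>.A j:{..<r}. p j i *.A a j)"
    using pA i a by (intro \<iota>_finsum[symmetric]) auto
   finally have "\<iota> (\<Sum>.A j:{..<r}. p j i *.A a j) = \<iota> (p k i *.A t)"
    using pA[OF k] i tA by simp
   then have "(\<Sum>.A j:{..<r}. p j i *.A a j) = p k i *.A t"
    using pA pA[OF k] i tA a by (intro inj_onD[OF inj]) (auto intro!: A.finsum_in)
   then show "(\<Sum>.?F j:{..<r}. a j **.?F p j) i = (t **.?F p k) i"
    using A.free_finsum_at[OF i, of "{..<r}" "%j. a j **.?F p j"] pF a i by (simp add: free_at_simps F.smult_closed)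
  qed (use pF a k tA in \<open>auto intro!: F.M.finsum_in F.smult_closed\<close>)
  have "(\<Sum>.A j:{..<r}. f b (p j) *.A a j) = f b (\<Sum>.?P j:{..<r}. a j **.?P p j)"
   using mod_hom_finsum[OF f[OF b] rmP RA, of "{..<r}" "%j. a j **.?P p j"] a p
    F.submoduleD(5)[OF P] mod_hom_smult[OF f[OF b]] fp[OF b] by (simp add: A.finsum_eqI cong: A.finsum_cong)
  also have "(\<Sum>.?P j:{..<r}. a j **.?P p j) = t **.?F p k"
   using F.finsum_submodule[OF P, of "{..<r}" "%j. a j **.?F p j"] rel a p F.submoduleD(5)[OF P] by simp
  also have "f b ... = f b (p k) *.A t" using mod_hom_smult[OF f[OF b] tA, of "p k"] p[OF k] by simp
  finally have fa: "(\<Sum>.A j:{..<r}. f b (p j) *.A a j) = f b (p k) *.A t" .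
  have "G b (X k) *.Q \<iota> t = (\<Sum>.Q j:{..<r}. \<iota> (f b (p j)) *.Q Y j (X k) *.Q \<iota> t)"
   unfolding G_def using fp[OF b] Yc[OF _ k] tA by (intro Q.finsum_mult_right) auto
  also have "... = (\<Sum>.Q j:{..<r}. \<iota> (f b (p j) *.A a j))"
   using fp[OF b] Yc[OF _ k] tA a by (intro Q.finsum_eqI) (auto simp: Q.m_assoc)
  also have "... = \<iota> (f b (p k)) *.Q \<iota> t"
   using \<iota>_finsum[of "{..<r}" "%j. f b (p j) *.A a j"] fp[OF b] fa a k tA by simp
  finally show ?thesis
   using unit[OF t] mod_hom_closed[OF G[OF b] X[OF k]] fp[OF b k]
   by (metis Q.Units_closed Q.Units_r_inv Q.m_assoc Q.r_one Q.Units_inv_closed \<iota>.hom_closed right_regular_simps(1))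
 qed
 have eQ: "fbasis Q {..<n} l <: ?FQ" for l by (rule Q.fbasis_closed)
 have Gc: "G b (fbasis Q {..<n} l) <: Q" if "b : B" for b l using mod_hom_closed[OF G[OF that] eQ] by simp
 \<comment> \<open>One left denominator for the values of all \<open>G b\<close> on the standard
   basis, hence for all these functionals at once.\<close>
 obtain s where s: "s : nonzerodivisors A"
  and sa: "!!b l. b : B ==> l < n ==> \<iota> s *.Q G b (fbasis Q {..<n} l) : \<iota> ` carrier A"
  using common_denominator_left[of "(%(b, l). G b (fbasis Q {..<n} l)) ` (B \<times> {..<n})"] B Gc
  by (auto simp: image_subset_iff split_paired_Ball_Sigma)
 note sA = nzd_closed[OF s]
 have "EX g:mod_hom A ?F ?RA. ALL x:P. g x = s *.A f b x" if b: "b : B" for b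
 proof -
  have "ALL l. EX a. l < n --> a <: A & \<iota> s *.Q G b (fbasis Q {..<n} l) = \<iota> a" using sa[OF b] by auto
  then obtain a where a: "!!l. l < n ==> a l <: A" "!!l. l < n ==> \<iota> s *.Q G b (fbasis Q {..<n} l) = \<iota> (a l)" by metis
  let ?g = "free_lift A ?RA {..<n} a"
  have g: "?g : mod_hom A ?F ?RA" by (rule RA.free_lift_hom) (use a in auto)
  have sf: "(%x. s *.A f b x) : mod_hom A ?P ?RA"
   using f[OF b] sA by (auto simp: mod_hom_mem A.r_distr A.m_assoc)
  have gp: "?g (p k) = s *.A f b (p k)" if k: "k : {..<r}" for k
  proof -
   have "\<iota> (?g (p k)) = \<iota> (\<Sum>.A l:{..<n}. a l *.A p k l)"
    using RA.free_lift_lessThan[of n a "p k"] a pF k by simp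
   also have "... = (\<Sum>.Q l:{..<n}. \<iota> (a l *.A p k l))" using a pA k by (intro \<iota>_finsum) auto
   also have "... = (\<Sum>.Q l:{..<n}. \<iota> s *.Q (G b (fbasis Q {..<n} l) *.Q X k l))"
    using a pA k sA Gc[OF b] by (intro Q.finsum_eqI) (auto simp: X_def Q.m_assoc[symmetric])
   also have "... = \<iota> s *.Q (\<Sum>.Q l:{..<n}. G b (fbasis Q {..<n} l) *.Q X k l)"
    using sA Gc[OF b] free_at[OF X] k by (intro Q.finsum_mult_left[symmetric]) auto
   also have "(\<Sum>.Q l:{..<n}. G b (fbasis Q {..<n} l) *.Q X k l) = G b (X k)"
    using RQ.free_hom_expand[OF G[OF b] X] RQ.free_lift_lessThan[of n "%l. G b (fbasis Q {..<n} l)" "X k"] Gc[OF b] X k by simp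
   also have "\<iota> s *.Q G b (X k) = \<iota> (s *.A f b (p k))" using GX[OF b] k sA fp[OF b] by simp
   finally show ?thesis
    using mod_hom_closed[OF g pF] sA fp[OF b] k by (intro inj_onD[OF inj]) auto
  qed
  have "?g x = s *.A f b x" if "x : P" for x
   using span that
   by (intro F.mod_hom_eq_on_span[where I="{..<r}" and x=p, OF RA P mod_hom_subdomain[OF g F.submoduleD(1)[OF P]] sf _ gp]) (use p in auto)
  with g show ?thesis by blast
 qed
 with s show ?thesis by blast
qed

end

section \<open>Extension of functionals\<close>

lemma fgE:
 assumes "fg A M P"
 obtains X where "finite X" "X \<subseteq> P" "ALL N. submodule N A M & X \<subseteq> N --> P \<subseteq> N"
 using assms unfolding fg_def by (elim conjE exE) (rule that)

lemma free_lifting: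
 assumes A: "ring A" and M: "right_module A M" and N: "right_module A N"
  and f: "f : mod_hom A (free_right_module A X) N" and \<pi>: "\<pi> : mod_hom A M N"
  and sub: "!!x. x <: (free_right_module A X) ==> f x : \<pi> ` carrier M"
 shows "EX g:mod_hom A (free_right_module A X) M. ALL c:carrier (free_right_module A X). \<pi> (g c) = f c"
proof -
 interpret A: ring A by fact
 interpret M: right_module A M by fact
 interpret N: right_module A N by fact
 have "ALL x. EX m. m <: M & \<pi> m = f (fbasis A X x)" using sub[OF A.fbasis_closed] by (metis imageE)
 then obtain u where u: "!!x. u x <: M" "!!x. \<pi> (u x) = f (fbasis A X x)" by metis
 have g: "free_lift A M X u : mod_hom A (free_right_module A X) M" by (rule M.free_lift_hom) (rule u)
 have "\<pi> (free_lift A M X u c) = f c" if "c <: (free_right_module A X)" for c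
  by (rule N.free_hom_eqI[OF mod_hom_compose[OF \<pi> g] f _ that]) (simp add: M.free_lift_fbasis u)
 with g show ?thesis by blast
qed

lemma projective_lifting:
 assumes W: "projective A W" and M: "right_module A M" and N: "right_module A N"
  and f: "f : mod_hom A W N" and \<pi>: "\<pi> : mod_hom A M N"
  and sub: "!!x. x <: W ==> f x : \<pi> ` carrier M"
 shows "EX g:mod_hom A W M. ALL w:carrier W. \<pi> (g w) = f w"
proof -
 obtain X :: "'c set" and i p where i: "i : mod_hom A W (free_right_module A X)"
  and p: "p : mod_hom A (free_right_module A X) W" and ip: "!!x. x <: W ==> p (i x) = x"
  using W unfolding projective_def by (elim conjE exE) (rule that, auto)
 have A: "ring A" using M by (simp add: right_module_def)
 obtain g where g: "g : mod_hom A (free_right_module A X) M"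
  "ALL c:carrier (free_right_module A X). \<pi> (g c) = f (p c)"
  using free_lifting[OF A M N mod_hom_compose[OF f p] \<pi>] sub[OF mod_hom_closed[OF p]] by blast
 have "\<pi> (g (i w)) = f w" if "w <: W" for w
  using g(2) mod_hom_closed[OF i that] ip[OF that] by simp
 with mod_hom_compose[OF g(1) i] show ?thesis by (intro bexI[of _ "%x. g (i x)"]) auto
qed

text \<open>Dimension shifting: this property passes to syzygies, and for \<open>Y = 0\<close> it says that \<open>\<pi>\<close> splits.\<close>

definition splits_modulo ::
 "('a, 'c) ring_scheme => ('a, 'm, 'd) module_scheme => ('f => 'm) => ('a, 'f, 'e) module_scheme =>
  ('a, 'y, 'g) module_scheme => bool" where
 "splits_modulo A L \<pi> F Y \<longleftrightarrow> (EX \<alpha> \<beta> s. \<alpha> : mod_hom A L Y & \<beta> : mod_hom A Y L & s : mod_hom A L F &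
   (ALL x:carrier L. x = \<beta> (\<alpha> x) +.L \<pi> (s x)))"

text \<open>The composites of \<alpha> and \<beta> with the covers lift to \<open>f\<close> from
  \<open>A^r\<close> to \<open>W\<close> and \<open>g\<close> back. The defect z - g(f z) - s(\<pi>
  z) lies in the kernel of \<pi>, so it lifts through \<pi>'. On that kernel s(\<pi> z) is zero, and
  what remains is the same decomposition one step further.\<close>

lemma splits_modulo_syzygy:
 fixes r r' :: nat
 assumes L: "right_module A L" and Y: "right_module A Y" and W: "projective A W"
  and \<pi>: "\<pi> : mod_hom A (frn A r) L" "\<pi> ` carrier (frn A r) = carrier L"
  and \<delta>: "\<delta> : mod_hom A W Y" "\<delta> ` carrier W = carrier Y"
  and \<pi>': "\<pi>' : mod_hom A (frn A r') (frn A r)"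
   "\<pi>' ` carrier (frn A r') = {z : carrier (frn A r). \<pi> z = \<zero>.L}"
  and split: "splits_modulo A L \<pi> (frn A r) Y"
 shows "splits_modulo A (frn A r(|carrier := {z : carrier (frn A r). \<pi> z = \<zero>.L}|)) \<pi>' (frn A r')
  (W(|carrier := {w : carrier W. \<delta> w = \<zero>.Y}|))"
proof -
 let ?F = "frn A r" and ?L' = "{z : carrier (frn A r). \<pi> z = \<zero>.L}" and ?Y' = "{w : carrier W. \<delta> w = \<zero>.Y}"
 interpret L: right_module A L by fact
 interpret Y: right_module A Y by fact
 have W': "right_module A W" using W by (simp add: projective_def)
 interpret W: right_module A W by (rule W')
 have F: "right_module A (frn A n)" for n by (rule L.R.right_module_free)
 interpret F: right_module A ?F by (rule F)
 obtain \<alpha> \<beta> s where \<alpha>: "\<alpha> : mod_hom A L Y" and \<beta>: "\<beta> : mod_hom A Y L" and s: "s : mod_hom A L ?F"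
  and eq: "!!x. x <: L ==> x = \<beta> (\<alpha> x) +.L \<pi> (s x)"
  using split unfolding splits_modulo_def by (elim conjE exE) (rule that, auto)
 note \<alpha>\<pi> = mod_hom_compose[OF \<alpha> \<pi>(1)] and \<beta>\<delta> = mod_hom_compose[OF \<beta> \<delta>(1)]
 obtain f where f: "f : mod_hom A ?F W" "!!z. z <: ?F ==> \<delta> (f z) = \<alpha> (\<pi> z)"
  using free_lifting[OF L.R.ring_axioms W' Y \<alpha>\<pi> \<delta>(1)] mod_hom_closed[OF \<alpha>\<pi>] \<delta>(2) by auto
 obtain g where g: "g : mod_hom A W ?F" "!!w. w <: W ==> \<pi> (g w) = \<beta> (\<delta> w)"
  using projective_lifting[OF W F L \<beta>\<delta> \<pi>(1)] mod_hom_closed[OF \<beta>\<delta>] \<pi>(2) by auto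
 let ?k = "%z. z -.?F (g (f z) +.?F s (\<pi> z))"
 have gf: "(%z. g (f z) +.?F s (\<pi> z)) : mod_hom A ?F ?F"
  by (intro mod_hom_sum F mod_hom_compose[OF g(1) f(1)] mod_hom_compose[OF s \<pi>(1)])
 have k: "?k : mod_hom A ?F ?F" by (intro mod_hom_diff F mod_hom_ident gf)
 have closed: "f z <: W" "g (f z) <: ?F" "\<pi> z <: L" "s (\<pi> z) <: ?F" if "z <: ?F" for z
  using that f(1) g(1) s \<pi>(1) by (auto simp: mod_hom_mem)
 have kL: "?k z : ?L'" if z: "z <: ?F" for z
 proof -
  have "\<pi> (g (f z) +.?F s (\<pi> z)) = \<pi> z"
   using closed[OF z] f(2)[OF z] g(2) eq[OF closed(3)[OF z]] mod_hom_add[OF \<pi>(1)] by simp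
  then have "\<pi> (?k z) = \<zero>.L"
   using mod_hom_minus[OF \<pi>(1) F L z mod_hom_closed[OF gf z]] closed[OF z] by (simp add: L.M.minus_eq_zero_iff)
  then show ?thesis using mod_hom_closed[OF k z] by simp
 qed
 obtain s' where s': "s' : mod_hom A ?F (frn A r')" "!!z. z <: ?F ==> \<pi>' (s' z) = ?k z"
  using free_lifting[OF L.R.ring_axioms F F k \<pi>'(1)] kL \<pi>'(2) by auto
 \<comment> \<open>Restricting to the kernel is harmless: the lift \<open>s'\<close> exists on all
   of \<open>A^r\<close>, and only there does the defect formula simplify.\<close>
 have sL: "s' : mod_hom A (?F(|carrier := ?L'|)) (frn A r')"
  by (rule mod_hom_subdomain[OF s'(1)]) auto
 have "f : mod_hom A (?F(|carrier := ?L'|)) (W(|carrier := ?Y'|))"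
  using f mod_hom_zero[OF \<alpha> L Y] by (auto simp: mod_hom_mem)
 moreover have "g : mod_hom A (W(|carrier := ?Y'|)) (?F(|carrier := ?L'|))"
  using g mod_hom_zero[OF \<beta> Y L] by (auto simp: mod_hom_mem)
 moreover have "z = g (f z) +.?F \<pi>' (s' z)" if z: "z : ?L'" for z
 proof -
  have z': "z <: ?F" "\<pi> z = \<zero>.L" using z by auto
  have "s (\<pi> z) = \<zero>.?F" using z' mod_hom_zero[OF s L F] by simp
  then have "\<pi>' (s' z) = z -.?F g (f z)" using s'(2)[OF z'(1)] closed(2)[OF z'(1)] by simp
  then show ?thesis
   using z' closed(2)[OF z'(1)] by (simp add: a_minus_def F.M.a_lcomm F.M.r_neg)
 qed
 ultimately show ?thesis using sL unfolding splits_modulo_def by (intro exI[of _ f] exI[of _ g] exI[of _ s']) auto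
qed

text \<open>The elements are the actual cosets. For a submodule of \<open>A^n\<close> the quotient
  then has the type over which \<open>finite_proj_dim_of_finitely_presented\<close>
  quantifies.\<close>

lemma quotient_module:
 fixes M :: "('a, 'm, 'd) module_scheme"
 assumes M: "right_module A M" and L: "submodule L A M"
 shows "EX (V :: ('a, 'm set) module) q. right_module A V & q : mod_hom A M V & q ` carrier M = carrier V &
  (ALL x:carrier M. q x = \<zero>.V \<longleftrightarrow> x : L)"
proof -
 interpret M: right_module A M by fact
 note L' = M.submoduleD[OF L]
 define q where "q x = {y : carrier M. y -.M x : L}" for x
 have swap: "y -.M x : L" if "x -.M y : L" "x <: M" "y <: M" for x y
 proof -
  have "-.M (x -.M y) = y -.M x" using that by (simp add: a_minus_def M.M.minus_add M.M.a_comm)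
  then show ?thesis using L'(6)[OF that(1)] by simp
 qed
 have chain: "x -.M z : L" if "x -.M y : L" "y -.M z : L" "x <: M" "y <: M" "z <: M" for x y z
 proof -
  have "(x -.M y) +.M (y -.M z) = x -.M z"
   using that(3-5) by (simp add: a_minus_def M.M.a_ac M.M.r_neg1 M.M.r_neg2)
  then show ?thesis using L'(4)[OF that(1,2)] by simp
 qed
 have q_eq: "q x = q y \<longleftrightarrow> x -.M y : L" if xy: "x <: M" "y <: M" for x y
 proof
  assume "q x = q y"
  moreover have "x : q x" using xy L'(3) by (simp add: q_def a_minus_def M.M.r_neg)
  ultimately show "x -.M y : L" by (simp add: q_def)
 next
  assume "x -.M y : L"
  then show "q x = q y" unfolding q_def using chain swap xy by blast
 qed
 define s where "s X = (SOME x. x <: M & q x = X)" for X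
 have s: "s (q x) <: M" "q (s (q x)) = q x" if "x <: M" for x
  using someI[of "%y. y <: M & q y = q x" x] that by (auto simp: s_def)
 define V :: "('a, 'm set) module" where "V = (|carrier = q ` carrier M, mult = undefined, one = undefined, zero = q \<zero>.M,
  add = (%X Y. q (s X +.M s Y)), smult = (%a X. q (a **.M s X))|)"
 have V: "carrier V = q ` carrier M" "\<zero>.V = q \<zero>.M" by (auto simp: V_def)
 have add: "q x +.V q y = q (x +.M y)" if xy: "x <: M" "y <: M" for x y
 proof -
  have "(s (q x) -.M x) +.M (s (q y) -.M y) = (s (q x) +.M s (q y)) -.M (x +.M y)"
   using s(1) xy by (simp add: a_minus_def M.M.minus_add M.M.a_ac)
  moreover have "s (q x) -.M x : L" "s (q y) -.M y : L"
   by (rule q_eq[OF s(1) _, THEN iffD1, OF _ _ s(2)], fact+)+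
  ultimately have "(s (q x) +.M s (q y)) -.M (x +.M y) : L" using L'(4) by metis
  then show ?thesis using q_eq[of "s (q x) +.M s (q y)" "x +.M y"] s(1) xy by (simp add: V_def)
 qed
 have smult: "a **.V q x = q (a **.M x)" if ax: "a <: A" "x <: M" for a x
 proof -
  have h: "(%x. a **.M x) (s (q x) +.M -.M x) = a **.M s (q x) +.M a **.M (-.M x)"
   using s(1) ax by (simp add: M.smult_r_distr)
  have "a **.M (-.M x) = -.M (a **.M x)"
   using ax by (metis M.M.a_inv_closed M.M.minus_equality M.M.l_neg M.smult_closed M.smult_r_distr M.smult_zero)
  moreover have "s (q x) -.M x : L" 
   by (rule q_eq[OF s(1) _, THEN iffD1, OF _ _ s(2)], fact+)
  then have "a **.M (s (q x) -.M x) : L" using L'(5) ax by blast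
  ultimately have "a **.M s (q x) -.M a **.M x : L" using h by (simp add: a_minus_def)
  then show ?thesis using q_eq[of "a **.M s (q x)" "a **.M x"] s(1) ax by (simp add: V_def M.smult_closed)
 qed
 have "abelian_group V"
 proof (rule abelian_groupI)
  fix X assume "X <: V"
  then obtain x where x: "x <: M" "X = q x" using V by auto
  then show "EX Y:carrier V. Y +.V X = \<zero>.V"
   by (intro bexI[of _ "q (-.M x)"]) (auto simp: V add M.M.l_neg)
 qed (auto simp: V add M.M.a_ac)
 then have "right_module A V"
  unfolding right_module_def right_module_axioms_def
  by (auto simp: V add smult M.ring_A M.smult_closed M.smult_l_distr M.smult_r_distr M.smult_assoc M.smult_one)
 moreover have "q : mod_hom A M V" by (rule mod_homI) (auto simp: V add smult)
 moreover have "q x = \<zero>.V \<longleftrightarrow> x : L" if "x <: M" for x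
  using q_eq[OF that M.M.zero_closed] that M.M.minus_equality[OF M.M.l_zero[OF M.M.zero_closed]] by (simp add: V a_minus_def)
 ultimately show ?thesis using V(1) by (intro exI[of _ V] exI[of _ q]) auto
qed

lemma (in ring) left_idealI:
 assumes "J \<subseteq> carrier R" "\<zero> : J" "!!x y. [|x : J; y : J|] ==> x \<oplus> y : J"
  "!!a x. [|a <: R; x : J|] ==> a \<otimes> x : J"
 shows "left_ideal J R"
proof (unfold_locales)
 fix x assume x: "x : J"
 have "\<ominus> x = \<ominus> \<one> \<otimes> x" using x assms(1) by (auto simp: l_minus)
 moreover have "inv\<^bsub>add_monoid (left_regular R)\<^esub> x = \<ominus> x" by (simp add: a_inv_def m_inv_def)
 ultimately show "inv\<^bsub>add_monoid (left_regular R)\<^esub> x : J"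
  using assms(4)[of "\<ominus> \<one>" x] x by simp
qed (use assms in auto)

section \<open>Finitely generated Hopf submodules of \<open>A^n\<close> are direct summands\<close>

locale hopf_quot = hopf_comod_alg K H conv eps S B cf v A ks TA + QR: quotient_ring A Q \<iota>
 for K :: "'k ring" and H :: "('k, 'h) module" and conv eps S B cf v
  and A :: "('a, 'ac) ring_scheme" and ks :: "'k => 'a" and TA
  and Q :: "('q, 'qc) ring_scheme" and \<iota> +
 assumes regular_Q: "von_neumann_regular Q"
  and coherent: "right_coherent A"
  and proj_dim: "finite_proj_dim_of_finitely_presented A"
begin

definition hopf_sub :: "nat => (nat => nat => 'h) => (nat => 'a) set => bool" where
 "hopf_sub n c P \<longleftrightarrow> comat {..<n} c & fg A (FR n) P & (ALL psi:D. ALL x:P. TF c n psi x : P)"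

lemma hopf_subD:
 assumes "hopf_sub n c P"
 shows "comat {..<n} c" "fg A (FR n) P" "submodule P A (FR n)" "P \<subseteq> carrier (FR n)"
  "!!psi x. [|psi : D; x : P|] ==> TF c n psi x : P"
 using assms right_module.submoduleD(1)[OF rm_FR] by (auto simp: hopf_sub_def fg_def)

text \<open>The finite set lies in the span over \<open>K\<close> of a family \<open>y\<close> in
  \<open>P\<close> with multiplicative matrix \<open>c\<close>. Twisting \<open>A^r\<close> by this
  very matrix makes the map from the standard basis to \<open>y\<close> equivariant.\<close>

lemma hopf_cover:
 assumes M: "hm M T" and P: "submodule P A M" and stable: "!!psi x. [|psi : D; x : P|] ==> T psi x : P"
  and X: "finite X" "X \<subseteq> P"
 obtains r :: nat and c y where "comat {..<r} c" "fam M T {..<r} c y" "!!i. i < r ==> y i : P"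
  "free_lift A M {..<r} y : mod_hom A (FR r) M" "free_lift A M {..<r} y ` carrier (FR r) \<subseteq> P"
  "X \<subseteq> span A M {..<r} y" "span A M {..<r} y = free_lift A M {..<r} y ` carrier (FR r)"
  "!!psi x. [|psi : D; x <: (FR r)|] ==>
   free_lift A M {..<r} y (TF c r psi x) = T psi (free_lift A M {..<r} y x)"
proof -
 note rm = comodD(1)[OF hm_comod[OF M]]
 interpret M: right_module A M by (rule rm)
 obtain r :: nat and c y where c: "comat {..<r} c" and y: "fam M T {..<r} c y" and yP: "!!i. i < r ==> y i : P"
  and sp: "!!x. x : X ==> EX k. (ALL i<r. k i <: K) & x = lc M {..<r} k y"
  by (rule comatrix_family[OF hm_comod[OF M] P stable X]) (assumption, assumption, rule that, assumption, assumption, simp, simp)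
 have yM: "y i <: M" if "i < r" for i using M.submoduleD(2)[OF P yP[OF that]] .
 have hom: "free_lift A M {..<r} y : mod_hom A (FR r) M" by (rule M.free_lift_hom) (use yM in auto)
 have span: "span A M {..<r} y = free_lift A M {..<r} y ` carrier (FR r)"
 proof (intro equalityI subsetI)
  fix u assume "u : span A M {..<r} y"
  then obtain a where a: "a : {..<r} \<rightarrow> carrier A" "u = (\<Sum>.M i:{..<r}. a i **.M y i)" by (auto simp: span_def)
  have a': "(\<lambda>i\<in>{..<r}. a i) <: (FR r)" using a(1) by (intro FR_carrierI) auto
  have "u = free_lift A M {..<r} y (\<lambda>i\<in>{..<r}. a i)"
   unfolding a(2) using a(1) yM
   by (subst M.free_lift_lessThan[OF yM a']) (auto intro!: M.M.finsum_eqI M.smult_closed)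
  with a' show "u : free_lift A M {..<r} y ` carrier (FR r)" by blast
 next
  fix u assume "u : free_lift A M {..<r} y ` carrier (FR r)"
  then obtain a where a: "a <: (FR r)" "u = free_lift A M {..<r} y a" by auto
  then show "u : span A M {..<r} y"
   using M.free_lift_lessThan[OF yM a(1)] free_at[OF a(1)] by (auto simp: span_def)
 qed
 have "x : span A M {..<r} y" if xX: "x : X" for x
 proof -
  obtain k where k: "ALL i<r. k i <: K" "x = lc M {..<r} k y" using sp[OF xX] by (elim exE conjE) (rule that)
  then show ?thesis unfolding span_def lc_def by (intro CollectI exI[of _ "%i. ks (k i)"]) auto
 qed
 moreover have "free_lift A M {..<r} y ` carrier (FR r) \<subseteq> P"
  unfolding span[symmetric] using yP by (intro M.span_subset[OF P]) auto
 ultimately show ?thesis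
  using that[OF c y yP hom _ _ span fam_cover_equivariant[OF c M y]] by auto
qed

lemma coact_cong:
 assumes M: "hm M T" and f: "f : mod_hom A M RR" and fg: "!!x. x <: M ==> f x = g x"
  and phi: "phi : D" and p: "p <: M"
 shows "coact M T f phi p = coact M T g phi p"
proof -
 have "T (cf b) p <: M" if "b : B" for b using comodD(2)[OF hm_comod[OF M] cf[OF that] p] .
 then show ?thesis
  unfolding coact_def using hom_closed[OF f] fg phi v
  by (intro Z.finsum_eqI) (auto intro!: TA_closed dual_S)
qed

text \<open>The elements \<open>a\<close> for which every \<open>TA psi a\<close> carries \<open>f\<close> to an extendable functional form a stable
 left ideal, which contains a common denominator of finitely many coacted functionals.\<close>

lemma functional_extends:
 assumes P: "hopf_sub n c P" and f: "f : mod_hom A (FR n(|carrier := P|)) RR"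
 shows "EX g:mod_hom A (FR n) RR. ALL x:P. g x = f x"
proof -
 note Pd = hopf_subD[OF P]
 let ?T = "TF c n" and ?P = "FR n(|carrier := P|)"
 interpret F: right_module A "FR n" by (rule rm_FR)
 have hF: "hm (FR n) ?T" by (rule hm_FR[OF Pd(1)])
 have hP: "hm ?P ?T" by (rule hm_submodule[OF hF Pd(3,5)])
 have rmP: "right_module A ?P" by (rule comodD(1)[OF hm_comod[OF hP]])
 interpret P: right_module A ?P by (rule rmP)
 obtain X where X: "finite X" "X \<subseteq> P" and Xtop: "ALL N. submodule N A (FR n) & X \<subseteq> N --> P \<subseteq> N"
  by (rule fgE[OF Pd(2)]) (rule that)
 note Xtop = Xtop[rule_format, OF conjI]
 obtain m :: nat and c' p where c': "comat {..<m} c'" and p: "fam ?P ?T {..<m} c' p"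
  and pP: "!!i. i < m ==> p i <: ?P"
  and Xs: "X \<subseteq> span A ?P {..<m} p"
  by (rule hopf_cover[OF hP P.submodule_carrier _ X(1)])
   (use X(2) Pd(5) in \<open>auto intro: that\<close>)
 have span_eq: "span A ?P {..<m} p \<subseteq> span A (FR n) {..<m} p"
  unfolding span_def
 proof clarify
  fix a assume a: "a : {..<m} \<rightarrow> carrier A"
  show "EX d. (\<Sum>.?P i:{..<m}. a i **.?P p i) = (\<Sum>.(FR n) i:{..<m}. d i **.(FR n) p i) & d : {..<m} \<rightarrow> carrier A"
   using a pP F.submoduleD(5)[OF Pd(3)] F.finsum_submodule[OF Pd(3), of "{..<m}" "%i. a i **.(FR n) p i"]
   by (intro exI[of _ a]) (auto simp: Pi_def)
 qed
 have pF: "p i <: (FR n)" if "i < m" for i using pP[OF that] Pd(4) by auto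
 have span: "P \<subseteq> span A (FR n) {..<m} p"
  using Xtop[OF F.submodule_span[of "{..<m}" p]] pF Xs span_eq by auto
 \<comment> \<open>The finite set of coacted functionals is fixed here, before any denominator is
   chosen for them.\<close>
 obtain B0 where B0: "finite B0" "B0 \<subseteq> B" and inv: "ALL psi:D. ALL a:carrier A. ALL j<m. TA psi a *.A f (p j) =
   (\<Sum>.A b:B0. coact ?P ?T (%x. a *.A coact ?P ?T f (cf b) x) (%h. psi (h *.H S (v b))) (p j))"
  using coact_inverse[OF hP f c' p] by (elim exE conjE) (rule that)
 define fb where "fb b = coact ?P ?T f (cf b)" for b
 have fb: "fb b : mod_hom A ?P RR" if "b : B0" for b
  unfolding fb_def using that B0(2) cf by (intro coact_hom[OF hP f]) auto
 obtain s where s: "s : nonzerodivisors A"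
  and ext: "ALL b:B0. EX g:mod_hom A (FR n) RR. ALL x:P. g x = s *.A fb b x"
  using QR.functional_extends_up_to_denominator[where p=p and r=m and f=fb, OF regular_Q Pd(3) _ span B0(1) fb] pP by auto
 note sA = QR.nzd_closed[OF s]
 define J where "J = {a : carrier A. EX g:mod_hom A (FR n) RR. ALL x:P. g x = a *.A f x}"
 define J0 where "J0 = {a : carrier A. ALL psi:D. TA psi a : J}"
 have fP: "f x <: A" if "x : P" for x using hom_closed[OF f] that by simp
 have Jsum: "(\<Sum>.A i:I. b i *.A a i) : J" if b: "!!i. i : I ==> b i <: A" and a: "!!i. i : I ==> a i : J" for I :: "nat set" and a b
 proof -
  have "ALL i:I. EX g. g : mod_hom A (FR n) RR & (ALL x:P. g x = a i *.A f x)" using a unfolding J_def by blast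
  then obtain g where g: "!!i. i : I ==> g i : mod_hom A (FR n) RR"
   "!!i x. i : I ==> x : P ==> g i x = a i *.A f x" by (subst (asm) bchoice_iff) auto
  have aA: "a i <: A" if "i : I" for i using a[OF that] by (simp add: J_def)
  have G: "(%x. \<Sum>.RR i:I. b i *.A g i x) : mod_hom A (FR n) RR"
   by (intro mod_hom_finsum_fun rm_FR rm_RR mult_hom_compose b g)
  have Gx: "(\<Sum>.RR i:I. b i *.A g i x) = (\<Sum>.A i:I. b i *.A a i) *.A f x" if x: "x : P" for x
  proof -
   have "(\<Sum>.A i:I. b i *.A g i x) = (\<Sum>.A i:I. (b i *.A a i) *.A f x)"
    using g(2) x b aA fP[OF x] by (intro Z.finsum_eqI) (auto simp: Z.m_assoc)
   then show ?thesis using b aA fP[OF x] by (simp add: Z.finsum_mult_right)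
  qed
  show ?thesis unfolding J_def by (intro CollectI conjI bexI[OF _ G] ballI Gx Z.finsum_in Z.m_closed b aA)
 qed
 have J1: "b *.A a : J" if "b <: A" "a : J" for a b
  using Jsum[of "{0}" "%_. b" "%_. a"] that by (simp add: Z.finsum_insert J_def)
 have J2: "a +.A b : J" if "a : J" "b : J" for a b
  using Jsum[of "{0, 1}" "%_. \<one>.A" "%i. if i = 0 then a else b"] that by (simp add: Z.finsum_insert J_def)
 have J3: "\<zero>.A : J" using Jsum[of "{}"] by simp
 have J0c: "J0 \<subseteq> carrier A" by (auto simp: J0_def)
 have "left_ideal J0 A"
 proof (rule Z.left_idealI[OF J0c])
  show "\<zero>.A : J0" using J3 T_zero[OF comod_A] by (simp add: J0_def)
  show "a +.A b : J0" if "a : J0" "b : J0" for a b using that J2 by (auto simp: J0_def TA_add)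
  fix b a assume b: "b <: A" and a: "a : J0"
  have aA: "a <: A" using a J0c by auto
  have bR: "b <: RR" using b by simp
  obtain m :: nat and y h where I: "rep RR TA {..<m} y h b" by (rule comod_rep[OF comod_A bR]) (rule that)
  have yh: "y i <: A" "h i <: H" if "i < m" for i using I that by (auto simp: rep_def)
  have "TA psi (b *.A a) : J" if psi: "psi : D" for psi
  proof -
   have "TA psi (b *.A a) = (\<Sum>.A i:{..<m}. y i *.A TA (%u. psi (h i *.H u)) a)"
    using T_smult_rep[OF hopf_A psi bR aA I] by simp
   also have "... : J" using a yh psi dual_left by (intro Jsum) (auto simp: J0_def)
   finally show ?thesis .
  qed
  then show "b *.A a : J0" using b aA by (simp add: J0_def)
 qed
 moreover have "TA psi a : J0" if "psi : D" "a : J0" for psi a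
  using that comodD(5)[OF comod_A] conv by (auto simp: J0_def)
 moreover have "s : J0"
 proof -
  obtain g where g: "!!b. b : B0 ==> g b : mod_hom A (FR n) RR"
   "!!b x. b : B0 ==> x : P ==> g b x = s *.A fb b x"
   using ext unfolding Bex_def by (subst (asm) bchoice_iff) auto
  have "TA psi s : J" if psi: "psi : D" for psi
  proof -
   have d: "(%h. psi (h *.H S (v b))) : D" if "b : B0" for b using dual_S[OF psi v] that B0(2) by auto
   \<comment> \<open>\<open>coact_inverse\<close> with \<open>a = s\<close> writes
     \<open>TA psi s\<close> times \<open>f\<close> as a sum of coacted functionals s f_0. Each s
     f_0 extends to some \<open>g b\<close> on \<open>A^n\<close>, and coacting \<open>g b\<close>
     there extends the coacted functional.\<close>
   let ?G = "%x. \<Sum>.RR b:B0. coact (FR n) ?T (g b) (%h. psi (h *.H S (v b))) x"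
   have gb: "coact (FR n) ?T (g b) (%h. psi (h *.H S (v b))) : mod_hom A (FR n) RR" if "b : B0" for b
    by (rule coact_hom[OF hF g(1)[OF that] d[OF that]])
   have G: "?G : mod_hom A (FR n) RR" by (intro mod_hom_finsum_fun rm_FR rm_RR gb)
   have "?G (p j) = TA psi s *.A f (p j)" if j: "j : {..<m}" for j
   proof -
    have pj: "p j <: ?P" using pP j by simp
    have "TA psi s *.A f (p j) = (\<Sum>.A b:B0. coact ?P ?T (%x. s *.A fb b x) (%h. psi (h *.H S (v b))) (p j))"
     using inv psi sA j unfolding fb_def by simp
    also have "... = (\<Sum>.A b:B0. coact (FR n) ?T (g b) (%h. psi (h *.H S (v b))) (p j))"
    proof (rule Z.finsum_eqI)
     fix b assume b: "b : B0"
     have "coact ?P ?T (%x. s *.A fb b x) (%h. psi (h *.H S (v b))) (p j) =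
       coact ?P ?T (g b) (%h. psi (h *.H S (v b))) (p j)"
      using g(2)[OF b] by (intro coact_cong[OF hP mult_hom_compose[OF sA fb[OF b]] _ d[OF b] pj]) simp
     \<comment> \<open>The defining formula of \<open>coact\<close> uses only the operators and the
       functional, so on elements of \<open>P\<close> it gives the same value in \<open>P\<close>
       and in \<open>A^n\<close>.\<close>
     also have "... = coact (FR n) ?T (g b) (%h. psi (h *.H S (v b))) (p j)" by (simp add: coact_def)
     finally show "coact ?P ?T (%x. s *.A fb b x) (%h. psi (h *.H S (v b))) (p j) =
      coact (FR n) ?T (g b) (%h. psi (h *.H S (v b))) (p j)" .
     show "coact (FR n) ?T (g b) (%h. psi (h *.H S (v b))) (p j) <: A"
      using hom_closed[OF gb[OF b]] pF j by simp
    qed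
    finally show ?thesis by simp
   qed
   note Gp = this
   have sf: "(%x. TA psi s *.A f x) : mod_hom A ?P RR" using sA psi by (intro mult_hom_compose f) simp
   have "?G x = TA psi s *.A f x" if "x : P" for x
    using span that pP
    by (intro F.mod_hom_eq_on_span[where I="{..<m}" and x=p, OF rm_RR Pd(3) mod_hom_subdomain[OF G Pd(4)] sf _ Gp]) auto
   then show ?thesis unfolding J_def using G sA psi by (intro CollectI conjI bexI[OF _ G]) auto
  qed
  then show ?thesis using sA by (simp add: J0_def)
 qed
 \<comment> \<open>A zero \<open>s\<close> would annihilate all of \<open>A\<close>; being a
   nonzerodivisor it would force \<open>A = 0\<close>. Hence \<open>J0\<close> is a nonzero ideal
   and simplicity applies.\<close>
 moreover have "s ~= \<zero>.A"
 proof
  assume "s = \<zero>.A"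
  then have "s *.A x = \<zero>.A" if "x <: A" for x using that by simp
  then have "x = \<zero>.A" if "x <: A" for x using s that unfolding nonzerodivisors_def by blast
  then have "carrier A = {\<zero>.A}" by auto
  then show False using nontrivial_A by simp
 qed
 ultimately have "J0 = carrier A" using simple_A[of J0] by blast
 then have "TA eps \<one>.A : J" using eps by (auto simp: J0_def)
 then have "\<one>.A : J" using comodD(6)[OF comod_A, of "\<one>.A"] by simp
 then show ?thesis unfolding J_def using fP by auto
qed

lemma free_hom_extends:
 fixes r :: nat
 assumes P: "hopf_sub n c P" and f: "f : mod_hom A (FR n(|carrier := P|)) (FR r)"
 shows "EX g:mod_hom A (FR n) (FR r). ALL x:P. g x = f x"
proof -
 note Pd = hopf_subD[OF P]
 have "ALL j. EX g. j < r --> g : mod_hom A (FR n) RR & (ALL x:P. g x = f x j)"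
  using functional_extends[OF P mod_hom_compose[OF Z.free_coord_hom f]] by (metis lessThan_iff)
 then obtain g where g: "!!j. j < r ==> g j : mod_hom A (FR n) RR" "!!j x. j < r ==> x : P ==> g j x = f x j" by metis
 have "(%x. \<lambda>j\<in>{..<r}. g j x) : mod_hom A (FR n) (FR r)"
 proof (rule mod_homI)
  show c: "(\<lambda>j\<in>{..<r}. g j x) <: (FR r)" if "x <: (FR n)" for x
   using hom_closed[OF g(1)] that by (intro FR_carrierI) auto
 qed (auto simp: free_right_module_simps(3,4)[of A "{..<r}"] mod_hom_add[OF g(1)] mod_hom_smult[OF g(1)] intro!: restrict_ext)
 note G = this
 have "(\<lambda>j\<in>{..<r}. g j x) = f x" if "x : P" for x
  using mod_hom_closed[OF f, of x] that g by (intro free_ext[where A=A and X="{..<r}"] FR_carrierI) (auto simp: free_at)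
 with G show ?thesis by (intro bexI[OF _ G] ballI) simp
qed

definition summand :: "nat => (nat => 'a) set => bool" where
 "summand n P \<longleftrightarrow> (EX \<rho>:mod_hom A (FR n) (FR n). (ALL x:carrier (FR n). \<rho> x : P) & (ALL x:P. \<rho> x = x))"

text \<open>Splitting the cover makes \<open>P\<close> only projective. Extending the section to all
  of \<open>A^n\<close>, which is where extension of functionals enters, and composing with \<pi>
  produces a retraction onto \<open>P\<close>.\<close>

lemma summand_of_section:
 fixes r :: nat
 assumes P: "hopf_sub n c P" and \<pi>: "\<pi> : mod_hom A (FR r) (FR n)" "\<pi> ` carrier (FR r) = P"
  and s: "s : mod_hom A (FR n(|carrier := P|)) (FR r)" "!!x. x : P ==> \<pi> (s x) = x"
 shows "summand n P"
proof -
 obtain g where g: "g : mod_hom A (FR n) (FR r)" "ALL x:P. g x = s x" using free_hom_extends[OF P s(1)] by blast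
 show ?thesis
  unfolding summand_def using g s(2) \<pi> mod_hom_closed[OF g(1)]
  by (intro bexI[of _ "%x. \<pi> (g x)"] conjI ballI mod_hom_compose[OF \<pi>(1) g(1)]) auto
qed

definition cover :: "nat => (nat => nat => 'h) => (nat => 'a) set => nat => (nat => nat => 'h) => ((nat => 'a) => nat => 'a) => bool" where
 "cover n c P r c' \<pi> \<longleftrightarrow> comat {..<r} c' & \<pi> : mod_hom A (FR r) (FR n) & \<pi> ` carrier (FR r) = P &
   (ALL psi:D. ALL x:carrier (FR r). \<pi> (TF c' r psi x) = TF c n psi (\<pi> x))"

lemma coverD:
 assumes "cover n c P r c' \<pi>"
 shows "comat {..<r} c'" "\<pi> : mod_hom A (FR r) (FR n)" "\<pi> ` carrier (FR r) = P"
  "!!psi x. [|psi : D; x <: (FR r)|] ==> \<pi> (TF c' r psi x) = TF c n psi (\<pi> x)"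
 using assms by (auto simp: cover_def)

lemma cover_ex:
 assumes P: "hopf_sub n c P"
 obtains r c' \<pi> where "cover n c P r c' \<pi>"
proof -
 note Pd = hopf_subD[OF P]
 interpret F: right_module A "FR n" by (rule rm_FR)
 have hF: "hm (FR n) (TF c n)" by (rule hm_FR[OF Pd(1)])
 obtain X where X: "finite X" "X \<subseteq> P" and Xtop: "ALL N. submodule N A (FR n) & X \<subseteq> N --> P \<subseteq> N"
  by (rule fgE[OF Pd(2)]) (rule that)
 note Xtop = Xtop[rule_format, OF conjI]
 show ?thesis
 proof (rule hopf_cover[OF hF Pd(3,5) X])
  fix r :: nat and c' y
  let ?\<pi> = "free_lift A (FR n) {..<r} y"
  assume *: "comat {..<r} c'" "!!i. i < r ==> y i : P" "?\<pi> : mod_hom A (FR r) (FR n)"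
   "?\<pi> ` carrier (FR r) \<subseteq> P" "X \<subseteq> span A (FR n) {..<r} y"
   "span A (FR n) {..<r} y = ?\<pi> ` carrier (FR r)"
   "!!psi x. [|psi : D; x <: (FR r)|] ==> ?\<pi> (TF c' r psi x) = TF c n psi (?\<pi> x)"
  have "P \<subseteq> span A (FR n) {..<r} y" using *(2,5) Pd(4) by (intro Xtop F.submodule_span) auto
  then have "P \<subseteq> ?\<pi> ` carrier (FR r)" unfolding *(6) .
  then have "cover n c P r c' ?\<pi>" using * unfolding cover_def by auto
  then show thesis by (rule that)
 qed
qed

lemma kernel_hopf_sub:
 assumes M: "hm M T" and c: "comat {..<r} c" and \<pi>: "\<pi> : mod_hom A (FR r) M"
  and eq: "!!psi x. [|psi : D; x <: (FR r)|] ==> \<pi> (TF c r psi x) = T psi (\<pi> x)"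
  and fg: "fg A (FR r) {z : carrier (FR r). \<pi> z = \<zero>.M}"
 shows "hopf_sub r c {z : carrier (FR r). \<pi> z = \<zero>.M}"
 using c fg eq TF_closed[OF c] T_zero[OF hm_comod[OF M]] by (auto simp: hopf_sub_def)

lemma cover_kernel:
 assumes P: "hopf_sub n c P" and cov: "cover n c P r c' \<pi>"
 shows "hopf_sub r c' {z : carrier (FR r). \<pi> z = \<zero>.(FR n)}"
 by (rule kernel_hopf_sub[OF hm_FR[OF hopf_subD(1)[OF P]] coverD(1,2,4)[OF cov] fg_kernel[OF Z.ring_axioms coherent coverD(2)[OF cov]]])

text \<open>If \<rho> retracts onto the kernel of \<pi>, then 1 - \<rho> kills the kernel and hence
  factors through \<pi>; the factor is a section over \<open>P\<close>.\<close>

lemma summand_of_kernel_summand: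
 fixes r :: nat
 assumes P: "hopf_sub n c P" and \<pi>: "\<pi> : mod_hom A (FR r) (FR n)" "\<pi> ` carrier (FR r) = P"
  and L: "summand r {z : carrier (FR r). \<pi> z = \<zero>.(FR n)}"
 shows "summand n P"
proof -
 note Pd = hopf_subD[OF P]
 interpret F: right_module A "FR n" by (rule rm_FR)
 interpret Fr: right_module A "FR r" by (rule rm_FR)
 obtain \<rho> where \<rho>: "\<rho> : mod_hom A (FR r) (FR r)" "!!z. z <: (FR r) ==> \<pi> (\<rho> z) = \<zero>.(FR n)"
   "!!z. z <: (FR r) ==> \<pi> z = \<zero>.(FR n) ==> \<rho> z = z"
  using L unfolding summand_def by auto
 define t where "t z = z -.(FR r) \<rho> z" for z
 have t: "t : mod_hom A (FR r) (FR r)" unfolding t_def by (intro mod_hom_diff rm_FR mod_hom_ident \<rho>)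
 have \<pi>t: "\<pi> (t z) = \<pi> z" if z: "z <: (FR r)" for z
  using mod_hom_minus[OF \<pi>(1) rm_FR rm_FR z mod_hom_closed[OF \<rho>(1) z]] \<rho>(2)[OF z] mod_hom_closed[OF \<pi>(1) z]
  by (simp add: t_def a_minus_def)
 have tcong: "t z = t w" if zw: "z <: (FR r)" "w <: (FR r)" "\<pi> z = \<pi> w" for z w
 proof -
  have d: "z -.(FR r) w <: (FR r)" using zw by simp
  have "\<pi> (z -.(FR r) w) = \<zero>.(FR n)"
   using mod_hom_minus[OF \<pi>(1) rm_FR rm_FR zw(1,2)] zw mod_hom_closed[OF \<pi>(1)] by (simp add: F.M.minus_eq_zero_iff)
  then have "t (z -.(FR r) w) = \<zero>.(FR r)" using \<rho>(3)[OF d] d by (simp add: t_def Fr.M.minus_eq_zero_iff)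
  then show ?thesis
   using mod_hom_minus[OF t rm_FR rm_FR zw(1,2)] mod_hom_closed[OF t] zw by (simp add: Fr.M.minus_eq_zero_iff)
 qed
 \<comment> \<open>An arbitrary choice of preimages; applying \<open>t\<close> removes the ambiguity
   and makes the choice linear.\<close>
 define w where "w x = (SOME z. z <: (FR r) & \<pi> z = x)" for x
 have w: "w x <: (FR r)" "\<pi> (w x) = x" if "x : P" for x
  using someI_ex[of "%z. z <: (FR r) & \<pi> z = x"] that \<pi>(2) unfolding w_def by auto
 note Ps = F.submoduleD[OF Pd(3)]
 have "(%x. t (w x)) : mod_hom A (FR n(|carrier := P|)) (FR r)"
 proof (rule mod_homI; simp)
  show "t (w x) <: (FR r)" if "x : P" for x using w[OF that] mod_hom_closed[OF t] by simp
  show "t (w (x +.(FR n) y)) = t (w x) +.(FR r) t (w y)" if "x : P" "y : P" for x y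
   using w that Ps(4)[OF that]
   by (subst mod_hom_add[OF t, symmetric]) (auto intro!: tcong simp: mod_hom_add[OF \<pi>(1)])
  show "t (w (a **.(FR n) x)) = a **.(FR r) t (w x)" if "a <: A" "x : P" for a x
   using w that Ps(5)[OF that]
   by (subst mod_hom_smult[OF t, symmetric]) (auto intro!: tcong Fr.smult_closed simp: mod_hom_smult[OF \<pi>(1)])
 qed
 then show ?thesis using w \<pi>t by (intro summand_of_section[OF P \<pi>]) auto
qed

text \<open>Iterated kernels of equivariant covers starting from \<open>P\<close> are compared with
  the syzygies of \<open>V = A^n/P\<close>: each kernel splits modulo the corresponding syzygy. Past
  the length of the resolution the syzygy is zero, so that the cover there splits.
  \<open>summand_of_kernel_summand\<close> then leads back to \<open>P\<close>.\<close>

theorem hopf_sub_summand: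
 assumes P: "hopf_sub n c P"
 shows "summand n P"
proof -
 note Pd = hopf_subD[OF P]
 interpret F: right_module A "FR n" by (rule rm_FR)
 obtain V :: "('a, (nat => 'a) set) module" and q where V: "right_module A V" and q: "q : mod_hom A (FR n) V"
   "q ` carrier (FR n) = carrier V" "ALL x:carrier (FR n). q x = \<zero>.V \<longleftrightarrow> x : P"
  using quotient_module[OF rm_FR Pd(3)] by (elim exE conjE) (rule that)
 have kerq: "{x : carrier (FR n). q x = \<zero>.V} = P" using q(3) Pd(4) by auto
 interpret V: right_module A V by (rule V)
 have "finitely_presented A V"
  unfolding finitely_presented_def
  using q Pd(2) F.fg_iff_finitely_generated[OF Pd(3)] kerq by (intro exI[of _ n] exI[of _ q]) (simp add: a_kernel_def')
 then obtain N where "proj_dim_le A V N" using proj_dim V unfolding finite_proj_dim_of_finitely_presented_def by blast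
 then obtain W :: "nat => ('a, ('a + (nat => 'a) set) list) module" and d e
  where res: "projective_resolution A V W d e" and W0: "ALL i>N. carrier (W i) = {\<zero>.(W i)}"
  unfolding proj_dim_le_def by (elim exE conjE) (rule that)
 have Wp: "projective A (W i)" and e: "e : mod_hom A (W 0) V" "e ` carrier (W 0) = carrier V"
  and d: "d i : mod_hom A (W (Suc i)) (W i)"
  and d0: "d 0 ` carrier (W 1) = {w : carrier (W 0). e w = \<zero>.V}"
  and dS: "d (Suc i) ` carrier (W (Suc (Suc i))) = {w : carrier (W (Suc i)). d i w = \<zero>.(W i)}" for i
  using res unfolding projective_resolution_def by (auto simp: a_kernel_def')
 have Wm: "right_module A (W i)" for i using Wp[of i] by (simp add: projective_def)
 \<comment> \<open>\<open>Z i\<close> is the kernel at \<open>W i\<close> and the image of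
   \<open>d i\<close>; counted from \<open>V\<close>, it is the syzygy of order i + 1.\<close>
 define Z where "Z i = (case i of 0 => {w : carrier (W 0). e w = \<zero>.V} | Suc i => {w : carrier (W (Suc i)). d i w = \<zero>.(W i)})" for i
 have dZ: "d i ` carrier (W (Suc i)) = Z i" for i using d0 dS by (cases i) (auto simp: Z_def)
 have ZW: "Z i \<subseteq> carrier (W i)" for i by (cases i) (auto simp: Z_def)
 have Zsub: "submodule (Z i) A (W i)" for i
  using submodule_kernel[OF Wm V e(1)] submodule_kernel[OF Wm Wm d] by (cases i) (auto simp: Z_def)
 \<comment> \<open>Induction on the distance \<open>k\<close> from \<open>i\<close> to
   \<open>Suc N\<close>. For k = 0 the module \<open>W i\<close> is zero, so \<beta> \<alpha> = 0
   and the decomposition says that \<open>s\<close> is a section of \<pi>.\<close>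
 have claim: "summand n' L" if "hopf_sub n' c' L" "cover n' c' L r c'' \<pi>"
  "splits_modulo A (FR n'(|carrier := L|)) \<pi> (FR r) (W i(|carrier := Z i|))" "i + k = Suc N" for i k n' c' L r c'' \<pi>
  using that
 proof (induction k arbitrary: i n' c' L r c'' \<pi>)
  case 0
  note L = hopf_subD[OF 0(1)] and cov = coverD[OF 0(2)]
  interpret F': right_module A "FR n'" by (rule rm_FR)
  have Lm: "right_module A (FR n'(|carrier := L|))" by (rule F'.right_module_submodule[OF L(3)])
  have Ym: "right_module A (W i(|carrier := Z i|))" by (rule right_module.right_module_submodule[OF Wm Zsub])
  obtain \<alpha> \<beta> s where \<alpha>: "\<alpha> : mod_hom A (FR n'(|carrier := L|)) (W i(|carrier := Z i|))"
   and \<beta>: "\<beta> : mod_hom A (W i(|carrier := Z i|)) (FR n'(|carrier := L|))" and s: "s : mod_hom A (FR n'(|carrier := L|)) (FR r)"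
   and eq: "ALL x:carrier (FR n'(|carrier := L|)). x = \<beta> (\<alpha> x) +.(FR n'(|carrier := L|)) \<pi> (s x)"
   using 0(3) unfolding splits_modulo_def by (elim exE conjE) (rule that)
  have h: "\<pi> (s x) = x" if x: "x : L" for x
  proof -
   have "\<alpha> x : Z i" using mod_hom_closed[OF \<alpha>] x by simp
   then have "\<alpha> x = \<zero>.(W i)" using ZW[of i] W0 0(4) by auto
   then have "\<beta> (\<alpha> x) = \<zero>.(FR n')" using mod_hom_zero[OF \<beta> Ym Lm] by simp
   moreover have "\<pi> (s x) <: (FR n')" using mod_hom_closed[OF cov(2)] mod_hom_closed[OF s] x by simp
   moreover have "x = \<beta> (\<alpha> x) +.(FR n') \<pi> (s x)" using bspec[OF eq, of x] x by simp
   ultimately show ?thesis by simp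
  qed
  show ?case by (rule summand_of_section[OF 0(1) cov(2,3) s h])
 next
  case (Suc k)
  note L = hopf_subD[OF Suc.prems(1)] and cov = coverD[OF Suc.prems(2)]
  interpret F': right_module A "FR n'" by (rule rm_FR)
  let ?L' = "{z : carrier (FR r). \<pi> z = \<zero>.(FR n')}"
  have Lm: "right_module A (FR n'(|carrier := L|))" by (rule F'.right_module_submodule[OF L(3)])
  have Ym: "right_module A (W i(|carrier := Z i|))" by (rule right_module.right_module_submodule[OF Wm Zsub])
  have L': "hopf_sub r c'' ?L'" by (rule cover_kernel[OF Suc.prems(1,2)])
  obtain r' c3 \<pi>' where cov': "cover r c'' ?L' r' c3 \<pi>'" by (rule cover_ex[OF L']) (rule that)
  have \<pi>L: "\<pi> : mod_hom A (FR r) (FR n'(|carrier := L|))"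
   using cov(2,3) by (auto simp: mod_hom_mem)
  have dY: "d i : mod_hom A (W (Suc i)) (W i(|carrier := Z i|))" using d[of i] dZ[of i] by (auto simp: mod_hom_mem)
  have "splits_modulo A (FR r(|carrier := ?L'|)) \<pi>' (FR r') (W (Suc i)(|carrier := Z (Suc i)|))"
   using splits_modulo_syzygy[OF Lm Ym Wp \<pi>L _ dY _ coverD(2)[OF cov'] _ Suc.prems(3)] cov(3) dZ coverD(3)[OF cov']
   by (simp add: Z_def)
  from Suc.IH[OF L' cov' this] Suc.prems(4) have "summand r ?L'" by simp
  then show ?case by (rule summand_of_kernel_summand[OF Suc.prems(1) cov(2,3)])
 qed
 obtain r c' \<pi> where cov: "cover n c P r c' \<pi>" by (rule cover_ex[OF P]) (rule that)
 \<comment> \<open>The comparison starts trivially with \<alpha> and \<beta>: \<open>V\<close>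
   splits modulo itself by the identity and the zero map. To make the lifting map zero is legitimate
   because the identity already carries everything.\<close>
 have "splits_modulo A V q (FR n) V"
  unfolding splits_modulo_def
 proof (intro exI[of _ "%x. x"] exI[of _ "%_. \<zero>.(FR n)"] conjI ballI mod_hom_ident)
  show "(%_. \<zero>.(FR n)) : mod_hom A V (FR n)" by (rule mod_homI) (auto simp: F.smult_zero)
  show "x = x +.V q \<zero>.(FR n)" if "x <: V" for x using that mod_hom_zero[OF q(1) rm_FR V] by simp
 qed
 from splits_modulo_syzygy[OF V V Wp q(1,2) e coverD(2)[OF cov] _ this]
 have "splits_modulo A (FR n(|carrier := P|)) \<pi> (FR r) (W 0(|carrier := Z 0|))"
  using coverD(3)[OF cov] kerq by (simp add: Z_def)
 from claim[OF P cov this, of "Suc N"] show ?thesis by simp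
qed

end

section \<open>Flatness and projectivity\<close>

lemma (in abelian_group) minus_minus_cancel: "[|x <: G; y <: G|] ==> x \<ominus> (x \<ominus> y) = y"
 by (simp add: a_minus_def minus_add r_neg2)

lemma (in abelian_group) diff_zero: "x <: G ==> x \<ominus> \<zero> = x"
 using minus_equality[OF l_zero[OF zero_closed]] by (simp add: a_minus_def)

text \<open>The equational criterion for flatness, with coordinates b_k that respect the relations
  inside a finite set. If \<Sum> x_i \<otimes> f(l_i) = 0, finitely many relations witness it, and
  the coordinates turn it into \<Sum> b_k(x_i) f(l_i) = 0. Injectivity of \<open>f\<close> gives
  \<Sum> b_k(x_i) l_i = 0, and \<Sum> x_i \<otimes> l_i = \<Sum> y_k \<otimes> \<Sum> b_k(x_i) l_i
  vanishes.\<close>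

lemma flat_of_local_coordinates:
 fixes A :: "('a, 'c) ring_scheme" and M :: "('a, 'm, 'd) module_scheme"
 assumes rm: "right_module A M"
  and coords: "!!X B. [|finite X; X \<subseteq> carrier M; finite B; B \<subseteq> carrier A|] ==> EX (m::nat) y b.
   (ALL k<m. y k <: M) & (ALL x:X. ALL k<m. b k x <: A) &
   (ALL x:X. x = (\<Sum>.M k:{..<m}. b k x **.M y k)) &
   (ALL x:X. ALL x':X. ALL k<m. x +.M x' : X --> b k (x +.M x') = b k x +.A b k x') &
   (ALL r:B. ALL x:X. ALL k<m. r **.M x : X --> b k (r **.M x) = b k x *.A r)"
 shows "flat TYPE('l) TYPE('n) A M"
 unfolding flat_def
proof (intro conjI allI impI rm, elim conjE)
 interpret M: right_module A M by (rule rm)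
 fix L :: "('a, 'l) module" and N :: "('a, 'n) module" and f
 assume L: "left_module A L" and N: "left_module A N" and f: "f : mod_hom A L N" and inj: "inj_on f (carrier L)"
 interpret L: left_module A L by (rule L)
 interpret N: left_module A N by (rule N)
 interpret TL: tensor_pair A M L by unfold_locales (erule (1) M.smult_closed, erule (1) L.smult_closed)
 interpret TN: tensor_pair A M N by unfold_locales (erule (1) M.smult_closed, erule (1) N.smult_closed)
 note fc = mod_hom_closed[OF f]
 have AL: "abelian_group L" and AN: "abelian_group N" by unfold_locales
 have bal: "balanced A M L (tensor_group A M N) (%x y. pure_tensor A M N (id x) (f y))"
  using TN.balanced_pt fc by (auto simp: balanced_def mod_hom_add[OF f] mod_hom_smult[OF f])
 let ?F = "tensor_map A M N id f"
 have F_add: "?F (s +.(tensor_group A M L) t) = ?F s +.(tensor_group A M N) ?F t"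
  if "s <: (tensor_group A M L)" "t <: (tensor_group A M L)" for s t
  unfolding tensor_map_def by (rule TL.tensor_lift_add[OF TN.abelian_group_T bal that])
 have F_closed: "?F t <: (tensor_group A M N)" if "t <: (tensor_group A M L)" for t
  unfolding tensor_map_def by (rule TL.tensor_lift_closed[OF TN.abelian_group_T bal that])
 have f0: "f \<zero>.L = \<zero>.N"
  using finsum_additive[OF L.M.abelian_monoid_axioms AN, of f "{}" "%_. \<zero>.L"] fc mod_hom_add[OF f] by simp
 have F0: "t = \<zero>.(tensor_group A M L)" if t: "t <: (tensor_group A M L)" and z: "?F t = \<zero>.(tensor_group A M N)" for t
 proof -
  obtain n :: nat and x l where x: "!!i. i < n ==> x i <: M" and l: "!!i. i < n ==> l i <: L"
   and teq: "t = (\<Sum>.(tensor_group A M L) i:{..<n}. pure_tensor A M L (x i) (l i))"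
   by (rule TL.pt_repr[OF t]) (rule that, assumption, auto)
  have "(\<Sum>.(tensor_group A M N) i:{..<n}. pure_tensor A M N (x i) (f (l i))) = \<zero>.(tensor_group A M N)"
   using TL.tensor_lift_sum_pt[OF TN.abelian_group_T bal, of "{..<n}" x l] x l z
   unfolding teq tensor_map_def by simp
  from TN.sum_pt_zeroD[OF AN _ _ _ this] x l fc
  obtain X0 B where X0: "finite X0" "X0 \<subseteq> carrier M" "finite B" "B \<subseteq> carrier A"
   and zero: "ALL \<beta>. balanced_on X0 B M N N \<beta> --> (\<Sum>.N i:{..<n}. \<beta> (x i) (f (l i))) = \<zero>.N" by auto
  let ?X = "X0 \<union> x ` {..<n}"
  have "finite ?X" "?X \<subseteq> carrier M" using X0 x by auto
  from coords[OF this X0(3,4)] obtain m :: nat and y b where y: "ALL k<m. y k <: M"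
   and b: "ALL x:?X. ALL k<m. b k x <: A" and xy: "ALL x:?X. x = (\<Sum>.M k:{..<m}. b k x **.M y k)"
   and badd: "ALL x:?X. ALL x':?X. ALL k<m. x +.M x' : ?X --> b k (x +.M x') = b k x +.A b k x'"
   and bsm: "ALL r:B. ALL x:?X. ALL k<m. r **.M x : ?X --> b k (r **.M x) = b k x *.A r"
   by (elim exE conjE) (rule that)
  have xc: "b k (x i) <: A" if "k < m" "i < n" for k i using b that by auto
  have fin: "(\<Sum>.L i:{..<n}. b k (x i) **.L l i) = \<zero>.L" if k: "k < m" for k
  proof -
   \<comment> \<open>\<open>balanced_on\<close> asks for values in \<open>N\<close> on the whole
     carrier, whereas the coordinates are controlled on ?X only; hence the default value zero
     elsewhere.\<close>
   let ?\<beta> = "%u v. if u : ?X then b k u **.N v else \<zero>.N"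
   have "balanced_on X0 B M N N ?\<beta>"
    unfolding balanced_on_def
   proof (intro conjI ballI impI)
    show "?\<beta> (r **.M u) v = ?\<beta> u (r **.N v)" if "r : B" "u : X0" "v <: N" "r **.M u : X0" for r u v
     using that bsm k b X0(4) by (auto simp: N.smult_assoc subset_iff)
    show "?\<beta> (u +.M u') v = ?\<beta> u v +.N ?\<beta> u' v" if "u : X0" "u' : X0" "v <: N" "u +.M u' : X0" for u u' v
     using that badd k b by (auto simp: N.smult_l_distr)
   qed (use b k in \<open>auto simp: N.smult_closed N.smult_r_distr\<close>)
   with zero have "(\<Sum>.N i:{..<n}. ?\<beta> (x i) (f (l i))) = \<zero>.N" by (elim allE) (erule mp)
   then have "(\<Sum>.N i:{..<n}. f (b k (x i) **.L l i)) = \<zero>.N"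
    using l xc[OF k] fc by (subst N.M.finsum_eqI[of _ _ "%i. ?\<beta> (x i) (f (l i))"])
     (auto simp: mod_hom_smult[OF f] N.smult_closed)
   then have "f (\<Sum>.L i:{..<n}. b k (x i) **.L l i) = f \<zero>.L"
    using finsum_additive[OF L.M.abelian_monoid_axioms AN, of f "{..<n}" "%i. b k (x i) **.L l i"]
     fc mod_hom_add[OF f] l xc[OF k] f0 by (simp add: L.smult_closed)
   then show ?thesis using l xc[OF k] by (intro inj_onD[OF inj]) (auto intro!: L.M.finsum_in L.smult_closed)
  qed
  note pb = TL.balanced_pt[unfolded balanced_def]
  have "t = (\<Sum>.(tensor_group A M L) i:{..<n}. \<Sum>.(tensor_group A M L) k:{..<m}. pure_tensor A M L (y k) (b k (x i) **.L l i))"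
   unfolding teq
  proof (rule TL.T.finsum_eqI)
   fix i assume i: "i : {..<n}"
   have "pure_tensor A M L (x i) (l i) = pure_tensor A M L (\<Sum>.M k:{..<m}. b k (x i) **.M y k) (l i)"
    using bspec[OF xy, of "x i"] i by simp
   also have "... = (\<Sum>.(tensor_group A M L) k:{..<m}. pure_tensor A M L (b k (x i) **.M y k) (l i))"
    using pb l i y xc by (intro finsum_additive[where f="%u. pure_tensor A M L u (l i)"] M.M.abelian_monoid_axioms TL.abelian_group_T)
     (auto simp: M.smult_closed)
   also have "... = (\<Sum>.(tensor_group A M L) k:{..<m}. pure_tensor A M L (y k) (b k (x i) **.L l i))"
    using pb l i y xc by (intro TL.T.finsum_eqI) (auto simp: TL.pt_closed L.smult_closed)
   finally show "pure_tensor A M L (x i) (l i) = (\<Sum>.(tensor_group A M L) k:{..<m}. pure_tensor A M L (y k) (b k (x i) **.L l i))" .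
   show "(\<Sum>.(tensor_group A M L) k:{..<m}. pure_tensor A M L (y k) (b k (x i) **.L l i)) <: (tensor_group A M L)"
    using l i y xc by (intro TL.T.finsum_in) (auto simp: TL.pt_closed L.smult_closed)
  qed
  also have "... = (\<Sum>.(tensor_group A M L) k:{..<m}. \<Sum>.(tensor_group A M L) i:{..<n}. pure_tensor A M L (y k) (b k (x i) **.L l i))"
   using l y xc by (intro TL.T.finsum_swap) (auto simp: TL.pt_closed L.smult_closed)
  also have "... = \<zero>.(tensor_group A M L)"
  proof (rule TL.T.finsum_zero')
   fix k assume k: "k : {..<m}"
   note add = finsum_additive[OF L.M.abelian_monoid_axioms TL.abelian_group_T, of "pure_tensor A M L (y k)"]
   have "pure_tensor A M L (y k) (\<Sum>.L i:{..<n}. b k (x i) **.L l i) =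
     (\<Sum>.(tensor_group A M L) i:{..<n}. pure_tensor A M L (y k) (b k (x i) **.L l i))"
    using pb l y xc k by (intro add) (auto simp: L.smult_closed)
   moreover have "pure_tensor A M L (y k) \<zero>.L = \<zero>.(tensor_group A M L)"
    using add[of "{}" "%_. \<zero>.L"] pb y k by simp
   ultimately show "(\<Sum>.(tensor_group A M L) i:{..<n}. pure_tensor A M L (y k) (b k (x i) **.L l i)) = \<zero>.(tensor_group A M L)"
    using fin k by simp
  qed
  finally show ?thesis .
 qed
 show "inj_on ?F (carrier (tensor_group A M L))"
 proof (rule inj_onI)
  fix s t assume st: "s <: (tensor_group A M L)" "t <: (tensor_group A M L)" "?F s = ?F t"
  let ?u = "s -.(tensor_group A M L) t"
  have "?F ?u +.(tensor_group A M N) ?F t = ?F s"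
   using F_add[of ?u t] st by (simp add: a_minus_def TL.T.a_assoc TL.T.l_neg)
  then have "?F ?u = \<zero>.(tensor_group A M N)"
   using st F_closed TL.T.minus_closed by (metis TN.T.add.l_cancel_one' TN.T.a_comm)
  from F0[OF _ this] show "s = t" using st TL.T.minus_eq_zero_iff by simp
 qed
qed

text \<open>An element of \<open>N\<close> is approximated from \<open>N'\<close> one coordinate at
  a time: the difference has its first \<open>k\<close> entries zero, and its entry at
  \<open>k\<close> is realised by an element of \<open>N'\<close> of the same kind.\<close>

lemma artinian_column_filtration:
 assumes R: "ring R" and N: "submodule N R (frn R m)" "submodule N' R (frn R m)" "N' \<subseteq> N"
  and eq: "!!k. k < m ==> {x k | x. x : N & (ALL j<k. x j = \<zero>.R)} \<subseteq> {x k | x. x : N' & (ALL j<k. x j = \<zero>.R)}"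
 shows "N \<subseteq> N'"
proof
 interpret R: ring R by fact
 interpret F: right_module R "frn R m" by (rule R.right_module_free)
 note N1 = F.submoduleD[OF N(1)] and N2 = F.submoduleD[OF N(2)]
 fix x assume x: "x : N"
 have "EX y:N'. ALL j<k. x j = y j" if "k \<le> m" for k
  using that
 proof (induction k)
  case 0
  show ?case using N2(3) by auto
 next
  case (Suc k)
  then obtain y where y: "y : N'" "ALL j<k. x j = y j" by auto
  have k: "k < m" using Suc.prems by simp
  have yN: "y : N" using y N(3) by auto
  have xy: "x j <: R" "y j <: R" if "j < m" for j
   using free_at[of x R "{..<m}" j] free_at[of y R "{..<m}" j] N1(2)[OF x] N1(2)[OF yN] that by auto
  let ?z = "x -.(frn R m) y"
  have z: "?z : N" by (rule N1(7)[OF x yN])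
  have zj: "?z j = x j -.R y j" if "j < m" for j
   using R.free_minus_at[of j "{..<m}" x y] N1(2)[OF x] N1(2)[OF yN] that by simp
  have "?z j = \<zero>.R" if "j < k" for j using zj[of j] y(2) xy[of j] that k by (simp add: R.minus_eq_zero_iff)
  then have "?z k : {x k | x. x : N & (ALL j<k. x j = \<zero>.R)}" using z by auto
  from subsetD[OF eq[OF k] this] obtain w where w: "w : N'" "ALL j<k. w j = \<zero>.R" "?z k = w k" by auto
  have "x j = (y +.(frn R m) w) j" if j: "j < Suc k" for j
  proof (cases "j = k")
   case True
   have "y k +.R (x k -.R y k) = x k" using xy[OF k] by (simp add: a_minus_def R.a_lcomm R.r_neg)
   then show ?thesis using True w(3) zj[OF k] k by (simp add: free_at_simps)
  next
   case False
   then show ?thesis using j k y(2) w(2) xy by (simp add: free_at_simps)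
  qed
  then show ?case using N2(4)[OF y(1) w(1)] by blast
 qed
 from this[OF order_refl] obtain y where y: "y : N'" "ALL j<m. x j = y j" by auto
 then have "x = y" using N1(2)[OF x] N2(2)[OF y(1)] by (intro free_ext[where A=R and X="{..<m}"]) auto
 then show "x : N'" using y(1) by simp
qed

text \<open>Each of the \<open>m\<close> chains of right ideals of leading entries becomes
  stationary; the sum of the individual bounds is a common bound, and equality of all leading ideals
  gives equality of the submodules.\<close>

lemma artinian_free_chain:
 assumes art: "right_artinian R" and N: "!!i. submodule (N i) R (frn R m)" "!!i. N (Suc i) \<subseteq> N i"
 shows "EX i::nat. N (Suc i) = N i"
proof -
 have R: "ring R" and dcc: "!!I :: nat => 'a set. (ALL i. right_ideal (I i) R & I (Suc i) \<subseteq> I i) ==> (EX n. ALL m>=n. I m = I n)"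
  using art unfolding right_artinian_def by blast+
 interpret R: ring R by fact
 interpret F: right_module R "frn R m" by (rule R.right_module_free)
 interpret RR: right_module R "right_regular R" by (rule R.right_module_right_regular)
 define I where "I k i = {x k | x. x : N i & (ALL j<k. x j = \<zero>.R)}" for k i
 have "EX n. ALL i>=n. I k i = I k n" if k: "k < m" for k
 proof (rule dcc, intro allI conjI)
  fix i
  note Ni = F.submoduleD[OF N(1)[of i]]
  show "I k (Suc i) \<subseteq> I k i" unfolding I_def using N(2) by blast
  have "submodule {x : N i. ALL j<k. x j = \<zero>.R} R (frn R m)"
   using Ni k by (intro F.submoduleI') (auto simp: free_at_simps)
  from submodule_image[OF F.right_module_axioms RR.right_module_axioms R.free_coord_hom this, of k]
  have "right_ideal ((%x. x k) ` {x : N i. ALL j<k. x j = \<zero>.R}) R" using k by simp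
  also have "(%x. x k) ` {x : N i. ALL j<k. x j = \<zero>.R} = I k i" unfolding I_def by auto
  finally show "right_ideal (I k i) R" .
 qed
 then obtain nk where nk: "!!k i. k < m ==> i \<ge> nk k ==> I k i = I k (nk k)" by metis
 define n where "n = (\<Sum>k<m. nk k)"
 have le: "nk k \<le> n" if "k < m" for k unfolding n_def using that by (intro member_le_sum) auto
 have "I k n = I k (Suc n)" if "k < m" for k
  using nk[OF that le[OF that]] nk[OF that le_SucI[OF le[OF that]]] by simp
 note eq = this[unfolded I_def]
 have "N n \<subseteq> N (Suc n)"
  by (rule artinian_column_filtration[OF R N(1) N(1) N(2) equalityD1[OF eq]])
 then show ?thesis using N(2)[of n] by blast
qed

text \<open>Applying phi to the matrix of \<open>E i\<close> gives an endomorphism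
  \<open>G i\<close> of \<open>R^m\<close>, and nesting makes the images descend. Where two
  consecutive images agree, a vector \<open>d\<close> fixed by \<open>E i\<close> has its image
  \<open>h d\<close> in the range of the idempotent \<open>G (Suc i)\<close>, so \<open>h d\<close>
  is fixed by it; but \<open>E (Suc i) d = 0\<close> makes it zero.\<close>

lemma nested_projections:
 fixes E :: "nat => (nat => 'a) => nat => 'a"
 assumes A: "ring A" and art: "right_artinian R" and phi: "phi : ring_hom A R"
  and E: "!!i. E i : mod_hom A (frn A m) (frn A m)"
  and idem: "!!i x. x <: (frn A m) ==> E i (E i x) = E i x"
  and nest: "!!i x. x <: (frn A m) ==> E i (E (Suc i) x) = E (Suc i) x"
 shows "EX i. ALL d:carrier (frn A m). E i d = d --> E (Suc i) d = \<zero>.(frn A m) --> (ALL k<m. phi (d k) = \<zero>.R)"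
proof -
 have R: "ring R" using art by (simp add: right_artinian_def)
 interpret phi: ring_hom_ring A R phi by (rule ring_hom_ringI2[OF A R phi])
 let ?F = "frn A m" and ?FR = "frn R m"
 interpret F: right_module A ?F by (rule phi.R.right_module_free)
 interpret FR: right_module R ?FR by (rule phi.S.right_module_free)
 define h where "h x = (\<lambda>j\<in>{..<m}. phi (x j))" for x
 have xc: "x j <: A" if "x <: ?F" "j < m" for x j using free_at[OF that(1)] that(2) by simp
 have h: "h x <: ?FR" if "x <: ?F" for x
  using xc[OF that] by (auto simp: h_def free_right_module_simps)
 have eF: "fbasis A {..<m} l <: ?F" for l by (rule phi.R.fbasis_closed)
 note Ec = mod_hom_closed[OF E]
 define G where "G i = free_lift R ?FR {..<m} (%l. h (E i (fbasis A {..<m} l)))" for i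
 have G: "G i : mod_hom R ?FR ?FR" for i unfolding G_def by (intro FR.free_lift_hom h Ec eF)
 note Gc = mod_hom_closed[OF G]
 have Gh: "G i (h x) = h (E i x)" if x: "x <: ?F" for i x
 proof (rule free_ext)
  show "G i (h x) <: ?FR" "h (E i x) <: ?FR" using Gc h Ec x by auto
  fix j assume j: "j : {..<m}"
  have "G i (h x) = (\<Sum>.?FR l:{..<m}. h x l **.?FR h (E i (fbasis A {..<m} l)))"
   unfolding G_def by (intro FR.free_lift_lessThan h Ec eF x)
  moreover have "h x l **.?FR h (E i (fbasis A {..<m} l)) <: ?FR" if "l : {..<m}" for l
   using free_at[OF h[OF x] that] by (intro FR.smult_closed h Ec eF)
  ultimately have "G i (h x) j = (\<Sum>.R l:{..<m}. (h x l **.?FR h (E i (fbasis A {..<m} l))) j)"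
   using phi.S.free_finsum_at[OF j, of "{..<m}" "%l. h x l **.?FR h (E i (fbasis A {..<m} l))"] by simp
  also have "... = (\<Sum>.R l:{..<m}. phi (E i (fbasis A {..<m} l) j) *.R phi (x l))"
   using j xc[OF x] xc[OF Ec[OF eF]] by (intro phi.S.finsum_eqI) (auto simp: free_at_simps h_def)
  also have "... = (\<Sum>.R l:{..<m}. phi (E i (fbasis A {..<m} l) j *.A x l))"
   using j x xc Ec eF by (intro phi.S.finsum_eqI) auto
  also have "... = phi (\<Sum>.A l:{..<m}. E i (fbasis A {..<m} l) j *.A x l)"
   using j x xc Ec eF by (intro finsum_additive[symmetric]) (auto intro: phi.R.abelian_monoid_axioms phi.S.is_abelian_group)
  also have "(\<Sum>.A l:{..<m}. E i (fbasis A {..<m} l) j *.A x l) = E i x j"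
   using F.free_hom_expand[OF E x] F.free_lift_lessThan[of m "%l. E i (fbasis A {..<m} l)" x] Ec eF x xc j
    phi.R.free_finsum_at[OF j, of "{..<m}" "%l. x l **.?F E i (fbasis A {..<m} l)"]
   by (simp add: free_at_simps F.smult_closed)
  finally show "G i (h x) j = h (E i x) j" using j by (simp add: h_def[of "E i x"])
 qed
 have GG: "G i (G k w) = G k w" if eq: "!!x. x <: ?F ==> E i (E k x) = E k x" and w: "w <: ?FR" for i k w
 proof (rule FR.free_hom_eqI[OF mod_hom_compose[OF G G] G _ w])
  fix l assume l: "l : {..<m}"
  have "G k (fbasis R {..<m} l) = h (E k (fbasis A {..<m} l))"
   unfolding G_def by (rule FR.free_lift_fbasis[OF _ l]) (intro h Ec eF)
  then show "G i (G k (fbasis R {..<m} l)) = G k (fbasis R {..<m} l)"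
   using Gh[OF Ec[OF eF]] eq[OF eF] by simp
 qed
 have "submodule (G i ` carrier ?FR) R ?FR" for i
  by (intro submodule_image[OF _ _ G] FR.submodule_carrier FR.right_module_axioms)
 moreover have "G (Suc i) ` carrier ?FR \<subseteq> G i ` carrier ?FR" for i
  using GG[OF nest] Gc by (metis image_eqI image_subsetI)
 ultimately obtain i where i: "G (Suc i) ` carrier ?FR = G i ` carrier ?FR"
  using artinian_free_chain[OF art, of "%i. G i ` carrier ?FR" m] by blast
 have "phi (d k) = \<zero>.R" if d: "d <: ?F" "E i d = d" "E (Suc i) d = \<zero>.?F" and k: "k < m" for d k
 proof -
  have "h d : G (Suc i) ` carrier ?FR" unfolding i using Gh[OF d(1), of i] d(2) h[OF d(1)] by (metis image_eqI)
  then obtain w where w: "w <: ?FR" "h d = G (Suc i) w" by auto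
  have "h d = G (Suc i) (h d)" unfolding w(2) using GG[OF idem w(1)] by simp
  also have "... = h \<zero>.?F" using Gh[OF d(1)] d(3) by simp
  finally have "h d k = h \<zero>.?F k" by simp
  then show ?thesis using k by (simp add: h_def free_at_simps)
 qed
 then show ?thesis by blast
qed

section \<open>Local coordinates, finite generation and splitting for Hopf modules\<close>

context hopf_quot
begin

text \<open>Local finiteness of comodules: the submodule generated over \<open>A\<close> by the
  finite family of \<open>hopf_cover\<close> is finitely generated and stable.\<close>

lemma hopf_sub_between:
 assumes c: "comat {..<n} c" and P: "submodule P A (FR n)" and stable: "!!psi x. [|psi : D; x : P|] ==> TF c n psi x : P"
  and X: "finite X" "X \<subseteq> P"
 shows "EX L. hopf_sub n c L & X \<subseteq> L & L \<subseteq> P"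
proof -
 interpret F: right_module A "FR n" by (rule rm_FR)
 show ?thesis
 proof (rule hopf_cover[OF hm_FR[OF c] P stable X])
  fix r :: nat and c' y
  let ?\<pi> = "free_lift A (FR n) {..<r} y"
  assume c': "comat {..<r} c'" and \<pi>: "?\<pi> : mod_hom A (FR r) (FR n)" "?\<pi> ` carrier (FR r) \<subseteq> P"
   "X \<subseteq> span A (FR n) {..<r} y" "span A (FR n) {..<r} y = ?\<pi> ` carrier (FR r)"
   and eq: "!!psi x. [|psi : D; x <: (FR r)|] ==> ?\<pi> (TF c' r psi x) = TF c n psi (?\<pi> x)"
  have "hopf_sub n c (?\<pi> ` carrier (FR r))"
   using c F.fg_range[OF \<pi>(1)] eq TF_closed[OF c'] by (auto simp: hopf_sub_def) (metis image_eqI)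
  then show ?thesis using \<pi> by blast
 qed
qed

text \<open>The relations among elements of \<open>X\<close> lift to finitely many elements
  \<open>W\<close> of the kernel of a cover. A finitely generated Hopf submodule \<open>L\<close> of
  the kernel contains \<open>W\<close> and is a direct summand of \<open>A^m\<close>. The
  complementary projection \<open>t\<close> kills \<open>W\<close> without changing the image in
  \<open>M\<close>, so that the entries of \<open>t (z x)\<close> satisfy the relations
  exactly.\<close>

lemma local_coordinates:
 assumes M: "hm M T" and X: "finite X" "X \<subseteq> carrier M" and R: "finite R" "R \<subseteq> carrier A"
 shows "EX (m::nat) y b. (ALL k<m. y k <: M) & (ALL x:X. ALL k<m. b k x <: A) &
   (ALL x:X. x = (\<Sum>.M k:{..<m}. b k x **.M y k)) &
   (ALL x:X. ALL x':X. ALL k<m. x +.M x' : X --> b k (x +.M x') = b k x +.A b k x') &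
   (ALL r:R. ALL x:X. ALL k<m. r **.M x : X --> b k (r **.M x) = b k x *.A r)"
proof -
 have rm: "right_module A M" by (rule comodD(1)[OF hm_comod[OF M]])
 interpret M: right_module A M by (rule rm)
 show ?thesis
 proof (rule hopf_cover[OF M M.submodule_carrier comodD(2)[OF hm_comod[OF M]] X])
  fix m :: nat and c y
  let ?\<pi> = "free_lift A M {..<m} y" and ?F = "FR m"
  assume c: "comat {..<m} c" and y: "!!i. i < m ==> y i <: M" and \<pi>: "?\<pi> : mod_hom A ?F M"
   and "X \<subseteq> span A M {..<m} y" "span A M {..<m} y = ?\<pi> ` carrier ?F"
   and eq: "!!psi x. [|psi : D; x <: ?F|] ==> ?\<pi> (TF c m psi x) = T psi (?\<pi> x)"
  then have "ALL x. EX z. x : X --> z <: ?F & ?\<pi> z = x" by auto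
  then obtain z where z: "!!x. x : X ==> z x <: ?F" "!!x. x : X ==> ?\<pi> (z x) = x" by metis
  interpret F: right_module A ?F by (rule rm_FR)
  let ?P = "{u : carrier ?F. ?\<pi> u = \<zero>.M}"
  \<comment> \<open>The lift \<open>z\<close> is arbitrary outside \<open>X\<close>. Intersecting
    with the kernel discards the differences for which x + x' or x r is not in \<open>X\<close> and
    which need not be relations.\<close>
  define W where "W = ((%(x, x'). z (x +.M x') -.?F (z x +.?F z x')) ` (X \<times> X) \<union>
   (%(r, x). z (r **.M x) -.?F (r **.?F z x)) ` (R \<times> X)) \<inter> ?P"
  have W: "finite W" "W \<subseteq> ?P" using X(1) R(1) by (auto simp: W_def)
  have W1: "z (x +.M x') -.?F (z x +.?F z x') : W" if "x : X" "x' : X" "x +.M x' : X" for x x'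
  proof -
   have "?\<pi> (z (x +.M x') -.?F (z x +.?F z x')) = \<zero>.M"
    using z that X(2) mod_hom_minus[OF \<pi> rm_FR rm] by (simp add: mod_hom_add[OF \<pi>] M.M.minus_eq_zero_iff subset_iff)
   then show ?thesis using z that unfolding W_def by auto
  qed
  have W2: "z (r **.M x) -.?F (r **.?F z x) : W" if "r : R" "x : X" "r **.M x : X" for r x
  proof -
   have rA: "r <: A" using that R(2) by auto
   have "?\<pi> (z (r **.M x) -.?F (r **.?F z x)) = \<zero>.M"
    using z that rA X(2) mod_hom_minus[OF \<pi> rm_FR rm]
    by (simp add: mod_hom_smult[OF \<pi>] M.M.minus_eq_zero_iff F.smult_closed M.smult_closed subset_iff)
   then show ?thesis using z that rA unfolding W_def by (auto intro: F.smult_closed)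
  qed
  have "submodule ?P A ?F" by (rule submodule_kernel[OF rm_FR rm \<pi>])
  moreover have "TF c m psi u : ?P" if "psi : D" "u : ?P" for psi u
   using that eq TF_closed[OF c] T_zero[OF hm_comod[OF M]] by auto
  ultimately obtain L where L: "hopf_sub m c L" "W \<subseteq> L" "L \<subseteq> ?P" using hopf_sub_between[OF c _ _ W] by blast
  obtain \<rho> where \<rho>: "\<rho> : mod_hom A ?F ?F" "!!u. u <: ?F ==> \<rho> u : L" "!!u. u : L ==> \<rho> u = u"
   using hopf_sub_summand[OF L(1)] unfolding summand_def by auto
  define t where "t u = u -.?F \<rho> u" for u
  have t: "t : mod_hom A ?F ?F" unfolding t_def by (intro mod_hom_diff rm_FR mod_hom_ident \<rho>)
  note tc = mod_hom_closed[OF t]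
  have \<pi>t: "?\<pi> (t u) = ?\<pi> u" if u: "u <: ?F" for u
   using mod_hom_minus[OF \<pi> rm_FR rm u mod_hom_closed[OF \<rho>(1) u]] \<rho>(2)[OF u] L(3) mod_hom_closed[OF \<pi> u]
   by (auto simp: t_def a_minus_def)
  have tW: "t u = t w" if uw: "u <: ?F" "w <: ?F" "u -.?F w : W" for u w
  proof -
   have "t (u -.?F w) = \<zero>.?F" using \<rho>(3)[of "u -.?F w"] L(2) uw by (auto simp: t_def F.M.minus_eq_zero_iff)
   then show ?thesis using mod_hom_minus[OF t rm_FR rm_FR uw(1,2)] tc uw by (simp add: F.M.minus_eq_zero_iff)
  qed
  show ?thesis
  proof (intro exI[of _ m] exI[of _ y] exI[of _ "%k x. t (z x) k"] conjI ballI allI impI)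
   show "t (z x) k <: A" if "x : X" "k < m" for x k using free_at[OF tc[OF z(1)[OF that(1)]]] that(2) by simp
   show "x = (\<Sum>.M k:{..<m}. t (z x) k **.M y k)" if "x : X" for x
    using \<pi>t[OF z(1)[OF that]] z(2)[OF that] M.free_lift_lessThan[OF y tc[OF z(1)[OF that]]] by simp
   show "t (z (x +.M x')) k = t (z x) k +.A t (z x') k" if "x : X" "x' : X" "k < m" "x +.M x' : X" for x x' k
    using tW[OF _ _ W1[OF that(1,2,4)]] z that mod_hom_add[OF t] by (simp add: free_at_simps)
   show "t (z (r **.M x)) k = t (z x) k *.A r" if "r : R" "x : X" "k < m" "r **.M x : X" for r x k
    using tW[OF _ _ W2[OF that(1,2,4)]] z that mod_hom_smult[OF t] R(2) F.smult_closed by (simp add: free_at_simps subset_iff)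
  qed (use y in auto)
 qed
qed

text \<open>The sums of values f x form a left ideal by \<open>mult\<close>, and a stable one by
  \<open>coact_trace\<close>, because the coaction on a value consists of values of coacted
  functionals. A nonzero value then makes it all of \<open>A\<close> by simplicity.\<close>

lemma functional_values_generate:
 assumes M: "hm M T" and F: "!!f. f : \<F> ==> f : mod_hom A M RR"
  and mult: "!!a f. [|a <: A; f : \<F>|] ==> (%x. a *.A f x) : \<F>"
  and co: "!!f phi. [|f : \<F>; phi : D|] ==> coact M T f phi : \<F>"
  and nz: "f0 : \<F>" "x0 <: M" "f0 x0 ~= \<zero>.A"
  and S: "\<zero>.A : U" "!!s t. [|s : U; t : U; s <: A; t <: A|] ==> s +.A t : U"
   "!!f x. [|f : \<F>; x <: M|] ==> f x : U"
 shows "\<one>.A : U"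
proof -
 interpret M: right_module A M by (rule comodD(1)[OF hm_comod[OF M]])
 define good where "good U \<longleftrightarrow> \<zero>.A : U & (ALL s:U. ALL t:U. s <: A --> t <: A --> s +.A t : U) &
  (ALL f:\<F>. ALL x:carrier M. f x : U)" for U
 have good_sum: "(\<Sum>.A i:I. u i) : U" if "good U" "finite I" "!!i. i : I ==> u i : U \<inter> carrier A" for U u and I :: "nat set"
  using that(2,3)
 proof (induction I)
  case empty
  show ?case using that(1) by (simp add: good_def)
 next
  case (insert i I)
  have "finsum A u I <: A" using insert.prems by (intro Z.finsum_in) auto
  moreover have "finsum A u (insert i I) = u i +.A finsum A u I"
   using insert.prems insert.hyps by (intro Z.finsum_insert) auto
  ultimately show ?case using insert that(1) by (simp add: good_def)
 qed
 \<comment> \<open>The intersection of all \<open>good\<close> sets. Closure properties of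
   \<open>J\<close> are obtained by checking that the preimage of a good set under multiplication by
   \<open>b\<close>, or under \<open>TA psi\<close>, is good again.\<close>
 define J where "J = {a : carrier A. ALL U. good U --> a : U}"
 have fJ: "f x : J" if "f : \<F>" "x <: M" for f x
  using that hom_closed[OF F] by (auto simp: J_def good_def)
 have "left_ideal J A"
 proof (rule Z.left_idealI)
  fix b a assume b: "b <: A" and a: "a : J"
  have "b *.A a : U" if "good U" for U
  proof -
   have "good {a : carrier A. b *.A a : U}"
    using that b mult hom_closed[OF F] unfolding good_def by (auto simp: Z.r_distr)
   then show ?thesis using a by (auto simp: J_def)
  qed
  then show "b *.A a : J" using a b by (auto simp: J_def)
 qed (auto simp: J_def good_def)
 moreover have "TA psi a : J" if psi: "psi : D" and a: "a : J" for psi a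
 proof -
  have "TA psi a : U" if U: "good U" for U
  proof -
   have "TA psi (f x) : U" if f: "f : \<F>" and x: "x <: M" for f x
   proof -
    obtain n :: nat and c p where c: "comat {..<n} c" and p: "fam M T {..<n} c p"
     and sp: "!!u. u : {x} ==> EX k. (ALL i<n. k i <: K) & u = lc M {..<n} k p"
     by (rule comatrix_family[OF hm_comod[OF M] M.submodule_carrier comodD(2)[OF hm_comod[OF M]], of "{x}"])
      (use x in \<open>auto intro: that\<close>)
    obtain k where k: "ALL i<n. k i <: K" "x = lc M {..<n} k p" using sp[OF singletonI] by (elim exE conjE) (rule that)
    have pM: "p i <: M" and cc: "c i j <: H" if "i < n" "j < n" for i j using p that by (auto simp: fam_def)
    have fp: "f (p i) <: RR" if "i : {..<n}" for i using hom_closed[OF F[OF f] pM[of i]] that by simp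
    have "f x = lc RR {..<n} k (%i. f (p i))"
     unfolding k(2) lc_def using k(1) pM
     by (subst mod_hom_finsum[OF F[OF f] M.right_module_axioms rm_RR]) (auto simp: mod_hom_smult[OF F[OF f]] M.smult_closed intro!: Z.finsum_eqI hom_closed[OF F[OF f]])
    then have "TA psi (f x) = (\<Sum>.A j:{..<n}. TA psi (f (p j)) *.A ks (k j))"
     using T_lc[OF comod_A psi, of "{..<n}" k "%i. f (p i)"] k(1) fp by (simp add: lc_RR)
    also have "... : U"
    proof (rule good_sum[OF U], simp)
     fix j assume j: "j : {..<n}"
     have dc: "(%h. psi (h *.H c i j)) : D" if "i < n" for i using dual_right[OF psi cc[OF that]] j by simp
     have g: "coact M T f (%h. psi (h *.H c i j)) : \<F>" if "i < n" for i by (rule co[OF f dc[OF that]])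
     have "TA psi (f (p j)) *.A ks (k j) =
       (\<Sum>.A i:{..<n}. coact M T f (%h. psi (h *.H c i j)) (p i)) *.A ks (k j)"
      using coact_trace[OF M F[OF f] c p psi, of j] j by simp
     also have "... = (\<Sum>.A i:{..<n}. coact M T f (%h. psi (h *.H c i j)) (p i) *.A ks (k j))"
      using j k(1) hom_closed[OF F[OF g]] pM by (intro Z.finsum_mult_right) auto
     also have "... = (\<Sum>.A i:{..<n}. coact M T f (%h. psi (h *.H c i j)) (ks (k j) **.M p i))"
      using j k(1) hom_closed[OF F[OF g]] pM M.smult_closed mod_hom_smult[OF F[OF g]]
      by (intro Z.finsum_eqI) auto
     also have "... : U"
      using U g j k(1) pM hom_closed[OF F[OF g]] M.smult_closed by (intro good_sum) (auto simp: good_def)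
     finally show "TA psi (f (p j)) *.A ks (k j) : U \<inter> carrier A" using fp[OF j] k(1) j psi by simp
    qed
    finally show ?thesis .
   qed
   then have "good {a : carrier A. TA psi a : U}"
    using U hom_closed[OF F] psi T_zero[OF comod_A psi] unfolding good_def by (auto simp: TA_add)
   then show ?thesis using a by (auto simp: J_def)
  qed
  then show ?thesis using a psi by (auto simp: J_def)
 qed
 moreover have "J ~= {\<zero>.A}" using fJ[OF nz(1,2)] nz(3) by auto
 ultimately have "J = carrier A" by (rule simple_A)
 then have "\<one>.A : J" by simp
 moreover have "good U" using S by (auto simp: good_def)
 ultimately show ?thesis by (auto simp: J_def)
qed

text \<open>Otherwise an infinite chain of direct summands has a descending chain of complements.  Over \<open>R\<close>
 two consecutive complements coincide, so \<open>phi\<close> kills the values of the functionals on one summand that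
 vanish on the previous one; but these values generate \<open>A\<close>.\<close>

lemma stable_fg:
 fixes R :: "('r, 'rc) ring_scheme"
 assumes art: "right_artinian R" and nonzero: "carrier R ~= {\<zero>.R}" and phi: "phi : ring_hom A R"
  and c: "comat {..<m} c" and P: "submodule P A (FR m)" and stable: "!!psi x. [|psi : D; x : P|] ==> TF c m psi x : P"
 shows "fg A (FR m) P"
proof (rule ccontr)
 assume nfg: "\<not> fg A (FR m) P"
 have R: "ring R" using art by (simp add: right_artinian_def)
 interpret phi: ring_hom_ring A R phi by (rule ring_hom_ringI2[OF Z.ring_axioms R phi])
 interpret F: right_module A "FR m" by (rule rm_FR)
 note Ps = F.submoduleD[OF P]
 \<comment> \<open>The last two clauses make \<open>E\<close> a projection of \<open>A^m\<close>
   with kernel \<open>L\<close>; its image is a complement of \<open>L\<close>.\<close>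
 define ok where "ok L E \<longleftrightarrow> hopf_sub m c L & L \<subseteq> P & E : mod_hom A (FR m) (FR m) & (ALL x:L. E x = \<zero>.(FR m)) &
  (ALL x:carrier (FR m). x -.(FR m) E x : L)" for L E
 have retract: "EX t:mod_hom A (FR m) (FR m). (ALL x:L. t x = \<zero>.(FR m)) & (ALL x:carrier (FR m). x -.(FR m) t x : L)"
  if L: "hopf_sub m c L" for L
 proof -
  obtain \<rho> where \<rho>: "\<rho> : mod_hom A (FR m) (FR m)" "ALL u:carrier (FR m). \<rho> u : L" "ALL u:L. \<rho> u = u"
   using hopf_sub_summand[OF L] unfolding summand_def by auto
  have LF: "L \<subseteq> carrier (FR m)" by (rule hopf_subD(4)[OF L])
  have "x -.(FR m) (x -.(FR m) \<rho> x) = \<rho> x" if x: "x <: (FR m)" for x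
   using x mod_hom_closed[OF \<rho>(1) x] by (simp add: F.M.minus_minus_cancel)
  then show ?thesis
   using \<rho>(2,3) LF by (intro bexI[OF _ mod_hom_diff[OF rm_FR rm_FR mod_hom_ident \<rho>(1)]])
    (auto simp: F.M.minus_eq_zero_iff subset_iff)
 qed
 have ex0: "EX p. ok (fst p) (snd p)"
 proof -
  obtain L where L: "hopf_sub m c L" "L \<subseteq> P" using hopf_sub_between[OF c P stable, of "{}"] by auto
  obtain t where "t\<in>mod_hom A (FR m) (FR m)" "ALL x:L. t x = \<zero>.(FR m)" "ALL x:carrier (FR m). x -.(FR m) t x : L"
   using retract[OF L(1)] by (elim bexE conjE) (rule that)
  then have "ok (fst (L, t)) (snd (L, t))" using L by (simp add: ok_def)
  then show ?thesis by (rule exI)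
 qed
 define step where "step p q \<longleftrightarrow> fst p \<subset> fst q & (ALL x:carrier (FR m). snd p (snd q x) = snd q x)"
  for p q :: "(nat => 'a) set \<times> ((nat => 'a) => nat => 'a)"
 have idem: "E (E x) = E x" if "ok L E" "x <: (FR m)" for L E x
 proof -
  have E: "E : mod_hom A (FR m) (FR m)" using that by (simp add: ok_def)
  have "E (x -.(FR m) E x) = \<zero>.(FR m)" using that by (simp add: ok_def)
  then show ?thesis
   using mod_hom_minus[OF E rm_FR rm_FR that(2) mod_hom_closed[OF E that(2)]] mod_hom_closed[OF E] that(2)
   by (simp add: F.M.minus_eq_zero_iff)
 qed
 have ex_step: "EX q. ok (fst q) (snd q) & step p q" if "ok (fst p) (snd p)" for p
 proof -
  define L E where "L = fst p" and "E = snd p"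
  have ok: "ok L E" using that by (simp add: L_def E_def)
  have L: "hopf_sub m c L" "L \<subseteq> P" and E: "E : mod_hom A (FR m) (FR m)" "!!x. x : L ==> E x = \<zero>.(FR m)"
   "!!x. x <: (FR m) ==> x -.(FR m) E x : L" using ok by (auto simp: ok_def)
  note Ec = mod_hom_closed[OF E(1)]
  have "L ~= P" using nfg hopf_subD(2)[OF L(1)] by auto
  then obtain u where u: "u : P" "u \<notin> L" using L(2) by auto
  obtain X where X: "finite X" "X \<subseteq> L" and Xtop: "ALL N. submodule N A (FR m) & X \<subseteq> N --> L \<subseteq> N"
   by (rule fgE[OF hopf_subD(2)[OF L(1)]]) (rule that)
  obtain L' where L': "hopf_sub m c L'" "insert u X \<subseteq> L'" "L' \<subseteq> P"
   using hopf_sub_between[OF c P stable, of "insert u X"] X u L(2) by auto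
  note L's = F.submoduleD[OF hopf_subD(3)[OF L'(1)]]
  have LL': "L \<subseteq> L'" using Xtop hopf_subD(3)[OF L'(1)] L'(2) by auto
  obtain t where t: "t : mod_hom A (FR m) (FR m)" and t0: "ALL x:L'. t x = \<zero>.(FR m)"
   and tL: "ALL x:carrier (FR m). x -.(FR m) t x : L'" using retract[OF L'(1)] by (elim bexE conjE) (rule that)
  note tc = mod_hom_closed[OF t]
  \<comment> \<open>A projection \<open>t\<close> for the larger \<open>L'\<close> alone would not
    have its image inside that of \<open>E\<close>. Sandwiching it between two copies of
    \<open>E\<close> keeps the kernel condition and makes the complements descend.\<close>
  let ?E = "%x. E (t (E x))"
  have EL': "E x : L'" if "x : L'" for x
  proof -
   have x: "x <: (FR m)" using L's(2)[OF that] .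
   have "x -.(FR m) (x -.(FR m) E x) = E x"
    using x Ec[OF x] by (simp add: F.M.minus_minus_cancel)
   then show ?thesis using L's(7)[OF that, of "x -.(FR m) E x"] E(3)[OF x] LL' by auto
  qed
  have "?E : mod_hom A (FR m) (FR m)" by (intro mod_hom_compose[OF E(1) mod_hom_compose[OF t E(1)]])
  moreover have "?E x = \<zero>.(FR m)" if "x : L'" for x using EL'[OF that] t0 mod_hom_zero[OF E(1) rm_FR rm_FR] by simp
  moreover have "x -.(FR m) ?E x : L'" if x: "x <: (FR m)" for x
  proof -
   let ?y = "E x" let ?z = "t ?y"
   have c3: "?y <: (FR m)" "?z <: (FR m)" "E ?z <: (FR m)" using Ec tc x by auto
   have "((x -.(FR m) ?y) +.(FR m) (?y -.(FR m) ?z)) +.(FR m) (?z -.(FR m) E ?z) = x -.(FR m) E ?z"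
    using x c3 by (simp add: a_minus_def F.M.a_ac F.M.r_neg1 F.M.r_neg2)
   moreover have "x -.(FR m) ?y : L'" "?y -.(FR m) ?z : L'" "?z -.(FR m) E ?z : L'"
    using E(3)[OF x] E(3)[OF c3(2)] bspec[OF tL c3(1)] LL' by auto
   ultimately show ?thesis using L's(4)[OF L's(4)] by metis
  qed
  ultimately have "ok L' ?E" using L' by (simp add: ok_def)
  moreover have "L \<subset> L'" using LL' u(2) L'(2) by auto
  moreover have "E (?E x) = ?E x" if "x <: (FR m)" for x using idem[OF ok tc[OF Ec[OF that]]] .
  ultimately show ?thesis by (intro exI[of _ "(L', ?E)"]) (auto simp: step_def L_def E_def)
 qed
 obtain s where s: "!!i. ok (fst (s i)) (snd (s i))" "!!i. step (s i) (s (Suc i))"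
  using dependent_nat_choice[of "%_ p. ok (fst p) (snd p)" "%_. step"] ex0 ex_step by metis
 define L E where "L i = fst (s i)" and "E i = snd (s i)" for i
 have ok: "ok (L i) (E i)" for i using s(1) by (simp add: L_def E_def)
 have L: "hopf_sub m c (L i)" and E: "E i : mod_hom A (FR m) (FR m)" and E0: "x : L i ==> E i x = \<zero>.(FR m)"
  and EL: "x <: (FR m) ==> x -.(FR m) E i x : L i" for i x using ok[of i] by (auto simp: ok_def)
 have LS: "L i \<subset> L (Suc i)" and nest: "x <: (FR m) ==> E i (E (Suc i) x) = E (Suc i) x" for i x
  using s(2)[of i] by (auto simp: step_def L_def E_def)
 \<comment> \<open>At this stage the complements have the same image over \<open>R\<close>;
   \<open>i\<close> says what this means for vectors of \<open>A^m\<close>.\<close>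
 obtain i where i: "!!d k. [|d <: (FR m); E i d = d; E (Suc i) d = \<zero>.(FR m); k < m|] ==> phi (d k) = \<zero>.R"
  using nested_projections[where E=E and m=m, OF Z.ring_axioms art phi E idem[OF ok] nest] by blast
 let ?L = "L i" and ?L' = "L (Suc i)"
 note Ld = hopf_subD[OF L[of i]] and L'd = hopf_subD[OF L[of "Suc i"]]
 let ?M = "FR m(|carrier := ?L'|)" and ?T = "TF c m"
 have hM: "hm ?M ?T" by (rule hm_submodule[OF hm_FR[OF c] L'd(3,5)])
 note Ec = mod_hom_closed[OF E]
 \<comment> \<open>Functionals on one summand that vanish on the previous one. The family is closed
   under coaction because the smaller summand is stable.\<close>
 define \<F> where "\<F> = {f : mod_hom A ?M RR. ALL x:?L. f x = \<zero>.A}"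
 obtain u where u: "u : ?L'" "u \<notin> ?L" using LS[of i] by auto
 have uF: "u <: (FR m)" using u L'd(4) by auto
 have "E i u ~= \<zero>.(FR m)"
  using EL[OF uF, of i] u(2) uF by (auto simp: F.M.diff_zero)
 \<comment> \<open>The k-th coordinate of \<open>E i\<close> is the required nonzero member of the
   family: it vanishes on ?L, but not at \<open>u\<close>.\<close>
 then obtain k where k: "k < m" "E i u k ~= \<zero>.A"
  using free_ext[where A=A and X="{..<m}", OF Ec[OF uF] F.M.zero_closed] by (auto simp: free_at_simps)
 have "\<one>.A : {a. phi a = \<zero>.R}"
 proof (rule functional_values_generate[OF hM, where \<F>=\<F> and ?f0.0="%x. E i x k" and ?x0.0=u])
  show "f : mod_hom A ?M RR" if "f : \<F>" for f using that by (simp add: \<F>_def)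
  show "(%x. a *.A f x) : \<F>" if "a <: A" "f : \<F>" for a f
   using that mult_hom_compose by (auto simp: \<F>_def)
  show "coact ?M ?T f psi : \<F>" if f: "f : \<F>" and psi: "psi : D" for f psi
  proof -
   have "coact ?M ?T f psi x = \<zero>.A" if x: "x : ?L" for x
   proof -
    have "TA (%u. psi (u *.H S (v b))) (f (?T (cf b) x)) = \<zero>.A" if "b : B" for b
     using T_zero[OF comod_A dual_S[OF psi v[OF that]]] Ld(5)[OF cf[OF that] x] f by (simp add: \<F>_def)
    then show ?thesis unfolding coact_def by (intro Z.finsum_zero') auto
   qed
   then show ?thesis using coact_hom[OF hM _ psi] f by (auto simp: \<F>_def)
  qed
  have Ek: "(%x. E i x k) : mod_hom A (FR m) RR" using k by (intro mod_hom_compose[OF Z.free_coord_hom E]) simp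
  show "(%x. E i x k) : \<F>"
   using E0 k mod_hom_subdomain[OF Ek L'd(4)] by (auto simp: \<F>_def free_at_simps)
  show "f x : {a. phi a = \<zero>.R}" if f: "f : \<F>" and x: "x <: ?M" for f x
  proof -
   have fh: "f : mod_hom A ?M RR" and f0: "!!x. x : ?L ==> f x = \<zero>.A" using f by (auto simp: \<F>_def)
   obtain g where g: "g : mod_hom A (FR m) RR" "ALL x:?L'. g x = f x" using functional_extends[OF L fh] by blast
   have xL: "x : ?L'" and xF: "x <: (FR m)" using x L'd(4) by auto
   \<comment> \<open>The vector differs from \<open>x\<close> by an element of ?L, so f x = g(?d).
     It is fixed by \<open>E i\<close> and lies in ?L', hence is killed by \<open>E (Suc i)\<close>;
     therefore phi kills its entries and with them \<open>g ?d\<close>.\<close>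
   let ?d = "E i x"
   have d: "?d <: (FR m)" by (rule Ec[OF xF])
   have diff: "x -.(FR m) ?d : ?L" by (rule EL[OF xF])
   have "x -.(FR m) (x -.(FR m) ?d) = ?d"
    using xF d by (simp add: F.M.minus_minus_cancel)
   then have dL: "?d : ?L'" using F.submoduleD(7)[OF L'd(3) xL, of "x -.(FR m) ?d"] diff LS[of i] by auto
   have "phi (?d j) = \<zero>.R" if "j < m" for j
    by (rule i[OF d idem[OF ok xF] E0[OF dL] that])
   moreover have "g ?d = (\<Sum>.A j:{..<m}. g (fbasis A {..<m} j) *.A ?d j)"
   proof -
    interpret RRm: right_module A RR by (rule rm_RR)
    show ?thesis
     using RRm.free_hom_expand[OF g(1) d] RRm.free_lift_lessThan[of m "%j. g (fbasis A {..<m} j)" ?d]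
      hom_closed[OF g(1) Z.fbasis_closed] d by simp
   qed
   moreover have "phi (\<Sum>.A j:{..<m}. g (fbasis A {..<m} j) *.A ?d j) =
     (\<Sum>.R j:{..<m}. phi (g (fbasis A {..<m} j) *.A ?d j))"
    using hom_closed[OF g(1) Z.fbasis_closed] free_at[OF d]
    by (intro finsum_additive) (auto intro: Z.abelian_monoid_axioms phi.S.is_abelian_group)
   moreover have "... = \<zero>.R" if "!!j. j < m ==> phi (?d j) = \<zero>.R"
    using that hom_closed[OF g(1) Z.fbasis_closed] free_at[OF d] by (intro phi.S.finsum_zero') auto
   ultimately have "phi (g ?d) = \<zero>.R" by simp
   moreover have "g ?d = f x"
   proof -
    have "g (x -.(FR m) ?d) = \<zero>.A" using g(2) diff f0 LS[of i] by auto
    then have "g x = g ?d"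
     using mod_hom_minus[OF g(1) rm_FR rm_RR xF d] hom_closed[OF g(1)] xF d by (simp add: Z.minus_eq_zero_iff)
    then show ?thesis using g(2) xL by simp
   qed
   ultimately show ?thesis by simp
  qed
 qed (use u k in auto)
 then have "\<one>.R = \<zero>.R" by simp
 then show False using nonzero phi.S.one_zeroD by blast
qed

theorem hopf_module_flat:
 assumes M: "hm M T"
 shows "flat TYPE('l) TYPE('n) A M"
 by (intro flat_of_local_coordinates local_coordinates[OF M] comodD(1)[OF hm_comod[OF M]])

text \<open>The extension step for a stable \<open>N\<close>: take an equivariant cover
  \<open>p\<close> of a vector outside \<open>N\<close>. The preimage of \<open>N\<close> in
  \<open>A^n\<close> is stable, hence finitely generated by \<open>stable_fg\<close>, hence a direct
  summand. The projection \<open>q\<close> onto a complement is then injective modulo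
  \<open>N\<close> after \<open>p\<close>, and \<open>N\<close> enlarged by the image of
  \<open>p\<close> is stable again.\<close>

theorem hopf_module_projective:
 fixes R :: "('r, 'rc) ring_scheme"
 assumes art: "right_artinian R" and nonzero: "carrier R ~= {\<zero>.R}" and phi: "phi : ring_hom A R" and M: "hm M T"
 shows "projective A M"
proof -
 have rm: "right_module A M" by (rule comodD(1)[OF hm_comod[OF M]])
 interpret M: right_module A M by (rule rm)
 note Tc = comodD(2)[OF hm_comod[OF M]] and Tadd = comodD(3)[OF hm_comod[OF M]]
 define \<N> where "\<N> = {N. submodule N A M & (ALL psi:D. ALL x:N. T psi x : N)}"
 show ?thesis
 proof (rule projective_by_extension[OF rm, of \<N>])
  show "{\<zero>.M} : \<N>"
   using T_zero[OF hm_comod[OF M]] by (auto simp: \<N>_def M.smult_zero intro!: M.submoduleI')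
  show "submodule N A M" if "N : \<N>" for N using that by (simp add: \<N>_def)
  show "\<Union>C : \<N>" if C: "C ~= {}" "C \<subseteq> \<N>" "!!N N'. [|N : C; N' : C|] ==> N \<subseteq> N' \<or> N' \<subseteq> N" for C
  proof -
   have sub: "submodule N A M" and st: "!!psi x. psi : D ==> x : N ==> T psi x : N" if "N : C" for N
    using that C(2) by (auto simp: \<N>_def)
   have "submodule (\<Union>C) A M"
   proof (rule M.submoduleI')
    show "\<Union>C \<subseteq> carrier M" using M.submoduleD(1)[OF sub] by auto
    show "\<zero>.M : \<Union>C" using M.submoduleD(3)[OF sub] C(1) by auto
    show "a **.M x : \<Union>C" if "a <: A" "x : \<Union>C" for a x
     using M.submoduleD(5)[OF sub that(1)] that(2) by auto
    fix x y assume "x : \<Union>C" "y : \<Union>C"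
    then obtain N N' where N: "N : C" "x : N" "N' : C" "y : N'" by auto
    from C(3)[OF N(1,3)] show "x +.M y : \<Union>C"
    proof
     assume "N \<subseteq> N'"
     then show ?thesis using M.submoduleD(4)[OF sub[OF N(3)], of x y] N by auto
    next
     assume "N' \<subseteq> N"
     then show ?thesis using M.submoduleD(4)[OF sub[OF N(1)], of x y] N by auto
    qed
   qed
   then show ?thesis using st by (auto simp: \<N>_def)
  qed
  fix N assume N: "N : \<N>" "N ~= carrier M"
  have Ns: "submodule N A M" and Nst: "!!psi x. [|psi : D; x : N|] ==> T psi x : N" using N by (auto simp: \<N>_def)
  note Nd = M.submoduleD[OF Ns]
  obtain u where u: "u <: M" "u \<notin> N" using N(2) Nd(1) by auto
  show "EX (n::nat) p q. p : mod_hom A (FR n) M & q : mod_hom A (FR n) (FR n) &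
   (ALL x:carrier (FR n). p x -.M p (q x) : N) & (ALL x:carrier (FR n). p (q x) : N --> q x = \<zero>.(FR n)) &
   {y +.M p x | y x. y : N & x <: (FR n)} : \<N> & \<not> p ` carrier (FR n) \<subseteq> N"
  proof (rule hopf_cover[OF M M.submodule_carrier Tc, of "{u}"])
   fix n :: nat and c y
   let ?p = "free_lift A M {..<n} y"
   assume c: "comat {..<n} c" and p: "?p : mod_hom A (FR n) M" and span: "{u} \<subseteq> span A M {..<n} y"
    "span A M {..<n} y = ?p ` carrier (FR n)"
    and eq: "!!psi x. [|psi : D; x <: (FR n)|] ==> ?p (TF c n psi x) = T psi (?p x)"
   interpret F: right_module A "FR n" by (rule rm_FR)
   note pc = mod_hom_closed[OF p]
   let ?L = "{x : carrier (FR n). ?p x : N}"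
   have Ls: "submodule ?L A (FR n)" by (rule submodule_preimage[OF rm_FR rm p Ns])
   have Lst: "TF c n psi x : ?L" if "psi : D" "x : ?L" for psi x using that eq Nst TF_closed[OF c] by auto
   have "hopf_sub n c ?L"
    unfolding hopf_sub_def using c stable_fg[OF art nonzero phi c Ls Lst] Lst by blast
   then obtain \<rho> where \<rho>: "\<rho> : mod_hom A (FR n) (FR n)" "!!x. x <: (FR n) ==> \<rho> x : ?L" "!!x. x : ?L ==> \<rho> x = x"
    using hopf_sub_summand unfolding summand_def by blast
   note \<rho>c = mod_hom_closed[OF \<rho>(1)]
   let ?q = "%x. x -.(FR n) \<rho> x"
   have q: "?q : mod_hom A (FR n) (FR n)" by (intro mod_hom_diff rm_FR mod_hom_ident \<rho>)
   have "?p x -.M ?p (?q x) : N" if x: "x <: (FR n)" for x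
   proof -
    have "?p x -.M (?p x -.M ?p (\<rho> x)) = ?p (\<rho> x)"
     using pc[OF x] pc[OF \<rho>c[OF x]] by (simp add: M.M.minus_minus_cancel)
    then show ?thesis using mod_hom_minus[OF p rm_FR rm x \<rho>c[OF x]] \<rho>(2)[OF x] by simp
   qed
   moreover have "?q x = \<zero>.(FR n)" if x: "x <: (FR n)" and "?p (?q x) : N" for x
   proof -
    have qc: "?q x <: (FR n)" by (rule mod_hom_closed[OF q x])
    have "\<rho> (?q x) = ?q x" using \<rho>(3)[of "?q x"] that qc by blast
    moreover have "\<rho> (?q x) = \<zero>.(FR n)"
     using mod_hom_minus[OF \<rho>(1) rm_FR rm_FR x \<rho>c[OF x]] \<rho>(3)[OF \<rho>(2)[OF x]] \<rho>c[OF x] by (simp add: F.M.minus_eq_zero_iff)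
    ultimately show ?thesis by simp
   qed
   moreover have "{y +.M ?p x | y x. y : N & x <: (FR n)} : \<N>" (is "?S : \<N>")
    unfolding \<N>_def
   proof (rule CollectI, intro conjI ballI)
    show "submodule ?S A M"
    proof (rule M.submoduleI')
     show "?S \<subseteq> carrier M" using Nd(2) pc by auto
     show "\<zero>.M : ?S" using Nd(3) mod_hom_zero[OF p rm_FR rm]
      by (intro CollectI exI[of _ "\<zero>.M"] exI[of _ "\<zero>.(FR n)"]) simp
     fix s assume "s : ?S"
     then obtain y x where s: "s = y +.M ?p x" "y : N" "x <: (FR n)" by auto
     show "a **.M s : ?S" if "a <: A" for a
      using s that Nd(2,5) pc mod_hom_smult[OF p that, of x] F.smult_closed[OF that, of x]
      by (intro CollectI exI[of _ "a **.M y"] exI[of _ "a **.(FR n) x"]) (simp add: M.smult_r_distr)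
     fix s' assume "s' : ?S"
     then obtain y' x' where s': "s' = y' +.M ?p x'" "y' : N" "x' <: (FR n)" by auto
     have "s +.M s' = (y +.M y') +.M ?p (x +.(FR n) x')"
      using s s' Nd(2) pc mod_hom_add[OF p, of x x'] by (simp add: M.M.a_ac)
     then show "s +.M s' : ?S" using s s' Nd(4) by blast
    qed
    fix psi s assume psi: "psi : D" and "s : ?S"
    then obtain y x where s: "s = y +.M ?p x" "y : N" "x <: (FR n)" by auto
    have "T psi s = T psi y +.M ?p (TF c n psi x)"
     using s Nd(2) pc Tadd[OF psi, of y "?p x"] eq[OF psi, of x] by simp
    then show "T psi s : ?S" using Nst[OF psi s(2)] TF_closed[OF c psi s(3)] by blast
   qed
   moreover have "\<not> ?p ` carrier (FR n) \<subseteq> N" using span u(2) by auto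
   ultimately show ?thesis using p q by (intro exI[of _ n] exI[of _ ?p] exI[of _ ?q]) blast
  qed (use u in auto)
 qed
qed

end

section \<open>From coactions to functionals\<close>

lemma module_right_module:
 assumes "module K V"
 shows "right_module K V"
proof -
 interpret module K V by fact
 show ?thesis
  by unfold_locales (auto simp: smult_l_distr smult_r_distr smult_assoc1[symmetric] m_comm)
qed

lemma tensor_simps [simp]:
 "carrier (tensor K V W) = carrier (tensor_group K V W)" "zero (tensor K V W) = zero (tensor_group K V W)"
 "add (tensor K V W) = add (tensor_group K V W)"
 "smult (tensor K V W) = (%c. tensor_map K V W (%x. c **.V x) id)"
 by (simp_all add: tensor_def ring.extend_def module.fields_def)

lemma abelian_group_tensor:
 assumes "abelian_group (tensor_group K V W)"
 shows "abelian_group (tensor K V W)"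
proof -
 interpret abelian_group "tensor_group K V W" by fact
 show ?thesis by (rule abelian_groupI) (auto simp: a_ac intro: l_neg)
qed

lemma tensor_algebra_simps [simp]:
 "carrier (tensor_algebra K V W) = carrier (tensor_group K V W)"
 "mult (tensor_algebra K V W) = (%s t. tensor_lift (tensor_group K V W) (%a b.
   tensor_lift (tensor_group K V W) (%a' b'. pure_tensor K V W (a *.V a') (b *.W b')) t) s)"
 "one (tensor_algebra K V W) = pure_tensor K V W \<one>.V \<one>.W"
 by (simp_all add: tensor_algebra_def)

lemma tensor_pairI: "[|right_module K V; right_module K W|] ==> tensor_pair K V W"
 by (simp add: tensor_pair_def tensor_pair_axioms_def right_module_def right_module_axioms_def)

lemma tensor_map_sum:
 assumes V: "right_module K V" and W: "right_module K W" and T: "tensor_pair K V' W'"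
  and f: "f : mod_hom K V V'" and g: "g : mod_hom K W W'"
  and xy: "!!i. i : I ==> x i <: V" "!!i. i : I ==> y i <: W"
 shows "tensor_map K V' W' f g (\<Sum>.(tensor_group K V W) i:I. pure_tensor K V W (x i) (y i)) =
  (\<Sum>.(tensor_group K V' W') i:I. pure_tensor K V' W' (f (x i)) (g (y i)))"
proof -
 interpret V: right_module K V by fact
 interpret W: right_module K W by fact
 interpret T: tensor_pair K V W by (rule tensor_pairI[OF V W])
 interpret T': tensor_pair K V' W' by fact
 have "balanced K V W (tensor_group K V' W') (%x y. pure_tensor K V' W' (f x) (g y))"
  using T'.balanced_pt mod_hom_closed[OF f] mod_hom_closed[OF g]
  by (auto simp: balanced_def mod_hom_add[OF f] mod_hom_add[OF g] mod_hom_smult[OF f] mod_hom_smult[OF g])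
 then show ?thesis
  unfolding tensor_map_def by (rule T.tensor_lift_sum_pt[OF T'.abelian_group_T _ xy])
qed

lemma tensor_smult_sum:
 assumes K: "cring K" and V: "right_module K V" and W: "right_module K W" and c: "c <: K"
  and xy: "!!i. i : I ==> x i <: V" "!!i. i : I ==> y i <: W"
 shows "c **.(tensor K V W) (\<Sum>.(tensor_group K V W) i:I. pure_tensor K V W (x i) (y i)) =
  (\<Sum>.(tensor_group K V W) i:I. pure_tensor K V W (c **.V x i) (y i))"
proof -
 interpret K: cring K by fact
 interpret V: right_module K V by fact
 have "(%x. c **.V x) : mod_hom K V V"
  using c by (intro mod_homI) (auto simp: V.smult_closed V.smult_r_distr V.smult_assoc[symmetric] K.m_comm)
 from tensor_map_sum[where x=x and y=y and I=I and g=id, OF V W tensor_pairI[OF V W] this _ xy] show ?thesis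
  by (simp add: mod_hom_mem)
qed

lemma tensor_pair_tensor:
 assumes K: "cring K" and V: "right_module K V" and W: "right_module K W"
 shows "abelian_group (tensor K V W)" "[|c <: K; t <: (tensor_group K V W)|] ==> c **.(tensor K V W) t <: (tensor_group K V W)"
proof -
 interpret V: right_module K V by fact
 interpret T: tensor_pair K V W by (rule tensor_pairI[OF V W])
 show "abelian_group (tensor K V W)" by (rule abelian_group_tensor[OF T.abelian_group_T])
 assume c: "c <: K" and "t <: (tensor_group K V W)"
 then obtain n :: nat and x y where *: "!!i. i < n ==> x i <: V" "!!i. i < n ==> y i <: W"
  "t = (\<Sum>.(tensor_group K V W) i:{..<n}. pure_tensor K V W (x i) (y i))" by (elim T.pt_repr) (rule that, assumption, auto)
 show "c **.(tensor K V W) t <: (tensor_group K V W)"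
  unfolding *(3) by (subst tensor_smult_sum[OF K V W c]) (use * c in \<open>auto intro!: T.T.finsum_in T.pt_closed V.smult_closed\<close>)
qed

text \<open>Instances: the products of \<open>H \<otimes> H\<close> and \<open>A \<otimes> H\<close>, and the compatibility axiom of Hopf modules.\<close>

lemma tensor_mult_sum:
 fixes I J :: "nat set"
 assumes K: "cring K" and V: "right_module K V" and W: "right_module K W" and H: "right_module K H"
  and act: "!!x b. [|x <: V; b <: W|] ==> act x b <: V"
   "!!x x' b. [|x <: V; x' <: V; b <: W|] ==> act (x +.V x') b = act x b +.V act x' b"
   "!!x b b'. [|x <: V; b <: W; b' <: W|] ==> act x (b +.W b') = act x b +.V act x b'"
   "!!c x b. [|c <: K; x <: V; b <: W|] ==> act (c **.V x) b = c **.V act x b"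
   "!!c x b. [|c <: K; x <: V; b <: W|] ==> act x (c **.W b) = c **.V act x b"
  and ringH: "ring H"
  and ml: "!!c x y. [|c <: K; x <: H; y <: H|] ==> (c **.H x) *.H y = c **.H (x *.H y)"
  and mr: "!!c x y. [|c <: K; x <: H; y <: H|] ==> x *.H (c **.H y) = c **.H (x *.H y)"
  and xh: "!!i. i : I ==> x i <: V" "!!i. i : I ==> h i <: H"
  and bg: "!!j. j : J ==> b j <: W" "!!j. j : J ==> g j <: H"
 shows "tensor_lift (tensor_group K V H) (%x h. tensor_lift (tensor_group K V H) (%b g.
   pure_tensor K V H (act x b) (h *.H g)) (\<Sum>.(tensor_group K W H) j:J. pure_tensor K W H (b j) (g j)))
   (\<Sum>.(tensor_group K V H) i:I. pure_tensor K V H (x i) (h i)) =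
  (\<Sum>.(tensor_group K V H) i:I. \<Sum>.(tensor_group K V H) j:J. pure_tensor K V H (act (x i) (b j)) (h i *.H g j))"
proof -
 interpret V: right_module K V by fact
 interpret H: ring H by fact
 interpret HM: right_module K H by fact
 interpret TV: tensor_pair K V H by (rule tensor_pairI[OF V H])
 interpret TW: tensor_pair K W H by (rule tensor_pairI[OF W H])
 let ?T = "tensor_group K V H" and ?s = "\<Sum>.(tensor_group K W H) j:J. pure_tensor K W H (b j) (g j)"
 note pb = TV.balanced_pt[unfolded balanced_def]
 have pmove: "pure_tensor K V H (c **.V u) w = pure_tensor K V H u (c **.H w)" if "c <: K" "u <: V" "w <: H" for c u w
  using pb that by blast
 have inner: "tensor_lift ?T (%b g. pure_tensor K V H (act x b) (h *.H g)) ?s =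
   (\<Sum>.?T j:J. pure_tensor K V H (act x (b j)) (h *.H g j))" if "x <: V" "h <: H" for x h
 proof (rule TW.tensor_lift_sum_pt[OF TV.abelian_group_T _ bg])
  show "balanced K W H ?T (%b g. pure_tensor K V H (act x b) (h *.H g))"
   unfolding balanced_def using that pb act by (auto simp: H.r_distr mr pmove)
 qed
 let ?B = "%x h. \<Sum>.?T j:J. pure_tensor K V H (act x (b j)) (h *.H g j)"
 let ?B' = "%x h. tensor_lift ?T (%b g. pure_tensor K V H (act x b) (h *.H g)) ?s"
 have c: "pure_tensor K V H (act x (b j)) (h *.H g j) <: ?T" if "x <: V" "h <: H" "j : J" for x h j
  using that act(1) bg by (intro TV.pt_closed) auto
 have bal: "balanced K V H ?T ?B'"
  unfolding balanced_def
 proof (intro conjI ballI)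
  fix x h assume x: "x <: V" and h: "h <: H"
  show "?B' x h <: ?T" using x h c by (simp add: inner TV.T.finsum_in)
  show "?B' (x +.V x') h = ?B' x h +.?T ?B' x' h" if x': "x' <: V" for x'
   unfolding inner[OF x h] inner[OF x' h] inner[OF V.M.a_closed[OF x x'] h]
   by (rule trans[OF TV.T.finsum_eqI TV.T.finsum_add]) (use x h x' pb act bg c in simp_all)
  show "?B' x (h +.H h') = ?B' x h +.?T ?B' x h'" if h': "h' <: H" for h'
   unfolding inner[OF x h] inner[OF x h'] inner[OF x H.a_closed[OF h h']]
   by (rule trans[OF TV.T.finsum_eqI TV.T.finsum_add]) (use x h h' pb act bg c in \<open>simp_all add: H.l_distr\<close>)
 next
  fix r x h assume r: "r <: K" and x: "x <: V" and h: "h <: H"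
  show "?B' (r **.V x) h = ?B' x (r **.H h)"
   using r x h act(1,4) bg c pmove[OF r] by (simp add: inner V.smult_closed HM.smult_closed) (intro TV.T.finsum_eqI, auto simp: ml HM.smult_closed TV.pt_closed)
 qed
 have "tensor_lift ?T ?B' (\<Sum>.?T i:I. pure_tensor K V H (x i) (h i)) = (\<Sum>.?T i:I. ?B' (x i) (h i))"
  by (rule TV.tensor_lift_sum_pt[OF TV.abelian_group_T bal xh])
 also have "... = (\<Sum>.?T i:I. ?B (x i) (h i))"
  using xh c by (intro TV.T.finsum_eqI) (auto simp: inner intro!: TV.T.finsum_in)
 finally show ?thesis .
qed

section \<open>Comodules as modules over the convolution algebra\<close>

locale hopf_setup =
 fixes K :: "'k ring" and H :: "('k, 'h) module" and \<Delta> \<epsilon> S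
 assumes hopf: "hopf_algebra K H \<Delta> \<epsilon> S"
begin

lemma field_K: "field K" and comodule_H: "right_comodule K H \<Delta> \<epsilon> H \<Delta>" and ring_H: "ring H"
 using hopf by (simp_all add: hopf_algebra_def unital_algebra_def coalgebra_def)

lemmas \<Delta>_linear = right_comodule.coaction_linear[OF comodule_H]

sublocale K: field K by (rule field_K)

lemma rmH: "right_module K H"
 using comodule_H by (intro module_right_module) (simp add: right_comodule_def)

sublocale HM: right_module K H by (rule rmH)
sublocale Hr: ring H by (rule ring_H)

lemma mult_lr: "[|c <: K; x <: H; y <: H|] ==> (c **.H x) *.H y = c **.H (x *.H y)"
 "[|c <: K; x <: H; y <: H|] ==> x *.H (c **.H y) = c **.H (x *.H y)"
proof -
 interpret HA: hopf_algebra K H \<Delta> \<epsilon> S by (rule hopf)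
 show "[|c <: K; x <: H; y <: H|] ==> (c **.H x) *.H y = c **.H (x *.H y)"
  by (rule HA.smult_mult_left)
 show "[|c <: K; x <: H; y <: H|] ==> x *.H (c **.H y) = c **.H (x *.H y)"
  by (rule HA.smult_mult_right)
qed

abbreviation "D \<equiv> mod_hom K H (left_regular K)"

lemma D_simps: "psi : D ==> h <: H ==> psi h <: K"
 "psi : D ==> h <: H ==> g <: H ==> psi (h +.H g) = psi h +.K psi g"
 "psi : D ==> h <: H ==> c <: K ==> psi (c **.H h) = c *.K psi h"
 by (auto simp: mod_hom_mem)

definition conv :: "('h => 'k) => ('h => 'k) => 'h => 'k" where
 "conv phi psi h = tensor_lift K (%x y. phi x *.K psi y) (\<Delta> h)"

text \<open>The concrete operator behind \<open>T psi\<close>, namely (id \<otimes> psi) composed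
  with the coaction.\<close>

definition slice :: "('k, 'v, 'd) module_scheme => ('v => ('v, 'h) tensor) => ('h => 'k) => 'v => 'v" where
 "slice V \<rho> psi m = tensor_lift V (%x h. psi h **.V x) (\<rho> m)"

lemma balanced_slice:
 assumes V: "right_module K V" and psi: "psi : D"
 shows "balanced K V H V (%x h. psi h **.V x)"
proof -
 interpret V: right_module K V by fact
 show ?thesis
  using psi by (auto simp: balanced_def D_simps V.smult_closed V.smult_r_distr V.smult_l_distr V.smult_assoc)
qed

lemma balanced_conv: "[|phi : D; psi : D|] ==> balanced K H H K (%x y. phi x *.K psi y)"
 by (auto simp: balanced_def D_simps K.l_distr K.r_distr K.m_ac)

lemma THH: "tensor_pair K H H" by (rule tensor_pairI[OF rmH rmH])

lemma \<Delta>_closed: "h <: H ==> \<Delta> h <: (tensor_group K H H)"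
 using mod_hom_closed[OF \<Delta>_linear] by simp

lemma tensor_lift_conv_smult:
 assumes phi: "phi : D" and psi: "psi : D" and r: "r <: K" and t: "t <: (tensor_group K H H)"
 shows "tensor_lift K (%x y. phi x *.K psi y) (r **.(tensor K H H) t) = r *.K tensor_lift K (%x y. phi x *.K psi y) t"
proof -
 interpret T2: tensor_pair K H H by (rule THH)
 let ?\<sigma> = "tensor_lift K (%x y. phi x *.K psi y)"
 note bc = balanced_conv[OF phi psi] and Kg = K.is_abelian_group
 obtain k :: nat and u a where u: "!!i. i < k ==> u i <: H" and a: "!!i. i < k ==> a i <: H"
  and t_eq: "t = (\<Sum>.(tensor_group K H H) i:{..<k}. pure_tensor K H H (u i) (a i))" by (rule T2.pt_repr[OF t]) (rule that, assumption, auto)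
 have "?\<sigma> (r **.(tensor K H H) t) = (\<Sum>.K i:{..<k}. phi (r **.H u i) *.K psi (a i))"
  unfolding t_eq using u a r
  by (subst tensor_smult_sum[OF K.is_cring rmH rmH r], simp, simp) (intro T2.tensor_lift_sum_pt[OF Kg bc], auto simp: HM.smult_closed)
 also have "... = (\<Sum>.K i:{..<k}. r *.K (phi (u i) *.K psi (a i)))"
  using u a r phi psi by (intro K.finsum_eqI) (auto simp: D_simps K.m_assoc)
 also have "... = r *.K (\<Sum>.K i:{..<k}. phi (u i) *.K psi (a i))"
  using u a r phi psi by (intro K.finsum_mult_left[symmetric]) (auto simp: D_simps)
 also have "(\<Sum>.K i:{..<k}. phi (u i) *.K psi (a i)) = ?\<sigma> t"
  unfolding t_eq using u a by (intro T2.tensor_lift_sum_pt[OF Kg bc, symmetric]) auto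
 finally show ?thesis .
qed

lemma conv_dual:
 assumes phi: "phi : D" and psi: "psi : D"
 shows "conv phi psi : D"
proof (rule mod_homI; simp)
 interpret T2: tensor_pair K H H by (rule THH)
 note bc = balanced_conv[OF phi psi] and Kg = K.is_abelian_group
 fix x z assume x: "x <: H"
 show "conv phi psi x <: K" using T2.tensor_lift_closed[OF Kg bc \<Delta>_closed[OF x]] by (simp add: conv_def)
 show "conv phi psi (x +.H z) = conv phi psi x +.K conv phi psi z" if "z <: H"
  using T2.tensor_lift_add[OF Kg bc \<Delta>_closed[OF x] \<Delta>_closed[OF that]] mod_hom_add[OF \<Delta>_linear x that] by (simp add: conv_def)
 show "conv phi psi (r **.H x) = r *.K conv phi psi x" if "r <: K" for r
  using tensor_lift_conv_smult[OF phi psi that \<Delta>_closed[OF x]] mod_hom_smult[OF \<Delta>_linear that x] by (simp add: conv_def del: tensor_simps(4))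
qed

context
 fixes V :: "('k, 'v, 'd) module_scheme" and \<rho>
 assumes V: "right_comodule K H \<Delta> \<epsilon> V \<rho>"
begin

lemmas coaction_linear = right_comodule.coaction_linear[OF V]
 and coaction_coassoc = right_comodule.coaction_coassoc[OF V]
 and coaction_counit = right_comodule.coaction_counit[OF V]

lemma rmV: "right_module K V"
 using V by (intro module_right_module) (simp add: right_comodule_def)

interpretation Vm: right_module K V by (rule rmV)
interpretation TV: tensor_pair K V H by (rule tensor_pairI[OF rmV rmH])

lemma coaction_repr:
 assumes "m <: V"
 obtains n :: nat and y h where "!!i. i < n ==> y i <: V" "!!i. i < n ==> h i <: H"
  "\<rho> m = (\<Sum>.(tensor_group K V H) i:{..<n}. pure_tensor K V H (y i) (h i))"
 using mod_hom_closed[OF coaction_linear assms] by (simp, elim TV.pt_repr) (rule that, assumption, auto)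

lemma slice_repr:
 assumes "psi : D" "!!i. i : I ==> y i <: V" "!!i. i : I ==> h i <: H"
  "\<rho> m = (\<Sum>.(tensor_group K V H) i:I. pure_tensor K V H (y i) (h i))"
 shows "slice V \<rho> psi m = (\<Sum>.V i:I. psi (h i) **.V y i)"
 unfolding slice_def assms(4)
 by (rule TV.tensor_lift_sum_pt[OF Vm.abelian_group_M balanced_slice[OF rmV assms(1)] assms(2,3)])

lemma slice_closed: "[|psi : D; m <: V|] ==> slice V \<rho> psi m <: V"
 using mod_hom_closed[OF coaction_linear, of m] unfolding slice_def
 by (intro TV.tensor_lift_closed[OF Vm.abelian_group_M balanced_slice[OF rmV]]) auto

lemma slice_add:
 assumes "psi : D" "m <: V" "m' <: V"
 shows "slice V \<rho> psi (m +.V m') = slice V \<rho> psi m +.V slice V \<rho> psi m'"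
 using mod_hom_closed[OF coaction_linear] mod_hom_add[OF coaction_linear assms(2,3)] assms unfolding slice_def
 by (simp add: TV.tensor_lift_add[OF Vm.abelian_group_M balanced_slice[OF rmV]])

lemma coaction_smult_repr:
 assumes "c <: K" "m <: V" "!!i. i : I ==> y i <: V" "!!i. i : I ==> h i <: H"
  "\<rho> m = (\<Sum>.(tensor_group K V H) i:I. pure_tensor K V H (y i) (h i))"
 shows "\<rho> (c **.V m) = (\<Sum>.(tensor_group K V H) i:I. pure_tensor K V H (c **.V y i) (h i))"
 using tensor_smult_sum[where x=y and y=h and I=I, OF K.is_cring rmV rmH assms(1,3,4)] mod_hom_smult[OF coaction_linear assms(1,2)] assms(5)
 by (simp del: tensor_simps(4))

lemma slice_smult:
 assumes "psi : D" "c <: K" "m <: V"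
 shows "slice V \<rho> psi (c **.V m) = c **.V slice V \<rho> psi m"
proof -
 obtain n :: nat and y h where y: "!!i. i < n ==> y i <: V" and h: "!!i. i < n ==> h i <: H"
  and eq: "\<rho> m = (\<Sum>.(tensor_group K V H) i:{..<n}. pure_tensor K V H (y i) (h i))" by (rule coaction_repr[OF assms(3)]) (rule that, assumption, auto)
 have "slice V \<rho> psi (c **.V m) = (\<Sum>.V i:{..<n}. psi (h i) **.V (c **.V y i))"
  using y h assms by (intro slice_repr coaction_smult_repr[OF assms(2,3) _ _ eq]) (auto simp: Vm.smult_closed)
 also have "... = (\<Sum>.V i:{..<n}. c **.V (psi (h i) **.V y i))"
  using y h assms D_simps(1) by (intro Vm.M.finsum_eqI) (auto simp: Vm.smult_closed Vm.smult_assoc[symmetric] K.m_comm)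
 also have "... = c **.V (\<Sum>.V i:{..<n}. psi (h i) **.V y i)"
  using y h assms D_simps(1) by (intro Vm.smult_finsum[symmetric]) (auto simp: Vm.smult_closed)
 also have "(\<Sum>.V i:{..<n}. psi (h i) **.V y i) = slice V \<rho> psi m" using y h assms eq by (intro slice_repr[symmetric]) auto
 finally show ?thesis .
qed

lemma slice_counit: "m <: V ==> slice V \<rho> \<epsilon> m = m"
 unfolding slice_def by (rule coaction_counit)

text \<open>Coassociativity under (id \<otimes> phi \<otimes> psi). Both sides of the axiom are
  first computed as explicit sums of pure tensors from one representation of \<rho>(m), and the
  triple contraction is applied afterwards.\<close>

lemma slice_slice:
 assumes phi: "phi : D" and psi: "psi : D" and m: "m <: V"
 shows "slice V \<rho> phi (slice V \<rho> psi m) = slice V \<rho> (conv phi psi) m"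
proof -
 let ?TV = "tensor_group K V H" and ?HH = "tensor K H H" and ?G = "tensor_group K V (tensor K H H)" and ?VH = "tensor K V H"
 interpret T2: tensor_pair K H H by (rule THH)
 note tHH = tensor_pair_tensor[OF K.is_cring rmH rmH] and tVH = tensor_pair_tensor[OF K.is_cring rmV rmH]
 interpret G: tensor_pair K V ?HH
  unfolding tensor_pair_def tensor_pair_axioms_def using tHH Vm.abelian_group_M Vm.smult_closed by (auto simp del: tensor_simps(4))
 interpret L: tensor_pair K ?VH H
  unfolding tensor_pair_def tensor_pair_axioms_def using tVH HM.abelian_group_M HM.smult_closed by (auto simp del: tensor_simps(4))
 have repr: "EX (n::nat) y h. (ALL i<n. y i <: V & h i <: H) & \<rho> x = (\<Sum>.?TV i:{..<n}. pure_tensor K V H (y i) (h i))"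
  if "x <: V" for x by (rule coaction_repr[OF that]) blast
 obtain n :: nat and y h where yh: "ALL i<n. y i <: V & h i <: H"
  and eq: "\<rho> m = (\<Sum>.?TV i:{..<n}. pure_tensor K V H (y i) (h i))" using repr[OF m] by (elim exE conjE) (rule that)
 have y: "y i <: V" and h: "h i <: H" if "i : {..<n}" for i using yh that by auto
 \<comment> \<open>A representation is packed into one triple of length, vectors and elements of
   \<open>H\<close>, so that a single choice provides representations of all the
   \<rho>(y_i).\<close>
 define good where "good i q \<longleftrightarrow> (ALL j<fst q. fst (snd q) j <: V & snd (snd q) j <: H) &
   \<rho> (y i) = (\<Sum>.?TV j:{..<fst q}. pure_tensor K V H (fst (snd q) j) (snd (snd q) j))"
  for i and q :: "nat \<times> (nat => 'v) \<times> (nat => 'h)"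
 have ex: "EX q. i : {..<n} --> good i q" for i
 proof (cases "i : {..<n}")
  case True
  obtain n1 y1 h1 where "ALL j<n1. y1 j <: V & h1 j <: H"
   "\<rho> (y i) = (\<Sum>.?TV j:{..<n1::nat}. pure_tensor K V H (y1 j) (h1 j))" using repr[OF y[OF True]] by (elim exE conjE) (rule that)
  then have "good i (n1, y1, h1)" by (simp add: good_def)
  then show ?thesis by (intro exI impI)
 qed simp
 have "ALL i. EX q. i : {..<n} --> good i q" by (rule allI) (rule ex)
 from choice[OF this] obtain q where q: "ALL i. i : {..<n} --> good i (q i)" by (elim exE) (rule that)
 define n' y' h' where "n' i = fst (q i)" and "y' i = fst (snd (q i))" and "h' i = snd (snd (q i))" for i
 have y': "y' i j <: V" and h': "h' i j <: H" if "i : {..<n}" "j : {..<n' i}" for i j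
  using q that by (auto simp: good_def n'_def y'_def h'_def)
 have eq': "\<rho> (y i) = (\<Sum>.?TV j:{..<n' i}. pure_tensor K V H (y' i j) (h' i j))" if "i : {..<n}" for i
  using q that by (simp add: good_def n'_def y'_def h'_def)
 note pG = G.balanced_pt[unfolded balanced_def, simplified tensor_simps(1-3)] and pH = T2.balanced_pt[unfolded balanced_def]
 have smH: "c **.?HH pure_tensor K H H a b = pure_tensor K H H (c **.H a) b"
  if "c <: K" "a <: H" "b <: H" for c a b
  using tensor_smult_sum[OF K.is_cring rmH rmH that(1), of "{0::nat}" "%_. a" "%_. b"] that
  by (simp add: T2.T.finsum_insert T2.pt_closed HM.smult_closed del: tensor_simps(4))
 have bal1: "balanced K V H ?G (%u a. pure_tensor K V ?HH u (pure_tensor K H H a z))" if z: "z <: H" for z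
  unfolding balanced_def
 proof (intro conjI ballI)
  show "pure_tensor K V ?HH (r **.V u) (pure_tensor K H H a z) = pure_tensor K V ?HH u (pure_tensor K H H (r **.H a) z)"
   if "r <: K" "u <: V" "a <: H" for r u a
   using pG that z T2.pt_closed smH[OF that(1,3) z] by metis
 qed (use z pG pH in \<open>auto simp: T2.pt_closed\<close>)
 let ?l = "%t z. tensor_lift ?G (%u a. pure_tensor K V ?HH u (pure_tensor K H H a z)) t"
 have l_sum: "?l (\<Sum>.?TV i:I. pure_tensor K V H (u i) (a i)) z = (\<Sum>.?G i:I. pure_tensor K V ?HH (u i) (pure_tensor K H H (a i) z))"
  if "z <: H" "!!i. i : I ==> u i <: V" "!!i. i : I ==> a i <: H" for z u a and I :: "nat set"
  by (rule TV.tensor_lift_sum_pt[OF G.abelian_group_T bal1[OF that(1)] that(2,3)])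
 have pGc: "pure_tensor K V ?HH u (pure_tensor K H H a z) <: ?G" if "u <: V" "a <: H" "z <: H" for u a z
  using that T2.pt_closed by (intro G.pt_closed) auto
 \<comment> \<open>\<open>tensor_assoc\<close> is the lift of ?l, and evaluating it on pure tensors
   requires ?l to be balanced. The scalar has to travel from \<open>t\<close> through the inner
   tensor of \<open>H\<close> with \<open>H\<close> to reach \<open>z\<close>.\<close>
 have bal2: "balanced K ?VH H ?G ?l"
  unfolding balanced_def
 proof (intro conjI ballI)
  fix t z assume "t <: ?VH" and z: "z <: H"
  then have t: "t <: ?TV" by simp
  obtain k :: nat and u a where u: "!!i. i < k ==> u i <: V" and a: "!!i. i < k ==> a i <: H"
   and t_eq: "t = (\<Sum>.?TV i:{..<k}. pure_tensor K V H (u i) (a i))" by (rule TV.pt_repr[OF t]) (rule that, assumption, auto)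
  show "?l t z <: ?G" by (rule TV.tensor_lift_closed[OF G.abelian_group_T bal1[OF z] t])
  show "?l (t +.?VH t') z = ?l t z +.?G ?l t' z" if "t' <: ?VH" for t'
   using TV.tensor_lift_add[OF G.abelian_group_T bal1[OF z] t, of t'] that by simp
  show "?l t (z +.H z') = ?l t z +.?G ?l t z'" if z': "z' <: H" for z'
  proof -
   have ls: "?l t w = (\<Sum>.?G i:{..<k}. pure_tensor K V ?HH (u i) (pure_tensor K H H (a i) w))" if "w <: H" for w
    unfolding t_eq by (rule l_sum[OF that]) (use u a in simp_all)
   show ?thesis
    unfolding ls[OF z] ls[OF z'] ls[OF HM.M.a_closed[OF z z']]
    by (rule trans[OF G.T.finsum_eqI G.T.finsum_add]) (use u a z z' pG pH T2.pt_closed pGc in simp_all)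
  qed
  show "?l (r **.?VH t) z = ?l t (r **.H z)" if r: "r <: K" for r
  proof -
   have "?l (r **.?VH t) z = (\<Sum>.?G i:{..<k}. pure_tensor K V ?HH (r **.V u i) (pure_tensor K H H (a i) z))"
    unfolding t_eq using u a z r
    by (subst tensor_smult_sum[OF K.is_cring rmV rmH r], simp, simp) (intro l_sum, auto simp: Vm.smult_closed)
   also have "... = (\<Sum>.?G i:{..<k}. pure_tensor K V ?HH (u i) (pure_tensor K H H (a i) (r **.H z)))"
   proof (rule G.T.finsum_eqI)
    fix i assume "i : {..<k}"
    then have ua: "u i <: V" "a i <: H" using u a by auto
    have "pure_tensor K V ?HH (r **.V u i) (pure_tensor K H H (a i) z) = pure_tensor K V ?HH (u i) (r **.?HH pure_tensor K H H (a i) z)"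
     using pG r ua z T2.pt_closed by metis
    also have "r **.?HH pure_tensor K H H (a i) z = pure_tensor K H H (a i) (r **.H z)"
     using smH[OF r ua(2) z] pH r ua z by metis
    finally show "pure_tensor K V ?HH (r **.V u i) (pure_tensor K H H (a i) z) = pure_tensor K V ?HH (u i) (pure_tensor K H H (a i) (r **.H z))" .
    show "pure_tensor K V ?HH (u i) (pure_tensor K H H (a i) (r **.H z)) <: ?G"
     using ua r z by (intro pGc HM.smult_closed)
   qed
   also have "... = ?l t (r **.H z)" unfolding t_eq using u a z r by (subst l_sum) (auto simp: HM.smult_closed)
   finally show ?thesis .
  qed
 qed
 have "tensor_map K ?VH H \<rho> id (\<rho> m) = (\<Sum>.(tensor_group K ?VH H) i:{..<n}. pure_tensor K ?VH H (\<rho> (y i)) (h i))"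
  unfolding eq using tensor_map_sum[where x=y and y=h and I="{..<n}" and g=id, OF rmV rmH L.tensor_pair_axioms coaction_linear _ y h]
  by (simp add: mod_hom_mem)
 then have "tensor_assoc K V H H (tensor_map K ?VH H \<rho> id (\<rho> m)) = (\<Sum>.?G i:{..<n}. ?l (\<rho> (y i)) (h i))"
  unfolding tensor_assoc_def using mod_hom_closed[OF coaction_linear y] h
  by (simp, intro L.tensor_lift_sum_pt[OF G.abelian_group_T bal2]) auto
 also have "... = (\<Sum>.?G i:{..<n}. \<Sum>.?G j:{..<n' i}. pure_tensor K V ?HH (y' i j) (pure_tensor K H H (h' i j) (h i)))"
 proof (rule G.T.finsum_eqI)
  fix i assume i: "i : {..<n}"
  show "?l (\<rho> (y i)) (h i) = (\<Sum>.?G j:{..<n' i}. pure_tensor K V ?HH (y' i j) (pure_tensor K H H (h' i j) (h i)))"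
   unfolding eq'[OF i] by (rule l_sum[OF h[OF i] y'[OF i] h'[OF i]])
  show "(\<Sum>.?G j:{..<n' i}. pure_tensor K V ?HH (y' i j) (pure_tensor K H H (h' i j) (h i))) <: ?G"
   by (intro G.T.finsum_in pGc y'[OF i] h'[OF i] h[OF i])
 qed
 finally have lhs: "tensor_assoc K V H H (tensor_map K ?VH H \<rho> id (\<rho> m)) = ..." .
 note \<Delta>c = \<Delta>_closed
 have rhs: "tensor_map K V ?HH id \<Delta> (\<rho> m) = (\<Sum>.?G i:{..<n}. pure_tensor K V ?HH (y i) (\<Delta> (h i)))"
  unfolding eq using tensor_map_sum[where x=y and y=h and I="{..<n}" and f=id, OF rmV rmH G.tensor_pair_axioms _ \<Delta>_linear y h] by (simp add: mod_hom_mem)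
 let ?\<sigma> = "tensor_lift K (%x y. phi x *.K psi y)"
 note bc = balanced_conv[OF phi psi] and Kg = K.is_abelian_group
 have \<sigma>c: "?\<sigma> t <: K" if "t <: (tensor_group K H H)" for t by (rule T2.tensor_lift_closed[OF Kg bc that])
 note \<sigma>s = tensor_lift_conv_smult[OF phi psi]
 \<comment> \<open>The contraction (id \<otimes> phi \<otimes> psi) on the nested tensor product,
   with the inner pair contracted by ?\<sigma>.\<close>
 let ?\<Theta> = "tensor_lift V (%u t. ?\<sigma> t **.V u)"
 have bal3: "balanced K V ?HH V (%u t. ?\<sigma> t **.V u)"
  using \<sigma>c \<sigma>s T2.tensor_lift_add[OF Kg bc]
  by (auto simp: balanced_def Vm.smult_closed Vm.smult_r_distr Vm.smult_l_distr Vm.smult_assoc simp del: tensor_simps(4))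
 note Vg = Vm.abelian_group_M
 have "(\<Sum>.V i:{..<n}. \<Sum>.V j:{..<n' i}. (phi (h' i j) *.K psi (h i)) **.V y' i j) =
   (\<Sum>.V i:{..<n}. ?\<Theta> (\<Sum>.?G j:{..<n' i}. pure_tensor K V ?HH (y' i j) (pure_tensor K H H (h' i j) (h i))))"
 proof (rule Vm.M.finsum_eqI)
  fix i assume i: "i : {..<n}"
  have "?\<Theta> (\<Sum>.?G j:{..<n' i}. pure_tensor K V ?HH (y' i j) (pure_tensor K H H (h' i j) (h i))) =
    (\<Sum>.V j:{..<n' i}. ?\<sigma> (pure_tensor K H H (h' i j) (h i)) **.V y' i j)"
   using y'[OF i] h'[OF i] h[OF i] T2.pt_closed by (intro G.tensor_lift_sum_pt[OF Vg bal3]) auto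
  also have "... = (\<Sum>.V j:{..<n' i}. (phi (h' i j) *.K psi (h i)) **.V y' i j)"
   using y'[OF i] h'[OF i] h[OF i] phi psi
   by (intro Vm.M.finsum_eqI) (auto simp: T2.tensor_lift_pt[OF Kg bc] D_simps Vm.smult_closed)
  finally show "(\<Sum>.V j:{..<n' i}. (phi (h' i j) *.K psi (h i)) **.V y' i j) =
   ?\<Theta> (\<Sum>.?G j:{..<n' i}. pure_tensor K V ?HH (y' i j) (pure_tensor K H H (h' i j) (h i)))" ..
  show "?\<Theta> (\<Sum>.?G j:{..<n' i}. pure_tensor K V ?HH (y' i j) (pure_tensor K H H (h' i j) (h i))) <: V"
   by (intro G.tensor_lift_closed[OF Vg bal3] G.T.finsum_in pGc y'[OF i] h'[OF i] h[OF i])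
 qed
 also have "... = ?\<Theta> (\<Sum>.?G i:{..<n}. \<Sum>.?G j:{..<n' i}. pure_tensor K V ?HH (y' i j) (pure_tensor K H H (h' i j) (h i)))"
  by (intro G.tensor_lift_finsum[OF Vg bal3, symmetric] G.T.finsum_in pGc y' h' h)
 also have "... = ?\<Theta> (\<Sum>.?G i:{..<n}. pure_tensor K V ?HH (y i) (\<Delta> (h i)))"
  using coaction_coassoc[OF m] unfolding lhs rhs by simp
 also have "... = (\<Sum>.V i:{..<n}. ?\<sigma> (\<Delta> (h i)) **.V y i)"
  using y h \<Delta>c by (intro G.tensor_lift_sum_pt[OF Vg bal3]) auto
 finally have key: "(\<Sum>.V i:{..<n}. \<Sum>.V j:{..<n' i}. (phi (h' i j) *.K psi (h i)) **.V y' i j) =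
  (\<Sum>.V i:{..<n}. conv phi psi (h i) **.V y i)" by (simp add: conv_def)
 note bs = conv_dual[OF phi psi]
 have "slice V \<rho> phi (slice V \<rho> psi m) = slice V \<rho> phi (\<Sum>.V i:{..<n}. psi (h i) **.V y i)"
  using slice_repr[OF psi y h eq] by simp
 also have "... = (\<Sum>.V i:{..<n}. slice V \<rho> phi (psi (h i) **.V y i))"
  using y h psi by (intro finsum_additive) (auto simp: slice_closed[OF phi] slice_add[OF phi] D_simps Vm.smult_closed Vm.M.abelian_monoid_axioms Vg)
 also have "... = (\<Sum>.V i:{..<n}. \<Sum>.V j:{..<n' i}. (phi (h' i j) *.K psi (h i)) **.V y' i j)"
 proof (rule Vm.M.finsum_eqI)
  fix i assume i: "i : {..<n}"
  have hi: "psi (h i) <: K" using h[OF i] psi by (simp add: D_simps)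
  have hij: "phi (h' i j) <: K" if "j : {..<n' i}" for j using h'[OF i that] phi by (simp add: D_simps)
  have "slice V \<rho> phi (psi (h i) **.V y i) = psi (h i) **.V (\<Sum>.V j:{..<n' i}. phi (h' i j) **.V y' i j)"
   using slice_smult[OF phi hi y[OF i]] slice_repr[OF phi y'[OF i] h'[OF i] eq'[OF i]] by simp
  also have "... = (\<Sum>.V j:{..<n' i}. psi (h i) **.V (phi (h' i j) **.V y' i j))"
   by (intro Vm.smult_finsum Vm.smult_closed hi hij y'[OF i])
  also have "... = (\<Sum>.V j:{..<n' i}. (phi (h' i j) *.K psi (h i)) **.V y' i j)"
   using hi hij y'[OF i] by (intro Vm.M.finsum_eqI) (auto simp: Vm.smult_assoc Vm.smult_closed)
  finally show "slice V \<rho> phi (psi (h i) **.V y i) = (\<Sum>.V j:{..<n' i}. (phi (h' i j) *.K psi (h i)) **.V y' i j)" .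
  show "(\<Sum>.V j:{..<n' i}. (phi (h' i j) *.K psi (h i)) **.V y' i j) <: V"
   by (intro Vm.M.finsum_in Vm.smult_closed K.m_closed hi hij y'[OF i])
 qed
 also have "... = slice V \<rho> (conv phi psi) m" unfolding key using slice_repr[OF bs y h eq] by simp
 finally show ?thesis .
qed

end

end

section \<open>The convolution algebra of a Hopf algebra\<close>

context hopf_setup
begin

lemma counit_dual: "\<epsilon> : D"
proof -
 interpret HA: hopf_algebra K H \<Delta> \<epsilon> S by (rule hopf)
 show ?thesis by (rule HA.counit_linear)
qed

lemma conv_repr:
 assumes "phi : D" "psi : D" "!!i. i : I ==> x i <: H" "!!i. i : I ==> y i <: H"
  "\<Delta> h = (\<Sum>.(tensor_group K H H) i:I. pure_tensor K H H (x i) (y i))"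
 shows "conv phi psi h = (\<Sum>.K i:I. phi (x i) *.K psi (y i))"
 unfolding conv_def assms(5)
 by (rule tensor_pair.tensor_lift_sum_pt[OF THH K.is_abelian_group balanced_conv[OF assms(1,2)] assms(3,4)])

lemma comult_repr:
 assumes "h <: H"
 obtains n :: nat and x y where "!!i. i < n ==> x i <: H" "!!i. i < n ==> y i <: H"
  "\<Delta> h = (\<Sum>.(tensor_group K H H) i:{..<n}. pure_tensor K H H (x i) (y i))"
 by (rule coaction_repr[OF comodule_H assms]) (rule that, assumption, auto)

lemma dual_finsum:
 assumes "phi : D" "!!i. i : I ==> x i <: H"
 shows "phi (finsum H x I) = (\<Sum>.K i:I. phi (x i))"
 by (rule finsum_additive[OF HM.M.abelian_monoid_axioms K.is_abelian_group]) (use assms in \<open>auto simp: D_simps\<close>)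

lemma dual_slice:
 assumes phi: "phi : D" and psi: "psi : D" and h: "h <: H"
 shows "phi (slice H \<Delta> psi h) = conv phi psi h"
proof -
 obtain n :: nat and x y where x: "!!i. i < n ==> x i <: H" and y: "!!i. i < n ==> y i <: H"
  and eq: "\<Delta> h = (\<Sum>.(tensor_group K H H) i:{..<n}. pure_tensor K H H (x i) (y i))"
  by (rule comult_repr[OF h]) (rule that, assumption, auto)
 have "slice H \<Delta> psi h = (\<Sum>.H i:{..<n}. psi (y i) **.H x i)"
  using x y eq by (intro slice_repr[OF comodule_H psi]) auto
 also have "phi ... = (\<Sum>.K i:{..<n}. phi (psi (y i) **.H x i))"
  using x y psi by (intro dual_finsum[OF phi]) (auto simp: D_simps HM.smult_closed)
 also have "... = (\<Sum>.K i:{..<n}. phi (x i) *.K psi (y i))"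
  using x y phi psi by (intro K.finsum_eqI) (auto simp: D_simps K.m_comm)
 also have "... = conv phi psi h" using x y eq by (intro conv_repr[OF phi psi, symmetric]) auto
 finally show ?thesis .
qed

lemma comult_mult:
 fixes I J :: "nat set"
 assumes "g <: H" "h <: H"
  and "!!i. i : I ==> x i <: H" "!!i. i : I ==> y i <: H"
  and "!!j. j : J ==> x' j <: H" "!!j. j : J ==> y' j <: H"
  and g: "\<Delta> g = (\<Sum>.(tensor_group K H H) i:I. pure_tensor K H H (x i) (y i))"
  and h: "\<Delta> h = (\<Sum>.(tensor_group K H H) j:J. pure_tensor K H H (x' j) (y' j))"
 shows "\<Delta> (g *.H h) = (\<Sum>.(tensor_group K H H) i:I. \<Sum>.(tensor_group K H H) j:J.
  pure_tensor K H H (x i *.H x' j) (y i *.H y' j))"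
proof -
 interpret HA: hopf_algebra K H \<Delta> \<epsilon> S by (rule hopf)
 have "\<Delta> (g *.H h) = \<Delta> g *.(tensor_algebra K H H) \<Delta> h" by (rule ring_hom_mult[OF HA.comult_ring_hom assms(1,2)])
 then show ?thesis
  unfolding g h using assms(3-6)
  by (simp, intro tensor_mult_sum[where act="%a b. a *.H b", OF K.is_cring rmH rmH rmH])
   (auto simp: Hr.l_distr Hr.r_distr mult_lr Hr.ring_axioms)
qed

lemma hopf_dual_ex: "EX B cf v. hopf_dual K H conv \<epsilon> S B cf v"
proof -
 interpret HA: hopf_algebra K H \<Delta> \<epsilon> S by (rule hopf)
 interpret T2: tensor_pair K H H by (rule THH)
 obtain B :: "'h set" and cf v where B: "!!b. b : B ==> cf b : D" "!!b. b : B ==> v b <: H"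
  "!!h. h <: H ==> finite {b : B. cf b h ~= \<zero>.K}"
  "!!h. h <: H ==> h = (\<Sum>.H b:{b : B. cf b h ~= \<zero>.K}. cf b h **.H v b)"
  by (rule dual_basis[OF field_K rmH]) blast
 have S: "S : mod_hom K H H" by (rule HA.antipode_linear)
 note Sc = mod_hom_closed[OF S] mod_hom_add[OF S] mod_hom_smult[OF S]
 have "hopf_dual K H conv \<epsilon> S B cf v"
 proof (rule hopf_dual.intro)
  show "\<epsilon> (x *.H y) = \<epsilon> x *.K \<epsilon> y" if "x <: H" "y <: H" for x y
   by (rule ring_hom_mult[OF HA.counit_ring_hom that])
  \<comment> \<open>Both sides are phi evaluated at slices of \<open>h\<close>: a convolution is a
    functional applied to a slice, and slices compose by \<open>slice_slice\<close> for
    \<open>H\<close> coacting on itself.\<close>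
  show "conv (conv phi psi) \<theta> h = conv phi (conv psi \<theta>) h" if "phi : D" "psi : D" "\<theta> : D" "h <: H" for phi psi \<theta> h
   using slice_slice[OF comodule_H that(2,3,4)] slice_closed[OF comodule_H that(3,4)] that
   by (simp add: dual_slice[symmetric] conv_dual)
  show "conv psi \<epsilon> h = psi h" if "psi : D" "h <: H" for psi h
   using dual_slice[OF that(1) counit_dual that(2)] slice_counit[OF comodule_H that(2)] by simp
  show "conv \<epsilon> psi h = psi h" if psi: "psi : D" and h: "h <: H" for psi h
  proof -
   obtain n :: nat and x y where x: "!!i. i < n ==> x i <: H" and y: "!!i. i < n ==> y i <: H"
    and eq: "\<Delta> h = (\<Sum>.(tensor_group K H H) i:{..<n}. pure_tensor K H H (x i) (y i))"
    by (rule comult_repr[OF h]) (rule that, assumption, auto)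
   have "balanced K H H H (%x y. \<epsilon> x **.H y)"
    using counit_dual by (auto simp: balanced_def D_simps HM.smult_closed HM.smult_r_distr HM.smult_l_distr HM.smult_assoc)
   from T2.tensor_lift_sum_pt[OF HM.abelian_group_M this, of "{..<n}" x y]
   have "h = (\<Sum>.H i:{..<n}. \<epsilon> (x i) **.H y i)" using HA.left_counit[OF h] x y eq by simp
   then have "psi h = psi (\<Sum>.H i:{..<n}. \<epsilon> (x i) **.H y i)" by simp
   also have "... = (\<Sum>.K i:{..<n}. psi (\<epsilon> (x i) **.H y i))"
    using x y by (intro dual_finsum[OF psi]) (auto simp: D_simps[OF counit_dual] HM.smult_closed)
   also have "... = (\<Sum>.K i:{..<n}. \<epsilon> (x i) *.K psi (y i))"
    using x y psi by (intro K.finsum_eqI) (auto simp: D_simps D_simps[OF counit_dual])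
   also have "... = conv \<epsilon> psi h" using x y eq by (intro conv_repr[OF counit_dual psi, symmetric]) auto
   finally show ?thesis ..
  qed
  show "EX (n::nat) x y. (ALL i<n. x i <: H & y i <: H) &
   (ALL phi:D. ALL psi:D. conv phi psi h = (\<Sum>.K i:{..<n}. phi (x i) *.K psi (y i))) &
   (\<Sum>.H i:{..<n}. S (x i) *.H y i) = \<epsilon> h **.H \<one>.H &
   (\<Sum>.H i:{..<n}. x i *.H S (y i)) = \<epsilon> h **.H \<one>.H" if h: "h <: H" for h
  proof -
   obtain n :: nat and x y where x: "!!i. i < n ==> x i <: H" and y: "!!i. i < n ==> y i <: H"
    and eq: "\<Delta> h = (\<Sum>.(tensor_group K H H) i:{..<n}. pure_tensor K H H (x i) (y i))"
    by (rule comult_repr[OF h]) (rule that, assumption, auto)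
   have b1: "balanced K H H H (%x y. S x *.H y)" and b2: "balanced K H H H (%x y. x *.H S y)"
    using Sc by (auto simp: balanced_def Hr.l_distr Hr.r_distr mult_lr)
   show ?thesis
    using T2.tensor_lift_sum_pt[OF HM.abelian_group_M b1, of "{..<n}" x y] T2.tensor_lift_sum_pt[OF HM.abelian_group_M b2, of "{..<n}" x y]
     HA.left_antipode[OF h] HA.right_antipode[OF h] x y eq
    by (intro exI[of _ n] exI[of _ x] exI[of _ y] conjI ballI conv_repr) auto
  qed
  show "EX (n::nat) x y (m::nat) x' y'.
   (ALL i<n. x i <: H & y i <: H) & (ALL i<m. x' i <: H & y' i <: H) &
   (ALL phi:D. ALL psi:D. conv phi psi g = (\<Sum>.K i:{..<n}. phi (x i) *.K psi (y i)) &
    conv phi psi h = (\<Sum>.K i:{..<m}. phi (x' i) *.K psi (y' i)) &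
    conv phi psi (g *.H h) = (\<Sum>.K i:{..<n}. \<Sum>.K j:{..<m}.
     phi (x i *.H x' j) *.K psi (y i *.H y' j)))" if g: "g <: H" and h: "h <: H" for g h
  proof -
   obtain n :: nat and x y where x: "!!i. i < n ==> x i <: H" and y: "!!i. i < n ==> y i <: H"
    and eq: "\<Delta> g = (\<Sum>.(tensor_group K H H) i:{..<n}. pure_tensor K H H (x i) (y i))"
    by (rule comult_repr[OF g]) (rule that, assumption, auto)
   obtain m :: nat and x' y' where x': "!!i. i < m ==> x' i <: H" and y': "!!i. i < m ==> y' i <: H"
    and eq': "\<Delta> h = (\<Sum>.(tensor_group K H H) i:{..<m}. pure_tensor K H H (x' i) (y' i))"
    by (rule comult_repr[OF h]) (rule that, assumption, auto)
   have gh: "conv phi psi (g *.H h) = (\<Sum>.K i:{..<n}. \<Sum>.K j:{..<m}. phi (x i *.H x' j) *.K psi (y i *.H y' j))"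
    if phi: "phi : D" and psi: "psi : D" for phi psi
   proof -
    note bc = balanced_conv[OF phi psi] and Kg = K.is_abelian_group
    have c: "pure_tensor K H H (x i *.H x' j) (y i *.H y' j) <: (tensor_group K H H)" if "i : {..<n}" "j : {..<m}" for i j
     using x y x' y' that by (intro T2.pt_closed) auto
    have "conv phi psi (g *.H h) = tensor_lift K (%x y. phi x *.K psi y) (\<Sum>.(tensor_group K H H) i:{..<n}. \<Sum>.(tensor_group K H H) j:{..<m}.
      pure_tensor K H H (x i *.H x' j) (y i *.H y' j))"
     unfolding conv_def using comult_mult[OF g h _ _ _ _ eq eq'] x y x' y' by simp
    also have "... = (\<Sum>.K i:{..<n}. tensor_lift K (%x y. phi x *.K psi y) (\<Sum>.(tensor_group K H H) j:{..<m}.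
      pure_tensor K H H (x i *.H x' j) (y i *.H y' j)))"
     by (intro T2.tensor_lift_finsum[OF Kg bc] T2.T.finsum_in c)
    also have "... = (\<Sum>.K i:{..<n}. \<Sum>.K j:{..<m}. phi (x i *.H x' j) *.K psi (y i *.H y' j))"
    proof (rule K.finsum_eqI)
     fix i assume i: "i : {..<n}"
     show "tensor_lift K (%x y. phi x *.K psi y) (\<Sum>.(tensor_group K H H) j:{..<m}. pure_tensor K H H (x i *.H x' j) (y i *.H y' j)) =
      (\<Sum>.K j:{..<m}. phi (x i *.H x' j) *.K psi (y i *.H y' j))"
      using x y x' y' i by (intro T2.tensor_lift_sum_pt[OF Kg bc]) auto
     show "(\<Sum>.K j:{..<m}. phi (x i *.H x' j) *.K psi (y i *.H y' j)) <: K"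
      using x y x' y' i phi psi by (intro K.finsum_in) (auto simp: D_simps)
    qed
    finally show ?thesis .
   qed
   have gc: "conv phi psi g = (\<Sum>.K i:{..<n}. phi (x i) *.K psi (y i))" "conv phi psi h = (\<Sum>.K i:{..<m}. phi (x' i) *.K psi (y' i))"
    if "phi : D" "psi : D" for phi psi
    using x y x' y' by (auto intro!: conv_repr[OF that _ _ eq] conv_repr[OF that _ _ eq'])
   show ?thesis
    by (intro exI[of _ n] exI[of _ x] exI[of _ y] exI[of _ m] exI[of _ x'] exI[of _ y'] conjI ballI allI impI gc gh) (use x y x' y' in auto)
  qed
 qed (fact field_K rmH ring_H mult_lr S B counit_dual conv_dual)+
 then show ?thesis by blast
qed

end

section \<open>The comodule algebra and its Hopf modules\<close>

locale comodule_algebra_setup = hopf_setup K H \<Delta> \<epsilon> S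
 for K :: "'k ring" and H :: "('k, 'h) module" and \<Delta> \<epsilon> S +
 fixes A :: "('k, 'a) module" and \<rho> and B cf v
 assumes comod_alg: "comodule_algebra K H \<Delta> \<epsilon> A \<rho>"
  and simple: "simple_comodule_algebra K H A \<rho>"
  and dual: "hopf_dual K H conv \<epsilon> S B cf v"
begin

definition ks :: "'k => 'a" where "ks c = c **.A \<one>.A"

lemma comodule_A: "right_comodule K H \<Delta> \<epsilon> A \<rho>" and algebra_A: "unital_algebra K A"
 using comod_alg by (simp_all add: comodule_algebra_def)

lemma ring_A: "ring A"
 using algebra_A by (simp add: unital_algebra_def)

sublocale Ar: ring A by (rule ring_A)

lemma rmA: "right_module K A" by (rule rmV[OF comodule_A])

lemma smult_ks: "[|c <: K; x <: A|] ==> c **.A x = ks c *.A x"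
 "[|c <: K; x <: A|] ==> c **.A x = x *.A ks c"
 using unital_algebra.smult_mult_left[OF algebra_A] unital_algebra.smult_mult_right[OF algebra_A] by (auto simp: ks_def)

lemma ks_closed: "c <: K ==> ks c <: A"
 by (simp add: ks_def right_module.smult_closed[OF rmA])

lemma coeff: "hopf_dual_coeff K H conv \<epsilon> S B cf v A ks"
 unfolding hopf_dual_coeff_def hopf_dual_coeff_axioms_def
proof (intro conjI allI impI dual ring_A)
 interpret Am: right_module K A by (rule rmA)
 show "ks : ring_hom K A"
 proof (rule ring_hom_memI)
  fix c d assume cd: "c <: K" "d <: K"
  show "ks (c *.K d) = ks c *.A ks d"
   using cd smult_ks(2)[OF cd(2) ks_closed[OF cd(1)]] by (simp add: ks_def Am.smult_assoc)
 qed (auto simp: ks_closed[unfolded ks_def] ks_def Am.smult_l_distr Am.smult_one)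
 show "ks c *.A z = z *.A ks c" if "c <: K" "z <: A" for c z
  using smult_ks[OF that] by simp
qed

sublocale HD: hopf_dual_coeff K H conv \<epsilon> S B cf v A ks by (rule coeff)

text \<open>One additive group in two roles: \<open>V\<close> is the vector space carrying the
  coaction, \<open>M\<close> the right module over \<open>A\<close>. The instances are
  \<open>A\<close> with its regular module, and \<open>underlying_space A M\<close> with a Hopf
  module \<open>M\<close>.\<close>

context
 fixes V :: "('k, 'v, 'd) module_scheme" and \<rho>V and M :: "('a, 'v, 'e) module_scheme"
 assumes V: "right_comodule K H \<Delta> \<epsilon> V \<rho>V" and M: "right_module A M"
  and same: "carrier V = carrier M" "add V = add M" "zero V = zero M"
  and smult: "!!c x. [|c <: K; x <: M|] ==> c **.V x = ks c **.M x"
begin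

interpretation M: right_module A M by (rule M)
interpretation Vm: right_module K V by (rule rmV[OF V])
interpretation TV: tensor_pair K V H by (rule tensor_pairI[OF rmV[OF V] rmH])

lemma finsum_same: "(!!i. i : I ==> f i <: M) ==> finsum V f I = finsum M f I"
 using finsum_additive[OF Vm.M.abelian_monoid_axioms M.abelian_group_M, of "%x. x" I f] same by simp

lemma lc_slice:
 assumes "psi : D" "!!i. i : I ==> y i <: M" "!!i. i : I ==> h i <: H"
 shows "(\<Sum>.V i:I. psi (h i) **.V y i) = HD.lc M I (%i. psi (h i)) y"
proof -
 have "(\<Sum>.V i:I. psi (h i) **.V y i) = (\<Sum>.M i:I. psi (h i) **.V y i)"
  using assms Vm.smult_closed same by (intro finsum_same) (auto simp: D_simps)
 also have "... = HD.lc M I (%i. psi (h i)) y"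
  unfolding HD.lc_def using assms by (intro M.M.finsum_eqI) (auto simp: smult D_simps ks_closed M.smult_closed)
 finally show ?thesis .
qed

lemma rep_slice:
 fixes n :: nat
 assumes "!!i. i < n ==> y i <: V" "!!i. i < n ==> h i <: H"
  "\<rho>V m = (\<Sum>.(tensor_group K V H) i:{..<n}. pure_tensor K V H (y i) (h i))"
 shows "HD.rep M (slice V \<rho>V) {..<n} y h m"
 unfolding HD.rep_def
proof (intro conjI ballI)
 fix psi assume psi: "psi : D"
 have "slice V \<rho>V psi m = (\<Sum>.V i:{..<n}. psi (h i) **.V y i)" using assms by (intro slice_repr[OF V psi]) auto
 also have "... = HD.lc M {..<n} (%i. psi (h i)) y" using assms same psi by (intro lc_slice) auto
 finally show "slice V \<rho>V psi m = HD.lc M {..<n} (%i. psi (h i)) y" .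
qed (use assms same in auto)

lemma comod_slice: "HD.comod M (slice V \<rho>V)"
 unfolding HD.comod_def
proof (intro conjI ballI M)
 fix x assume "x <: M"
 then have x: "x <: V" by (simp add: same)
 show "slice V \<rho>V \<epsilon> x = x" by (rule slice_counit[OF V x])
 show "EX (n::nat) y h. HD.rep M (slice V \<rho>V) {..<n} y h x"
  by (rule coaction_repr[OF V x]) (blast intro: rep_slice)
 show "slice V \<rho>V phi (slice V \<rho>V psi x) = slice V \<rho>V (conv phi psi) x" if "phi : D" "psi : D" for phi psi
  by (rule slice_slice[OF V that x])
next
 fix psi x assume psi: "psi : D" and "x <: M"
 then have x: "x <: V" by (simp add: same)
 show c: "slice V \<rho>V psi x <: M" using slice_closed[OF V psi x] by (simp add: same)
 show "slice V \<rho>V psi (x +.M y) = slice V \<rho>V psi x +.M slice V \<rho>V psi y" if "y <: M" for y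
  using slice_add[OF V psi x, of y] that by (simp add: same)
next
 fix psi c x assume psi: "psi : D" and c: "c <: K" and x: "x <: M"
 then have xV: "x <: V" by (simp add: same)
 show "slice V \<rho>V psi (ks c **.M x) = ks c **.M slice V \<rho>V psi x"
  using slice_smult[OF V psi c xV] slice_closed[OF V psi xV] x c by (simp add: smult same)
qed

text \<open>The compatibility axiom becomes a double sum of pure tensors by
  \<open>tensor_mult_sum\<close>; contracting with psi and collecting along the representation of
  \<open>a\<close> gives the form required by \<open>hopfm\<close>.\<close>

lemma hopfm_slice:
 assumes \<rho>V: "!!m a. [|m <: M; a <: A|] ==> \<rho>V (a **.M m) =
   tensor_lift (tensor_group K V H) (%x h. tensor_lift (tensor_group K V H) (%b g.
    pure_tensor K V H (b **.M x) (h *.H g)) (\<rho> a)) (\<rho>V m)"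
  and TA: "!!psi a. TA psi a = slice A \<rho> psi a"
  and repA: "!!(n::nat) z g a. [|!!i. i < n ==> z i <: A; !!i. i < n ==> g i <: H;
   \<rho> a = (\<Sum>.(tensor_group K A H) i:{..<n}. pure_tensor K A H (z i) (g i))|] ==> HD.rep (right_regular A) TA {..<n} z g a"
 shows "HD.hopfm TA M (slice V \<rho>V)"
 unfolding HD.hopfm_def
proof (intro conjI ballI comod_slice)
 fix psi m a assume psi: "psi : D" and m: "m <: M" and a: "a <: A"
 have mV: "m <: V" using m by (simp add: same)
 obtain n :: nat and y h where y: "!!i. i < n ==> y i <: V" and h: "!!i. i < n ==> h i <: H"
  and eq: "\<rho>V m = (\<Sum>.(tensor_group K V H) i:{..<n}. pure_tensor K V H (y i) (h i))"
  by (rule coaction_repr[OF V mV]) (rule that, assumption, auto)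
 obtain k :: nat and z g where z: "!!i. i < k ==> z i <: A" and g: "!!i. i < k ==> g i <: H"
  and eqA: "\<rho> a = (\<Sum>.(tensor_group K A H) i:{..<k}. pure_tensor K A H (z i) (g i))"
  by (rule coaction_repr[OF comodule_A a]) (rule that, assumption, auto)
 have yM: "y i <: M" if "i < n" for i using y[OF that] by (simp add: same)
 have commute: "b **.M (c **.V x) = c **.V (b **.M x)" "(c **.A b) **.M x = c **.V (b **.M x)"
  if "c <: K" "x <: M" "b <: A" for b c x
  using that by (simp_all add: smult smult_ks(2) ks_closed M.smult_closed M.smult_assoc[symmetric] HD.ks_central)
 let ?T = "tensor_group K V H"
 have prod: "\<rho>V (a **.M m) = (\<Sum>.?T i:{..<n}. \<Sum>.?T j:{..<k}. pure_tensor K V H (z j **.M y i) (h i *.H g j))"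
  unfolding \<rho>V[OF m a] eq eqA using y h z g
  by (intro tensor_mult_sum[where act="%x b. b **.M x", OF K.is_cring rmV[OF V] rmA rmH _ _ _ _ _ ring_H mult_lr])
   (auto simp: same M.smult_closed M.smult_l_distr M.smult_r_distr commute)
 have zy: "z j **.M y i <: M" if "i < n" "j < k" for i j using yM z that by (intro M.smult_closed) auto
 have psic: "psi (h i *.H g j) <: K" if "i < n" "j < k" for i j using h g that psi by (simp add: D_simps)
 have ptc: "pure_tensor K V H (z j **.M y i) (h i *.H g j) <: ?T" if "i : {..<n}" "j : {..<k}" for i j
  using zy h g that by (intro TV.pt_closed) (auto simp: same)
 note bs = balanced_slice[OF rmV[OF V] psi] and Vg = Vm.abelian_group_M
 have cc: "psi (h i *.H g j) **.V (z j **.M y i) <: M" if "i < n" "j < k" for i j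
  using zy[OF that] psic[OF that] by (simp add: smult ks_closed M.smult_closed)
 have "slice V \<rho>V psi (a **.M m) = (\<Sum>.V i:{..<n}. tensor_lift V (%x h. psi h **.V x) (\<Sum>.?T j:{..<k}. pure_tensor K V H (z j **.M y i) (h i *.H g j)))"
  unfolding slice_def prod by (intro TV.tensor_lift_finsum[OF Vg bs] TV.T.finsum_in ptc)
 also have "... = (\<Sum>.V i:{..<n}. \<Sum>.M j:{..<k}. psi (h i *.H g j) **.V (z j **.M y i))"
 proof (rule Vm.M.finsum_eqI)
  fix i assume i: "i : {..<n}"
  have "tensor_lift V (%x h. psi h **.V x) (\<Sum>.?T j:{..<k}. pure_tensor K V H (z j **.M y i) (h i *.H g j)) =
    (\<Sum>.V j:{..<k}. psi (h i *.H g j) **.V (z j **.M y i))"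
   using zy h g i by (intro TV.tensor_lift_sum_pt[OF Vg bs]) (auto simp: same)
  also have "... = (\<Sum>.M j:{..<k}. psi (h i *.H g j) **.V (z j **.M y i))" using cc i by (intro finsum_same) auto
  finally show "tensor_lift V (%x h. psi h **.V x) (\<Sum>.?T j:{..<k}. pure_tensor K V H (z j **.M y i) (h i *.H g j)) = ..." .
  show "(\<Sum>.M j:{..<k}. psi (h i *.H g j) **.V (z j **.M y i)) <: V"
   unfolding same using cc i by (intro M.M.finsum_in) auto
 qed
 also have "... = (\<Sum>.M i:{..<n}. \<Sum>.M j:{..<k}. psi (h i *.H g j) **.V (z j **.M y i))"
  using cc by (intro finsum_same M.M.finsum_in) auto
 also have "... = (\<Sum>.M j:{..<k}. \<Sum>.M i:{..<n}. psi (h i *.H g j) **.V (z j **.M y i))"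
  using cc by (intro M.M.finsum_swap) auto
 also have "... = (\<Sum>.M j:{..<k}. z j **.M slice V \<rho>V (%u. psi (u *.H g j)) m)"
 proof (rule M.M.finsum_eqI)
  fix j assume "j : {..<k}"
  then have j: "j < k" by simp
  have d: "(%u. psi (u *.H g j)) : D" using psi g[OF j] by (auto simp: mod_hom_mem Hr.l_distr mult_lr)
  have yV: "psi (h i *.H g j) **.V y i <: M" if "i < n" for i
   using yM[OF that] psic[OF that j] by (simp add: smult ks_closed M.smult_closed)
  have "slice V \<rho>V (%u. psi (u *.H g j)) m = (\<Sum>.V i:{..<n}. psi (h i *.H g j) **.V y i)"
   using y h eq by (intro slice_repr[OF V d]) auto
  also have "... = (\<Sum>.M i:{..<n}. psi (h i *.H g j) **.V y i)" using yV by (intro finsum_same) auto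
  also have "z j **.M ... = (\<Sum>.M i:{..<n}. z j **.M (psi (h i *.H g j) **.V y i))"
   using yV z[OF j] by (intro M.smult_finsum) auto
  also have "... = (\<Sum>.M i:{..<n}. psi (h i *.H g j) **.V (z j **.M y i))"
   using cc[OF _ j] psic[OF _ j] yM z[OF j] by (intro M.M.finsum_eqI) (auto simp: commute)
  finally show "(\<Sum>.M i:{..<n}. psi (h i *.H g j) **.V (z j **.M y i)) = z j **.M slice V \<rho>V (%u. psi (u *.H g j)) m" ..
  show "z j **.M slice V \<rho>V (%u. psi (u *.H g j)) m <: M"
   using slice_closed[OF V d mV] z[OF j] by (simp add: same M.smult_closed)
 qed
 finally show "EX (n::nat) z g. HD.rep (right_regular A) TA {..<n} z g a &
   slice V \<rho>V psi (a **.M m) = (\<Sum>.M j:{..<n}. z j **.M slice V \<rho>V (%h. psi (h *.H g j)) m)"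
  using repA[OF z g eqA] by (intro exI[of _ k] exI[of _ z] exI[of _ g]) auto
qed

end

lemma regular_same:
 "carrier A = carrier (right_regular A)" "add A = add (right_regular A)" "zero A = zero (right_regular A)"
 "[|c <: K; x <: (right_regular A)|] ==> c **.A x = ks c **.(right_regular A) x"
 by (simp_all add: smult_ks(2))

lemma rmRR: "right_module A (right_regular A)" by (rule Ar.right_module_right_regular)

lemmas rep_A = rep_slice[OF comodule_A rmRR regular_same] and comod_A = comod_slice[OF comodule_A rmRR regular_same]

lemma hopf_A: "HD.hopfm (slice A \<rho>) (right_regular A) (slice A \<rho>)"
proof (rule hopfm_slice[OF comodule_A rmRR regular_same _ refl rep_A])
 fix m a assume "m <: (right_regular A)" and a: "a <: A"
 then have m: "m <: A" by simp
 have "\<rho> : ring_hom A (tensor_algebra K A H)" by (rule comodule_algebra.coaction_ring_hom[OF comod_alg])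
 from ring_hom_mult[OF this m a]
 show "\<rho> (a **.(right_regular A) m) = tensor_lift (tensor_group K A H) (%x h. tensor_lift (tensor_group K A H)
  (%b g. pure_tensor K A H (b **.(right_regular A) x) (h *.H g)) (\<rho> a)) (\<rho> m)" by simp
qed

lemma generate_finsum:
 assumes "abelian_group G" "finite I" "!!i. i : I ==> f i : X" "X \<subseteq> carrier G"
 shows "finsum G f I : generate (add_monoid G) X"
 using assms(2,3)
proof (induction I)
 interpret G: abelian_group G by fact
 case empty
 show ?case using generate.one[of "add_monoid G" X] by simp
next
 interpret G: abelian_group G by fact
 case (insert i I)
 have "f i +.G finsum G f I : generate (add_monoid G) X"
  using generate.eng[OF generate.incl[of "f i" X "add_monoid G"], of "finsum G f I"] insert by simp
 then show ?case using insert assms(4) by (subst G.finsum_insert) auto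
qed

text \<open>It translates stability under the operators into the subcomodule condition: if
  \<open>J\<close> is stable, the first factors lie in \<open>J\<close>, so the coaction of an
  element of \<open>J\<close> is a sum of pure tensors from \<open>J\<close> and \<open>H\<close>,
  as the simplicity hypothesis requires.\<close>

lemma coaction_expand:
 assumes a: "a <: A"
 shows "EX B0. finite B0 & B0 \<subseteq> B & \<rho> a = (\<Sum>.(tensor_group K A H) b:B0. pure_tensor K A H (slice A \<rho> (cf b) a) (v b))"
proof -
 interpret TA: tensor_pair K A H by (rule tensor_pairI[OF rmA rmH])
 interpret Am: right_module K A by (rule rmA)
 let ?T = "tensor_group K A H"
 obtain n :: nat and y h where y: "!!i. i < n ==> y i <: A" and h: "!!i. i < n ==> h i <: H"
  and eq: "\<rho> a = (\<Sum>.?T i:{..<n}. pure_tensor K A H (y i) (h i))"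
  by (rule coaction_repr[OF comodule_A a]) (rule that, assumption, auto)
 define B0 where "B0 = (\<Union>i<n. {b : B. cf b (h i) ~= \<zero>.K})"
 have B0: "finite B0" "B0 \<subseteq> B" unfolding B0_def using HD.cf_finite h by auto
 have cfc: "cf b (h i) <: K" and vc: "v b <: H" if "b : B0" "i < n" for b i
  using that B0(2) HD.cf HD.v h D_simps(1) by blast+
 note pb = TA.balanced_pt[unfolded balanced_def]
 have pt1: "pure_tensor K A H (y i) (h i) = (\<Sum>.?T b:B0. pure_tensor K A H (cf b (h i) **.A y i) (v b))" if i: "i < n" for i
 proof -
  have "h i = (\<Sum>.H b:{b : B. cf b (h i) ~= \<zero>.K}. cf b (h i) **.H v b)" by (rule HD.basis[OF h[OF i]])
  also have "... = (\<Sum>.H b:B0. cf b (h i) **.H v b)"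
  proof (rule HM.M.finsum_superset[OF B0(1)])
   show "{b : B. cf b (h i) ~= \<zero>.K} \<subseteq> B0" unfolding B0_def using i by auto
   show "cf b (h i) **.H v b = \<zero>.H" if "b : B0 - {b : B. cf b (h i) ~= \<zero>.K}" for b
    using that B0(2) vc[of b i] i by (auto simp: HM.zero_smult)
   show "cf b (h i) **.H v b <: H" if "b : {b : B. cf b (h i) ~= \<zero>.K}" for b
    using that cfc[of b i] vc[of b i] i unfolding B0_def by (intro HM.smult_closed) auto
  qed
  finally have "pure_tensor K A H (y i) (h i) = pure_tensor K A H (y i) (\<Sum>.H b:B0. cf b (h i) **.H v b)" by simp
  also have "... = (\<Sum>.?T b:B0. pure_tensor K A H (y i) (cf b (h i) **.H v b))"
   using pb y[OF i] cfc[OF _ i] vc[OF _ i] HM.smult_closed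
   by (intro finsum_additive[OF HM.M.abelian_monoid_axioms TA.abelian_group_T]) auto
  also have "... = (\<Sum>.?T b:B0. pure_tensor K A H (cf b (h i) **.A y i) (v b))"
  proof (rule TA.T.finsum_eqI)
   fix b assume b: "b : B0"
   show "pure_tensor K A H (y i) (cf b (h i) **.H v b) = pure_tensor K A H (cf b (h i) **.A y i) (v b)"
    using pb y[OF i] cfc[OF b i] vc[OF b i] by metis
   show "pure_tensor K A H (cf b (h i) **.A y i) (v b) <: ?T"
    using y[OF i] cfc[OF b i] vc[OF b i] by (intro TA.pt_closed Am.smult_closed)
  qed
  finally show ?thesis .
 qed
 have ptc: "pure_tensor K A H (cf b (h i) **.A y i) (v b) <: ?T" if "b : B0" "i : {..<n}" for b i
  using y cfc[OF that(1)] vc[OF that(1)] that(2) by (intro TA.pt_closed Am.smult_closed) auto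
 have "\<rho> a = (\<Sum>.?T i:{..<n}. \<Sum>.?T b:B0. pure_tensor K A H (cf b (h i) **.A y i) (v b))"
  unfolding eq by (intro TA.T.finsum_eqI pt1 TA.T.finsum_in ptc) auto
 also have "... = (\<Sum>.?T b:B0. \<Sum>.?T i:{..<n}. pure_tensor K A H (cf b (h i) **.A y i) (v b))"
  by (rule TA.T.finsum_swap) (use B0 ptc in auto)
 also have "... = (\<Sum>.?T b:B0. pure_tensor K A H (slice A \<rho> (cf b) a) (v b))"
 proof (rule TA.T.finsum_eqI)
  fix b assume b: "b : B0"
  have cD: "cf b : D" and vH: "v b <: H" using b B0(2) HD.cf HD.v by auto
  have "slice A \<rho> (cf b) a = (\<Sum>.A i:{..<n}. cf b (h i) **.A y i)"
   using y h eq by (intro slice_repr[OF comodule_A cD]) auto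
  then show "(\<Sum>.?T i:{..<n}. pure_tensor K A H (cf b (h i) **.A y i) (v b)) = pure_tensor K A H (slice A \<rho> (cf b) a) (v b)"
   using pb vH y cfc[OF b] Am.smult_closed
   by (simp, intro finsum_additive[where f="%u. pure_tensor K A H u (v b)", OF Ar.abelian_monoid_axioms TA.abelian_group_T, symmetric]) auto
  show "pure_tensor K A H (slice A \<rho> (cf b) a) (v b) <: ?T"
   by (intro TA.pt_closed slice_closed[OF comodule_A cD a] vH)
 qed
 finally show ?thesis using B0 by blast
qed

lemma hopf_comod_alg: "hopf_comod_alg K H conv \<epsilon> S B cf v A ks (slice A \<rho>)"
proof (intro hopf_comod_alg.intro hopf_comod_alg_axioms.intro coeff hopf_A)
 interpret TA: tensor_pair K A H by (rule tensor_pairI[OF rmA rmH])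
 show "carrier A ~= {\<zero>.A}" using simple by (simp add: simple_comodule_algebra_def)
 fix J assume J: "left_ideal J A" and st: "!!psi a. psi : D ==> a : J ==> slice A \<rho> psi a : J" and nz: "J ~= {\<zero>.A}"
 have JA: "J \<subseteq> carrier A" using J by (auto simp: submodule_def subgroup_def)
 let ?X = "{pure_tensor K A H x h | x h. x : J & h <: H}"
 have "\<rho> a : generate (add_monoid (tensor_group K A H)) ?X" if a: "a : J" for a
 proof -
  have aA: "a <: A" using a JA by auto
  obtain B0 where B0: "finite B0" "B0 \<subseteq> B"
   and eq: "\<rho> a = (\<Sum>.(tensor_group K A H) b:B0. pure_tensor K A H (slice A \<rho> (cf b) a) (v b))"
   using coaction_expand[OF aA] by (elim exE conjE) (rule that)
  have "pure_tensor K A H (slice A \<rho> (cf b) a) (v b) : ?X" if "b : B0" for b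
   using st[OF HD.cf a] HD.v B0(2) that by (intro CollectI exI conjI refl) auto
  moreover have "?X \<subseteq> carrier (tensor_group K A H)" using JA by (auto intro: TA.pt_closed)
  ultimately show ?thesis unfolding eq by (intro generate_finsum[OF TA.abelian_group_T B0(1)])
 qed
 then show "J = carrier A" using simple J nz unfolding simple_comodule_algebra_def by blast
qed

lemma hopf_module_slice:
 assumes "hopf_module K H \<Delta> \<epsilon> A \<rho> M \<rho>M"
 shows "HD.hopfm (slice A \<rho>) M (slice (underlying_space A M) \<rho>M)"
proof -
 have M: "right_module A M" and V: "right_comodule K H \<Delta> \<epsilon> (underlying_space A M) \<rho>M"
  using assms by (simp_all add: hopf_module_def)
 show ?thesis
  by (rule hopfm_slice[OF V M _ _ _ _ _ refl rep_A])
   (auto simp: underlying_space_def ks_def hopf_module.coaction_smult[OF assms, unfolded underlying_space_def])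
qed

end

theorem theorem4p4:
 fixes K :: "'k ring" and H :: "('k, 'h) module" and A :: "('k, 'a) module"
  and Q :: "'q ring"
 assumes hopf: "hopf_algebra K H \<Delta> \<epsilon> S"
  and comodule_algebra: "comodule_algebra K H \<Delta> \<epsilon> A \<rho>"
  and simple: "simple_comodule_algebra K H A \<rho>"
  and quotient_ring: "classical_quotient_ring A Q \<iota>" "von_neumann_regular Q"
  and coherent: "right_coherent A"
  and proj_dim: "finite_proj_dim_of_finitely_presented A"
 shows "(\<forall>(M :: ('a, 'm) module) \<rho>M.
      hopf_module K H \<Delta> \<epsilon> A \<rho> M \<rho>M \<longrightarrow> flat TYPE('l) TYPE('n) A M) \<and>
     ((\<exists>(R :: 'r ring) \<phi>. right_artinian R \<and> carrier R \<noteq> {\<zero>\<^bsub>R\<^esub>} \<and> \<phi> \<in> ring_hom A R) \<longrightarrow>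
     (\<forall>(M :: ('a, 'm) module) \<rho>M.
      hopf_module K H \<Delta> \<epsilon> A \<rho> M \<rho>M \<longrightarrow> projective A M))"
proof -
 interpret HS: hopf_setup K H \<Delta> \<epsilon> S by (rule hopf_setup.intro[OF hopf])
 obtain B cf v where dual: "hopf_dual K H HS.conv \<epsilon> S B cf v" using HS.hopf_dual_ex by (elim exE) (rule that)
 interpret CS: comodule_algebra_setup K H \<Delta> \<epsilon> S A \<rho> B cf v
  by (intro comodule_algebra_setup.intro comodule_algebra_setup_axioms.intro HS.hopf_setup_axioms comodule_algebra simple dual)
 interpret HQ: hopf_quot K H HS.conv \<epsilon> S B cf v A CS.ks "HS.slice A \<rho>" Q \<iota>
  by (intro hopf_quot.intro hopf_quot_axioms.intro quotient_ring.intro CS.hopf_comod_alg quotient_ring coherent proj_dim)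
 show ?thesis
 proof (intro conjI allI impI)
  fix M :: "('a, 'm) module" and \<rho>M
  assume M: "hopf_module K H \<Delta> \<epsilon> A \<rho> M \<rho>M"
  show "flat TYPE('l) TYPE('n) A M" by (rule HQ.hopf_module_flat[OF CS.hopf_module_slice[OF M]])
 next
  fix M :: "('a, 'm) module" and \<rho>M
  assume "\<exists>(R :: 'r ring) \<phi>. right_artinian R \<and> carrier R \<noteq> {\<zero>\<^bsub>R\<^esub>} \<and> \<phi> \<in> ring_hom A R"
  then obtain R :: "'r ring" and \<phi> where R: "right_artinian R" "carrier R \<noteq> {\<zero>\<^bsub>R\<^esub>}" "\<phi> \<in> ring_hom A R"
   by (elim exE conjE) (rule that)
  assume M: "hopf_module K H \<Delta> \<epsilon> A \<rho> M \<rho>M"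
  show "projective A M" by (rule HQ.hopf_module_projective[OF R CS.hopf_module_slice[OF M]])
 qed
qed

end
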